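(* Let $G \to H$ be an abelian extension of simplicial groupoids with abelian kernel $A$. Then there is a simplicial set $Y'$ equipped with a fibration $Y' \to \bar{W}[H \ltimes \bar{W}A]$ such that the projection $Y' \to \bar{W}H$ (the composite with $\bar{W}[H\ltimes \bar{W}A]\to \bar{W}H$) is a weak equivalence, and such that $$Y' \times_{\bar{W}[H \ltimes \bar{W}A]} \bar{W}H \cong \bar{W}G,$$ where the fibre product is taken along the zero section $\bar{W}H \to \bar{W}[H\ltimes \bar{W}A]$. Moreover, the space $Y'$ and the weak equivalence $w\colon Y' \to \bar{W}H$ can be chosen functorially.
   Context: A morphism $f\colon G\to H$ of groupoids is an abelian extension if it is an isomorphism on objects, surjective on morphisms, and the groups $A(x):=\ker(f\colon G(x,x)\to H(fx,fx))$ are abelian for all objects $x$ of $G$; conjugation makes $A$ a representation of $H$ in abelian groups. A simplicial groupoid is a simplicial diagram of groupoids, and an abelian extension of simplicial groupoids is one which is an abelian extension in each simplicial level. For a bisimplicial set $X$, the simplicial set $\nabla X$ (right adjoint to the total décalage functor $\mathrm{DEC}(X)_{mn}=X_{m+n+1}$) is given by $\nabla_p(X)=\{(x_0,\ldots,x_p)\in\prod_{i=0}^p X_{i,p-i} : \partial_0^v x_i=\partial_{i+1}^h x_{i+1},\ 0\le i<p\}$. For a simplicial groupoid $\Gamma$, the levelwise nerve $B\Gamma$ is a bisimplicial set and $\bar{W}\Gamma:=\nabla B\Gamma$ (the usual classifying space of a simplicial groupoid when the objects are constant). For a representation $A$ of $H$ in simplicial abelian groups, $\bar{W}A$ is formed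 objectwise (by applying $\nabla$ to the levelwise nerve of $A$) and carries the induced $H$-action; $H\ltimes \bar{W}A$ is the associated semidirect product simplicial groupoid with the same objects as $H$, a group object over $H$. "Fibration" and "weak equivalence" refer to the Kan model structure on simplicial sets.
   Formalization: The kernel A, as a simplicial set over the objects of H, is assumed to be a Kan fibration. This is automatic when the objects are constant; when objects vary with the simplicial level the claim can fail without it, since W̄G → W̄H need not be a fibration. *)

theory Defs
  imports Main
begin

section \<open>Simplicial sets\<close>

text \<open>\<open>face X n i\<close> is the map \<open>\<partial>\<^sub>i\<close> from degree \<open>n\<close> to degree \<open>n - 1\<close> and \<open>degen X n i\<close> is
  \<open>\<sigma>\<^sub>i\<close> from degree \<open>n\<close> to degree \<open>n + 1\<close>. Here and below, all operations are only meaningful on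
  the carriers.\<close>

record 'a sset =
  simp :: "nat \<Rightarrow> 'a set"
  face :: "nat \<Rightarrow> nat \<Rightarrow> 'a \<Rightarrow> 'a"
  degen :: "nat \<Rightarrow> nat \<Rightarrow> 'a \<Rightarrow> 'a"

definition sset :: "'a sset \<Rightarrow> bool" where
  "sset X \<longleftrightarrow>
    (\<forall>n. \<forall>x \<in> simp X (Suc n). \<forall>i \<le> Suc n. face X (Suc n) i x \<in> simp X n) \<and>
    (\<forall>n. \<forall>x \<in> simp X n. \<forall>i \<le> n. degen X n i x \<in> simp X (Suc n)) \<and>
    (\<forall>n. \<forall>x \<in> simp X (Suc (Suc n)). \<forall>i j. i < j \<and> j \<le> Suc (Suc n) \<longrightarrow>
       face X (Suc n) i (face X (Suc (Suc n)) j x) =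
       face X (Suc n) (j - 1) (face X (Suc (Suc n)) i x)) \<and>
    (\<forall>n. \<forall>x \<in> simp X n. \<forall>i j. i \<le> j \<and> j \<le> n \<longrightarrow>
       degen X (Suc n) i (degen X n j x) = degen X (Suc n) (Suc j) (degen X n i x)) \<and>
    (\<forall>n. \<forall>x \<in> simp X n. \<forall>j \<le> n.
       face X (Suc n) j (degen X n j x) = x \<and> face X (Suc n) (Suc j) (degen X n j x) = x) \<and>
    (\<forall>n. \<forall>x \<in> simp X n. \<forall>i j. i < j \<and> j \<le> n \<longrightarrow>
       face X (Suc n) i (degen X n j x) = degen X (n - 1) (j - 1) (face X n i x)) \<and>
    (\<forall>n. \<forall>x \<in> simp X n. \<forall>i j. Suc j < i \<and> i \<le> Suc n \<longrightarrow>
       face X (Suc n) i (degen X n j x) = degen X (n - 1) j (face X n (i - 1) x))"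

definition smap :: "'a sset \<Rightarrow> 'b sset \<Rightarrow> (nat \<Rightarrow> 'a \<Rightarrow> 'b) \<Rightarrow> bool" where
  "smap X Y f \<longleftrightarrow>
    (\<forall>n. \<forall>x \<in> simp X n. f n x \<in> simp Y n) \<and>
    (\<forall>n. \<forall>x \<in> simp X (Suc n). \<forall>i \<le> Suc n. f n (face X (Suc n) i x) = face Y (Suc n) i (f (Suc n) x)) \<and>
    (\<forall>n. \<forall>x \<in> simp X n. \<forall>i \<le> n. f (Suc n) (degen X n i x) = degen Y n i (f n x))"

definition siso :: "'a sset \<Rightarrow> 'b sset \<Rightarrow> (nat \<Rightarrow> 'a \<Rightarrow> 'b) \<Rightarrow> bool" where
  "siso X Y f \<longleftrightarrow> smap X Y f \<and> (\<forall>n. bij_betw (f n) (simp X n) (simp Y n))"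

definition sprod :: "'a sset \<Rightarrow> 'b sset \<Rightarrow> ('a \<times> 'b) sset" where
  "sprod X Y = \<lparr> simp = (\<lambda>n. simp X n \<times> simp Y n),
     face = (\<lambda>n i. map_prod (face X n i) (face Y n i)),
     degen = (\<lambda>n i. map_prod (degen X n i) (degen Y n i)) \<rparr>"

definition fibprod :: "'a sset \<Rightarrow> 'b sset \<Rightarrow> (nat \<Rightarrow> 'a \<Rightarrow> 'c) \<Rightarrow> (nat \<Rightarrow> 'b \<Rightarrow> 'c) \<Rightarrow> ('a \<times> 'b) sset" where
  "fibprod X Y f g = (sprod X Y) \<lparr> simp := (\<lambda>n. {(x, y) \<in> simp X n \<times> simp Y n. f n x = g n y}) \<rparr>"

text \<open>An \<open>n\<close>-simplex of \<open>\<Delta>\<^sup>m\<close>, i.e. a monotone map from \<open>{0..n}\<close> to \<open>{0..m}\<close>, is the list of its values.\<close>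

definition std_simplex :: "nat \<Rightarrow> nat list sset" where
  "std_simplex m = \<lparr> simp = (\<lambda>n. {xs. length xs = Suc n \<and> sorted xs \<and> set xs \<subseteq> {0..m}}),
     face = (\<lambda>n i xs. take i xs @ drop (Suc i) xs),
     degen = (\<lambda>n i xs. take (Suc i) xs @ drop i xs) \<rparr>"

text \<open>Right lifting property against all horn inclusions; the family \<open>y\<close> (indices other than \<open>k\<close>)
  is the horn.\<close>

definition kan_fibration :: "'a sset \<Rightarrow> 'b sset \<Rightarrow> (nat \<Rightarrow> 'a \<Rightarrow> 'b) \<Rightarrow> bool" where
  "kan_fibration X Y p \<longleftrightarrow> sset X \<and> sset Y \<and> smap X Y p \<and>
    (\<forall>n k y b. k \<le> Suc n \<and> b \<in> simp Y (Suc n) \<and>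
       (\<forall>i \<le> Suc n. i \<noteq> k \<longrightarrow> y i \<in> simp X n \<and> p n (y i) = face Y (Suc n) i b) \<and>
       (\<forall>i j. i < j \<and> j \<le> Suc n \<and> i \<noteq> k \<and> j \<noteq> k \<longrightarrow> face X n i (y j) = face X n (j - 1) (y i))
     \<longrightarrow> (\<exists>x \<in> simp X (Suc n). p (Suc n) x = b \<and> (\<forall>i \<le> Suc n. i \<noteq> k \<longrightarrow> face X (Suc n) i x = y i)))"

definition kan_complex :: "'a sset \<Rightarrow> bool" where
  "kan_complex X \<longleftrightarrow> kan_fibration X (std_simplex 0) (\<lambda>n _. replicate (Suc n) 0)"

definition homotopy :: "'a sset \<Rightarrow> 'b sset \<Rightarrow> (nat \<Rightarrow> 'a \<Rightarrow> 'b) \<Rightarrow> (nat \<Rightarrow> 'a \<Rightarrow> 'b) \<Rightarrow> bool" where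
  "homotopy X Z u v \<longleftrightarrow> (\<exists>h. smap (sprod X (std_simplex 1)) Z h \<and>
     (\<forall>n. \<forall>x \<in> simp X n. h n (x, replicate (Suc n) 0) = u n x \<and> h n (x, replicate (Suc n) 1) = v n x))"

text \<open>\<open>f\<close> is a weak equivalence if it induces a bijection from \<open>\<pi>\<^sub>0 Map(Y, Z)\<close> to \<open>\<pi>\<^sub>0 Map(X, Z)\<close> for every
  Kan complex \<open>Z\<close>. Testing \<open>Z\<close> on one type suffices: \<open>'a + 'b + nat\<close> is infinite and at least as large
  as \<open>X\<close> and \<open>Y\<close>, so it accommodates fibrant replacements of \<open>X\<close> and of \<open>Y\<close>, and these two Kan
  complexes detect whether \<open>f\<close> is invertible in the homotopy category.\<close>

definition weak_equivalence :: "'a sset \<Rightarrow> 'b sset \<Rightarrow> (nat \<Rightarrow> 'a \<Rightarrow> 'b) \<Rightarrow> bool" where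
  "weak_equivalence X Y f \<longleftrightarrow> sset X \<and> sset Y \<and> smap X Y f \<and>
    (\<forall>Z :: ('a + 'b + nat) sset. kan_complex Z \<longrightarrow>
      (\<forall>u. smap X Z u \<longrightarrow> (\<exists>v. smap Y Z v \<and> equivclp (homotopy X Z) (\<lambda>n. v n \<circ> f n) u)) \<and>
      (\<forall>v v'. smap Y Z v \<and> smap Y Z v' \<and>
         equivclp (homotopy X Z) (\<lambda>n. v n \<circ> f n) (\<lambda>n. v' n \<circ> f n) \<longrightarrow> equivclp (homotopy Y Z) v v'))"

text \<open>In \<open>bisimp X m n\<close>, \<open>m\<close> is the horizontal and \<open>n\<close> the vertical degree; the operations carry the
  bidegree of their source.\<close>

record 'a bisset =
  bisimp :: "nat \<Rightarrow> nat \<Rightarrow> 'a set"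
  hface :: "nat \<Rightarrow> nat \<Rightarrow> nat \<Rightarrow> 'a \<Rightarrow> 'a"
  hdegen :: "nat \<Rightarrow> nat \<Rightarrow> nat \<Rightarrow> 'a \<Rightarrow> 'a"
  vface :: "nat \<Rightarrow> nat \<Rightarrow> nat \<Rightarrow> 'a \<Rightarrow> 'a"
  vdegen :: "nat \<Rightarrow> nat \<Rightarrow> nat \<Rightarrow> 'a \<Rightarrow> 'a"

text \<open>The operations are the ones making \<open>nabla\<close> right adjoint to the total decalage (Artin--Mazur):
  \<open>\<partial>\<^sub>i (x\<^sub>0,\<dots>,x\<^sub>p) = (\<partial>\<^sup>v\<^sub>i x\<^sub>0, \<dots>, \<partial>\<^sup>v\<^sub>1 x\<^sub>i\<^sub>-\<^sub>1, \<partial>\<^sup>h\<^sub>i x\<^sub>i\<^sub>+\<^sub>1, \<dots>, \<partial>\<^sup>h\<^sub>i x\<^sub>p)\<close> and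
  \<open>\<sigma>\<^sub>i (x\<^sub>0,\<dots>,x\<^sub>p) = (\<sigma>\<^sup>v\<^sub>i x\<^sub>0, \<dots>, \<sigma>\<^sup>v\<^sub>0 x\<^sub>i, \<sigma>\<^sup>h\<^sub>i x\<^sub>i, \<dots>, \<sigma>\<^sup>h\<^sub>i x\<^sub>p)\<close>.\<close>

definition nabla :: "'a bisset \<Rightarrow> 'a list sset" where
  "nabla X = \<lparr>
     simp = (\<lambda>p. {x. length x = Suc p \<and> (\<forall>i \<le> p. x ! i \<in> bisimp X i (p - i)) \<and>
        (\<forall>i < p. vface X i (p - i) 0 (x ! i) = hface X (Suc i) (p - Suc i) (Suc i) (x ! Suc i))}),
     face = (\<lambda>p i x. map (\<lambda>j. if j < i then vface X j (p - j) (i - j) (x ! j)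
        else hface X (Suc j) (p - Suc j) i (x ! Suc j)) [0..<p]),
     degen = (\<lambda>p i x. map (\<lambda>j. if j \<le> i then vdegen X j (p - j) (i - j) (x ! j)
        else hdegen X (j - 1) (p - (j - 1)) i (x ! (j - 1))) [0..<Suc (Suc p)]) \<rparr>"

section \<open>Groupoids and simplicial groupoids\<close>

text \<open>\<open>gcomp G g h\<close> is the composite \<open>g \<circ> h\<close>, defined when \<open>src G g = trg G h\<close>.\<close>

record ('o, 'm) gpd =
  Ob :: "'o set"
  Ar :: "'m set"
  src :: "'m \<Rightarrow> 'o"
  trg :: "'m \<Rightarrow> 'o"
  gid :: "'o \<Rightarrow> 'm"
  gcomp :: "'m \<Rightarrow> 'm \<Rightarrow> 'm"
  ginv :: "'m \<Rightarrow> 'm"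

definition groupoid :: "('o, 'm) gpd \<Rightarrow> bool" where
  "groupoid G \<longleftrightarrow>
    (\<forall>g \<in> Ar G. src G g \<in> Ob G \<and> trg G g \<in> Ob G) \<and>
    (\<forall>x \<in> Ob G. gid G x \<in> Ar G \<and> src G (gid G x) = x \<and> trg G (gid G x) = x) \<and>
    (\<forall>g \<in> Ar G. \<forall>h \<in> Ar G. src G g = trg G h \<longrightarrow>
       gcomp G g h \<in> Ar G \<and> src G (gcomp G g h) = src G h \<and> trg G (gcomp G g h) = trg G g) \<and>
    (\<forall>g \<in> Ar G. gcomp G g (gid G (src G g)) = g \<and> gcomp G (gid G (trg G g)) g = g) \<and>
    (\<forall>g \<in> Ar G. \<forall>h \<in> Ar G. \<forall>k \<in> Ar G. src G g = trg G h \<and> src G h = trg G k \<longrightarrow>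
       gcomp G (gcomp G g h) k = gcomp G g (gcomp G h k)) \<and>
    (\<forall>g \<in> Ar G. ginv G g \<in> Ar G \<and> src G (ginv G g) = trg G g \<and> trg G (ginv G g) = src G g \<and>
       gcomp G (ginv G g) g = gid G (src G g) \<and> gcomp G g (ginv G g) = gid G (trg G g))"

record ('o, 'm, 'p, 'q) gfun =
  fob :: "'o \<Rightarrow> 'p"
  far :: "'m \<Rightarrow> 'q"

definition gfunctor :: "('o, 'm) gpd \<Rightarrow> ('p, 'q) gpd \<Rightarrow> ('o, 'm, 'p, 'q) gfun \<Rightarrow> bool" where
  "gfunctor G H F \<longleftrightarrow>
    (\<forall>x \<in> Ob G. fob F x \<in> Ob H \<and> far F (gid G x) = gid H (fob F x)) \<and>
    (\<forall>g \<in> Ar G. far F g \<in> Ar H \<and> src H (far F g) = fob F (src G g) \<and> trg H (far F g) = fob F (trg G g)) \<and>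
    (\<forall>g \<in> Ar G. \<forall>h \<in> Ar G. src G g = trg G h \<longrightarrow> far F (gcomp G g h) = gcomp H (far F g) (far F h))"

definition gfun_comp :: "('p, 'q, 'r, 's) gfun \<Rightarrow> ('o, 'm, 'p, 'q) gfun \<Rightarrow> ('o, 'm, 'r, 's) gfun" where
  "gfun_comp F E = \<lparr> fob = fob F \<circ> fob E, far = far F \<circ> far E \<rparr>"

definition gfun_eq :: "('o, 'm) gpd \<Rightarrow> ('o, 'm, 'p, 'q) gfun \<Rightarrow> ('o, 'm, 'p, 'q) gfun \<Rightarrow> bool" where
  "gfun_eq G E F \<longleftrightarrow> (\<forall>x \<in> Ob G. fob E x = fob F x) \<and> (\<forall>g \<in> Ar G. far E g = far F g)"

record ('o, 'm) sgpd =
  lev :: "nat \<Rightarrow> ('o, 'm) gpd"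
  gface :: "nat \<Rightarrow> nat \<Rightarrow> ('o, 'm, 'o, 'm) gfun"
  gdegen :: "nat \<Rightarrow> nat \<Rightarrow> ('o, 'm, 'o, 'm) gfun"

definition obj_sset :: "('o, 'm) sgpd \<Rightarrow> 'o sset" where
  "obj_sset \<Gamma> = \<lparr> simp = (\<lambda>n. Ob (lev \<Gamma> n)), face = (\<lambda>n i. fob (gface \<Gamma> n i)),
     degen = (\<lambda>n i. fob (gdegen \<Gamma> n i)) \<rparr>"

definition arr_sset :: "('o, 'm) sgpd \<Rightarrow> 'm sset" where
  "arr_sset \<Gamma> = \<lparr> simp = (\<lambda>n. Ar (lev \<Gamma> n)), face = (\<lambda>n i. far (gface \<Gamma> n i)),
     degen = (\<lambda>n i. far (gdegen \<Gamma> n i)) \<rparr>"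

definition simplicial_groupoid :: "('o, 'm) sgpd \<Rightarrow> bool" where
  "simplicial_groupoid \<Gamma> \<longleftrightarrow>
    (\<forall>n. groupoid (lev \<Gamma> n)) \<and>
    (\<forall>n. \<forall>i \<le> Suc n. gfunctor (lev \<Gamma> (Suc n)) (lev \<Gamma> n) (gface \<Gamma> (Suc n) i)) \<and>
    (\<forall>n. \<forall>i \<le> n. gfunctor (lev \<Gamma> n) (lev \<Gamma> (Suc n)) (gdegen \<Gamma> n i)) \<and>
    sset (obj_sset \<Gamma>) \<and> sset (arr_sset \<Gamma>)"

definition sgpd_map :: "('o, 'm) sgpd \<Rightarrow> ('p, 'q) sgpd \<Rightarrow> (nat \<Rightarrow> ('o, 'm, 'p, 'q) gfun) \<Rightarrow> bool" where
  "sgpd_map \<Gamma> \<Delta> F \<longleftrightarrow> (\<forall>n. gfunctor (lev \<Gamma> n) (lev \<Delta> n) (F n)) \<and>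
     smap (obj_sset \<Gamma>) (obj_sset \<Delta>) (\<lambda>n. fob (F n)) \<and> smap (arr_sset \<Gamma>) (arr_sset \<Delta>) (\<lambda>n. far (F n))"

section \<open>The nerve and the functor \<open>Wbar\<close>\<close>

text \<open>The string \<open>c \<rightarrow> \<bullet> \<rightarrow> \<cdots> \<rightarrow> \<bullet>\<close> of composable arrows \<open>a\<^sub>1, \<dots>, a\<^sub>m\<close> is the pair \<open>(c, [a\<^sub>1, \<dots>, a\<^sub>m])\<close>.
  In \<open>nerve\<close> the nerve direction is horizontal and that of \<open>\<Gamma>\<close> vertical; with \<open>nabla\<close> as above this gives
  the classical \<open>Wbar\<close> when the objects are constant: a \<open>p\<close>-simplex is then a string of \<open>p\<close> composable
  arrows from \<open>\<Gamma>\<^sub>p\<^sub>-\<^sub>1, \<dots>, \<Gamma>\<^sub>0\<close>.\<close>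

fun gpath :: "('o, 'm) gpd \<Rightarrow> 'o \<Rightarrow> 'm list \<Rightarrow> bool" where
  "gpath G c [] \<longleftrightarrow> c \<in> Ob G"
| "gpath G c (a # as) \<longleftrightarrow> c \<in> Ob G \<and> a \<in> Ar G \<and> src G a = c \<and> gpath G (trg G a) as"

fun nerve_face :: "('o, 'm) gpd \<Rightarrow> nat \<Rightarrow> 'o \<times> 'm list \<Rightarrow> 'o \<times> 'm list" where
  "nerve_face G i (c, as) =
    (if i = 0 then (trg G (hd as), tl as)
     else if i = length as then (c, butlast as)
     else (c, take (i - 1) as @ [gcomp G (as ! i) (as ! (i - 1))] @ drop (Suc i) as))"

fun nerve_degen :: "('o, 'm) gpd \<Rightarrow> nat \<Rightarrow> 'o \<times> 'm list \<Rightarrow> 'o \<times> 'm list" where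
  "nerve_degen G i (c, as) =
    (c, take i as @ [gid G (if i = 0 then c else trg G (as ! (i - 1)))] @ drop i as)"

definition nerve_map :: "('o, 'm, 'p, 'q) gfun \<Rightarrow> 'o \<times> 'm list \<Rightarrow> 'p \<times> 'q list" where
  "nerve_map F = map_prod (fob F) (map (far F))"

definition nerve :: "('o, 'm) sgpd \<Rightarrow> ('o \<times> 'm list) bisset" where
  "nerve \<Gamma> = \<lparr>
     bisimp = (\<lambda>m n. {(c, as). length as = m \<and> gpath (lev \<Gamma> n) c as}),
     hface = (\<lambda>m n. nerve_face (lev \<Gamma> n)),
     hdegen = (\<lambda>m n. nerve_degen (lev \<Gamma> n)),
     vface = (\<lambda>m n i. nerve_map (gface \<Gamma> n i)),
     vdegen = (\<lambda>m n i. nerve_map (gdegen \<Gamma> n i)) \<rparr>"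

definition Wbar :: "('o, 'm) sgpd \<Rightarrow> ('o \<times> 'm list) list sset" where
  "Wbar \<Gamma> = nabla (nerve \<Gamma>)"

definition Wbar_map ::
  "(nat \<Rightarrow> ('o, 'm, 'p, 'q) gfun) \<Rightarrow> nat \<Rightarrow> ('o \<times> 'm list) list \<Rightarrow> ('p \<times> 'q list) list" where
  "Wbar_map F p x = map (\<lambda>i. nerve_map (F (p - i)) (x ! i)) [0..<Suc p]"

section \<open>Representations and semidirect products\<close>

text \<open>The data of a representation of a simplicial groupoid \<open>H\<close> in (simplicial) abelian groups:
  in degree \<open>n\<close>, a group \<open>rcar n y\<close> for each object \<open>y\<close> of \<open>H\<^sub>n\<close>, on which an arrow \<open>h\<close> from \<open>y\<close> to \<open>z\<close>
  acts by \<open>ract n h\<close> with values in \<open>rcar n z\<close>; \<open>rface n i y\<close> takes values in the group of \<open>\<partial>\<^sub>i y\<close>.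
  With constant objects this is a simplicial abelian group for each object.\<close>

record ('p, 'q, 'a) srep =
  rcar :: "nat \<Rightarrow> 'p \<Rightarrow> 'a set"
  radd :: "nat \<Rightarrow> 'p \<Rightarrow> 'a \<Rightarrow> 'a \<Rightarrow> 'a"
  rzero :: "nat \<Rightarrow> 'p \<Rightarrow> 'a"
  rneg :: "nat \<Rightarrow> 'p \<Rightarrow> 'a \<Rightarrow> 'a"
  ract :: "nat \<Rightarrow> 'q \<Rightarrow> 'a \<Rightarrow> 'a"
  rface :: "nat \<Rightarrow> nat \<Rightarrow> 'p \<Rightarrow> 'a \<Rightarrow> 'a"
  rdegen :: "nat \<Rightarrow> nat \<Rightarrow> 'p \<Rightarrow> 'a \<Rightarrow> 'a"

text \<open>The groups of a representation, viewed as the simplicial groupoid with the objects of \<open>H\<close>, with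
  automorphism groups \<open>rcar n y\<close> and with no other arrows.\<close>

definition rep_gpd :: "('p, 'q) sgpd \<Rightarrow> ('p, 'q, 'a) srep \<Rightarrow> ('p, 'p \<times> 'a) sgpd" where
  "rep_gpd H A = \<lparr>
     lev = (\<lambda>n. \<lparr> Ob = Ob (lev H n), Ar = Sigma (Ob (lev H n)) (rcar A n), src = fst, trg = fst,
        gid = (\<lambda>y. (y, rzero A n y)), gcomp = (\<lambda>(y, a) (_, b). (y, radd A n y a b)),
        ginv = (\<lambda>(y, a). (y, rneg A n y a)) \<rparr>),
     gface = (\<lambda>n i. \<lparr> fob = fob (gface H n i), far = (\<lambda>(y, a). (fob (gface H n i) y, rface A n i y a)) \<rparr>),
     gdegen = (\<lambda>n i. \<lparr> fob = fob (gdegen H n i), far = (\<lambda>(y, a). (fob (gdegen H n i) y, rdegen A n i y a)) \<rparr>) \<rparr>"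

fun iter_face0 :: "(nat \<Rightarrow> nat \<Rightarrow> 'x \<Rightarrow> 'x) \<Rightarrow> nat \<Rightarrow> nat \<Rightarrow> 'x \<Rightarrow> 'x" where
  "iter_face0 d n 0 x = x"
| "iter_face0 d n (Suc i) x = d (n - i) 0 (iter_face0 d n i x)"

text \<open>An element of \<open>Wbar (rep_gpd H A)\<close> in degree \<open>n\<close> has components \<open>x\<^sub>i\<close> in the \<open>i\<close>-th power of
  \<open>rcar A (n - i) (\<partial>\<^sub>0\<^sup>i y)\<close> for a unique object \<open>y\<close> of \<open>H\<^sub>n\<close>. The group structure is the componentwise
  one, and \<open>h\<close> acts on \<open>x\<^sub>i\<close> through \<open>\<partial>\<^sub>0\<^sup>i h\<close>.\<close>

definition Wbar_rep :: "('p, 'q) sgpd \<Rightarrow> ('p, 'q, 'a) srep \<Rightarrow> ('p, 'q, ('p \<times> ('p \<times> 'a) list) list) srep" where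
  "Wbar_rep H A = \<lparr>
     rcar = (\<lambda>n y. {x \<in> simp (Wbar (rep_gpd H A)) n. fst (x ! 0) = y}),
     radd = (\<lambda>n y u v. map (\<lambda>i. (fst (u ! i),
        map2 (\<lambda>(z, a) (_, b). (z, radd A (n - i) z a b)) (snd (u ! i)) (snd (v ! i)))) [0..<Suc n]),
     rzero = (\<lambda>n y. map (\<lambda>i. let z = iter_face0 (face (obj_sset H)) n i y in
        (z, replicate i (z, rzero A (n - i) z))) [0..<Suc n]),
     rneg = (\<lambda>n y u. map (\<lambda>i. (fst (u ! i),
        map (\<lambda>(z, a). (z, rneg A (n - i) z a)) (snd (u ! i)))) [0..<Suc n]),
     ract = (\<lambda>n h u. map (\<lambda>i. let k = iter_face0 (face (arr_sset H)) n i h; z = trg (lev H (n - i)) k in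
        (z, map (\<lambda>(_, a). (z, ract A (n - i) k a)) (snd (u ! i)))) [0..<Suc n]),
     rface = (\<lambda>n i y. face (Wbar (rep_gpd H A)) n i),
     rdegen = (\<lambda>n i y. degen (Wbar (rep_gpd H A)) n i) \<rparr>"

text \<open>An arrow \<open>(h, u)\<close> of \<open>semidirect H V\<close> has \<open>u\<close> in the group at the target of \<open>h\<close>, and
  \<open>(k, v) \<circ> (h, u) = (k \<circ> h, v + k \<cdot> u)\<close>.\<close>

definition semidirect :: "('p, 'q) sgpd \<Rightarrow> ('p, 'q, 'a) srep \<Rightarrow> ('p, 'q \<times> 'a) sgpd" where
  "semidirect H V = \<lparr>
     lev = (\<lambda>n. \<lparr> Ob = Ob (lev H n),
        Ar = Sigma (Ar (lev H n)) (\<lambda>h. rcar V n (trg (lev H n) h)),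
        src = (\<lambda>(h, u). src (lev H n) h), trg = (\<lambda>(h, u). trg (lev H n) h),
        gid = (\<lambda>y. (gid (lev H n) y, rzero V n y)),
        gcomp = (\<lambda>(k, v) (h, u). (gcomp (lev H n) k h, radd V n (trg (lev H n) k) v (ract V n k u))),
        ginv = (\<lambda>(h, u). (ginv (lev H n) h,
          ract V n (ginv (lev H n) h) (rneg V n (trg (lev H n) h) u))) \<rparr>),
     gface = (\<lambda>n i. \<lparr> fob = fob (gface H n i),
        far = (\<lambda>(h, u). (far (gface H n i) h, rface V n i (trg (lev H n) h) u)) \<rparr>),
     gdegen = (\<lambda>n i. \<lparr> fob = fob (gdegen H n i),
        far = (\<lambda>(h, u). (far (gdegen H n i) h, rdegen V n i (trg (lev H n) h) u)) \<rparr>) \<rparr>"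

definition semidirect_proj :: "nat \<Rightarrow> ('p, 'q \<times> 'a, 'p, 'q) gfun" where
  "semidirect_proj n = \<lparr> fob = (\<lambda>y. y), far = fst \<rparr>"

definition zero_section ::
  "('p, 'q) sgpd \<Rightarrow> ('p, 'q, 'a) srep \<Rightarrow> nat \<Rightarrow> ('p, 'q, 'p, 'q \<times> 'a) gfun" where
  "zero_section H V n = \<lparr> fob = (\<lambda>y. y), far = (\<lambda>h. (h, rzero V n (trg (lev H n) h))) \<rparr>"

section \<open>Abelian extensions\<close>

definition gkernel :: "('o, 'm) gpd \<Rightarrow> ('p, 'q) gpd \<Rightarrow> ('o, 'm, 'p, 'q) gfun \<Rightarrow> 'o \<Rightarrow> 'm set" where
  "gkernel G H f x = {a \<in> Ar G. src G a = x \<and> trg G a = x \<and> far f a = gid H (fob f x)}"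

definition abelian_gpd_extension :: "('o, 'm) gpd \<Rightarrow> ('p, 'q) gpd \<Rightarrow> ('o, 'm, 'p, 'q) gfun \<Rightarrow> bool" where
  "abelian_gpd_extension G H f \<longleftrightarrow> groupoid G \<and> groupoid H \<and> gfunctor G H f \<and>
     bij_betw (fob f) (Ob G) (Ob H) \<and> far f ` Ar G = Ar H \<and>
     (\<forall>x \<in> Ob G. \<forall>a \<in> gkernel G H f x. \<forall>b \<in> gkernel G H f x. gcomp G a b = gcomp G b a)"

record ('o, 'm, 'p, 'q) gext =
  etot :: "('o, 'm) sgpd"
  ebase :: "('p, 'q) sgpd"
  eprj :: "nat \<Rightarrow> ('o, 'm, 'p, 'q) gfun"

definition abelian_extension :: "('o, 'm, 'p, 'q) gext \<Rightarrow> bool" where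
  "abelian_extension E \<longleftrightarrow>
     simplicial_groupoid (etot E) \<and> simplicial_groupoid (ebase E) \<and> sgpd_map (etot E) (ebase E) (eprj E) \<and>
     (\<forall>n. abelian_gpd_extension (lev (etot E) n) (lev (ebase E) n) (eprj E n))"

text \<open>The kernel as a representation of the base. Objects of the base are identified with those of
  the total groupoid, and \<open>h\<close> acts by conjugation with any arrow over \<open>h\<close>: the choice does not matter
  because the kernel is abelian.\<close>

definition kernel_rep :: "('o, 'm, 'p, 'q) gext \<Rightarrow> ('p, 'q, 'm) srep" where
  "kernel_rep E = (let ob = (\<lambda>n. inv_into (Ob (lev (etot E) n)) (fob (eprj E n))) in \<lparr>
     rcar = (\<lambda>n y. gkernel (lev (etot E) n) (lev (ebase E) n) (eprj E n) (ob n y)),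
     radd = (\<lambda>n y. gcomp (lev (etot E) n)),
     rzero = (\<lambda>n y. gid (lev (etot E) n) (ob n y)),
     rneg = (\<lambda>n y. ginv (lev (etot E) n)),
     ract = (\<lambda>n h a. let g = (SOME g. g \<in> Ar (lev (etot E) n) \<and> far (eprj E n) g = h) in
        gcomp (lev (etot E) n) (gcomp (lev (etot E) n) g a) (ginv (lev (etot E) n) g)),
     rface = (\<lambda>n i y. far (gface (etot E) n i)),
     rdegen = (\<lambda>n i y. far (gdegen (etot E) n i)) \<rparr>)"

text \<open>The total simplicial set of the kernel, lying over the simplicial set of objects.\<close>

definition kernel_sset :: "('o, 'm, 'p, 'q) gext \<Rightarrow> ('p \<times> 'm) sset" where
  "kernel_sset E = arr_sset (rep_gpd (ebase E) (kernel_rep E))"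

text \<open>When the objects are constant, the kernel is a simplicial abelian group at each object, and
  \<open>fibrant_kernel\<close> always holds: see \<open>fibrant_kernel_if_constant_objects\<close> below. When the objects vary
  it is a genuine condition, and it cannot be dropped if \<open>Wbar (etot E)\<close> is to be the base change
  of a fibration along \<open>Wbar (ebase E)\<close>. For instance, let \<open>H\<close> have objects \<open>\<Delta>\<^sup>1\<close> and only identity
  arrows, and let the automorphism group of a simplex \<open>\<sigma>\<close> in \<open>G\<close> be a fixed abelian group \<open>M \<noteq> 0\<close> if \<open>\<sigma>\<close> is
  constant at the vertex \<open>0\<close>, and zero otherwise. Then \<open>Wbar G\<close>, over \<open>Wbar H = \<Delta>\<^sup>1\<close>, has the fibres \<open>K(M, 1)\<close>
  and a point, so it is not a fibration.\<close>

definition fibrant_kernel :: "('o, 'm, 'p, 'q) gext \<Rightarrow> bool" where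
  "fibrant_kernel E \<longleftrightarrow> kan_fibration (kernel_sset E) (obj_sset (ebase E)) (\<lambda>n. fst)"

definition constant_objects :: "('o, 'm) sgpd \<Rightarrow> bool" where
  "constant_objects \<Gamma> \<longleftrightarrow>
    (\<forall>n. Ob (lev \<Gamma> n) = Ob (lev \<Gamma> 0)) \<and>
    (\<forall>n. \<forall>i \<le> Suc n. \<forall>x \<in> Ob (lev \<Gamma> 0). fob (gface \<Gamma> (Suc n) i) x = x) \<and>
    (\<forall>n. \<forall>i \<le> n. \<forall>x \<in> Ob (lev \<Gamma> 0). fob (gdegen \<Gamma> n i) x = x)"

definition semidirect_Wbar :: "('o, 'm, 'p, 'q) gext \<Rightarrow> ('p, 'q \<times> ('p \<times> ('p \<times> 'm) list) list) sgpd" where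
  "semidirect_Wbar E = semidirect (ebase E) (Wbar_rep (ebase E) (kernel_rep E))"

text \<open>Morphisms of abelian extensions are commutative squares.\<close>

record ('o, 'm, 'p, 'q) gext_map =
  mtot :: "nat \<Rightarrow> ('o, 'm, 'o, 'm) gfun"
  mbase :: "nat \<Rightarrow> ('p, 'q, 'p, 'q) gfun"

definition extension_map ::
  "('o, 'm, 'p, 'q) gext \<Rightarrow> ('o, 'm, 'p, 'q) gext \<Rightarrow> ('o, 'm, 'p, 'q) gext_map \<Rightarrow> bool" where
  "extension_map E E' F \<longleftrightarrow> sgpd_map (etot E) (etot E') (mtot F) \<and> sgpd_map (ebase E) (ebase E') (mbase F) \<and>
     (\<forall>n. gfun_eq (lev (etot E) n) (gfun_comp (eprj E' n) (mtot F n)) (gfun_comp (mbase F n) (eprj E n)))"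

definition extension_map_eq ::
  "('o, 'm, 'p, 'q) gext \<Rightarrow> ('o, 'm, 'p, 'q) gext_map \<Rightarrow> ('o, 'm, 'p, 'q) gext_map \<Rightarrow> bool" where
  "extension_map_eq E F F' \<longleftrightarrow> (\<forall>n. gfun_eq (lev (etot E) n) (mtot F n) (mtot F' n) \<and>
     gfun_eq (lev (ebase E) n) (mbase F n) (mbase F' n))"

definition extension_map_id :: "('o, 'm, 'p, 'q) gext_map" where
  "extension_map_id = \<lparr> mtot = (\<lambda>n. \<lparr> fob = (\<lambda>x. x), far = (\<lambda>g. g) \<rparr>),
     mbase = (\<lambda>n. \<lparr> fob = (\<lambda>x. x), far = (\<lambda>g. g) \<rparr>) \<rparr>"

definition extension_map_comp ::
  "('o, 'm, 'p, 'q) gext_map \<Rightarrow> ('o, 'm, 'p, 'q) gext_map \<Rightarrow> ('o, 'm, 'p, 'q) gext_map" where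
  "extension_map_comp F' F = \<lparr> mtot = (\<lambda>n. gfun_comp (mtot F' n) (mtot F n)),
     mbase = (\<lambda>n. gfun_comp (mbase F' n) (mbase F n)) \<rparr>"

section \<open>The kernel condition for constant objects\<close>

lemma simplicial_group_horn:
  fixes S :: "nat \<Rightarrow> 'a set" and d s :: "nat \<Rightarrow> nat \<Rightarrow> 'a \<Rightarrow> 'a" and m :: "nat \<Rightarrow> 'a \<Rightarrow> 'a \<Rightarrow> 'a"
  assumes X: "sset \<lparr> simp = S, face = d, degen = s \<rparr>"
    and m: "\<And>n a b. a \<in> S n \<Longrightarrow> b \<in> S n \<Longrightarrow> m n a b \<in> S n"
    and assoc: "\<And>n a b c. a \<in> S n \<Longrightarrow> b \<in> S n \<Longrightarrow> c \<in> S n \<Longrightarrow> m n (m n a b) c = m n a (m n b c)"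
    and e: "\<And>n. e n \<in> S n" "\<And>n a. a \<in> S n \<Longrightarrow> m n a (e n) = a" "\<And>n a. a \<in> S n \<Longrightarrow> m n (e n) a = a"
    and v: "\<And>n a. a \<in> S n \<Longrightarrow> v n a \<in> S n" "\<And>n a. a \<in> S n \<Longrightarrow> m n (v n a) a = e n"
      "\<And>n a. a \<in> S n \<Longrightarrow> m n a (v n a) = e n"
    and dm: "\<And>n i a b. a \<in> S (Suc n) \<Longrightarrow> b \<in> S (Suc n) \<Longrightarrow> i \<le> Suc n \<Longrightarrow>
      d (Suc n) i (m (Suc n) a b) = m n (d (Suc n) i a) (d (Suc n) i b)"
    and se: "\<And>n i. i \<le> n \<Longrightarrow> s n i (e n) = e (Suc n)"
    and k: "k \<le> Suc n" and y: "\<And>i. i \<le> Suc n \<Longrightarrow> i \<noteq> k \<Longrightarrow> y i \<in> S n"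
    and compat: "\<And>i j. i < j \<Longrightarrow> j \<le> Suc n \<Longrightarrow> i \<noteq> k \<Longrightarrow> j \<noteq> k \<Longrightarrow> d n i (y j) = d n (j - 1) (y i)"
  shows "\<exists>x \<in> S (Suc n). \<forall>i \<le> Suc n. i \<noteq> k \<longrightarrow> d (Suc n) i x = y i"
proof -
  have dS: "d (Suc n) i x \<in> S n" if "x \<in> S (Suc n)" "i \<le> Suc n" for n i x
    using X that by (simp add: sset_def)
  have sS: "s n i x \<in> S (Suc n)" if "x \<in> S n" "i \<le> n" for n i x
    using X that by (simp add: sset_def)
  have dd: "d (Suc n) i (d (Suc (Suc n)) j x) = d (Suc n) (j - 1) (d (Suc (Suc n)) i x)"
    if "x \<in> S (Suc (Suc n))" "i < j" "j \<le> Suc (Suc n)" for n i j x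
    using X that unfolding sset_def by simp
  have ds0: "d (Suc n) j (s n j x) = x" "d (Suc n) (Suc j) (s n j x) = x"
    if "x \<in> S n" "j \<le> n" for n j x
    using X that unfolding sset_def by auto
  have ds1: "d (Suc n) i (s n j x) = s (n - 1) (j - 1) (d n i x)" if "x \<in> S n" "i < j" "j \<le> n" for n i j x
    using X that unfolding sset_def by simp
  have ds2: "d (Suc n) i (s n j x) = s (n - 1) j (d n (i - 1) x)" if "x \<in> S n" "Suc j < i" "i \<le> Suc n" for n i j x
    using X that unfolding sset_def by simp
  have de: "d (Suc n) i (e (Suc n)) = e n" if "i \<le> Suc n" for n i
  proof -
    let ?a = "d (Suc n) i (e (Suc n))"
    have a: "?a \<in> S n" using that dS e by blast
    have "m n ?a ?a = ?a" using dm[of "e (Suc n)" n "e (Suc n)" i] e that by simp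
    then have "m n (v n ?a) (m n ?a ?a) = m n (v n ?a) ?a" by simp
    then show ?thesis using a assoc v e by metis
  qed
  have dv: "m n (d (Suc n) i (v (Suc n) a)) (d (Suc n) i a) = e n"
    if "a \<in> S (Suc n)" "i \<le> Suc n" for n i a
    using dm[of "v (Suc n) a" n a i] that v de by simp
  \<comment> \<open>the basic correction step\<close>
  have step: "\<exists>w' \<in> S (Suc n). d (Suc n) i w' = y i \<and> (\<forall>j \<in> J. d (Suc n) j w' = y j)"
    if w: "w \<in> S (Suc n)" and i: "i \<le> Suc n" "i \<noteq> k" and t: "t \<le> n" "i = t \<or> i = Suc t"
      and J: "\<forall>j \<in> J. j \<le> Suc n \<and> j \<noteq> k \<and> (j < t \<or> Suc t < j) \<and> d (Suc n) j w = y j" for w i t J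
  proof -
    define c where "c = m n (v n (d (Suc n) i w)) (y i)"
    define w' where "w' = m (Suc n) w (s n t c)"
    have dw: "d (Suc n) i w \<in> S n" using dS w i by blast
    have yi: "y i \<in> S n" using y i by blast
    have c: "c \<in> S n" unfolding c_def using dw yi m v by blast
    have sc: "s n t c \<in> S (Suc n)" using c sS t by blast
    have w': "w' \<in> S (Suc n)" unfolding w'_def using w sc m by blast
    have dsc: "d (Suc n) i (s n t c) = c" using ds0[OF c t(1)] t(2) by auto
    have "d (Suc n) i w' = m n (d (Suc n) i w) c" unfolding w'_def using dm[OF w sc i(1)] dsc by simp
    also have "\<dots> = y i" unfolding c_def using assoc dw yi v e by metis
    finally have A: "d (Suc n) i w' = y i" .
    have "d (Suc n) j w' = y j" if j: "j \<in> J" for j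
    proof -
      have jj: "j \<le> Suc n" "j \<noteq> k" "j < t \<or> Suc t < j" and wj: "d (Suc n) j w = y j" using J j by auto
      have yj: "y j \<in> S n" using y jj by blast
      obtain n' where n': "n = Suc n'" using jj t by (cases n) auto
      have eq: "d (Suc n) j (s n t c) = e n"
        using jj(3)
      proof
        assume lt: "j < t"
        then have ji: "j < i" using t by auto
        have "d n j (d (Suc n) i w) = d n (i - 1) (d (Suc n) j w)"
          using dd[of w n' j i] w n' ji i by simp
        also have "\<dots> = d n j (y i)" using compat[OF ji i(1) jj(2) i(2)] wj by simp
        finally have h: "d n j (d (Suc n) i w) = d n j (y i)" .
        have jn: "j \<le> n" using lt t by simp
        have "d n j c = m n' (d n j (v n (d (Suc n) i w))) (d n j (y i))"
          unfolding c_def using dm[of "v n (d (Suc n) i w)" n' "y i" j] dw yi v jn n' by simp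
        also have "\<dots> = e n'" using dv[of "d (Suc n) i w" n' j] dw jn n' h by simp
        finally have "d n j c = e n'" .
        then show ?thesis using ds1[OF c lt t(1)] se[of "t - 1" n'] lt t n' by simp
      next
        assume gt: "Suc t < j"
        then have ij: "i < j" using t by auto
        have "d n i (d (Suc n) j w) = d n (j - 1) (d (Suc n) i w)"
          using dd[of w n' i j] w n' ij jj by simp
        moreover have "d n i (y j) = d n (j - 1) (y i)" using compat[OF ij jj(1) i(2) jj(2)] .
        ultimately have h: "d n (j - 1) (d (Suc n) i w) = d n (j - 1) (y i)" using wj by simp
        have jn: "j - 1 \<le> n" using jj by simp
        have "d n (j - 1) c = m n' (d n (j - 1) (v n (d (Suc n) i w))) (d n (j - 1) (y i))"
          unfolding c_def using dm[of "v n (d (Suc n) i w)" n' "y i" "j - 1"] dw yi v jn n' by simp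
        also have "\<dots> = e n'" using dv[of "d (Suc n) i w" n' "j - 1"] dw jn n' h by simp
        finally have "d n (j - 1) c = e n'" .
        then show ?thesis using ds2[OF c gt jj(1)] se[of t n'] gt jj n' by simp
      qed
      have "d (Suc n) j w' = m n (d (Suc n) j w) (e n)" unfolding w'_def using dm[OF w sc jj(1)] eq by simp
      then show ?thesis using wj yj e by simp
    qed
    then show ?thesis using A w' by blast
  qed
  have low: "i \<le> k \<Longrightarrow> \<exists>w \<in> S (Suc n). \<forall>j \<in> {..<i}. d (Suc n) j w = y j" for i
  proof (induction i)
    case 0
    then show ?case using e by auto
  next
    case (Suc i)
    then obtain w where w: "w \<in> S (Suc n)" "\<forall>j \<in> {..<i}. d (Suc n) j w = y j" by auto
    obtain w' where "w' \<in> S (Suc n)" "d (Suc n) i w' = y i" "\<forall>j \<in> {..<i}. d (Suc n) j w' = y j"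
      using step[OF w(1), of i i "{..<i}"] w(2) Suc.prems k by auto
    then have "\<forall>j \<in> {..<Suc i}. d (Suc n) j w' = y j" by (auto simp: less_Suc_eq)
    then show ?case using \<open>w' \<in> S (Suc n)\<close> by blast
  qed
  have high: "k + i \<le> Suc n \<Longrightarrow>
    \<exists>w \<in> S (Suc n). \<forall>j \<in> {..<k} \<union> {Suc (Suc n) - i..Suc n}. d (Suc n) j w = y j" for i
  proof (induction i)
    case 0
    then show ?case using low[of k] by auto
  next
    case (Suc i)
    let ?J = "{..<k} \<union> {Suc (Suc n) - i..Suc n}" and ?i = "Suc n - i"
    obtain w where w: "w \<in> S (Suc n)" "\<forall>j \<in> ?J. d (Suc n) j w = y j"
      using Suc.IH Suc.prems by fastforce
    have i: "?i \<le> Suc n" "?i \<noteq> k" "n - i \<le> n" "?i = Suc (n - i)" using Suc.prems by linarith+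
    have "\<forall>j \<in> ?J. j \<le> Suc n \<and> j \<noteq> k \<and> (j < n - i \<or> Suc (n - i) < j) \<and> d (Suc n) j w = y j"
    proof
      fix j assume j: "j \<in> ?J"
      have "j < k \<or> (Suc (Suc n) - i \<le> j \<and> j \<le> Suc n)" using j by auto
      then have "j \<le> Suc n \<and> j \<noteq> k \<and> (j < n - i \<or> Suc (n - i) < j)" using Suc.prems by linarith
      then show "j \<le> Suc n \<and> j \<noteq> k \<and> (j < n - i \<or> Suc (n - i) < j) \<and> d (Suc n) j w = y j" using w j by blast
    qed
    then obtain w' where w': "w' \<in> S (Suc n)" "d (Suc n) ?i w' = y ?i" "\<forall>j \<in> ?J. d (Suc n) j w' = y j"
      using step[OF w(1) i(1-3) disjI2[OF i(4)]] by blast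
    have "{..<k} \<union> {Suc (Suc n) - Suc i..Suc n} \<subseteq> insert (Suc n - i) ({..<k} \<union> {Suc (Suc n) - i..Suc n})"
      by auto
    then show ?case using w' by blast
  qed
  obtain w where "w \<in> S (Suc n)" "\<forall>j \<in> {..<k} \<union> {Suc (Suc n) - (Suc n - k)..Suc n}. d (Suc n) j w = y j"
    using high[of "Suc n - k"] k by auto
  then show ?thesis using k by (intro bexI[of _ w]) auto
qed


lemma sset_face: "sset X \<Longrightarrow> x \<in> simp X (Suc n) \<Longrightarrow> i \<le> Suc n \<Longrightarrow> face X (Suc n) i x \<in> simp X n"
  and sset_degen: "sset X \<Longrightarrow> x \<in> simp X n \<Longrightarrow> i \<le> n \<Longrightarrow> degen X n i x \<in> simp X (Suc n)"
  by (simp_all add: sset_def)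

lemma gfunctorD:
  assumes "gfunctor G H F"
  shows "x \<in> Ob G \<Longrightarrow> fob F x \<in> Ob H" "x \<in> Ob G \<Longrightarrow> far F (gid G x) = gid H (fob F x)"
    "g \<in> Ar G \<Longrightarrow> far F g \<in> Ar H" "g \<in> Ar G \<Longrightarrow> src H (far F g) = fob F (src G g)"
    "g \<in> Ar G \<Longrightarrow> trg H (far F g) = fob F (trg G g)"
  using assms by (simp_all add: gfunctor_def)

lemma sgpdD:
  assumes "simplicial_groupoid \<Gamma>"
  shows "i \<le> Suc n \<Longrightarrow> gfunctor (lev \<Gamma> (Suc n)) (lev \<Gamma> n) (gface \<Gamma> (Suc n) i)"
    "i \<le> n \<Longrightarrow> gfunctor (lev \<Gamma> n) (lev \<Gamma> (Suc n)) (gdegen \<Gamma> n i)"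
  using assms by (simp_all add: simplicial_groupoid_def)

lemma kernel_sset_simps:
  "simp (kernel_sset E) n = Sigma (Ob (lev (ebase E) n)) (rcar (kernel_rep E) n)"
  "face (kernel_sset E) n i (x, a) = (fob (gface (ebase E) n i) x, far (gface (etot E) n i) a)"
  "degen (kernel_sset E) n i (x, a) = (fob (gdegen (ebase E) n i) x, far (gdegen (etot E) n i) a)"
  by (simp_all add: kernel_sset_def arr_sset_def rep_gpd_def kernel_rep_def Let_def)

lemma mem_kernel:
  assumes "abelian_extension E" "y \<in> Ob (lev (ebase E) n)"
  shows "a \<in> rcar (kernel_rep E) n y \<longleftrightarrow> a \<in> Ar (lev (etot E) n) \<and>
    src (lev (etot E) n) a = trg (lev (etot E) n) a \<and> far (eprj E n) a = gid (lev (ebase E) n) y"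
proof -
  let ?G = "lev (etot E) n" and ?H = "lev (ebase E) n" and ?f = "eprj E n"
  have ab: "abelian_gpd_extension ?G ?H ?f" using assms by (simp add: abelian_extension_def)
  then have bij: "bij_betw (fob ?f) (Ob ?G) (Ob ?H)" and F: "gfunctor ?G ?H ?f"
    and gG: "groupoid ?G" and gH: "groupoid ?H"
    unfolding abelian_gpd_extension_def by blast+
  define x where "x = inv_into (Ob ?G) (fob ?f) y"
  have x: "x \<in> Ob ?G" "fob ?f x = y"
    using bij assms(2) unfolding x_def bij_betw_def by (auto simp: inv_into_into f_inv_into_f)
  have "src ?G a = x" if "a \<in> Ar ?G" "far ?f a = gid ?H y"
  proof -
    have "fob ?f (src ?G a) = y"
      using F that gH assms(2) unfolding gfunctor_def groupoid_def by metis
    moreover have "src ?G a \<in> Ob ?G" using gG that unfolding groupoid_def by blast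
    ultimately show ?thesis using bij x unfolding bij_betw_def inj_on_def by blast
  qed
  then show ?thesis using x by (auto simp: kernel_rep_def gkernel_def x_def)
qed

lemma sset_kernel:
  assumes E: "abelian_extension E"
  shows "sset (kernel_sset E)" "smap (kernel_sset E) (obj_sset (ebase E)) (\<lambda>n. fst)"
proof -
  have A: "sset (arr_sset (etot E))" and B: "sset (obj_sset (ebase E))"
    and G: "simplicial_groupoid (etot E)" and H: "simplicial_groupoid (ebase E)"
    and P: "sgpd_map (etot E) (ebase E) (eprj E)"
    using E unfolding abelian_extension_def simplicial_groupoid_def by blast+
  have f: "far (gface (etot E) (Suc n) i) a \<in> rcar (kernel_rep E) n (fob (gface (ebase E) (Suc n) i) x)"
    if x: "x \<in> Ob (lev (ebase E) (Suc n))" and a: "a \<in> rcar (kernel_rep E) (Suc n) x" and i: "i \<le> Suc n" for n i x a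
  proof -
    let ?b = "far (gface (etot E) (Suc n) i) a" and ?y = "fob (gface (ebase E) (Suc n) i) x"
    have y: "?y \<in> Ob (lev (ebase E) n)" and
      id: "far (gface (ebase E) (Suc n) i) (gid (lev (ebase E) (Suc n)) x) = gid (lev (ebase E) n) ?y"
      using gfunctorD(1,2)[OF sgpdD(1)[OF H i] x] .
    have a': "a \<in> Ar (lev (etot E) (Suc n))" "src (lev (etot E) (Suc n)) a = trg (lev (etot E) (Suc n)) a"
      "far (eprj E (Suc n)) a = gid (lev (ebase E) (Suc n)) x" using a mem_kernel[OF E x] by auto
    have "?b \<in> Ar (lev (etot E) n)" "src (lev (etot E) n) ?b = trg (lev (etot E) n) ?b"
      using gfunctorD(3-5)[OF sgpdD(1)[OF G i] a'(1)] a'(2) by simp_all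
    moreover have "far (eprj E n) ?b = gid (lev (ebase E) n) ?y"
      using P a' i id unfolding sgpd_map_def smap_def arr_sset_def by simp
    ultimately show ?thesis using mem_kernel[OF E y] by simp
  qed
  have g: "far (gdegen (etot E) n i) a \<in> rcar (kernel_rep E) (Suc n) (fob (gdegen (ebase E) n i) x)"
    if x: "x \<in> Ob (lev (ebase E) n)" and a: "a \<in> rcar (kernel_rep E) n x" and i: "i \<le> n" for n i x a
  proof -
    let ?b = "far (gdegen (etot E) n i) a" and ?y = "fob (gdegen (ebase E) n i) x"
    have y: "?y \<in> Ob (lev (ebase E) (Suc n))" and
      id: "far (gdegen (ebase E) n i) (gid (lev (ebase E) n) x) = gid (lev (ebase E) (Suc n)) ?y"
      using gfunctorD(1,2)[OF sgpdD(2)[OF H i] x] .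
    have a': "a \<in> Ar (lev (etot E) n)" "src (lev (etot E) n) a = trg (lev (etot E) n) a"
      "far (eprj E n) a = gid (lev (ebase E) n) x" using a mem_kernel[OF E x] by auto
    have "?b \<in> Ar (lev (etot E) (Suc n))" "src (lev (etot E) (Suc n)) ?b = trg (lev (etot E) (Suc n)) ?b"
      using gfunctorD(3-5)[OF sgpdD(2)[OF G i] a'(1)] a'(2) by simp_all
    moreover have "far (eprj E (Suc n)) ?b = gid (lev (ebase E) (Suc n)) ?y"
      using P a' i id unfolding sgpd_map_def smap_def arr_sset_def by simp
    ultimately show ?thesis using mem_kernel[OF E y] by simp
  qed
  have K: "\<And>n x a. x \<in> Ob (lev (ebase E) n) \<Longrightarrow> a \<in> rcar (kernel_rep E) n x \<Longrightarrow> a \<in> Ar (lev (etot E) n)"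
    using mem_kernel[OF E] by blast
  have fo: "\<And>n x i. x \<in> Ob (lev (ebase E) (Suc n)) \<Longrightarrow> i \<le> Suc n \<Longrightarrow> fob (gface (ebase E) (Suc n) i) x \<in> Ob (lev (ebase E) n)"
    and go: "\<And>n x i. x \<in> Ob (lev (ebase E) n) \<Longrightarrow> i \<le> n \<Longrightarrow> fob (gdegen (ebase E) n i) x \<in> Ob (lev (ebase E) (Suc n))"
    using B unfolding sset_def obj_sset_def by simp_all
  show "sset (kernel_sset E)"
    using A B unfolding sset_def
    by (intro conjI allI ballI impI; clarsimp simp: kernel_sset_simps f g fo go obj_sset_def arr_sset_def K)
  show "smap (kernel_sset E) (obj_sset (ebase E)) (\<lambda>n. fst)"
    unfolding smap_def by (auto simp: kernel_sset_simps obj_sset_def)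
qed

lemma fibrant_kernel_if_constant_objects:
  assumes E: "abelian_extension E" and const: "constant_objects (ebase E)"
  shows "fibrant_kernel E"
  unfolding fibrant_kernel_def kan_fibration_def
proof (intro conjI allI impI)
  show ks: "sset (kernel_sset E)" and km: "smap (kernel_sset E) (obj_sset (ebase E)) (\<lambda>n. fst)"
    using sset_kernel[OF E] by blast+
  show "sset (obj_sset (ebase E))" using E unfolding abelian_extension_def simplicial_groupoid_def by blast
  fix n k y b
  assume hyp: "k \<le> Suc n \<and> b \<in> simp (obj_sset (ebase E)) (Suc n) \<and>
       (\<forall>i \<le> Suc n. i \<noteq> k \<longrightarrow> y i \<in> simp (kernel_sset E) n \<and> fst (y i) = face (obj_sset (ebase E)) (Suc n) i b) \<and>
       (\<forall>i j. i < j \<and> j \<le> Suc n \<and> i \<noteq> k \<and> j \<noteq> k \<longrightarrow>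
          face (kernel_sset E) n i (y j) = face (kernel_sset E) n (j - 1) (y i))"
  have Ob: "Ob (lev (ebase E) n) = Ob (lev (ebase E) 0)" for n
    using const unfolding constant_objects_def by blast
  have b0: "b \<in> Ob (lev (ebase E) (Suc n))" using hyp by (simp add: obj_sset_def)
  have b: "b \<in> Ob (lev (ebase E) i)" for i using b0 Ob[of "Suc n"] Ob[of i] by blast
  have fb: "fob (gface (ebase E) (Suc n) i) b = b" if "i \<le> Suc n" for n i
    using const b that unfolding constant_objects_def by blast
  have gb: "fob (gdegen (ebase E) n i) b = b" if "i \<le> n" for n i
    using const b that unfolding constant_objects_def by blast
  define S where "S = (\<lambda>n. rcar (kernel_rep E) n b)"
  define d where "d = (\<lambda>n i. far (gface (etot E) n i))"
  define s where "s = (\<lambda>n i. far (gdegen (etot E) n i))"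
  define x where "x = (\<lambda>n. inv_into (Ob (lev (etot E) n)) (fob (eprj E n)) b)"
  have ab: "abelian_gpd_extension (lev (etot E) n) (lev (ebase E) n) (eprj E n)" for n
    using E by (simp add: abelian_extension_def)
  have gG: "groupoid (lev (etot E) n)" and gH: "groupoid (lev (ebase E) n)"
    and F: "gfunctor (lev (etot E) n) (lev (ebase E) n) (eprj E n)"
    and bij: "bij_betw (fob (eprj E n)) (Ob (lev (etot E) n)) (Ob (lev (ebase E) n))" for n
    using ab[of n] unfolding abelian_gpd_extension_def by blast+
  have x: "x n \<in> Ob (lev (etot E) n)" "fob (eprj E n) (x n) = b" for n
    using bij[of n] b[of n] unfolding x_def bij_betw_def by (auto simp: inv_into_into f_inv_into_f)
  have S: "a \<in> S n \<longleftrightarrow> a \<in> Ar (lev (etot E) n) \<and> src (lev (etot E) n) a = x n \<and> trg (lev (etot E) n) a = x n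
      \<and> far (eprj E n) a = gid (lev (ebase E) n) b" for n a
    using x[of n] by (simp add: S_def kernel_rep_def gkernel_def x_def)
  have G: "simplicial_groupoid (etot E)" and P: "sgpd_map (etot E) (ebase E) (eprj E)"
    using E by (simp_all add: abelian_extension_def)
  have Hid: "gcomp (lev (ebase E) n) (gid (lev (ebase E) n) b) (gid (lev (ebase E) n) b) = gid (lev (ebase E) n) b" for n
    using gH[of n] b[of n] unfolding groupoid_def by metis
  have mem: "gid (lev (etot E) n) (x n) \<in> S n" for n
    using gG[of n] F[of n] x[of n] unfolding S groupoid_def gfunctor_def by simp
  have mS: "gcomp (lev (etot E) n) a c \<in> S n" if "a \<in> S n" "c \<in> S n" for n a c
    using gG[of n] F[of n] that Hid[of n] unfolding S groupoid_def gfunctor_def by simp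
  have vS: "ginv (lev (etot E) n) a \<in> S n" if "a \<in> S n" for n a
  proof -
    let ?v = "ginv (lev (etot E) n) a" and ?H = "lev (ebase E) n"
    have a: "a \<in> Ar (lev (etot E) n)" "src (lev (etot E) n) a = x n" "trg (lev (etot E) n) a = x n"
      "far (eprj E n) a = gid ?H b" using that S by auto
    have v: "?v \<in> Ar (lev (etot E) n)" "src (lev (etot E) n) ?v = x n" "trg (lev (etot E) n) ?v = x n"
      "gcomp (lev (etot E) n) ?v a = gid (lev (etot E) n) (x n)"
      using gG[of n] a unfolding groupoid_def by auto
    have "gid ?H b = far (eprj E n) (gcomp (lev (etot E) n) ?v a)"
      using v F[of n] x[of n] unfolding gfunctor_def by simp
    also have "\<dots> = gcomp ?H (far (eprj E n) ?v) (gid ?H b)"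
      using F[of n] v(1,2) a unfolding gfunctor_def by simp
    also have "\<dots> = far (eprj E n) ?v"
    proof -
      have "far (eprj E n) ?v \<in> Ar ?H" "src ?H (far (eprj E n) ?v) = b"
        using F[of n] v x[of n] unfolding gfunctor_def by auto
      then show ?thesis using gH[of n] unfolding groupoid_def by metis
    qed
    finally show ?thesis using v S by simp
  qed
  have se: "s n i (gid (lev (etot E) n) (x n)) = gid (lev (etot E) (Suc n)) (x (Suc n))" if "i \<le> n" for n i
  proof -
    let ?z = "fob (gdegen (etot E) n i) (x n)"
    have z: "?z \<in> Ob (lev (etot E) (Suc n))" and
      e: "s n i (gid (lev (etot E) n) (x n)) = gid (lev (etot E) (Suc n)) ?z"
      using gfunctorD(1,2)[OF sgpdD(2)[OF G that] x(1)] unfolding s_def by blast+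
    have "fob (eprj E (Suc n)) ?z = b"
      using P that x[of n] gb[OF that] unfolding sgpd_map_def smap_def obj_sset_def by simp
    then have "?z = x (Suc n)" using bij[of "Suc n"] z x[of "Suc n"] unfolding bij_betw_def inj_on_def by metis
    then show ?thesis using e by simp
  qed
  have X: "sset \<lparr> simp = S, face = d, degen = s \<rparr>"
  proof -
    have A: "sset (arr_sset (etot E))" using G unfolding simplicial_groupoid_def by blast
    have K: "\<And>n a. a \<in> S n \<Longrightarrow> a \<in> Ar (lev (etot E) n)" using S by blast
    have f: "d (Suc n) i a \<in> S n" if "a \<in> S (Suc n)" "i \<le> Suc n" for n i a
    proof -
      have "(b, a) \<in> simp (kernel_sset E) (Suc n)" using that b by (simp add: kernel_sset_simps S_def)
      then have "face (kernel_sset E) (Suc n) i (b, a) \<in> simp (kernel_sset E) n"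
        using sset_face[OF ks] that by blast
      then show ?thesis using fb that by (simp add: kernel_sset_simps S_def d_def)
    qed
    have g: "s n i a \<in> S (Suc n)" if "a \<in> S n" "i \<le> n" for n i a
    proof -
      have "(b, a) \<in> simp (kernel_sset E) n" using that b by (simp add: kernel_sset_simps S_def)
      then have "degen (kernel_sset E) n i (b, a) \<in> simp (kernel_sset E) (Suc n)"
        using sset_degen[OF ks] that by blast
      then show ?thesis using gb that by (simp add: kernel_sset_simps S_def s_def)
    qed
    show ?thesis
      using A unfolding sset_def
      by (intro conjI allI ballI impI; simp add: f g arr_sset_def K flip: d_def s_def)
  qed
  have y: "snd (y i) \<in> S n" "fst (y i) = b" if "i \<le> Suc n" "i \<noteq> k" for i
    using hyp that fb[of i n] by (auto simp: kernel_sset_simps S_def obj_sset_def)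
  have compat: "d n i (snd (y j)) = d n (j - 1) (snd (y i))"
    if "i < j" "j \<le> Suc n" "i \<noteq> k" "j \<noteq> k" for i j
  proof -
    have "face (kernel_sset E) n i (y j) = face (kernel_sset E) n (j - 1) (y i)" using hyp that by blast
    then show ?thesis by (cases "y i"; cases "y j") (simp add: kernel_sset_simps d_def)
  qed
  have "\<exists>a \<in> S (Suc n). \<forall>i \<le> Suc n. i \<noteq> k \<longrightarrow> d (Suc n) i a = snd (y i)"
  proof (rule simplicial_group_horn[OF X, where m = "\<lambda>n. gcomp (lev (etot E) n)"
        and e = "\<lambda>n. gid (lev (etot E) n) (x n)" and v = "\<lambda>n. ginv (lev (etot E) n)"])
    show "gcomp (lev (etot E) n) (gcomp (lev (etot E) n) a b) c = gcomp (lev (etot E) n) a (gcomp (lev (etot E) n) b c)"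
      if "a \<in> S n" "b \<in> S n" "c \<in> S n" for n a b c
      using gG[of n] that unfolding S groupoid_def by simp
    show "gcomp (lev (etot E) n) a (gid (lev (etot E) n) (x n)) = a"
      "gcomp (lev (etot E) n) (gid (lev (etot E) n) (x n)) a = a"
      "gcomp (lev (etot E) n) (ginv (lev (etot E) n) a) a = gid (lev (etot E) n) (x n)"
      "gcomp (lev (etot E) n) a (ginv (lev (etot E) n) a) = gid (lev (etot E) n) (x n)"
      if "a \<in> S n" for n a
      using gG[of n] that unfolding S groupoid_def by metis+
    show "d (Suc n) i (gcomp (lev (etot E) (Suc n)) a b) = gcomp (lev (etot E) n) (d (Suc n) i a) (d (Suc n) i b)"
      if "a \<in> S (Suc n)" "b \<in> S (Suc n)" "i \<le> Suc n" for n i a b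
      using G that unfolding S simplicial_groupoid_def gfunctor_def d_def by simp
  qed (use hyp mS vS mem se y compat in auto)
  then obtain a where a: "a \<in> S (Suc n)" "\<And>i. i \<le> Suc n \<Longrightarrow> i \<noteq> k \<Longrightarrow> d (Suc n) i a = snd (y i)" by blast
  show "\<exists>x \<in> simp (kernel_sset E) (Suc n). fst x = b \<and>
      (\<forall>i \<le> Suc n. i \<noteq> k \<longrightarrow> face (kernel_sset E) (Suc n) i x = y i)"
  proof (rule bexI)
    have "face (kernel_sset E) (Suc n) i (b, a) = y i" if i: "i \<le> Suc n" "i \<noteq> k" for i
    proof -
      have "face (kernel_sset E) (Suc n) i (b, a) = (b, snd (y i))"
        using a(2)[OF i] fb[OF i(1)] unfolding kernel_sset_simps d_def by blast
      also have "\<dots> = y i" using y(2)[OF i] by (metis prod.collapse)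
      finally show ?thesis .
    qed
    then show "fst (b, a) = b \<and> (\<forall>i \<le> Suc n. i \<noteq> k \<longrightarrow> face (kernel_sset E) (Suc n) i (b, a) = y i)" by simp
    show "(b, a) \<in> simp (kernel_sset E) (Suc n)" using a(1) b by (simp add: kernel_sset_simps S_def)
  qed
qed

end

theory Submission
  imports Defs
begin

text \<open>
  Let \<open>G \<rightarrow> H\<close> be an abelian extension with kernel \<open>A\<close>. The simplicial abelian group \<open>A\<close> is contained
  in the contractible simplicial abelian group \<open>W A\<close>, with quotient \<open>Wbar A\<close>. Pushing the extension
  forward along \<open>A \<rightarrow> W A\<close> gives an extension \<open>G'\<close> of \<open>H\<close> with kernel \<open>W A\<close>. The quotient of \<open>G'\<close> by \<open>A\<close>
  is the push-forward of the extension along the zero map \<open>A \<rightarrow> Wbar A\<close>, that is, the split extension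
  \<open>H \<ltimes> Wbar A\<close>. So \<open>G' \<rightarrow> H \<ltimes> Wbar A\<close> is an extension with kernel \<open>A\<close> whose restriction to the zero
  section is \<open>G\<close>, while the kernel of \<open>G' \<rightarrow> H\<close> is contractible. The space \<open>Y'\<close> is \<open>Wbar G'\<close>.

  Apart from its zeroth face, \<open>W A\<close> is the product of \<open>A\<close> and \<open>Wbar A\<close>. This gives a model \<open>W_ext\<close> of
  \<open>G'\<close> without quotients, functorial on the nose: in each degree it is \<open>G \<ltimes> Wbar A\<close>, where \<open>G\<close> acts
  through \<open>H\<close>, and only the zeroth face \<open>(g, u) \<mapsto> (\<tau>(u) \<circ> \<partial>\<^sub>0 g, \<partial>\<^sub>0 u)\<close> differs from that of the
  semidirect product, by the first entry \<open>\<tau>(u)\<close> of \<open>u\<close>.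

  All computations in \<open>Wbar \<Gamma>\<close> use coordinates: a simplex of positive degree is the same as an object
  (\<open>wob\<close>), an arrow (\<open>war\<close>) and its zeroth face, and in these terms the faces and degeneracies have a
  simple recursive description. The coordinates reduce lifting problems in \<open>Wbar\<close> to lifting problems
  for arrows (\<open>kan_fibration_Wbar_map\<close>, \<open>boundary_lifting_Wbar_map\<close>). Horns of arrows lift from \<open>H\<close>
  to \<open>G\<close>: an arbitrary lift is corrected by filling a horn in the kernel, which is fibrant (\<open>horn_G\<close>).
  Boundaries of arrows lift from \<open>H\<close> to \<open>G'\<close>: once a horn in \<open>G\<close> is filled, the remaining zeroth face is
  wrong by an element of \<open>A\<close>, which the twist \<open>\<tau>(u)\<close> can absorb (\<open>boundary_lifting_W_ext_arr\<close>).

  A map with the lifting property for boundaries has a section, and a homotopy between the identity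
  and the map followed by this section; both come from skeletal induction (\<open>boundary_lifting_extension\<close>).
  Hence it is a weak equivalence.
\<close>

section \<open>Simplicial identities\<close>

text \<open>The simplicial identities with all shifts of indices written as successors, so that no predecessor
  of a degree or of an index has to be simplified.\<close>

lemma ssetI:
  assumes "\<And>n x i. x \<in> simp X (Suc n) \<Longrightarrow> i \<le> Suc n \<Longrightarrow> face X (Suc n) i x \<in> simp X n"
    and "\<And>n x i. x \<in> simp X n \<Longrightarrow> i \<le> n \<Longrightarrow> degen X n i x \<in> simp X (Suc n)"
    and "\<And>n x i j. x \<in> simp X (Suc (Suc n)) \<Longrightarrow> i \<le> j \<Longrightarrow> j \<le> Suc n \<Longrightarrow>
      face X (Suc n) i (face X (Suc (Suc n)) (Suc j) x) = face X (Suc n) j (face X (Suc (Suc n)) i x)"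
    and "\<And>n x i j. x \<in> simp X n \<Longrightarrow> i \<le> j \<Longrightarrow> j \<le> n \<Longrightarrow>
      degen X (Suc n) i (degen X n j x) = degen X (Suc n) (Suc j) (degen X n i x)"
    and "\<And>n x i. x \<in> simp X n \<Longrightarrow> i \<le> n \<Longrightarrow> face X (Suc n) i (degen X n i x) = x"
    and "\<And>n x i. x \<in> simp X n \<Longrightarrow> i \<le> n \<Longrightarrow> face X (Suc n) (Suc i) (degen X n i x) = x"
    and "\<And>n x i j. x \<in> simp X (Suc n) \<Longrightarrow> i \<le> j \<Longrightarrow> j \<le> n \<Longrightarrow>
      face X (Suc (Suc n)) i (degen X (Suc n) (Suc j) x) = degen X n j (face X (Suc n) i x)"
    and "\<And>n x i j. x \<in> simp X (Suc n) \<Longrightarrow> j < i \<Longrightarrow> i \<le> Suc n \<Longrightarrow>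
      face X (Suc (Suc n)) (Suc i) (degen X (Suc n) j x) = degen X n j (face X (Suc n) i x)"
  shows "sset X"
  unfolding sset_def
proof (intro conjI allI ballI impI)
  fix n x and i j :: nat
  show "face X (Suc n) i (face X (Suc (Suc n)) j x) = face X (Suc n) (j - 1) (face X (Suc (Suc n)) i x)"
    if "x \<in> simp X (Suc (Suc n))" "i < j \<and> j \<le> Suc (Suc n)"
    using assms(3)[of x n i "j - 1"] that by (cases j) auto
  show "face X (Suc n) i (degen X n j x) = degen X (n - 1) (j - 1) (face X n i x)"
    if "x \<in> simp X n" "i < j \<and> j \<le> n"
    using assms(7)[of x "n - 1" i "j - 1"] that by (cases j; cases n) auto
  show "face X (Suc n) i (degen X n j x) = degen X (n - 1) j (face X n (i - 1) x)"
    if "x \<in> simp X n" "Suc j < i \<and> i \<le> Suc n"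
    using assms(8)[of x "n - 1" j "i - 1"] that by (cases i; cases n) auto
qed (use assms in auto)

lemma
  assumes "sset X"
  shows sset_face_face: "x \<in> simp X (Suc (Suc n)) \<Longrightarrow> i \<le> j \<Longrightarrow> j \<le> Suc n \<Longrightarrow>
      face X (Suc n) i (face X (Suc (Suc n)) (Suc j) x) = face X (Suc n) j (face X (Suc (Suc n)) i x)"
    and sset_degen_degen: "x \<in> simp X n \<Longrightarrow> i \<le> j \<Longrightarrow> j \<le> n \<Longrightarrow>
      degen X (Suc n) i (degen X n j x) = degen X (Suc n) (Suc j) (degen X n i x)"
    and sset_face_degen_same: "x \<in> simp X n \<Longrightarrow> i \<le> n \<Longrightarrow> face X (Suc n) i (degen X n i x) = x"
    and sset_face_degen_Suc: "x \<in> simp X n \<Longrightarrow> i \<le> n \<Longrightarrow> face X (Suc n) (Suc i) (degen X n i x) = x"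
    and sset_face_degen_low: "x \<in> simp X (Suc n) \<Longrightarrow> i \<le> j \<Longrightarrow> j \<le> n \<Longrightarrow>
      face X (Suc (Suc n)) i (degen X (Suc n) (Suc j) x) = degen X n j (face X (Suc n) i x)"
    and sset_face_degen_high: "x \<in> simp X (Suc n) \<Longrightarrow> j < i \<Longrightarrow> i \<le> Suc n \<Longrightarrow>
      face X (Suc (Suc n)) (Suc i) (degen X (Suc n) j x) = degen X n j (face X (Suc n) i x)"
proof -
  note s = assms[unfolded sset_def]
  show "x \<in> simp X (Suc (Suc n)) \<Longrightarrow> i \<le> j \<Longrightarrow> j \<le> Suc n \<Longrightarrow>
      face X (Suc n) i (face X (Suc (Suc n)) (Suc j) x) = face X (Suc n) j (face X (Suc (Suc n)) i x)"
    using s[THEN conjunct2, THEN conjunct2, THEN conjunct1, rule_format, of x n i "Suc j"] by simp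
  show "x \<in> simp X n \<Longrightarrow> i \<le> j \<Longrightarrow> j \<le> n \<Longrightarrow>
      degen X (Suc n) i (degen X n j x) = degen X (Suc n) (Suc j) (degen X n i x)"
    using s[THEN conjunct2, THEN conjunct2, THEN conjunct2, THEN conjunct1, rule_format] by simp
  show "x \<in> simp X n \<Longrightarrow> i \<le> n \<Longrightarrow> face X (Suc n) i (degen X n i x) = x"
    "x \<in> simp X n \<Longrightarrow> i \<le> n \<Longrightarrow> face X (Suc n) (Suc i) (degen X n i x) = x"
    using s[THEN conjunct2, THEN conjunct2, THEN conjunct2, THEN conjunct2, THEN conjunct1, rule_format] by simp_all
  show "x \<in> simp X (Suc n) \<Longrightarrow> i \<le> j \<Longrightarrow> j \<le> n \<Longrightarrow>
      face X (Suc (Suc n)) i (degen X (Suc n) (Suc j) x) = degen X n j (face X (Suc n) i x)"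
    using s[THEN conjunct2, THEN conjunct2, THEN conjunct2, THEN conjunct2, THEN conjunct2, THEN conjunct1, rule_format, of x "Suc n" i "Suc j"] by simp
  show "x \<in> simp X (Suc n) \<Longrightarrow> j < i \<Longrightarrow> i \<le> Suc n \<Longrightarrow>
      face X (Suc (Suc n)) (Suc i) (degen X (Suc n) j x) = degen X n j (face X (Suc n) i x)"
    using s[THEN conjunct2, THEN conjunct2, THEN conjunct2, THEN conjunct2, THEN conjunct2, THEN conjunct2, rule_format, of x "Suc n" j "Suc i"] by simp
qed

section \<open>Groupoids and simplicial groupoids\<close>

locale gpd_loc =
  fixes G :: "('o, 'm) gpd"
  assumes gpd: "groupoid G"
begin

lemma src_Ob: "g \<in> Ar G \<Longrightarrow> src G g \<in> Ob G"
  and trg_Ob: "g \<in> Ar G \<Longrightarrow> trg G g \<in> Ob G"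
  and id_Ar: "x \<in> Ob G \<Longrightarrow> gid G x \<in> Ar G"
  and id_src: "x \<in> Ob G \<Longrightarrow> src G (gid G x) = x"
  and id_trg: "x \<in> Ob G \<Longrightarrow> trg G (gid G x) = x"
  and comp_Ar: "g \<in> Ar G \<Longrightarrow> h \<in> Ar G \<Longrightarrow> src G g = trg G h \<Longrightarrow> gcomp G g h \<in> Ar G"
  and comp_src: "g \<in> Ar G \<Longrightarrow> h \<in> Ar G \<Longrightarrow> src G g = trg G h \<Longrightarrow> src G (gcomp G g h) = src G h"
  and comp_trg: "g \<in> Ar G \<Longrightarrow> h \<in> Ar G \<Longrightarrow> src G g = trg G h \<Longrightarrow> trg G (gcomp G g h) = trg G g"
  and comp_id: "g \<in> Ar G \<Longrightarrow> src G g = x \<Longrightarrow> gcomp G g (gid G x) = g"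
  and id_comp: "g \<in> Ar G \<Longrightarrow> trg G g = x \<Longrightarrow> gcomp G (gid G x) g = g"
  and comp_assoc: "g \<in> Ar G \<Longrightarrow> h \<in> Ar G \<Longrightarrow> k \<in> Ar G \<Longrightarrow> src G g = trg G h \<Longrightarrow> src G h = trg G k \<Longrightarrow>
      gcomp G (gcomp G g h) k = gcomp G g (gcomp G h k)"
  and inv_Ar: "g \<in> Ar G \<Longrightarrow> ginv G g \<in> Ar G"
  and inv_src: "g \<in> Ar G \<Longrightarrow> src G (ginv G g) = trg G g"
  and inv_trg: "g \<in> Ar G \<Longrightarrow> trg G (ginv G g) = src G g"
  and inv_comp: "g \<in> Ar G \<Longrightarrow> gcomp G (ginv G g) g = gid G (src G g)"
  and comp_inv: "g \<in> Ar G \<Longrightarrow> gcomp G g (ginv G g) = gid G (trg G g)"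
  using gpd unfolding groupoid_def by blast+

lemmas typing = src_Ob trg_Ob id_Ar id_src id_trg comp_Ar comp_src comp_trg inv_Ar inv_src inv_trg

lemma inv_comp_cancel: "g \<in> Ar G \<Longrightarrow> h \<in> Ar G \<Longrightarrow> trg G g = trg G h \<Longrightarrow> gcomp G g (gcomp G (ginv G g) h) = h"
  by (metis comp_assoc comp_inv id_comp inv_Ar inv_src inv_trg)

lemma inv_comp_cancel': "g \<in> Ar G \<Longrightarrow> h \<in> Ar G \<Longrightarrow> src G g = trg G h \<Longrightarrow> gcomp G (ginv G g) (gcomp G g h) = h"
  by (metis comp_assoc inv_comp id_comp inv_Ar inv_src)

lemma comp_inv_cancel: "g \<in> Ar G \<Longrightarrow> h \<in> Ar G \<Longrightarrow> src G g = trg G h \<Longrightarrow> gcomp G (gcomp G g h) (ginv G h) = g"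
  by (metis comp_assoc comp_inv comp_id inv_Ar inv_trg)

lemma comp_inv_cancel': "g \<in> Ar G \<Longrightarrow> h \<in> Ar G \<Longrightarrow> src G g = src G h \<Longrightarrow> gcomp G (gcomp G g (ginv G h)) h = g"
  by (metis comp_assoc inv_comp comp_id inv_Ar inv_src inv_trg)

lemma left_cancel:
  assumes "g \<in> Ar G" "h \<in> Ar G" "k \<in> Ar G" "src G g = trg G h" "src G g = trg G k" "gcomp G g h = gcomp G g k"
  shows "h = k"
  using assms inv_comp_cancel' by metis

lemma right_cancel:
  assumes "g \<in> Ar G" "h \<in> Ar G" "k \<in> Ar G" "src G h = trg G g" "src G k = trg G g" "gcomp G h g = gcomp G k g"
  shows "h = k"
  using assms comp_inv_cancel by metis

end

lemma gfunctor_comp: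
  "gfunctor G H F \<Longrightarrow> g \<in> Ar G \<Longrightarrow> h \<in> Ar G \<Longrightarrow> src G g = trg G h \<Longrightarrow>
    far F (gcomp G g h) = gcomp H (far F g) (far F h)"
  by (simp add: gfunctor_def)

lemma (in gpd_loc) functor_inv:
  assumes F: "gfunctor G H F" and H: "groupoid H" and g: "g \<in> Ar G"
  shows "far F (ginv G g) = ginv H (far F g)"
proof -
  interpret H: gpd_loc H by unfold_locales (rule H)
  have Fg: "far F g \<in> Ar H" "src H (far F g) = fob F (src G g)" "trg H (far F g) = fob F (trg G g)"
    using gfunctorD[OF F] g by auto
  have Fi: "far F (ginv G g) \<in> Ar H" "trg H (far F (ginv G g)) = fob F (src G g)"
    using gfunctorD[OF F] g typing by auto
  have "gcomp H (far F g) (far F (ginv G g)) = far F (gcomp G g (ginv G g))"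
    by (rule gfunctor_comp[OF F, symmetric]) (use g typing in auto)
  also have "\<dots> = gcomp H (far F g) (ginv H (far F g))"
    using comp_inv H.comp_inv gfunctorD[OF F] g Fg typing by simp
  finally have e: "gcomp H (far F g) (far F (ginv G g)) = gcomp H (far F g) (ginv H (far F g))" .
  show ?thesis
    by (rule H.left_cancel[OF Fg(1) Fi(1) H.inv_Ar[OF Fg(1)] _ _ e]) (simp_all add: Fg Fi H.typing)
qed

locale sgroupoid =
  fixes G :: "('o, 'm) sgpd"
  assumes sgpd: "simplicial_groupoid G"

sublocale sgroupoid \<subseteq> lv: gpd_loc "lev G n" for n
  using sgpd by unfold_locales (simp add: simplicial_groupoid_def)

context sgroupoid
begin

lemma obj_sset: "sset (obj_sset G)" and arr_sset: "sset (arr_sset G)"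
  using sgpd unfolding simplicial_groupoid_def by blast+

lemma
  assumes "i \<le> Suc n"
  shows dob_Ob: "x \<in> Ob (lev G (Suc n)) \<Longrightarrow> fob (gface G (Suc n) i) x \<in> Ob (lev G n)"
    and dar_id: "x \<in> Ob (lev G (Suc n)) \<Longrightarrow>
      far (gface G (Suc n) i) (gid (lev G (Suc n)) x) = gid (lev G n) (fob (gface G (Suc n) i) x)"
    and dar_Ar: "g \<in> Ar (lev G (Suc n)) \<Longrightarrow> far (gface G (Suc n) i) g \<in> Ar (lev G n)"
    and dar_src: "g \<in> Ar (lev G (Suc n)) \<Longrightarrow>
      src (lev G n) (far (gface G (Suc n) i) g) = fob (gface G (Suc n) i) (src (lev G (Suc n)) g)"
    and dar_trg: "g \<in> Ar (lev G (Suc n)) \<Longrightarrow>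
      trg (lev G n) (far (gface G (Suc n) i) g) = fob (gface G (Suc n) i) (trg (lev G (Suc n)) g)"
    and dar_comp: "g \<in> Ar (lev G (Suc n)) \<Longrightarrow> h \<in> Ar (lev G (Suc n)) \<Longrightarrow>
      src (lev G (Suc n)) g = trg (lev G (Suc n)) h \<Longrightarrow>
      far (gface G (Suc n) i) (gcomp (lev G (Suc n)) g h) =
      gcomp (lev G n) (far (gface G (Suc n) i) g) (far (gface G (Suc n) i) h)"
  using sgpdD(1)[OF sgpd assms] unfolding gfunctor_def by blast+

lemma dar_inv: "i \<le> Suc n \<Longrightarrow> g \<in> Ar (lev G (Suc n)) \<Longrightarrow>
    far (gface G (Suc n) i) (ginv (lev G (Suc n)) g) = ginv (lev G n) (far (gface G (Suc n) i) g)"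
  using lv.functor_inv[OF sgpdD(1)[OF sgpd]] lv.gpd by blast

lemma
  assumes "i \<le> n"
  shows sob_Ob: "x \<in> Ob (lev G n) \<Longrightarrow> fob (gdegen G n i) x \<in> Ob (lev G (Suc n))"
    and sar_id: "x \<in> Ob (lev G n) \<Longrightarrow>
      far (gdegen G n i) (gid (lev G n) x) = gid (lev G (Suc n)) (fob (gdegen G n i) x)"
    and sar_Ar: "g \<in> Ar (lev G n) \<Longrightarrow> far (gdegen G n i) g \<in> Ar (lev G (Suc n))"
    and sar_src: "g \<in> Ar (lev G n) \<Longrightarrow>
      src (lev G (Suc n)) (far (gdegen G n i) g) = fob (gdegen G n i) (src (lev G n) g)"
    and sar_trg: "g \<in> Ar (lev G n) \<Longrightarrow>
      trg (lev G (Suc n)) (far (gdegen G n i) g) = fob (gdegen G n i) (trg (lev G n) g)"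
    and sar_comp: "g \<in> Ar (lev G n) \<Longrightarrow> h \<in> Ar (lev G n) \<Longrightarrow>
      src (lev G n) g = trg (lev G n) h \<Longrightarrow>
      far (gdegen G n i) (gcomp (lev G n) g h) =
      gcomp (lev G (Suc n)) (far (gdegen G n i) g) (far (gdegen G n i) h)"
  using sgpdD(2)[OF sgpd assms] unfolding gfunctor_def by blast+

lemmas typing = lv.typing dob_Ob dar_Ar dar_src dar_trg sob_Ob sar_Ar sar_src sar_trg

lemmas dob_dob = sset_face_face[OF obj_sset, unfolded obj_sset_def, simplified]
  and sob_sob = sset_degen_degen[OF obj_sset, unfolded obj_sset_def, simplified]
  and dob_sob_same = sset_face_degen_same[OF obj_sset, unfolded obj_sset_def, simplified]
  and dob_sob_Suc = sset_face_degen_Suc[OF obj_sset, unfolded obj_sset_def, simplified]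
  and dob_sob_low = sset_face_degen_low[OF obj_sset, unfolded obj_sset_def, simplified]
  and dob_sob_high = sset_face_degen_high[OF obj_sset, unfolded obj_sset_def, simplified]

lemmas dar_dar = sset_face_face[OF arr_sset, unfolded arr_sset_def, simplified]
  and sar_sar = sset_degen_degen[OF arr_sset, unfolded arr_sset_def, simplified]
  and dar_sar_same = sset_face_degen_same[OF arr_sset, unfolded arr_sset_def, simplified]
  and dar_sar_Suc = sset_face_degen_Suc[OF arr_sset, unfolded arr_sset_def, simplified]
  and dar_sar_low = sset_face_degen_low[OF arr_sset, unfolded arr_sset_def, simplified]
  and dar_sar_high = sset_face_degen_high[OF arr_sset, unfolded arr_sset_def, simplified]

end

section \<open>Iterated zeroth faces\<close>

lemma iter_face0_Suc: "iter_face0 d (Suc n) (Suc j) x = iter_face0 d n j (d (Suc n) 0 x)"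
  by (induction j) simp_all

declare iter_face0.simps(2) [simp del]

lemma iter_face0_in:
  assumes X: "sset X" and x: "x \<in> simp X n"
  shows "j \<le> n \<Longrightarrow> iter_face0 (face X) n j x \<in> simp X (n - j)"
proof (induction j)
  case (Suc j)
  then have "n - j = Suc (n - Suc j)" by simp
  then show ?case using sset_face[OF X, of "iter_face0 (face X) n j x" "n - Suc j" 0] Suc
    by (simp add: iter_face0.simps(2))
qed (use x in simp)

text \<open>The face \<open>\<partial>\<^sub>i\<close> moves past the zeroth faces, losing one index each time, until it has become a zeroth
  face itself.\<close>

lemma iter_face0_face:
  assumes X: "sset X" and x: "x \<in> simp X (Suc n)" and i: "i \<le> Suc n"
  shows "j \<le> n \<Longrightarrow> iter_face0 (face X) n j (face X (Suc n) i x) =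
    (if j < i then face X (Suc n - j) (i - j) (iter_face0 (face X) (Suc n) j x)
     else iter_face0 (face X) (Suc n) (Suc j) x)"
proof (induction j)
  case (Suc j)
  define m where "m = n - Suc j"
  have m: "n - j = Suc m" "Suc n - j = Suc (Suc m)" "n - Suc j = m" using Suc.prems by (auto simp: m_def)
  let ?y = "iter_face0 (face X) (Suc n) j x"
  have y: "?y \<in> simp X (Suc (Suc m))" using iter_face0_in[OF X x, of j] Suc.prems m by simp
  show ?case
  proof (cases "j < i")
    case True
    have "i - j - 1 \<le> Suc m" using i m by linarith
    then have "face X (Suc m) 0 (face X (Suc (Suc m)) (i - j) ?y) =
        face X (Suc m) (i - j - 1) (face X (Suc (Suc m)) 0 ?y)"
      using sset_face_face[OF X y, of 0 "i - j - 1"] True by (simp add: Suc_diff_Suc)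
    then show ?thesis using Suc True m by (auto simp: iter_face0.simps(2) less_Suc_eq_le)
  next
    case False
    then show ?thesis using Suc m by (simp add: iter_face0.simps(2))
  qed
qed (auto simp: iter_face0.simps(2))

lemma iter_face0_degen:
  assumes X: "sset X" and x: "x \<in> simp X n" and i: "i \<le> n"
  shows "j \<le> Suc n \<Longrightarrow> iter_face0 (face X) (Suc n) j (degen X n i x) =
    (if j \<le> i then degen X (n - j) (i - j) (iter_face0 (face X) n j x)
     else iter_face0 (face X) n (j - 1) x)"
proof (induction j)
  case (Suc j)
  let ?y = "iter_face0 (face X) n j x"
  consider "j = i" | "j < i" | "i < j" by linarith
  then show ?case
  proof cases
    case 1
    then show ?thesis using Suc sset_face_degen_same[OF X iter_face0_in[OF X x], of j 0] i
      by (simp add: iter_face0.simps(2) Suc_diff_le)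
  next
    case 2
    define m where "m = n - Suc j"
    have m: "n - j = Suc m" "Suc n - j = Suc (Suc m)" "n - Suc j = m" using 2 i by (auto simp: m_def)
    have y: "?y \<in> simp X (Suc m)" using iter_face0_in[OF X x, of j] 2 i m by simp
    have "i - j = Suc (i - Suc j)" "i - Suc j \<le> m" using 2 i m by linarith+
    then show ?thesis using Suc 2 m sset_face_degen_low[OF X y, of 0 "i - Suc j"]
      by (simp add: iter_face0.simps(2))
  next
    case 3
    then obtain j' where "j = Suc j'" by (cases j) auto
    then show ?thesis using Suc 3 by (simp add: iter_face0.simps(2))
  qed
qed simp

section \<open>The simplices of \<open>Wbar\<close>\<close>

text \<open>The last face of a string drops its last arrow. So the matching condition of \<open>nabla\<close> says that each
  string arises from the zeroth face of the preceding one by appending an arrow.\<close>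

lemma mem_Wbar: "x \<in> simp (Wbar G) n \<longleftrightarrow> length x = Suc n \<and>
    (\<forall>i \<le> n. length (snd (x ! i)) = i \<and> gpath (lev G (n - i)) (fst (x ! i)) (snd (x ! i))) \<and>
    (\<forall>i < n. fst (x ! Suc i) = fob (gface G (n - i) 0) (fst (x ! i)) \<and>
       butlast (snd (x ! Suc i)) = map (far (gface G (n - i) 0)) (snd (x ! i)))"
proof -
  have 1: "x ! i \<in> bisimp (nerve G) i (n - i) \<longleftrightarrow>
      length (snd (x ! i)) = i \<and> gpath (lev G (n - i)) (fst (x ! i)) (snd (x ! i))" for i
    by (cases "x ! i") (simp add: nerve_def)
  have 2: "(vface (nerve G) i (n - i) 0 (x ! i) = hface (nerve G) (Suc i) (n - Suc i) (Suc i) (x ! Suc i)) \<longleftrightarrow>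
      fst (x ! Suc i) = fob (gface G (n - i) 0) (fst (x ! i)) \<and>
       butlast (snd (x ! Suc i)) = map (far (gface G (n - i) 0)) (snd (x ! i))"
    if "length (snd (x ! Suc i)) = Suc i" for i
    using that by (cases "x ! i"; cases "x ! Suc i") (auto simp: nerve_def nerve_map_def)
  have 3: "(\<forall>i < n. vface (nerve G) i (n - i) 0 (x ! i) = hface (nerve G) (Suc i) (n - Suc i) (Suc i) (x ! Suc i)) \<longleftrightarrow>
      (\<forall>i < n. fst (x ! Suc i) = fob (gface G (n - i) 0) (fst (x ! i)) \<and>
       butlast (snd (x ! Suc i)) = map (far (gface G (n - i) 0)) (snd (x ! i)))" (is "?l \<longleftrightarrow> ?r")
    if l: "\<forall>i \<le> n. length (snd (x ! i)) = i"
  proof (intro all_cong)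
    fix i assume "i < n"
    then have "length (snd (x ! Suc i)) = Suc i" using l by simp
    from 2[OF this] show "(vface (nerve G) i (n - i) 0 (x ! i) =
        hface (nerve G) (Suc i) (n - Suc i) (Suc i) (x ! Suc i)) \<longleftrightarrow>
      fst (x ! Suc i) = fob (gface G (n - i) 0) (fst (x ! i)) \<and>
       butlast (snd (x ! Suc i)) = map (far (gface G (n - i) 0)) (snd (x ! i))" .
  qed
  have 4: "(\<forall>i \<le> n. x ! i \<in> bisimp (nerve G) i (n - i)) \<longleftrightarrow>
      (\<forall>i \<le> n. length (snd (x ! i)) = i \<and> gpath (lev G (n - i)) (fst (x ! i)) (snd (x ! i)))"
    by (simp only: 1)
  have "x \<in> simp (Wbar G) n \<longleftrightarrow> length x = Suc n \<and> (\<forall>i \<le> n. x ! i \<in> bisimp (nerve G) i (n - i)) \<and>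
      (\<forall>i < n. vface (nerve G) i (n - i) 0 (x ! i) = hface (nerve G) (Suc i) (n - Suc i) (Suc i) (x ! Suc i))"
    by (simp add: Wbar_def nabla_def)
  then show ?thesis
    by (cases "\<forall>i \<le> n. length (snd (x ! i)) = i") (simp only: 3 4, simp add: 4, blast)
qed

definition wob :: "('o \<times> 'm list) list \<Rightarrow> 'o" where
  "wob x = fst (hd x)"

definition war :: "('o \<times> 'm list) list \<Rightarrow> 'm" where
  "war x = hd (snd (x ! 1))"

text \<open>The simplex with object \<open>c\<close>, first arrow \<open>g\<close> and zeroth face \<open>x\<close>. Its strings all start with the
  same arrow up to zeroth faces, which is why \<open>g\<close> determines all the arrows that are missing in \<open>x\<close>.\<close>

definition wcons :: "('o, 'm) sgpd \<Rightarrow> nat \<Rightarrow> 'o \<Rightarrow> 'm \<Rightarrow> ('o \<times> 'm list) list \<Rightarrow> ('o \<times> 'm list) list" where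
  "wcons G n c g x = (c, []) # map (\<lambda>j. (iter_face0 (face (obj_sset G)) n j (fob (gface G (Suc n) 0) c),
     iter_face0 (face (arr_sset G)) n j g # snd (x ! j))) [0..<Suc n]"

lemma length_wcons: "length (wcons G n c g x) = Suc (Suc n)"
  by (simp add: wcons_def)

lemma wcons_nth_0: "wcons G n c g x ! 0 = (c, [])"
  by (simp add: wcons_def)

lemma wcons_nth_Suc: "j \<le> n \<Longrightarrow> wcons G n c g x ! Suc j =
    (iter_face0 (face (obj_sset G)) n j (fob (gface G (Suc n) 0) c),
     iter_face0 (face (arr_sset G)) n j g # snd (x ! j))"
  unfolding wcons_def by (simp del: upt_Suc)

lemmas wcons_nth = length_wcons wcons_nth_0 wcons_nth_Suc

lemma wob_wcons: "wob (wcons G n c g x) = c"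
  by (simp add: wob_def wcons_def)

lemma war_wcons: "war (wcons G n c g x) = g"
  by (simp add: war_def wcons_nth_Suc)

lemma nerve_face_Suc_Suc:
  assumes "as \<noteq> []"
  shows "nerve_face G (Suc (Suc i)) (c, a # as) = (c, a # snd (nerve_face G (Suc i) (c', as)))"
  using assms by auto

lemma nerve_face_one: "nerve_face G (Suc 0) (c, a # b # as) = (c, gcomp G b a # as)"
  by simp

lemma nerve_degen_Suc:
  "nerve_degen G (Suc i) (c, a # as) = (c, a # snd (nerve_degen G i (trg G a, as)))"
  by (cases i) auto

lemma face_Wbar:
  "face (Wbar G) p i x = map (\<lambda>j. if j < i then nerve_map (gface G (p - j) (i - j)) (x ! j)
     else nerve_face (lev G (p - Suc j)) i (x ! Suc j)) [0..<p]"
  by (simp add: Wbar_def nabla_def nerve_def)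

lemma degen_Wbar:
  "degen (Wbar G) p i x = map (\<lambda>j. if j \<le> i then nerve_map (gdegen G (p - j) (i - j)) (x ! j)
     else nerve_degen (lev G (p - (j - 1))) i (x ! (j - 1))) [0..<Suc (Suc p)]"
  unfolding Wbar_def nabla_def nerve_def by (simp del: upt_Suc)

lemma face_Wbar_nth: "j < p \<Longrightarrow> face (Wbar G) p i x ! j =
    (if j < i then nerve_map (gface G (p - j) (i - j)) (x ! j) else nerve_face (lev G (p - Suc j)) i (x ! Suc j))"
  by (simp add: face_Wbar)

lemma degen_Wbar_nth: "j \<le> Suc p \<Longrightarrow> degen (Wbar G) p i x ! j =
    (if j \<le> i then nerve_map (gdegen G (p - j) (i - j)) (x ! j)
     else nerve_degen (lev G (p - (j - 1))) i (x ! (j - 1)))"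
  unfolding degen_Wbar by (simp del: upt_Suc)

lemma length_face_Wbar: "length (face (Wbar G) p i x) = p"
  by (simp add: face_Wbar)

lemma length_degen_Wbar: "length (degen (Wbar G) p i x) = Suc (Suc p)"
  by (simp add: degen_Wbar)

context sgroupoid
begin

abbreviation "itO \<equiv> iter_face0 (face (Defs.obj_sset G))"
abbreviation "itA \<equiv> iter_face0 (face (Defs.arr_sset G))"

lemma itO_Ob: "x \<in> Ob (lev G n) \<Longrightarrow> j \<le> n \<Longrightarrow> itO n j x \<in> Ob (lev G (n - j))"
  using iter_face0_in[OF obj_sset, of x n j] by (simp add: Defs.obj_sset_def)

lemma itA_Ar: "x \<in> Ar (lev G n) \<Longrightarrow> j \<le> n \<Longrightarrow> itA n j x \<in> Ar (lev G (n - j))"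
  using iter_face0_in[OF arr_sset, of x n j] by (simp add: Defs.arr_sset_def)

lemma itA_src: "g \<in> Ar (lev G n) \<Longrightarrow> j \<le> n \<Longrightarrow> src (lev G (n - j)) (itA n j g) = itO n j (src (lev G n) g)"
  and itA_trg: "g \<in> Ar (lev G n) \<Longrightarrow> j \<le> n \<Longrightarrow> trg (lev G (n - j)) (itA n j g) = itO n j (trg (lev G n) g)"
  and itA_id: "x \<in> Ob (lev G n) \<Longrightarrow> j \<le> n \<Longrightarrow> itA n j (gid (lev G n) x) = gid (lev G (n - j)) (itO n j x)"
proof (induction j)
  case (Suc j)
  have n: "n - j = Suc (n - Suc j)" if "Suc j \<le> n" using that by simp
  { case 1 then show ?case using Suc(1) n[OF 1(2)] itA_Ar[OF 1(1), of j] dar_src[of 0 "n - Suc j" "itA n j g"]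
      by (simp add: iter_face0.simps(2) Defs.obj_sset_def Defs.arr_sset_def) }
  { case 2 then show ?case using Suc(2) n[OF 2(2)] itA_Ar[OF 2(1), of j] dar_trg[of 0 "n - Suc j" "itA n j g"]
      by (simp add: iter_face0.simps(2) Defs.obj_sset_def Defs.arr_sset_def) }
  { case 3 then show ?case using Suc(3) n[OF 3(2)] itO_Ob[OF 3(1), of j] dar_id[of 0 "n - Suc j" "itO n j x"]
      by (simp add: iter_face0.simps(2) Defs.obj_sset_def Defs.arr_sset_def) }
qed simp_all

lemma itA_comp: "g \<in> Ar (lev G n) \<Longrightarrow> h \<in> Ar (lev G n) \<Longrightarrow> src (lev G n) g = trg (lev G n) h \<Longrightarrow> j \<le> n \<Longrightarrow>
    itA n j (gcomp (lev G n) g h) = gcomp (lev G (n - j)) (itA n j g) (itA n j h)"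
proof (induction j)
  case (Suc j)
  then have n: "n - j = Suc (n - Suc j)" by simp
  show ?case using Suc n itA_Ar[of g n j] itA_Ar[of h n j] itA_src[of g n j] itA_trg[of h n j]
      dar_comp[of 0 "n - Suc j" "itA n j g" "itA n j h"]
    by (simp add: iter_face0.simps(2) Defs.arr_sset_def)
qed simp

lemma Wbar_nth_0: "x \<in> simp (Wbar G) n \<Longrightarrow> x ! 0 = (wob x, [])"
  unfolding mem_Wbar wob_def by (cases "x ! 0"; cases x) auto

lemma wob_Ob: assumes "x \<in> simp (Wbar G) n" shows "wob x \<in> Ob (lev G n)"
proof -
  have "gpath (lev G (n - 0)) (fst (x ! 0)) (snd (x ! 0))" using assms unfolding mem_Wbar by blast
  then show ?thesis using Wbar_nth_0[OF assms] by simp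
qed

lemma fst_Wbar_nth: "x \<in> simp (Wbar G) n \<Longrightarrow> j \<le> n \<Longrightarrow> fst (x ! j) = itO n j (wob x)"
proof (induction j)
  case 0
  then show ?case using Wbar_nth_0 by simp
next
  case (Suc j)
  then show ?case by (simp add: mem_Wbar iter_face0.simps(2) Defs.obj_sset_def)
qed

lemma Wbar_0: "x \<in> simp (Wbar G) 0 \<longleftrightarrow> (\<exists>c \<in> Ob (lev G 0). x = [(c, [])])"
proof
  assume x: "x \<in> simp (Wbar G) 0"
  then have "length x = 1" by (simp add: mem_Wbar)
  then have "x = [x ! 0]" by (cases x) auto
  then show "\<exists>c \<in> Ob (lev G 0). x = [(c, [])]" using Wbar_nth_0[OF x] wob_Ob[OF x] by auto
qed (auto simp: mem_Wbar)

definition wcomp :: "nat \<Rightarrow> 'o \<Rightarrow> 'm \<Rightarrow> ('o \<times> 'm list) list \<Rightarrow> bool" where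
  "wcomp n c g x \<longleftrightarrow> c \<in> Ob (lev G (Suc n)) \<and> g \<in> Ar (lev G n) \<and> x \<in> simp (Wbar G) n \<and>
     src (lev G n) g = fob (gface G (Suc n) 0) c \<and> trg (lev G n) g = wob x"

lemma wcons_in:
  assumes "wcomp n c g x"
  shows "wcons G n c g x \<in> simp (Wbar G) (Suc n)"
proof -
  have c: "c \<in> Ob (lev G (Suc n))" and g: "g \<in> Ar (lev G n)" and x: "x \<in> simp (Wbar G) n"
    and s: "src (lev G n) g = fob (gface G (Suc n) 0) c" and t: "trg (lev G n) g = wob x"
    using assms by (auto simp: wcomp_def)
  have 1: "length (snd (x ! j)) = j" "gpath (lev G (n - j)) (itO n j (wob x)) (snd (x ! j))" if "j \<le> n" for j
    using x that fst_Wbar_nth[OF x that] by (auto simp: mem_Wbar)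
  have dc: "fob (gface G (Suc n) 0) c \<in> Ob (lev G n)" using c dob_Ob by simp
  have 2: "length (snd (wcons G n c g x ! i)) = i \<and>
      gpath (lev G (Suc n - i)) (fst (wcons G n c g x ! i)) (snd (wcons G n c g x ! i))" if "i \<le> Suc n" for i
    using that 1 c itO_Ob[OF dc] itA_Ar[OF g] itA_src[OF g] itA_trg[OF g] s t
    by (cases i) (auto simp: wcons_nth)
  show ?thesis
    unfolding mem_Wbar
  proof (intro conjI allI impI)
    fix i
    show "length (snd (wcons G n c g x ! i)) = i"
      "gpath (lev G (Suc n - i)) (fst (wcons G n c g x ! i)) (snd (wcons G n c g x ! i))" if "i \<le> Suc n"
      using 2[OF that] by blast+
    assume i: "i < Suc n"
    show "fst (wcons G n c g x ! Suc i) = fob (gface G (Suc n - i) 0) (fst (wcons G n c g x ! i))"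
      using i by (cases i) (auto simp: wcons_nth iter_face0.simps(2) Defs.obj_sset_def)
    show "butlast (snd (wcons G n c g x ! Suc i)) = map (far (gface G (Suc n - i) 0)) (snd (wcons G n c g x ! i))"
    proof (cases i)
      case (Suc j)
      then have "butlast (snd (x ! i)) = map (far (gface G (n - j) 0)) (snd (x ! j))" "length (snd (x ! i)) = Suc j"
        using x i 1(1)[of i] by (auto simp: mem_Wbar)
      moreover from this(2) have "snd (x ! i) \<noteq> []" by auto
      ultimately have "butlast (snd (x ! i)) = map (far (gface G (n - j) 0)) (snd (x ! j))" "snd (x ! i) \<noteq> []"
        by blast+
      then show ?thesis using i Suc by (simp add: wcons_nth iter_face0.simps(2) Defs.arr_sset_def)
    qed (use i x in \<open>auto simp: wcons_nth mem_Wbar\<close>)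
  qed (simp add: wcons_nth)
qed

lemma face_0_wcons:
  assumes "wcomp n c g x"
  shows "face (Wbar G) (Suc n) 0 (wcons G n c g x) = x"
proof (rule nth_equalityI)
  have g: "g \<in> Ar (lev G n)" and x: "x \<in> simp (Wbar G) n" and t: "trg (lev G n) g = wob x"
    using assms by (auto simp: wcomp_def)
  show "length (face (Wbar G) (Suc n) 0 (wcons G n c g x)) = length x"
    using x by (simp add: length_face_Wbar mem_Wbar)
  fix j assume "j < length (face (Wbar G) (Suc n) 0 (wcons G n c g x))"
  then have j: "j \<le> n" by (simp add: length_face_Wbar)
  then show "face (Wbar G) (Suc n) 0 (wcons G n c g x) ! j = x ! j"
    using itA_trg[OF g j] fst_Wbar_nth[OF x j] t
    by (simp add: face_Wbar_nth wcons_nth prod_eq_iff)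
qed

text \<open>The matching conditions force the first arrow of every string to be an iterated zeroth face of the
  arrow in the string of length one; removing all these first arrows leaves the zeroth face.\<close>

lemma Wbar_Suc_cases:
  assumes x: "x \<in> simp (Wbar G) (Suc n)"
  obtains c g y where "wcomp n c g y" "x = wcons G n c g y"
proof -
  have len: "length x = Suc (Suc n)" and l: "\<And>i. i \<le> Suc n \<Longrightarrow> length (snd (x ! i)) = i"
    and p: "\<And>i. i \<le> Suc n \<Longrightarrow> gpath (lev G (Suc n - i)) (fst (x ! i)) (snd (x ! i))"
    and f: "\<And>i. i < Suc n \<Longrightarrow> fst (x ! Suc i) = fob (gface G (Suc n - i) 0) (fst (x ! i))"
    and b: "\<And>i. i < Suc n \<Longrightarrow> butlast (snd (x ! Suc i)) = map (far (gface G (Suc n - i) 0)) (snd (x ! i))"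
    using x unfolding mem_Wbar by blast+
  define a where "a j = hd (snd (x ! Suc j))" for j
  define r where "r j = tl (snd (x ! Suc j))" for j
  define c where "c = wob x"
  define y where "y = map (\<lambda>j. (trg (lev G (n - j)) (a j), r j)) [0..<Suc n]"
  have s: "snd (x ! Suc j) = a j # r j" if "j \<le> n" for j
    using l[of "Suc j"] that unfolding a_def r_def by (cases "snd (x ! Suc j)") auto
  have ax: "a j \<in> Ar (lev G (n - j))" "src (lev G (n - j)) (a j) = fst (x ! Suc j)"
    "gpath (lev G (n - j)) (trg (lev G (n - j)) (a j)) (r j)" "length (r j) = j"
    if "j \<le> n" for j
    using p[of "Suc j"] l[of "Suc j"] s[OF that] that by auto
  have ba: "a (Suc j) = far (gface G (n - j) 0) (a j)" "butlast (r (Suc j)) = map (far (gface G (n - j) 0)) (r j)"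
    if "j < n" for j
  proof -
    have "r (Suc j) \<noteq> []" using ax(4)[of "Suc j"] that by auto
    then show "a (Suc j) = far (gface G (n - j) 0) (a j)"
      "butlast (r (Suc j)) = map (far (gface G (n - j) 0)) (r j)"
      using b[of "Suc j"] s[of j] s[of "Suc j"] that by auto
  qed
  have it: "itA n j (a 0) = a j" if "j \<le> n" for j
    using that by (induction j) (auto simp: iter_face0.simps(2) Defs.arr_sset_def ba)
  have ynth: "y ! j = (trg (lev G (n - j)) (a j), r j)" if "j \<le> n" for j
    using that unfolding y_def by (simp del: upt_Suc)
  have yin: "y \<in> simp (Wbar G) n"
    unfolding mem_Wbar
  proof (intro conjI allI impI)
    show "length y = Suc n" by (simp add: y_def)
    fix i
    show "length (snd (y ! i)) = i" "gpath (lev G (n - i)) (fst (y ! i)) (snd (y ! i))" if "i \<le> n"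
      using ax[of i] that by (auto simp: ynth)
    assume i: "i < n"
    then have "n - i = Suc (n - Suc i)" by simp
    then show "fst (y ! Suc i) = fob (gface G (n - i) 0) (fst (y ! i))"
      using i ba(1)[OF i] ax(1)[of i] dar_trg[of 0 "n - Suc i" "a i"] by (simp add: ynth)
    show "butlast (snd (y ! Suc i)) = map (far (gface G (n - i) 0)) (snd (y ! i))"
      using i ba(2)[OF i] by (simp add: ynth)
  qed
  have c0: "x ! 0 = (c, [])" using Wbar_nth_0[OF x] by (simp add: c_def)
  have wy: "wob y = trg (lev G n) (a 0)" using Wbar_nth_0[OF yin] ynth[of 0] by simp
  have comp: "wcomp n c (a 0) y"
    using wob_Ob[OF x] ax[of 0] yin f[of 0] c0 wy by (simp add: wcomp_def c_def)
  have "x = wcons G n c (a 0) y"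
  proof (rule nth_equalityI)
    fix j assume "j < length x"
    then have j: "j \<le> Suc n" using len by simp
    show "x ! j = wcons G n c (a 0) y ! j"
    proof (cases j)
      case (Suc i)
      then have "fst (x ! j) = itO n i (fob (gface G (Suc n) 0) c)"
        using fst_Wbar_nth[OF x j] by (simp add: iter_face0_Suc c_def Defs.obj_sset_def)
      then show ?thesis using Suc j s[of i] it[of i] by (simp add: wcons_nth ynth prod_eq_iff)
    qed (simp add: c0 wcons_nth)
  qed (simp add: len length_wcons)
  then show ?thesis using comp that by blast
qed

lemma face_1_wcons_0: "wcomp 0 c g x \<Longrightarrow> face (Wbar G) 1 1 (wcons G 0 c g x) = [(fob (gface G 1 1) c, [])]"
  by (simp add: face_Wbar wcons_nth nerve_map_def)

text \<open>The first face composes the first two arrows; \<open>g\<close> lives one degree above \<open>g'\<close>, hence the \<open>\<partial>\<^sub>0\<close>.\<close>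

lemma face_1_wcons:
  assumes gx: "wcomp (Suc n) c g (wcons G n c' g' x)" and x: "wcomp n c' g' x"
  shows "face (Wbar G) (Suc (Suc n)) (Suc 0) (wcons G (Suc n) c g (wcons G n c' g' x)) =
    wcons G n (fob (gface G (Suc (Suc n)) (Suc 0)) c)
      (gcomp (lev G n) g' (far (gface G (Suc n) 0) g)) x" (is "?l = ?r")
proof (rule nth_equalityI)
  have c: "c \<in> Ob (lev G (Suc (Suc n)))" and g: "g \<in> Ar (lev G (Suc n))" and g': "g' \<in> Ar (lev G n)"
    and t: "src (lev G n) g' = trg (lev G n) (far (gface G (Suc n) 0) g)"
    using gx x dar_trg[of 0 n g] by (auto simp: wcomp_def wob_wcons)
  fix j assume "j < length ?l"
  then have j: "j \<le> Suc n" by (simp add: length_face_Wbar)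
  show "?l ! j = ?r ! j"
  proof (cases j)
    case (Suc i)
    then have i: "i \<le> n" using j by simp
    have "itA n i (gcomp (lev G n) g' (far (gface G (Suc n) 0) g)) =
        gcomp (lev G (n - i)) (itA n i g') (itA (Suc n) (Suc i) g)"
      using itA_comp[OF g' _ t i] dar_Ar[OF _ g, of 0] by (simp add: iter_face0_Suc Defs.arr_sset_def)
    moreover have "itO (Suc n) (Suc i) (fob (gface G (Suc (Suc n)) 0) c) =
        itO n i (fob (gface G (Suc n) 0) (fob (gface G (Suc (Suc n)) (Suc 0)) c))"
      using dob_dob[OF c, of 0 0] by (simp add: iter_face0_Suc Defs.obj_sset_def)
    ultimately show ?thesis using Suc i by (simp add: face_Wbar_nth wcons_nth nerve_face_one del: nerve_face.simps)
  qed (simp add: face_Wbar_nth wcons_nth nerve_map_def)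
qed (simp add: length_face_Wbar length_wcons)

lemma face_Suc_Suc_wcons:
  assumes gx: "wcomp (Suc n) c g x" and i: "i \<le> n"
  shows "face (Wbar G) (Suc (Suc n)) (Suc (Suc i)) (wcons G (Suc n) c g x) =
    wcons G n (fob (gface G (Suc (Suc n)) (Suc (Suc i))) c) (far (gface G (Suc n) (Suc i)) g)
      (face (Wbar G) (Suc n) (Suc i) x)" (is "?l = ?r")
proof (rule nth_equalityI)
  have c: "c \<in> Ob (lev G (Suc (Suc n)))" and g: "g \<in> Ar (lev G (Suc n))" and x: "x \<in> simp (Wbar G) (Suc n)"
    using gx by (auto simp: wcomp_def wob_wcons)
  have dc: "fob (gface G (Suc (Suc n)) 0) c \<in> Ob (lev G (Suc n))" using c dob_Ob by simp
  fix j assume "j < length ?l"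
  then have j: "j \<le> Suc n" by (simp add: length_face_Wbar)
  show "?l ! j = ?r ! j"
  proof (cases j)
    case (Suc k)
    then have k: "k \<le> n" using j by simp
    have A: "itA n k (far (gface G (Suc n) (Suc i)) g) =
      (if k < Suc i then far (gface G (Suc n - k) (Suc i - k)) (itA (Suc n) k g) else itA (Suc n) (Suc k) g)"
      using iter_face0_face[OF arr_sset, of g n "Suc i" k] g i k by (simp add: Defs.arr_sset_def)
    have O: "itO n k (fob (gface G (Suc n) 0) (fob (gface G (Suc (Suc n)) (Suc (Suc i))) c)) =
      (if k < Suc i then fob (gface G (Suc n - k) (Suc i - k)) (itO (Suc n) k (fob (gface G (Suc (Suc n)) 0) c))
       else itO (Suc n) (Suc k) (fob (gface G (Suc (Suc n)) 0) c))"
      using iter_face0_face[OF obj_sset, of "fob (gface G (Suc (Suc n)) 0) c" n "Suc i" k] dc i k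
        dob_dob[OF c, of 0 "Suc i"] by (simp add: Defs.obj_sset_def)
    show ?thesis
    proof (cases "k < Suc i")
      case True
      then show ?thesis using Suc k A O
        by (simp add: face_Wbar_nth wcons_nth nerve_map_def)
    next
      case False
      have "length (snd (x ! Suc k)) = Suc k" using x k by (simp add: mem_Wbar)
      then have ne: "snd (x ! Suc k) \<noteq> []" by auto
      have "nerve_face (lev G (n - k)) (Suc i) (x ! Suc k) =
          nerve_face (lev G (n - k)) (Suc i) (fst (x ! Suc k), snd (x ! Suc k))" by simp
      then show ?thesis using Suc k A O False nerve_face_Suc_Suc[OF ne, where c' = "fst (x ! Suc k)"]
        by (simp add: face_Wbar_nth wcons_nth del: nerve_face.simps)
    qed
  qed (simp add: face_Wbar_nth wcons_nth nerve_map_def)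
qed (simp add: length_face_Wbar length_wcons)

lemma degen_0_Wbar:
  assumes x: "x \<in> simp (Wbar G) n"
  shows "degen (Wbar G) n 0 x = wcons G n (fob (gdegen G n 0) (wob x)) (gid (lev G n) (wob x)) x" (is "?l = ?r")
proof (rule nth_equalityI)
  fix j assume "j < length ?l"
  then have j: "j \<le> Suc n" by (simp add: length_degen_Wbar)
  show "?l ! j = ?r ! j"
  proof (cases j)
    case 0
    then show ?thesis using Wbar_nth_0[OF x] by (simp add: degen_Wbar_nth wcons_nth nerve_map_def)
  next
    case (Suc k)
    then have k: "k \<le> n" using j by simp
    have "nerve_degen K 0 p = (fst p, gid K (fst p) # snd p)" for K :: "('o, 'm) gpd" and p
      by (cases p) simp
    then have "nerve_degen (lev G (n - k)) 0 (x ! k) =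
        (itO n k (wob x), gid (lev G (n - k)) (itO n k (wob x)) # snd (x ! k))"
      using fst_Wbar_nth[OF x k] by simp
    then show ?thesis using Suc k itA_id[OF wob_Ob[OF x] k] dob_sob_same[OF wob_Ob[OF x], of 0]
      by (simp add: degen_Wbar_nth wcons_nth)
  qed
qed (simp add: length_degen_Wbar length_wcons)

lemma degen_Suc_wcons:
  assumes gx: "wcomp n c g x" and i: "i \<le> n"
  shows "degen (Wbar G) (Suc n) (Suc i) (wcons G n c g x) =
    wcons G (Suc n) (fob (gdegen G (Suc n) (Suc i)) c) (far (gdegen G n i) g) (degen (Wbar G) n i x)" (is "?l = ?r")
proof (rule nth_equalityI)
  have c: "c \<in> Ob (lev G (Suc n))" and g: "g \<in> Ar (lev G n)" and x: "x \<in> simp (Wbar G) n"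
    and t: "trg (lev G n) g = wob x"
    using gx by (auto simp: wcomp_def wob_wcons)
  have dc: "fob (gface G (Suc n) 0) c \<in> Ob (lev G n)" using c dob_Ob by simp
  fix j assume "j < length ?l"
  then have j: "j \<le> Suc (Suc n)" by (simp add: length_degen_Wbar)
  show "?l ! j = ?r ! j"
  proof (cases j)
    case (Suc k)
    then have k: "k \<le> Suc n" using j by simp
    have A: "itA (Suc n) k (far (gdegen G n i) g) =
      (if k \<le> i then far (gdegen G (n - k) (i - k)) (itA n k g) else itA n (k - 1) g)"
      using iter_face0_degen[OF arr_sset, of g n i k] g i k by (simp add: Defs.arr_sset_def)
    have O: "itO (Suc n) k (fob (gface G (Suc (Suc n)) 0) (fob (gdegen G (Suc n) (Suc i)) c)) =
      (if k \<le> i then fob (gdegen G (n - k) (i - k)) (itO n k (fob (gface G (Suc n) 0) c))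
       else itO n (k - 1) (fob (gface G (Suc n) 0) c))"
      using iter_face0_degen[OF obj_sset, of "fob (gface G (Suc n) 0) c" n i k] dc i k
        dob_sob_low[OF c, of 0 i] by (simp add: Defs.obj_sset_def)
    show ?thesis
    proof (cases "k \<le> i")
      case True
      then show ?thesis using Suc k i A O by (simp add: degen_Wbar_nth wcons_nth nerve_map_def)
    next
      case False
      then obtain l where l: "k = Suc l" by (cases k) auto
      then have ln: "l \<le> n" using k by simp
      have "x ! l = (trg (lev G (n - l)) (itA n l g), snd (x ! l))"
        using fst_Wbar_nth[OF x ln] itA_trg[OF g ln] t by (simp add: prod_eq_iff)
      then have "nerve_degen (lev G (n - l)) i (x ! l) =
          nerve_degen (lev G (n - l)) i (trg (lev G (n - l)) (itA n l g), snd (x ! l))" by simp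
      then show ?thesis using Suc l ln A O False
        by (simp add: degen_Wbar_nth wcons_nth nerve_degen_Suc del: nerve_degen.simps)
    qed
  qed (simp add: degen_Wbar_nth wcons_nth nerve_map_def)
qed (simp add: length_degen_Wbar length_wcons)

end

section \<open>Faces and degeneracies in coordinates\<close>

context sgroupoid
begin

lemma wcompD:
  assumes "wcomp n c g x"
  shows "c \<in> Ob (lev G (Suc n))" "g \<in> Ar (lev G n)" "x \<in> simp (Wbar G) n"
    "src (lev G n) g = fob (gface G (Suc n) 0) c" "trg (lev G n) g = wob x"
  using assms by (simp_all add: wcomp_def)

text \<open>The second claim is carried along the induction because it makes the coordinates of the face fit
  together.\<close>

lemma face_Wbar_aux:
  "x \<in> simp (Wbar G) (Suc n) \<Longrightarrow> i \<le> Suc n \<Longrightarrow> face (Wbar G) (Suc n) i x \<in> simp (Wbar G) n \<and>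
    (0 < i \<longrightarrow> wob (face (Wbar G) (Suc n) i x) = fob (gface G (Suc n) i) (wob x))"
proof (induction n arbitrary: x i)
  case 0
  obtain c g y where x: "wcomp 0 c g y" "x = wcons G 0 c g y" using Wbar_Suc_cases[OF 0(1)] .
  consider "i = 0" | "i = 1" using 0 by linarith
  then show ?case
  proof cases
    case 1
    then show ?thesis using x face_0_wcons[OF x(1)] wcompD[OF x(1)] by simp
  next
    case 2
    then show ?thesis using x face_1_wcons_0[OF x(1)] wcompD(1)[OF x(1)] dob_Ob[of 1 0 c]
      by (simp add: Wbar_0 wob_wcons) (simp add: wob_def)
  qed
next
  case (Suc n)
  obtain c g y where x: "wcomp (Suc n) c g y" "x = wcons G (Suc n) c g y" using Wbar_Suc_cases[OF Suc(2)] .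
  note xD = wcompD[OF x(1)]
  consider "i = 0" | "i = Suc 0" | k where "i = Suc (Suc k)" by (metis not0_implies_Suc)
  then show ?case
  proof cases
    case 1
    then show ?thesis using x face_0_wcons[OF x(1)] xD by simp
  next
    case 2
    obtain c' g' z where y: "wcomp n c' g' z" "y = wcons G n c' g' z" using Wbar_Suc_cases[OF xD(3)] .
    note yD = wcompD[OF y(1)]
    have "wcomp n (fob (gface G (Suc (Suc n)) (Suc 0)) c) (gcomp (lev G n) g' (far (gface G (Suc n) 0) g)) z"
      using xD yD dob_dob[of c n 0 0] y(2) by (simp add: wcomp_def typing wob_wcons)
    then show ?thesis using wcons_in face_1_wcons[of n c g c' g' z] x y 2 by (simp add: wob_wcons)
  next
    case 3
    then have k: "k \<le> n" using Suc by simp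
    have "wcomp n (fob (gface G (Suc (Suc n)) (Suc (Suc k))) c) (far (gface G (Suc n) (Suc k)) g)
        (face (Wbar G) (Suc n) (Suc k) y)"
      using xD Suc.IH[of y "Suc k"] dob_dob[of c n 0 "Suc k"] k by (simp add: wcomp_def typing)
    then show ?thesis using wcons_in face_Suc_Suc_wcons[OF x(1) k] x 3 by (simp add: wob_wcons)
  qed
qed

lemma face_Wbar_in: "x \<in> simp (Wbar G) (Suc n) \<Longrightarrow> i \<le> Suc n \<Longrightarrow> face (Wbar G) (Suc n) i x \<in> simp (Wbar G) n"
  using face_Wbar_aux by blast

lemma wob_face_Suc: "x \<in> simp (Wbar G) (Suc n) \<Longrightarrow> i \<le> n \<Longrightarrow>
    wob (face (Wbar G) (Suc n) (Suc i) x) = fob (gface G (Suc n) (Suc i)) (wob x)"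
  using face_Wbar_aux by simp

lemma
  assumes "x \<in> simp (Wbar G) (Suc n)"
  shows war_Ar: "war x \<in> Ar (lev G n)"
    and war_src: "src (lev G n) (war x) = fob (gface G (Suc n) 0) (wob x)"
    and war_trg: "trg (lev G n) (war x) = wob (face (Wbar G) (Suc n) 0 x)"
    and wcons_eta: "wcons G n (wob x) (war x) (face (Wbar G) (Suc n) 0 x) = x"
proof -
  obtain c g y where x: "wcomp n c g y" "x = wcons G n c g y" using Wbar_Suc_cases[OF assms] .
  show "war x \<in> Ar (lev G n)" "src (lev G n) (war x) = fob (gface G (Suc n) 0) (wob x)"
    "trg (lev G n) (war x) = wob (face (Wbar G) (Suc n) 0 x)"
    "wcons G n (wob x) (war x) (face (Wbar G) (Suc n) 0 x) = x"
    using x wcompD[OF x(1)] face_0_wcons[OF x(1)] by (simp_all add: wob_wcons war_wcons)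
qed

lemma Wbar_eqI:
  assumes "x \<in> simp (Wbar G) (Suc n)" "y \<in> simp (Wbar G) (Suc n)" "wob x = wob y" "war x = war y"
    "face (Wbar G) (Suc n) 0 x = face (Wbar G) (Suc n) 0 y"
  shows "x = y"
  by (rule trans[OF wcons_eta[OF assms(1), symmetric]], simp only: assms(3-5), rule wcons_eta[OF assms(2)])

lemma Wbar_eqI_0: "x \<in> simp (Wbar G) 0 \<Longrightarrow> y \<in> simp (Wbar G) 0 \<Longrightarrow> wob x = wob y \<Longrightarrow> x = y"
  by (auto simp: Wbar_0 wob_def)

lemma war_face_1:
  assumes "x \<in> simp (Wbar G) (Suc (Suc n))"
  shows "war (face (Wbar G) (Suc (Suc n)) (Suc 0) x) =
    gcomp (lev G n) (war (face (Wbar G) (Suc (Suc n)) 0 x)) (far (gface G (Suc n) 0) (war x))"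
proof -
  obtain c g y where x: "wcomp (Suc n) c g y" "x = wcons G (Suc n) c g y" using Wbar_Suc_cases[OF assms] .
  obtain c' g' z where y: "wcomp n c' g' z" "y = wcons G n c' g' z" using Wbar_Suc_cases[OF wcompD(3)[OF x(1)]] .
  show ?thesis using x y face_1_wcons[of n c g c' g' z] face_0_wcons[OF x(1)] by (simp add: war_wcons)
qed

lemma face_0_face_1:
  assumes "x \<in> simp (Wbar G) (Suc (Suc n))"
  shows "face (Wbar G) (Suc n) 0 (face (Wbar G) (Suc (Suc n)) (Suc 0) x) =
    face (Wbar G) (Suc n) 0 (face (Wbar G) (Suc (Suc n)) 0 x)"
proof -
  obtain c g y where x: "wcomp (Suc n) c g y" "x = wcons G (Suc n) c g y" using Wbar_Suc_cases[OF assms] .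
  obtain c' g' z where y: "wcomp n c' g' z" "y = wcons G n c' g' z" using Wbar_Suc_cases[OF wcompD(3)[OF x(1)]] .
  have "wcomp n (fob (gface G (Suc (Suc n)) (Suc 0)) c) (gcomp (lev G n) g' (far (gface G (Suc n) 0) g)) z"
    using wcompD[OF x(1)] wcompD[OF y(1)] dob_dob[of c n 0 0] y(2) by (simp add: wcomp_def typing wob_wcons)
  then show ?thesis using x y face_1_wcons[of n c g c' g' z] face_0_wcons by simp
qed

lemma
  assumes "x \<in> simp (Wbar G) (Suc (Suc n))" and i: "i \<le> n"
  shows war_face_Suc_Suc: "war (face (Wbar G) (Suc (Suc n)) (Suc (Suc i)) x) = far (gface G (Suc n) (Suc i)) (war x)"
    and face_0_face_Suc_Suc: "face (Wbar G) (Suc n) 0 (face (Wbar G) (Suc (Suc n)) (Suc (Suc i)) x) =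
    face (Wbar G) (Suc n) (Suc i) (face (Wbar G) (Suc (Suc n)) 0 x)"
proof -
  obtain c g y where x: "wcomp (Suc n) c g y" "x = wcons G (Suc n) c g y" using Wbar_Suc_cases[OF assms(1)] .
  note xD = wcompD[OF x(1)]
  show "war (face (Wbar G) (Suc (Suc n)) (Suc (Suc i)) x) = far (gface G (Suc n) (Suc i)) (war x)"
    using face_Suc_Suc_wcons[OF x(1) i] x by (simp add: war_wcons)
  have "wcomp n (fob (gface G (Suc (Suc n)) (Suc (Suc i))) c) (far (gface G (Suc n) (Suc i)) g)
        (face (Wbar G) (Suc n) (Suc i) y)"
    using xD face_Wbar_aux[of y n "Suc i"] dob_dob[of c n 0 "Suc i"] i by (simp add: wcomp_def typing)
  then show "face (Wbar G) (Suc n) 0 (face (Wbar G) (Suc (Suc n)) (Suc (Suc i)) x) =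
    face (Wbar G) (Suc n) (Suc i) (face (Wbar G) (Suc (Suc n)) 0 x)"
    using x face_Suc_Suc_wcons[OF x(1) i] face_0_wcons by simp
qed

lemma face_0_face:
  assumes "x \<in> simp (Wbar G) (Suc (Suc n))" "i \<le> Suc n"
  shows "face (Wbar G) (Suc n) 0 (face (Wbar G) (Suc (Suc n)) (Suc i) x) =
    face (Wbar G) (Suc n) i (face (Wbar G) (Suc (Suc n)) 0 x)"
  using face_0_face_1[OF assms(1)] face_0_face_Suc_Suc[OF assms(1)] assms(2) by (cases i) auto

lemma degen_0_wcomp: "x \<in> simp (Wbar G) n \<Longrightarrow> wcomp n (fob (gdegen G n 0) (wob x)) (gid (lev G n) (wob x)) x"
  using dob_sob_same[of "wob x" n 0] by (simp add: wcomp_def wob_Ob typing)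

lemma degen_Wbar_aux:
  "x \<in> simp (Wbar G) n \<Longrightarrow> i \<le> n \<Longrightarrow> degen (Wbar G) n i x \<in> simp (Wbar G) (Suc n) \<and>
    wob (degen (Wbar G) n i x) = fob (gdegen G n i) (wob x)"
proof (induction n arbitrary: x i)
  case 0
  then show ?case using degen_0_Wbar degen_0_wcomp wcons_in by (simp add: wob_wcons)
next
  case (Suc n)
  obtain c g y where x: "wcomp n c g y" "x = wcons G n c g y" using Wbar_Suc_cases[OF Suc(2)] .
  note xD = wcompD[OF x(1)]
  show ?case
  proof (cases i)
    case 0
    then show ?thesis using degen_0_Wbar degen_0_wcomp wcons_in Suc by (simp add: wob_wcons)
  next
    case (Suc k)
    then have k: "k \<le> n" using Suc.prems by simp
    have "wcomp (Suc n) (fob (gdegen G (Suc n) (Suc k)) c) (far (gdegen G n k) g) (degen (Wbar G) n k y)"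
      using xD Suc.IH[of y k] dob_sob_low[of c n 0 k] k by (simp add: wcomp_def typing)
    then show ?thesis using wcons_in degen_Suc_wcons[OF x(1) k] x Suc by (simp add: wob_wcons)
  qed
qed

lemma degen_Wbar_in: "x \<in> simp (Wbar G) n \<Longrightarrow> i \<le> n \<Longrightarrow> degen (Wbar G) n i x \<in> simp (Wbar G) (Suc n)"
  and wob_degen: "x \<in> simp (Wbar G) n \<Longrightarrow> i \<le> n \<Longrightarrow> wob (degen (Wbar G) n i x) = fob (gdegen G n i) (wob x)"
  using degen_Wbar_aux by blast+

lemma war_degen_0: "x \<in> simp (Wbar G) n \<Longrightarrow> war (degen (Wbar G) n 0 x) = gid (lev G n) (wob x)"
  and face_0_degen_0: "x \<in> simp (Wbar G) n \<Longrightarrow> face (Wbar G) (Suc n) 0 (degen (Wbar G) n 0 x) = x"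
  using degen_0_Wbar face_0_wcons[OF degen_0_wcomp] by (simp_all add: war_wcons)

lemma
  assumes "x \<in> simp (Wbar G) (Suc n)" and i: "i \<le> n"
  shows war_degen_Suc: "war (degen (Wbar G) (Suc n) (Suc i) x) = far (gdegen G n i) (war x)"
    and face_0_degen_Suc: "face (Wbar G) (Suc (Suc n)) 0 (degen (Wbar G) (Suc n) (Suc i) x) =
      degen (Wbar G) n i (face (Wbar G) (Suc n) 0 x)"
proof -
  obtain c g y where x: "wcomp n c g y" "x = wcons G n c g y" using Wbar_Suc_cases[OF assms(1)] .
  note xD = wcompD[OF x(1)]
  show "war (degen (Wbar G) (Suc n) (Suc i) x) = far (gdegen G n i) (war x)"
    using degen_Suc_wcons[OF x(1) i] x by (simp add: war_wcons)
  have "wcomp (Suc n) (fob (gdegen G (Suc n) (Suc i)) c) (far (gdegen G n i) g) (degen (Wbar G) n i y)"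
    using xD degen_Wbar_aux[of y n i] dob_sob_low[of c n 0 i] i by (simp add: wcomp_def typing)
  then show "face (Wbar G) (Suc (Suc n)) 0 (degen (Wbar G) (Suc n) (Suc i) x) =
      degen (Wbar G) n i (face (Wbar G) (Suc n) 0 x)"
    using x degen_Suc_wcons[OF x(1) i] face_0_wcons by simp
qed

text \<open>The coordinates of all faces and degeneracies. Together with extensionality in the coordinates they
  turn an identity in \<open>Wbar G\<close> into the same identity for objects and arrows of \<open>G\<close> and for the zeroth
  faces, which are covered by induction.\<close>

lemmas chart = face_Wbar_in degen_Wbar_in wob_Ob wob_face_Suc wob_degen war_Ar war_src war_trg
  war_face_1 war_face_Suc_Suc war_degen_0 war_degen_Suc face_0_face face_0_degen_0 face_0_degen_Suc

text \<open>The only arrow coordinate that is not an instance of a simplicial identity for arrows is that of a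
  first face, a composite; for \<open>i = j = 1\<close> the identity is associativity of composition.\<close>

lemma Wbar_face_face:
  "x \<in> simp (Wbar G) (Suc (Suc n)) \<Longrightarrow> i \<le> j \<Longrightarrow> j \<le> Suc n \<Longrightarrow>
    face (Wbar G) (Suc n) i (face (Wbar G) (Suc (Suc n)) (Suc j) x) =
    face (Wbar G) (Suc n) j (face (Wbar G) (Suc (Suc n)) i x)"
proof (induction n arbitrary: x i j)
  case 0
  show ?case
  proof (cases i)
    case 0
    then show ?thesis using face_0_face "0.prems" by simp
  next
    case (Suc k)
    then have ij: "i = Suc 0" "j = Suc 0" using 0 by auto
    show ?thesis unfolding ij using "0.prems"(1) dob_dob[of "wob x" 0 1 1]
      by (intro Wbar_eqI_0) (simp_all add: chart)
  qed
next
  case (Suc n)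
  show ?case
  proof (cases i)
    case 0
    then show ?thesis using face_0_face Suc.prems by simp
  next
    case i: (Suc k)
    then obtain l where j: "j = Suc l" "k \<le> l" "l \<le> Suc n" using Suc.prems by (cases j) auto
    let ?d = "\<lambda>n. face (Wbar G) n" and ?y = "face (Wbar G) (Suc (Suc (Suc n))) 0 x"
    have x: "x \<in> simp (Wbar G) (Suc (Suc (Suc n)))" by fact
    have y: "?y \<in> simp (Wbar G) (Suc (Suc n))" using x by (simp add: chart)
    have wx: "war x \<in> Ar (lev G (Suc (Suc n)))" "war ?y \<in> Ar (lev G (Suc n))"
      "src (lev G (Suc n)) (war ?y) = fob (gface G (Suc (Suc n)) 0) (trg (lev G (Suc (Suc n))) (war x))"
      using x y by (simp_all add: chart)
    have f: "?d (Suc n) k (?d (Suc (Suc n)) (Suc l) ?y) = ?d (Suc n) l (?d (Suc (Suc n)) k ?y)"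
      by (rule Suc.IH) (use y j in auto)
    have w: "war (?d (Suc (Suc n)) i (?d (Suc (Suc (Suc n))) (Suc j) x)) =
        war (?d (Suc (Suc n)) j (?d (Suc (Suc (Suc n))) i x))"
    proof (cases k)
      case 0
      show ?thesis
      proof (cases l)
        case l: 0
        show ?thesis using x y wx 0 l i j dar_dar[OF wx(1), of 0 0]
            lv.comp_assoc[of "war (?d (Suc (Suc n)) 0 ?y)" n "far (gface G (Suc n) 0) (war ?y)"
              "far (gface G (Suc n) 0) (far (gface G (Suc (Suc n)) 0) (war x))"]
            dar_comp[of 0 n "war ?y" "far (gface G (Suc (Suc n)) 0) (war x)"]
          by (simp add: chart typing)
      next
        case l: (Suc m)
        show ?thesis using x y wx 0 l i j dar_dar[OF wx(1), of 0 "Suc m"]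
            dar_comp[of "Suc m" n "war ?y" "far (gface G (Suc (Suc n)) 0) (war x)"]
          by (simp add: chart typing)
      qed
    next
      case (Suc k')
      then obtain l' where "l = Suc l'" using j by (cases l) auto
      then show ?thesis using x i j Suc dar_dar[OF wx(1), of k l] by (simp add: chart)
    qed
    show ?thesis
      by (rule Wbar_eqI[of _ n]) (use x i j w f dob_dob[of "wob x" "Suc n" i j] in \<open>simp_all add: chart\<close>)
  qed
qed

lemma Wbar_degen_degen:
  "x \<in> simp (Wbar G) n \<Longrightarrow> i \<le> j \<Longrightarrow> j \<le> n \<Longrightarrow>
    degen (Wbar G) (Suc n) i (degen (Wbar G) n j x) = degen (Wbar G) (Suc n) (Suc j) (degen (Wbar G) n i x)"
proof (induction n arbitrary: x i j)
  case 0
  then show ?case using sob_sob[of "wob x" 0 0 0] sar_id[of 0 0 "wob x"]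
    by - (rule Wbar_eqI[of _ "Suc 0"], simp_all add: chart)
next
  case (Suc n)
  have x: "x \<in> simp (Wbar G) (Suc n)" by fact
  have s: "fob (gdegen G (Suc (Suc n)) i) (fob (gdegen G (Suc n) j) (wob x)) =
    fob (gdegen G (Suc (Suc n)) (Suc j)) (fob (gdegen G (Suc n) i) (wob x))"
    using sob_sob[of "wob x" "Suc n" i j] x Suc.prems by (simp add: chart)
  show ?case
  proof (cases i)
    case 0
    then show ?thesis using x s Suc.prems sar_id[of j "Suc n" "wob x"]
      by - (rule Wbar_eqI[of _ "Suc (Suc n)"], simp_all add: chart)
  next
    case i: (Suc k)
    then obtain l where j: "j = Suc l" "k \<le> l" "l \<le> n" using Suc.prems by (cases j) auto
    show ?thesis using x s i j sar_sar[of "war x" n k l] Suc.IH[of "face (Wbar G) (Suc n) 0 x" k l]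
      by - (rule Wbar_eqI[of _ "Suc (Suc n)"], simp_all add: chart)
  qed
qed

lemma Wbar_face_degen_same:
  "x \<in> simp (Wbar G) n \<Longrightarrow> i \<le> n \<Longrightarrow> face (Wbar G) (Suc n) i (degen (Wbar G) n i x) = x"
proof (induction n arbitrary: x i)
  case 0
  then show ?case by (simp add: chart)
next
  case (Suc n)
  have x: "x \<in> simp (Wbar G) (Suc n)" by fact
  show ?case
  proof (cases i)
    case 0
    then show ?thesis using x by (simp add: chart)
  next
    case i: (Suc k)
    then have k: "k \<le> n" using Suc.prems by simp
    have f: "face (Wbar G) (Suc n) k (degen (Wbar G) n k (face (Wbar G) (Suc n) 0 x)) = face (Wbar G) (Suc n) 0 x"
      using Suc.IH x k by (simp add: chart)
    have w: "war (face (Wbar G) (Suc (Suc n)) i (degen (Wbar G) (Suc n) i x)) = war x"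
    proof (cases k)
      case 0
      then show ?thesis using x i dar_sar_same[of "war x" n 0] lv.id_comp[of "war x" n]
        by (simp add: chart)
    next
      case (Suc m)
      then show ?thesis using x i k dar_sar_same[of "war x" n k] by (simp add: chart)
    qed
    show ?thesis
      by (rule Wbar_eqI[of _ n]) (use x i k w f dob_sob_same[of "wob x" "Suc n" i] in \<open>simp_all add: chart\<close>)
  qed
qed

lemma Wbar_face_degen_Suc:
  "x \<in> simp (Wbar G) n \<Longrightarrow> i \<le> n \<Longrightarrow> face (Wbar G) (Suc n) (Suc i) (degen (Wbar G) n i x) = x"
proof (induction n arbitrary: x i)
  case 0
  then show ?case using dob_sob_Suc[of "wob x" 0 0] by (intro Wbar_eqI_0) (simp_all add: chart)
next
  case (Suc n)
  have x: "x \<in> simp (Wbar G) (Suc n)" by fact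
  have s: "fob (gface G (Suc (Suc n)) (Suc i)) (fob (gdegen G (Suc n) i) (wob x)) = wob x"
    using dob_sob_Suc[of "wob x" "Suc n" i] x Suc.prems by (simp add: chart)
  show ?case
  proof (cases i)
    case 0
    then show ?thesis using x s dar_id[of 0 n "wob x"] lv.comp_id[of "war x" n]
      by - (rule Wbar_eqI[of _ n], simp_all add: chart)
  next
    case i: (Suc k)
    then have k: "k \<le> n" using Suc.prems by simp
    show ?thesis using x i k s dar_sar_Suc[of "war x" n k] Suc.IH[of "face (Wbar G) (Suc n) 0 x" k]
      by - (rule Wbar_eqI[of _ n], simp_all add: chart)
  qed
qed

lemma Wbar_face_degen_low:
  "x \<in> simp (Wbar G) (Suc n) \<Longrightarrow> i \<le> j \<Longrightarrow> j \<le> n \<Longrightarrow>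
    face (Wbar G) (Suc (Suc n)) i (degen (Wbar G) (Suc n) (Suc j) x) = degen (Wbar G) n j (face (Wbar G) (Suc n) i x)"
proof (induction n arbitrary: x i j)
  case 0
  then show ?case by (simp add: chart)
next
  case (Suc n)
  have x: "x \<in> simp (Wbar G) (Suc (Suc n))" by fact
  show ?case
  proof (cases i)
    case 0
    then show ?thesis using x Suc.prems by (simp add: chart)
  next
    case i: (Suc k)
    then obtain l where j: "j = Suc l" "k \<le> l" "l \<le> n" using Suc.prems by (cases j) auto
    let ?y = "face (Wbar G) (Suc (Suc n)) 0 x"
    have y: "?y \<in> simp (Wbar G) (Suc n)" using x by (simp add: chart)
    have f: "face (Wbar G) (Suc (Suc n)) k (degen (Wbar G) (Suc n) (Suc l) ?y) =
        degen (Wbar G) n l (face (Wbar G) (Suc n) k ?y)"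
      by (rule Suc.IH) (use y j in auto)
    have wx: "war x \<in> Ar (lev G (Suc n))" "war ?y \<in> Ar (lev G n)"
      "src (lev G n) (war ?y) = fob (gface G (Suc n) 0) (trg (lev G (Suc n)) (war x))"
      using x y by (simp_all add: chart)
    have w: "war (face (Wbar G) (Suc (Suc (Suc n))) i (degen (Wbar G) (Suc (Suc n)) (Suc j) x)) =
        war (degen (Wbar G) (Suc n) j (face (Wbar G) (Suc (Suc n)) i x))"
    proof (cases k)
      case 0
      then show ?thesis using x y wx i j dar_sar_low[of "war x" n 0 l]
          sar_comp[of l n "war ?y" "far (gface G (Suc n) 0) (war x)"] by (simp add: chart typing)
    next
      case (Suc k')
      then show ?thesis using x i j dar_sar_low[of "war x" n k l] by (simp add: chart)
    qed
    show ?thesis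
      by (rule Wbar_eqI[of _ "Suc n"]) (use x i j w f dob_sob_low[of "wob x" "Suc n" i j] in \<open>simp_all add: chart\<close>)
  qed
qed

lemma Wbar_face_degen_high:
  "x \<in> simp (Wbar G) (Suc n) \<Longrightarrow> j < i \<Longrightarrow> i \<le> Suc n \<Longrightarrow>
    face (Wbar G) (Suc (Suc n)) (Suc i) (degen (Wbar G) (Suc n) j x) = degen (Wbar G) n j (face (Wbar G) (Suc n) i x)"
proof (induction n arbitrary: x i j)
  case 0
  then have ij: "i = Suc 0" "j = 0" by auto
  show ?case unfolding ij using "0.prems"(1) dob_sob_high[of "wob x" 0 0 1] dar_id[of 1 0 "wob x"]
    by - (rule Wbar_eqI[of _ 0], simp_all add: chart)
next
  case (Suc n)
  have x: "x \<in> simp (Wbar G) (Suc (Suc n))" by fact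
  obtain k where i: "i = Suc k" "k \<le> Suc n" using Suc.prems by (cases i) auto
  have s: "fob (gface G (Suc (Suc (Suc n))) (Suc i)) (fob (gdegen G (Suc (Suc n)) j) (wob x)) =
      fob (gdegen G (Suc n) j) (fob (gface G (Suc (Suc n)) i) (wob x))"
    using dob_sob_high[of "wob x" "Suc n" j i] x Suc.prems by (simp add: chart)
  show ?case
  proof (cases j)
    case 0
    then show ?thesis using x i s dar_id[of "Suc k" "Suc n" "wob x"]
      by - (rule Wbar_eqI[of _ "Suc n"], simp_all add: chart)
  next
    case j: (Suc l)
    then obtain m where k: "k = Suc m" "l \<le> m" "m \<le> n" using Suc.prems i by (cases k) auto
    show ?thesis using x i j k s dar_sar_high[of "war x" n l k]
        Suc.IH[of "face (Wbar G) (Suc (Suc n)) 0 x" l k]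
      by - (rule Wbar_eqI[of _ "Suc n"], simp_all add: chart)
  qed
qed

lemma sset_Wbar: "sset (Wbar G)"
  by (rule ssetI) (fact face_Wbar_in degen_Wbar_in Wbar_face_face Wbar_degen_degen
    Wbar_face_degen_same Wbar_face_degen_Suc Wbar_face_degen_low Wbar_face_degen_high)+

end

section \<open>Functoriality of \<open>Wbar\<close>\<close>

locale sgroupoid_map = G: sgroupoid G + H: sgroupoid H
  for G :: "('o, 'm) sgpd" and H :: "('p, 'q) sgpd" +
  fixes F :: "nat \<Rightarrow> ('o, 'm, 'p, 'q) gfun"
  assumes map: "sgpd_map G H F"
begin

lemma F_functor: "gfunctor (lev G n) (lev H n) (F n)"
  and F_obj: "smap (Defs.obj_sset G) (Defs.obj_sset H) (\<lambda>n. fob (F n))"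
  and F_arr: "smap (Defs.arr_sset G) (Defs.arr_sset H) (\<lambda>n. far (F n))"
  using map by (simp_all add: sgpd_map_def)

lemmas F_typing = gfunctorD[OF F_functor]
lemmas F_comp = gfunctor_comp[OF F_functor]

lemma F_face:
  "x \<in> Ob (lev G (Suc n)) \<Longrightarrow> i \<le> Suc n \<Longrightarrow> fob (F n) (fob (gface G (Suc n) i) x) = fob (gface H (Suc n) i) (fob (F (Suc n)) x)"
  "g \<in> Ar (lev G (Suc n)) \<Longrightarrow> i \<le> Suc n \<Longrightarrow> far (F n) (far (gface G (Suc n) i) g) = far (gface H (Suc n) i) (far (F (Suc n)) g)"
  and F_degen:
  "x \<in> Ob (lev G n) \<Longrightarrow> i \<le> n \<Longrightarrow> fob (F (Suc n)) (fob (gdegen G n i) x) = fob (gdegen H n i) (fob (F n) x)"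
  "g \<in> Ar (lev G n) \<Longrightarrow> i \<le> n \<Longrightarrow> far (F (Suc n)) (far (gdegen G n i) g) = far (gdegen H n i) (far (F n) g)"
  using F_obj F_arr unfolding smap_def Defs.obj_sset_def Defs.arr_sset_def by simp_all

end

lemma iter_face0_smap:
  assumes X: "sset X" and f: "smap X Y f" and x: "x \<in> simp X n"
  shows "j \<le> n \<Longrightarrow> iter_face0 (face Y) n j (f n x) = f (n - j) (iter_face0 (face X) n j x)"
proof (induction j)
  case (Suc j)
  define m where "m = n - Suc j"
  have m: "n - j = Suc m" "n - Suc j = m" using Suc.prems by (auto simp: m_def)
  have "iter_face0 (face X) n j x \<in> simp X (Suc m)" using iter_face0_in[OF X x, of j] Suc.prems m by simp
  then show ?case using f Suc m by (simp add: iter_face0.simps(2) smap_def)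
qed simp

lemma Wbar_map_nth: "i \<le> n \<Longrightarrow> Wbar_map F n x ! i = nerve_map (F (n - i)) (x ! i)"
  unfolding Wbar_map_def by (simp del: upt_Suc)

lemma length_Wbar_map: "length (Wbar_map F n x) = Suc n"
  by (simp add: Wbar_map_def)

lemma Wbar_map_comp: "Wbar_map (\<lambda>n. gfun_comp (F n) (E n)) n x = Wbar_map F n (Wbar_map E n x)"
proof (rule nth_equalityI)
  fix i assume "i < length (Wbar_map (\<lambda>n. gfun_comp (F n) (E n)) n x)"
  then have "i \<le> n" by (simp add: length_Wbar_map)
  then show "Wbar_map (\<lambda>n. gfun_comp (F n) (E n)) n x ! i = Wbar_map F n (Wbar_map E n x) ! i"
    by (cases "x ! i") (simp add: Wbar_map_nth nerve_map_def gfun_comp_def)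
qed (simp add: length_Wbar_map)

context sgroupoid_map
begin

lemma Wbar_map_wcons:
  assumes w: "G.wcomp n c g x"
  shows "Wbar_map F (Suc n) (wcons G n c g x) = wcons H n (fob (F (Suc n)) c) (far (F n) g) (Wbar_map F n x)"
    (is "?l = ?r")
proof (rule nth_equalityI)
  note D = G.wcompD[OF w]
  have dc: "fob (gface G (Suc n) 0) c \<in> simp (Defs.obj_sset G) n" and g: "g \<in> simp (Defs.arr_sset G) n"
    using D G.dob_Ob by (simp_all add: Defs.obj_sset_def Defs.arr_sset_def)
  fix j assume "j < length ?l"
  then have j: "j \<le> Suc n" by (simp add: length_Wbar_map)
  show "?l ! j = ?r ! j"
  proof (cases j)
    case (Suc k)
    then have k: "k \<le> n" using j by simp
    then show ?thesis
      using Suc iter_face0_smap[OF G.obj_sset F_obj dc k] iter_face0_smap[OF G.arr_sset F_arr g k] F_face(1)[OF D(1), of 0]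
      by (simp add: Wbar_map_nth wcons_nth nerve_map_def)
  qed (simp add: Wbar_map_nth wcons_nth nerve_map_def)
qed (simp add: length_Wbar_map length_wcons)

lemma Wbar_map_aux: "x \<in> simp (Wbar G) n \<Longrightarrow> Wbar_map F n x \<in> simp (Wbar H) n \<and> wob (Wbar_map F n x) = fob (F n) (wob x)"
proof (induction n arbitrary: x)
  case 0
  then show ?case using F_typing(1)[of _ 0]
    by (auto simp: G.Wbar_0 H.Wbar_0 Wbar_map_def nerve_map_def wob_def)
next
  case (Suc n)
  obtain c g y where x: "G.wcomp n c g y" "x = wcons G n c g y" using G.Wbar_Suc_cases[OF Suc(2)] .
  note D = G.wcompD[OF x(1)]
  have "H.wcomp n (fob (F (Suc n)) c) (far (F n) g) (Wbar_map F n y)"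
    using D Suc.IH[OF D(3)] F_typing F_face(1)[OF D(1), of 0] by (simp add: H.wcomp_def)
  then show ?case using H.wcons_in Wbar_map_wcons[OF x(1)] x by (simp add: wob_wcons)
qed

lemma Wbar_map_in: "x \<in> simp (Wbar G) n \<Longrightarrow> Wbar_map F n x \<in> simp (Wbar H) n"
  and wob_Wbar_map: "x \<in> simp (Wbar G) n \<Longrightarrow> wob (Wbar_map F n x) = fob (F n) (wob x)"
  using Wbar_map_aux by blast+

lemma
  assumes "x \<in> simp (Wbar G) (Suc n)"
  shows war_Wbar_map: "war (Wbar_map F (Suc n) x) = far (F n) (war x)"
    and face_0_Wbar_map: "face (Wbar H) (Suc n) 0 (Wbar_map F (Suc n) x) = Wbar_map F n (face (Wbar G) (Suc n) 0 x)"
proof -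
  obtain c g y where x: "G.wcomp n c g y" "x = wcons G n c g y" using G.Wbar_Suc_cases[OF assms] .
  note D = G.wcompD[OF x(1)]
  have "H.wcomp n (fob (F (Suc n)) c) (far (F n) g) (Wbar_map F n y)"
    using D Wbar_map_aux[OF D(3)] F_typing F_face(1)[OF D(1), of 0] by (simp add: H.wcomp_def)
  then show "war (Wbar_map F (Suc n) x) = far (F n) (war x)"
    "face (Wbar H) (Suc n) 0 (Wbar_map F (Suc n) x) = Wbar_map F n (face (Wbar G) (Suc n) 0 x)"
    using H.face_0_wcons G.face_0_wcons[OF x(1)] Wbar_map_wcons[OF x(1)] x by (simp_all add: war_wcons)
qed

lemmas map_chart = Wbar_map_in wob_Wbar_map war_Wbar_map face_0_Wbar_map

lemma Wbar_map_face: "x \<in> simp (Wbar G) (Suc n) \<Longrightarrow> i \<le> Suc n \<Longrightarrow>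
    Wbar_map F n (face (Wbar G) (Suc n) i x) = face (Wbar H) (Suc n) i (Wbar_map F (Suc n) x)"
proof (induction n arbitrary: x i)
  case 0
  show ?case
  proof (cases i)
    case (Suc k)
    then show ?thesis using 0 F_face(1)[of "wob x" 0 1]
      by (intro H.Wbar_eqI_0) (simp_all add: map_chart G.chart H.chart)
  qed (use 0 in \<open>simp add: map_chart\<close>)
next
  case (Suc n)
  have x: "x \<in> simp (Wbar G) (Suc (Suc n))" by fact
  show ?case
  proof (cases i)
    case i: (Suc k)
    let ?y = "face (Wbar G) (Suc (Suc n)) 0 x"
    have wx: "war x \<in> Ar (lev G (Suc n))" "war ?y \<in> Ar (lev G n)"
      "src (lev G n) (war ?y) = fob (gface G (Suc n) 0) (trg (lev G (Suc n)) (war x))"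
      using x by (simp_all add: G.chart)
    have w: "war (Wbar_map F (Suc n) (face (Wbar G) (Suc (Suc n)) i x)) =
        war (face (Wbar H) (Suc (Suc n)) i (Wbar_map F (Suc (Suc n)) x))"
    proof (cases k)
      case 0
      then show ?thesis using x wx i F_face(2)[of "war x" n 0]
          F_comp[of "war ?y" n "far (gface G (Suc n) 0) (war x)"]
        by (simp add: map_chart G.chart H.chart G.typing)
    next
      case (Suc l)
      then show ?thesis using x wx i F_face(2)[of "war x" n k] Suc.prems
        by (simp add: map_chart G.chart H.chart G.typing)
    qed
    show ?thesis using w x i Suc.prems F_face(1)[of "wob x" "Suc n" i] Suc.IH[of ?y k]
      by - (rule H.Wbar_eqI[of _ n], simp_all add: map_chart G.chart H.chart)
  qed (use x in \<open>simp add: map_chart\<close>)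
qed

lemma Wbar_map_degen: "x \<in> simp (Wbar G) n \<Longrightarrow> i \<le> n \<Longrightarrow>
    Wbar_map F (Suc n) (degen (Wbar G) n i x) = degen (Wbar H) n i (Wbar_map F n x)"
proof (induction n arbitrary: x i)
  case 0
  then show ?case using F_degen(1)[of "wob x" 0 0] F_typing(2)[of "wob x" 0]
    by - (rule H.Wbar_eqI[of _ 0], simp_all add: map_chart G.chart H.chart)
next
  case (Suc n)
  have x: "x \<in> simp (Wbar G) (Suc n)" by fact
  show ?case
  proof (cases i)
    case 0
    then show ?thesis using x F_degen(1)[of "wob x" "Suc n" 0] F_typing(2)[of "wob x" "Suc n"]
      by - (rule H.Wbar_eqI[of _ "Suc n"], simp_all add: map_chart G.chart H.chart)
  next
    case (Suc k)
    then show ?thesis using x Suc.prems F_degen(1)[of "wob x" "Suc n" i] F_degen(2)[of "war x" n k]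
        Suc.IH[of "face (Wbar G) (Suc n) 0 x" k]
      by - (rule H.Wbar_eqI[of _ "Suc n"], simp_all add: map_chart G.chart H.chart)
  qed
qed

lemma smap_Wbar_map: "smap (Wbar G) (Wbar H) (Wbar_map F)"
  unfolding smap_def using Wbar_map_in Wbar_map_face Wbar_map_degen by blast

lemma Wbar_map_inj:
  assumes ob: "\<And>n. inj_on (fob (F n)) (Ob (lev G n))" and ar: "\<And>n. inj_on (far (F n)) (Ar (lev G n))"
  shows "x \<in> simp (Wbar G) n \<Longrightarrow> y \<in> simp (Wbar G) n \<Longrightarrow> Wbar_map F n x = Wbar_map F n y \<Longrightarrow> x = y"
proof (induction n arbitrary: x y)
  case 0
  then have "fob (F 0) (wob x) = fob (F 0) (wob y)" by (simp flip: wob_Wbar_map)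
  then show ?case using 0 ob[of 0] G.wob_Ob G.Wbar_eqI_0[of x y] by (simp add: inj_on_eq_iff)
next
  case (Suc n)
  have "fob (F (Suc n)) (wob x) = fob (F (Suc n)) (wob y)" "far (F n) (war x) = far (F n) (war y)"
    "Wbar_map F n (face (Wbar G) (Suc n) 0 x) = Wbar_map F n (face (Wbar G) (Suc n) 0 y)"
    using wob_Wbar_map[OF Suc.prems(1)] wob_Wbar_map[OF Suc.prems(2)] war_Wbar_map[OF Suc.prems(1)]
      war_Wbar_map[OF Suc.prems(2)] face_0_Wbar_map[OF Suc.prems(1)] face_0_Wbar_map[OF Suc.prems(2)] Suc.prems(3)
    by simp_all
  then show ?case using Suc ob[of "Suc n"] ar[of n]
    by - (rule G.Wbar_eqI[of _ n], simp_all add: inj_on_eq_iff G.chart)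
qed

end

lemma (in sgroupoid) Wbar_map_cong:
  assumes ob: "\<And>n x. x \<in> Ob (lev G n) \<Longrightarrow> fob (F n) x = fob (F' n) x"
    and ar: "\<And>n g. g \<in> Ar (lev G n) \<Longrightarrow> far (F n) g = far (F' n) g"
    and x: "x \<in> simp (Wbar G) n"
  shows "Wbar_map F n x = Wbar_map F' n x"
proof (rule nth_equalityI)
  have p: "map (far (F k)) as = map (far (F' k)) as" if "gpath (lev G k) c as" for k c as
    using that by (induction as arbitrary: c) (auto simp: ar)
  have q: "c \<in> Ob (lev G k)" if "gpath (lev G k) c as" for k c as
    using that by (cases as) auto
  fix i assume "i < length (Wbar_map F n x)"
  then have i: "i \<le> n" by (simp add: length_Wbar_map)
  then have "gpath (lev G (n - i)) (fst (x ! i)) (snd (x ! i))" using x by (simp add: mem_Wbar)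
  then show "Wbar_map F n x ! i = Wbar_map F' n x ! i"
    using i p q ob by (cases "x ! i") (simp add: Wbar_map_nth nerve_map_def)
qed (simp add: length_Wbar_map)

lemma (in sgroupoid) Wbar_map_id:
  assumes ob: "\<And>n x. x \<in> Ob (lev G n) \<Longrightarrow> fob (F n) x = x"
    and ar: "\<And>n g. g \<in> Ar (lev G n) \<Longrightarrow> far (F n) g = g"
    and x: "x \<in> simp (Wbar G) n"
  shows "Wbar_map F n x = x"
proof -
  have "Wbar_map F n x = Wbar_map (\<lambda>_. \<lparr> fob = (\<lambda>x. x), far = (\<lambda>g. g) \<rparr>) n x"
    by (rule Wbar_map_cong) (use ob ar x in auto)
  also have "\<dots> = x"
    using x by (intro nth_equalityI) (simp_all add: length_Wbar_map Wbar_map_nth nerve_map_def mem_Wbar prod.map_id0[unfolded id_def])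
  finally show ?thesis .
qed

section \<open>Representations\<close>

lemma rep_sset_simps:
  "simp (Defs.arr_sset (rep_gpd H A)) n = Sigma (Ob (lev H n)) (rcar A n)"
  "face (Defs.arr_sset (rep_gpd H A)) n i (y, a) = (fob (gface H n i) y, rface A n i y a)"
  "degen (Defs.arr_sset (rep_gpd H A)) n i (y, a) = (fob (gdegen H n i) y, rdegen A n i y a)"
  by (simp_all add: Defs.arr_sset_def rep_gpd_def)

text \<open>A representation in simplicial abelian groups. The simplicial identities are those of the total
  simplicial set of elements, in which the base point is part of the element.\<close>

locale srep = sgroupoid H for H :: "('p, 'q) sgpd" +
  fixes A :: "('p, 'q, 'a) srep"
  assumes add_in: "y \<in> Ob (lev H n) \<Longrightarrow> a \<in> rcar A n y \<Longrightarrow> b \<in> rcar A n y \<Longrightarrow> radd A n y a b \<in> rcar A n y"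
    and add_assoc: "y \<in> Ob (lev H n) \<Longrightarrow> a \<in> rcar A n y \<Longrightarrow> b \<in> rcar A n y \<Longrightarrow> c \<in> rcar A n y \<Longrightarrow>
      radd A n y (radd A n y a b) c = radd A n y a (radd A n y b c)"
    and add_comm: "y \<in> Ob (lev H n) \<Longrightarrow> a \<in> rcar A n y \<Longrightarrow> b \<in> rcar A n y \<Longrightarrow> radd A n y a b = radd A n y b a"
    and zero_in: "y \<in> Ob (lev H n) \<Longrightarrow> rzero A n y \<in> rcar A n y"
    and zero_add: "y \<in> Ob (lev H n) \<Longrightarrow> a \<in> rcar A n y \<Longrightarrow> radd A n y (rzero A n y) a = a"
    and neg_in: "y \<in> Ob (lev H n) \<Longrightarrow> a \<in> rcar A n y \<Longrightarrow> rneg A n y a \<in> rcar A n y"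
    and neg_add: "y \<in> Ob (lev H n) \<Longrightarrow> a \<in> rcar A n y \<Longrightarrow> radd A n y (rneg A n y a) a = rzero A n y"
    and act_in: "h \<in> Ar (lev H n) \<Longrightarrow> a \<in> rcar A n (src (lev H n) h) \<Longrightarrow> ract A n h a \<in> rcar A n (trg (lev H n) h)"
    and act_add: "h \<in> Ar (lev H n) \<Longrightarrow> a \<in> rcar A n (src (lev H n) h) \<Longrightarrow> b \<in> rcar A n (src (lev H n) h) \<Longrightarrow>
      ract A n h (radd A n (src (lev H n) h) a b) = radd A n (trg (lev H n) h) (ract A n h a) (ract A n h b)"
    and act_id: "y \<in> Ob (lev H n) \<Longrightarrow> a \<in> rcar A n y \<Longrightarrow> ract A n (gid (lev H n) y) a = a"
    and act_comp: "g \<in> Ar (lev H n) \<Longrightarrow> h \<in> Ar (lev H n) \<Longrightarrow> src (lev H n) g = trg (lev H n) h \<Longrightarrow>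
      a \<in> rcar A n (src (lev H n) h) \<Longrightarrow> ract A n (gcomp (lev H n) g h) a = ract A n g (ract A n h a)"
    and rface_add: "y \<in> Ob (lev H (Suc n)) \<Longrightarrow> a \<in> rcar A (Suc n) y \<Longrightarrow> b \<in> rcar A (Suc n) y \<Longrightarrow> i \<le> Suc n \<Longrightarrow>
      rface A (Suc n) i y (radd A (Suc n) y a b) =
      radd A n (fob (gface H (Suc n) i) y) (rface A (Suc n) i y a) (rface A (Suc n) i y b)"
    and rdegen_add: "y \<in> Ob (lev H n) \<Longrightarrow> a \<in> rcar A n y \<Longrightarrow> b \<in> rcar A n y \<Longrightarrow> i \<le> n \<Longrightarrow>
      rdegen A n i y (radd A n y a b) =
      radd A (Suc n) (fob (gdegen H n i) y) (rdegen A n i y a) (rdegen A n i y b)"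
    and rface_act: "h \<in> Ar (lev H (Suc n)) \<Longrightarrow> a \<in> rcar A (Suc n) (src (lev H (Suc n)) h) \<Longrightarrow> i \<le> Suc n \<Longrightarrow>
      rface A (Suc n) i (trg (lev H (Suc n)) h) (ract A (Suc n) h a) =
      ract A n (far (gface H (Suc n) i) h) (rface A (Suc n) i (src (lev H (Suc n)) h) a)"
    and rdegen_act: "h \<in> Ar (lev H n) \<Longrightarrow> a \<in> rcar A n (src (lev H n) h) \<Longrightarrow> i \<le> n \<Longrightarrow>
      rdegen A n i (trg (lev H n) h) (ract A n h a) =
      ract A (Suc n) (far (gdegen H n i) h) (rdegen A n i (src (lev H n) h) a)"
    and sset_rep: "sset (Defs.arr_sset (rep_gpd H A))"
begin

lemma rface_in: "y \<in> Ob (lev H (Suc n)) \<Longrightarrow> a \<in> rcar A (Suc n) y \<Longrightarrow> i \<le> Suc n \<Longrightarrow>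
    rface A (Suc n) i y a \<in> rcar A n (fob (gface H (Suc n) i) y)"
  using sset_face[OF sset_rep, of "(y, a)"] by (simp add: rep_sset_simps)

lemma rdegen_in: "y \<in> Ob (lev H n) \<Longrightarrow> a \<in> rcar A n y \<Longrightarrow> i \<le> n \<Longrightarrow>
    rdegen A n i y a \<in> rcar A (Suc n) (fob (gdegen H n i) y)"
  using sset_degen[OF sset_rep, of "(y, a)"] by (simp add: rep_sset_simps)

lemma rface_rface: "y \<in> Ob (lev H (Suc (Suc n))) \<Longrightarrow> a \<in> rcar A (Suc (Suc n)) y \<Longrightarrow> i \<le> j \<Longrightarrow> j \<le> Suc n \<Longrightarrow>
    rface A (Suc n) i (fob (gface H (Suc (Suc n)) (Suc j)) y) (rface A (Suc (Suc n)) (Suc j) y a) =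
    rface A (Suc n) j (fob (gface H (Suc (Suc n)) i) y) (rface A (Suc (Suc n)) i y a)"
  using sset_face_face[OF sset_rep, of "(y, a)"] by (simp add: rep_sset_simps)

lemma rdegen_rdegen: "y \<in> Ob (lev H n) \<Longrightarrow> a \<in> rcar A n y \<Longrightarrow> i \<le> j \<Longrightarrow> j \<le> n \<Longrightarrow>
    rdegen A (Suc n) i (fob (gdegen H n j) y) (rdegen A n j y a) =
    rdegen A (Suc n) (Suc j) (fob (gdegen H n i) y) (rdegen A n i y a)"
  using sset_degen_degen[OF sset_rep, of "(y, a)"] by (simp add: rep_sset_simps)

lemma rface_rdegen_same: "y \<in> Ob (lev H n) \<Longrightarrow> a \<in> rcar A n y \<Longrightarrow> i \<le> n \<Longrightarrow>
    rface A (Suc n) i (fob (gdegen H n i) y) (rdegen A n i y a) = a"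
  using sset_face_degen_same[OF sset_rep, of "(y, a)"] by (simp add: rep_sset_simps)

lemma rface_rdegen_Suc: "y \<in> Ob (lev H n) \<Longrightarrow> a \<in> rcar A n y \<Longrightarrow> i \<le> n \<Longrightarrow>
    rface A (Suc n) (Suc i) (fob (gdegen H n i) y) (rdegen A n i y a) = a"
  using sset_face_degen_Suc[OF sset_rep, of "(y, a)"] by (simp add: rep_sset_simps)

lemma rface_rdegen_low: "y \<in> Ob (lev H (Suc n)) \<Longrightarrow> a \<in> rcar A (Suc n) y \<Longrightarrow> i \<le> j \<Longrightarrow> j \<le> n \<Longrightarrow>
    rface A (Suc (Suc n)) i (fob (gdegen H (Suc n) (Suc j)) y) (rdegen A (Suc n) (Suc j) y a) =
    rdegen A n j (fob (gface H (Suc n) i) y) (rface A (Suc n) i y a)"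
  using sset_face_degen_low[OF sset_rep, of "(y, a)"] by (simp add: rep_sset_simps)

lemma rface_rdegen_high: "y \<in> Ob (lev H (Suc n)) \<Longrightarrow> a \<in> rcar A (Suc n) y \<Longrightarrow> j < i \<Longrightarrow> i \<le> Suc n \<Longrightarrow>
    rface A (Suc (Suc n)) (Suc i) (fob (gdegen H (Suc n) j) y) (rdegen A (Suc n) j y a) =
    rdegen A n j (fob (gface H (Suc n) i) y) (rface A (Suc n) i y a)"
  using sset_face_degen_high[OF sset_rep, of "(y, a)"] by (simp add: rep_sset_simps)

lemma add_zero: "y \<in> Ob (lev H n) \<Longrightarrow> a \<in> rcar A n y \<Longrightarrow> radd A n y a (rzero A n y) = a"
  using zero_add add_comm zero_in by metis

lemma add_neg: "y \<in> Ob (lev H n) \<Longrightarrow> a \<in> rcar A n y \<Longrightarrow> radd A n y a (rneg A n y a) = rzero A n y"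
  using neg_add add_comm neg_in by metis

lemma idem_zero:
  assumes "y \<in> Ob (lev H n)" "a \<in> rcar A n y" "radd A n y a a = a"
  shows "a = rzero A n y"
proof -
  have "radd A n y (rneg A n y a) (radd A n y a a) = a"
    using add_assoc[of y n "rneg A n y a" a a] assms(1,2) by (simp add: neg_in neg_add zero_add)
  then show ?thesis using assms by (simp add: neg_add)
qed

lemma rface_zero: "y \<in> Ob (lev H (Suc n)) \<Longrightarrow> i \<le> Suc n \<Longrightarrow>
    rface A (Suc n) i y (rzero A (Suc n) y) = rzero A n (fob (gface H (Suc n) i) y)"
  using rface_add[of y n "rzero A (Suc n) y" "rzero A (Suc n) y" i]
  by (intro idem_zero) (simp_all add: dob_Ob rface_in zero_in zero_add)

lemma rdegen_zero: "y \<in> Ob (lev H n) \<Longrightarrow> i \<le> n \<Longrightarrow>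
    rdegen A n i y (rzero A n y) = rzero A (Suc n) (fob (gdegen H n i) y)"
  using rdegen_add[of y n "rzero A n y" "rzero A n y" i]
  by (intro idem_zero) (simp_all add: sob_Ob rdegen_in zero_in zero_add)

lemma act_zero: "h \<in> Ar (lev H n) \<Longrightarrow> ract A n h (rzero A n (src (lev H n) h)) = rzero A n (trg (lev H n) h)"
  using act_add[of h n "rzero A n (src (lev H n) h)" "rzero A n (src (lev H n) h)"]
  by (intro idem_zero) (simp_all add: typing act_in zero_in zero_add)

lemmas rep_typing = typing add_in zero_in neg_in act_in rface_in rdegen_in

lemma lev_rep_simps:
  "Ob (lev (rep_gpd H A) n) = Ob (lev H n)" "Ar (lev (rep_gpd H A) n) = Sigma (Ob (lev H n)) (rcar A n)"
  "src (lev (rep_gpd H A) n) = fst" "trg (lev (rep_gpd H A) n) = fst"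
  "gid (lev (rep_gpd H A) n) y = (y, rzero A n y)"
  "gcomp (lev (rep_gpd H A) n) (y, a) (z, b) = (y, radd A n y a b)"
  "ginv (lev (rep_gpd H A) n) (y, a) = (y, rneg A n y a)"
  "fob (gface (rep_gpd H A) n i) = fob (gface H n i)"
  "fob (gdegen (rep_gpd H A) n i) = fob (gdegen H n i)"
  "far (gface (rep_gpd H A) n i) (y, a) = (fob (gface H n i) y, rface A n i y a)"
  "far (gdegen (rep_gpd H A) n i) (y, a) = (fob (gdegen H n i) y, rdegen A n i y a)"
  by (simp_all add: rep_gpd_def)

lemma simplicial_groupoid_rep_gpd: "simplicial_groupoid (rep_gpd H A)"
  unfolding simplicial_groupoid_def
proof (intro conjI allI impI)
  show "groupoid (lev (rep_gpd H A) n)" for n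
    unfolding groupoid_def
    by (auto simp: lev_rep_simps rep_typing add_assoc zero_add add_zero neg_add add_neg)
  show "gfunctor (lev (rep_gpd H A) (Suc n)) (lev (rep_gpd H A) n) (gface (rep_gpd H A) (Suc n) i)" if "i \<le> Suc n" for n i
    using that unfolding gfunctor_def by (auto simp: lev_rep_simps rep_typing rface_zero rface_add)
  show "gfunctor (lev (rep_gpd H A) n) (lev (rep_gpd H A) (Suc n)) (gdegen (rep_gpd H A) n i)" if "i \<le> n" for n i
    using that unfolding gfunctor_def by (auto simp: lev_rep_simps rep_typing rdegen_zero rdegen_add)
  have "Defs.obj_sset (rep_gpd H A) = Defs.obj_sset H" by (simp add: Defs.obj_sset_def lev_rep_simps)
  then show "sset (Defs.obj_sset (rep_gpd H A))" using obj_sset by simp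
qed (rule sset_rep)

end

section \<open>Semidirect products\<close>

context srep
begin

lemma lev_semidirect_simps:
  "Ob (lev (semidirect H A) n) = Ob (lev H n)"
  "Ar (lev (semidirect H A) n) = Sigma (Ar (lev H n)) (\<lambda>h. rcar A n (trg (lev H n) h))"
  "src (lev (semidirect H A) n) (h, u) = src (lev H n) h" "trg (lev (semidirect H A) n) (h, u) = trg (lev H n) h"
  "gid (lev (semidirect H A) n) y = (gid (lev H n) y, rzero A n y)"
  "gcomp (lev (semidirect H A) n) (k, v) (h, u) = (gcomp (lev H n) k h, radd A n (trg (lev H n) k) v (ract A n k u))"
  "ginv (lev (semidirect H A) n) (h, u) = (ginv (lev H n) h,
      ract A n (ginv (lev H n) h) (rneg A n (trg (lev H n) h) u))"
  "fob (gface (semidirect H A) n i) = fob (gface H n i)"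
  "fob (gdegen (semidirect H A) n i) = fob (gdegen H n i)"
  "far (gface (semidirect H A) n i) (h, u) = (far (gface H n i) h, rface A n i (trg (lev H n) h) u)"
  "far (gdegen (semidirect H A) n i) (h, u) = (far (gdegen H n i) h, rdegen A n i (trg (lev H n) h) u)"
  by (simp_all add: semidirect_def)

lemma act_add': "h \<in> Ar (lev H n) \<Longrightarrow> src (lev H n) h = y \<Longrightarrow> a \<in> rcar A n y \<Longrightarrow> b \<in> rcar A n y \<Longrightarrow>
    ract A n h (radd A n y a b) = radd A n (trg (lev H n) h) (ract A n h a) (ract A n h b)"
  using act_add by blast

lemma act_zero': "h \<in> Ar (lev H n) \<Longrightarrow> src (lev H n) h = y \<Longrightarrow> ract A n h (rzero A n y) = rzero A n (trg (lev H n) h)"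
  using act_zero by blast

lemma act_inv_neg:
  assumes h: "h \<in> Ar (lev H n)" and u: "u \<in> rcar A n (trg (lev H n) h)"
  shows "ract A n (ginv (lev H n) h) (rneg A n (trg (lev H n) h) u) \<in> rcar A n (src (lev H n) h)"
    "ract A n h (ract A n (ginv (lev H n) h) (rneg A n (trg (lev H n) h) u)) = rneg A n (trg (lev H n) h) u"
    "radd A n (src (lev H n) h) (ract A n (ginv (lev H n) h) (rneg A n (trg (lev H n) h) u))
        (ract A n (ginv (lev H n) h) u) = rzero A n (src (lev H n) h)"
proof -
  show "ract A n (ginv (lev H n) h) (rneg A n (trg (lev H n) h) u) \<in> rcar A n (src (lev H n) h)"
    using act_in[of "ginv (lev H n) h" n "rneg A n (trg (lev H n) h) u"] h u by (simp add: rep_typing)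
  show "ract A n h (ract A n (ginv (lev H n) h) (rneg A n (trg (lev H n) h) u)) = rneg A n (trg (lev H n) h) u"
    using act_comp[of h n "ginv (lev H n) h" "rneg A n (trg (lev H n) h) u"] h u
    by (simp add: rep_typing lv.comp_inv act_id)
  show "radd A n (src (lev H n) h) (ract A n (ginv (lev H n) h) (rneg A n (trg (lev H n) h) u))
        (ract A n (ginv (lev H n) h) u) = rzero A n (src (lev H n) h)"
    using act_add[of "ginv (lev H n) h" n "rneg A n (trg (lev H n) h) u" u] act_zero[of "ginv (lev H n) h" n] h u
    by (simp add: rep_typing neg_add)
qed

lemma groupoid_semidirect: "groupoid (lev (semidirect H A) n)"
  unfolding groupoid_def
  by (auto simp: lev_semidirect_simps rep_typing lv.comp_id lv.id_comp act_zero add_zero act_id zero_add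
      act_inv_neg lv.inv_comp lv.comp_inv add_neg lv.comp_assoc add_assoc act_add' act_comp)

lemma gfunctor_semidirect_face: "i \<le> Suc n \<Longrightarrow>
    gfunctor (lev (semidirect H A) (Suc n)) (lev (semidirect H A) n) (gface (semidirect H A) (Suc n) i)"
  unfolding gfunctor_def
  by (auto simp: lev_semidirect_simps rep_typing dar_id rface_zero rface_act dar_comp rface_add)

lemma gfunctor_semidirect_degen: "i \<le> n \<Longrightarrow>
    gfunctor (lev (semidirect H A) n) (lev (semidirect H A) (Suc n)) (gdegen (semidirect H A) n i)"
  unfolding gfunctor_def
  by (auto simp: lev_semidirect_simps rep_typing sar_id rdegen_zero rdegen_act sar_comp rdegen_add)

lemma sset_semidirect_arr: "sset (Defs.arr_sset (semidirect H A))"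
  by (rule ssetI; clarsimp simp: Defs.arr_sset_def lev_semidirect_simps rep_typing dar_dar sar_sar
      dar_sar_same dar_sar_Suc dar_sar_low dar_sar_high)
    (simp_all add: typing rface_in rdegen_in rface_rface rdegen_rdegen rface_rdegen_same rface_rdegen_Suc rface_rdegen_low rface_rdegen_high)

lemma simplicial_groupoid_semidirect: "simplicial_groupoid (semidirect H A)"
proof -
  have "Defs.obj_sset (semidirect H A) = Defs.obj_sset H" by (simp add: Defs.obj_sset_def lev_semidirect_simps)
  then show ?thesis
    unfolding simplicial_groupoid_def
    using groupoid_semidirect gfunctor_semidirect_face gfunctor_semidirect_degen obj_sset sset_semidirect_arr by simp
qed

end

section \<open>The representation \<open>Wbar A\<close>\<close>

lemma (in sgroupoid) itA_inv: "g \<in> Ar (lev G n) \<Longrightarrow> j \<le> n \<Longrightarrow>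
    itA n j (ginv (lev G n) g) = ginv (lev G (n - j)) (itA n j g)"
proof (induction j)
  case (Suc j)
  then have n: "n - j = Suc (n - Suc j)" by simp
  show ?case using Suc n itA_Ar[of g n j] dar_inv[of 0 "n - Suc j" "itA n j g"]
    by (simp add: iter_face0.simps(2) Defs.arr_sset_def)
qed simp

sublocale srep \<subseteq> R: sgroupoid "rep_gpd H A"
  by unfold_locales (rule simplicial_groupoid_rep_gpd)

context srep
begin

abbreviation "W \<equiv> Wbar_rep H A"
abbreviation "WS \<equiv> Wbar (rep_gpd H A)"

lemma mem_W: "x \<in> rcar W n y \<longleftrightarrow> x \<in> simp WS n \<and> wob x = y"
  using R.Wbar_nth_0[of x n] by (auto simp: Wbar_rep_def)

lemma W_face_simps: "rface W n i y = face WS n i" "rdegen W n i y = degen WS n i"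
  by (simp_all add: Wbar_rep_def)

lemma obj_sset_rep_gpd: "Defs.obj_sset (rep_gpd H A) = Defs.obj_sset H"
  by (simp add: Defs.obj_sset_def lev_rep_simps)

lemma
  assumes "u \<in> simp WS (Suc n)"
  shows fst_war: "fst (war u) = fob (gface H (Suc n) 0) (wob u)"
    and war_eta: "(fob (gface H (Suc n) 0) (wob u), snd (war u)) = war u"
    and snd_war_in: "snd (war u) \<in> rcar A n (fob (gface H (Suc n) 0) (wob u))"
    and W_wob_face_0: "wob (face WS (Suc n) 0 u) = fob (gface H (Suc n) 0) (wob u)"
proof -
  show f: "fst (war u) = fob (gface H (Suc n) 0) (wob u)"
    using R.war_src[OF assms] by (simp add: lev_rep_simps)
  then show "(fob (gface H (Suc n) 0) (wob u), snd (war u)) = war u" by (simp add: prod_eq_iff)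
  show "snd (war u) \<in> rcar A n (fob (gface H (Suc n) 0) (wob u))"
    using R.war_Ar[OF assms] f by (auto simp: lev_rep_simps)
  show "wob (face WS (Suc n) 0 u) = fob (gface H (Suc n) 0) (wob u)"
    using R.war_trg[OF assms] f by (simp add: lev_rep_simps)
qed

lemma W_wob_Ob: "u \<in> simp WS n \<Longrightarrow> wob u \<in> Ob (lev H n)"
  using R.wob_Ob by (simp add: lev_rep_simps)

lemma W_wob_face: "u \<in> simp WS (Suc n) \<Longrightarrow> i \<le> Suc n \<Longrightarrow> wob (face WS (Suc n) i u) = fob (gface H (Suc n) i) (wob u)"
  using W_wob_face_0 R.wob_face_Suc[of u n "i - 1"] by (cases i) (simp_all add: lev_rep_simps)

lemma W_wob_degen: "u \<in> simp WS n \<Longrightarrow> i \<le> n \<Longrightarrow> wob (degen WS n i u) = fob (gdegen H n i) (wob u)"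
  using R.wob_degen by (simp add: lev_rep_simps)

lemma snd_war_face_1:
  assumes "u \<in> simp WS (Suc (Suc n))"
  shows "snd (war (face WS (Suc (Suc n)) (Suc 0) u)) =
    radd A n (fob (gface H (Suc n) 0) (fob (gface H (Suc (Suc n)) 0) (wob u)))
      (snd (war (face WS (Suc (Suc n)) 0 u))) (rface A (Suc n) 0 (fob (gface H (Suc (Suc n)) 0) (wob u)) (snd (war u)))"
proof -
  have d: "face WS (Suc (Suc n)) 0 u \<in> simp WS (Suc n)" using R.face_Wbar_in assms by simp
  show ?thesis
    using R.war_face_1[OF assms] fst_war[OF assms] fst_war[OF d] W_wob_face_0[OF assms]
    by (cases "war u"; cases "war (face WS (Suc (Suc n)) 0 u)") (simp add: lev_rep_simps)
qed

lemma snd_war_face_Suc_Suc: "u \<in> simp WS (Suc (Suc n)) \<Longrightarrow> i \<le> n \<Longrightarrow>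
    snd (war (face WS (Suc (Suc n)) (Suc (Suc i)) u)) =
    rface A (Suc n) (Suc i) (fob (gface H (Suc (Suc n)) 0) (wob u)) (snd (war u))"
  using R.war_face_Suc_Suc[of u n i] fst_war[of u "Suc n"] by (cases "war u") (simp add: lev_rep_simps)

lemma snd_war_degen_0: "u \<in> simp WS n \<Longrightarrow> snd (war (degen WS n 0 u)) = rzero A n (wob u)"
  using R.war_degen_0 by (simp add: lev_rep_simps)

lemma snd_war_degen_Suc: "u \<in> simp WS (Suc n) \<Longrightarrow> i \<le> n \<Longrightarrow>
    snd (war (degen WS (Suc n) (Suc i) u)) = rdegen A n i (fob (gface H (Suc n) 0) (wob u)) (snd (war u))"
  using R.war_degen_Suc[of u n i] fst_war[of u n] by (cases "war u") (simp add: lev_rep_simps)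

lemma W_eqI_0: "u \<in> simp WS 0 \<Longrightarrow> v \<in> simp WS 0 \<Longrightarrow> wob u = wob v \<Longrightarrow> u = v"
  by (rule R.Wbar_eqI_0)

lemma W_eqI: "u \<in> simp WS (Suc n) \<Longrightarrow> v \<in> simp WS (Suc n) \<Longrightarrow> wob u = wob v \<Longrightarrow> snd (war u) = snd (war v) \<Longrightarrow>
    face WS (Suc n) 0 u = face WS (Suc n) 0 v \<Longrightarrow> u = v"
  using fst_war[of u n] fst_war[of v n] by - (rule R.Wbar_eqI[of _ n], simp_all add: prod_eq_iff)

lemma W_wcomp:
  "y \<in> Ob (lev H (Suc n)) \<Longrightarrow> a \<in> rcar A n (fob (gface H (Suc n) 0) y) \<Longrightarrow> u \<in> simp WS n \<Longrightarrow>
    wob u = fob (gface H (Suc n) 0) y \<Longrightarrow> R.wcomp n y (fob (gface H (Suc n) 0) y, a) u"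
  by (simp add: R.wcomp_def lev_rep_simps dob_Ob)

lemma W_eta: "u \<in> simp WS (Suc n) \<Longrightarrow>
    wcons (rep_gpd H A) n (wob u) (fob (gface H (Suc n) 0) (wob u), snd (war u)) (face WS (Suc n) 0 u) = u"
  using R.wcons_eta war_eta by metis

lemma radd_W_nth: "i \<le> n \<Longrightarrow> radd W n y u v ! i =
    (fst (u ! i), map2 (gcomp (lev (rep_gpd H A) (n - i))) (snd (u ! i)) (snd (v ! i)))"
  unfolding Wbar_rep_def rep_gpd_def by (simp del: upt_Suc)

lemma rneg_W_nth: "i \<le> n \<Longrightarrow> rneg W n y u ! i = (fst (u ! i), map (ginv (lev (rep_gpd H A) (n - i))) (snd (u ! i)))"
  unfolding Wbar_rep_def rep_gpd_def by (simp del: upt_Suc)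

lemma rzero_W_nth: "i \<le> n \<Longrightarrow> rzero W n y ! i =
    (itO n i y, replicate i (gid (lev (rep_gpd H A) (n - i)) (itO n i y)))"
  unfolding Wbar_rep_def rep_gpd_def by (simp del: upt_Suc add: Let_def)

lemma ract_W_nth: "i \<le> n \<Longrightarrow> ract W n h u ! i = (trg (lev H (n - i)) (itA n i h),
    map (\<lambda>(_, a). (trg (lev H (n - i)) (itA n i h), ract A (n - i) (itA n i h) a)) (snd (u ! i)))"
  unfolding Wbar_rep_def by (simp del: upt_Suc add: Let_def)

lemma length_W: "length (radd W n y u v) = Suc n" "length (rneg W n y u) = Suc n"
  "length (rzero W n y) = Suc n" "length (ract W n h u) = Suc n"
  by (simp_all add: Wbar_rep_def)

text \<open>In coordinates, each operation of \<open>Wbar A\<close> is the operation of \<open>A\<close> on the arrow and the operation in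
  one degree less on the zeroth face. So the axioms of a representation pass from \<open>A\<close> to \<open>Wbar A\<close> by
  induction on the degree.\<close>

lemma radd_wcons:
  assumes z: "z \<in> Ob (lev H n)" and ab: "a \<in> rcar A n z" "b \<in> rcar A n z"
  shows "radd W (Suc n) y (wcons (rep_gpd H A) n c (z, a) u) (wcons (rep_gpd H A) n c (z, b) v) =
    wcons (rep_gpd H A) n c (z, radd A n z a b) (radd W n z u v)" (is "?l = ?r")
proof (rule nth_equalityI)
  fix j assume "j < length ?l"
  then have "j \<le> Suc n" by (simp add: length_W)
  then show "?l ! j = ?r ! j"
    using R.itA_comp[of "(z, a)" n "(z, b)"] z ab
    by (cases j) (simp_all add: radd_W_nth wcons_nth lev_rep_simps)
qed (simp add: length_W length_wcons)

lemma rneg_wcons: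
  assumes z: "z \<in> Ob (lev H n)" and a: "a \<in> rcar A n z"
  shows "rneg W (Suc n) y (wcons (rep_gpd H A) n c (z, a) u) = wcons (rep_gpd H A) n c (z, rneg A n z a) (rneg W n z u)"
    (is "?l = ?r")
proof (rule nth_equalityI)
  fix j assume "j < length ?l"
  then have "j \<le> Suc n" by (simp add: length_W)
  then show "?l ! j = ?r ! j"
    using R.itA_inv[of "(z, a)" n] z a by (cases j) (simp_all add: rneg_W_nth wcons_nth lev_rep_simps)
qed (simp add: length_W length_wcons)

lemma rzero_wcons:
  assumes y: "y \<in> Ob (lev H (Suc n))"
  shows "rzero W (Suc n) y = wcons (rep_gpd H A) n y
    (fob (gface H (Suc n) 0) y, rzero A n (fob (gface H (Suc n) 0) y)) (rzero W n (fob (gface H (Suc n) 0) y))"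
    (is "?l = ?r")
proof (rule nth_equalityI)
  let ?z = "fob (gface H (Suc n) 0) y"
  have z: "?z \<in> Ob (lev (rep_gpd H A) n)" using y dob_Ob by (simp add: lev_rep_simps)
  fix j assume "j < length ?l"
  then have j: "j \<le> Suc n" by (simp add: length_W)
  show "?l ! j = ?r ! j"
  proof (cases j)
    case (Suc k)
    have "itO (Suc n) (Suc k) y = itO n k ?z" by (simp add: iter_face0_Suc Defs.obj_sset_def)
    then show ?thesis using Suc j R.itA_id[OF z, of k]
      by (simp add: rzero_W_nth wcons_nth lev_rep_simps obj_sset_rep_gpd)
  qed (simp add: rzero_W_nth wcons_nth)
qed (simp add: length_W length_wcons)

lemma itA_act:
  assumes h: "h \<in> Ar (lev H n)" and a: "a \<in> rcar A n (src (lev H n) h)"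
  shows "j \<le> n \<Longrightarrow> (\<exists>b \<in> rcar A (n - j) (src (lev H (n - j)) (itA n j h)).
    R.itA n j (src (lev H n) h, a) = (src (lev H (n - j)) (itA n j h), b) \<and>
    R.itA n j (trg (lev H n) h, ract A n h a) = (trg (lev H (n - j)) (itA n j h), ract A (n - j) (itA n j h) b))"
proof (induction j)
  case (Suc j)
  define m where "m = n - Suc j"
  have m: "n - j = Suc m" "n - Suc j = m" using Suc.prems by (auto simp: m_def)
  let ?k = "itA n j h"
  have k: "?k \<in> Ar (lev H (Suc m))" using itA_Ar[OF h, of j] Suc.prems m by simp
  obtain b where b: "b \<in> rcar A (Suc m) (src (lev H (Suc m)) ?k)"
    "R.itA n j (src (lev H n) h, a) = (src (lev H (Suc m)) ?k, b)"
    "R.itA n j (trg (lev H n) h, ract A n h a) = (trg (lev H (Suc m)) ?k, ract A (Suc m) ?k b)"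
    using Suc m by auto
  show ?case
    using b k m rface_act[OF k b(1), of 0] rface_in[OF _ b(1), of 0] lv.src_Ob
    by (intro bexI[of _ "rface A (Suc m) 0 (src (lev H (Suc m)) ?k) b"])
      (simp_all add: iter_face0.simps(2) rep_sset_simps typing, simp_all add: Defs.arr_sset_def typing)
qed (use a in simp)

lemma ract_wcons:
  assumes h: "h \<in> Ar (lev H (Suc n))" and a: "a \<in> rcar A n (fob (gface H (Suc n) 0) (src (lev H (Suc n)) h))"
  shows "ract W (Suc n) h (wcons (rep_gpd H A) n c (fob (gface H (Suc n) 0) (src (lev H (Suc n)) h), a) u) =
    wcons (rep_gpd H A) n (trg (lev H (Suc n)) h)
      (fob (gface H (Suc n) 0) (trg (lev H (Suc n)) h), ract A n (far (gface H (Suc n) 0) h) a)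
      (ract W n (far (gface H (Suc n) 0) h) u)" (is "?l = ?r")
proof (rule nth_equalityI)
  let ?h = "far (gface H (Suc n) 0) h"
  have h': "?h \<in> Ar (lev H n)" "src (lev H n) ?h = fob (gface H (Suc n) 0) (src (lev H (Suc n)) h)"
    "trg (lev H n) ?h = fob (gface H (Suc n) 0) (trg (lev H (Suc n)) h)"
    using h by (simp_all add: typing)
  fix j assume "j < length ?l"
  then have j: "j \<le> Suc n" by (simp add: length_W)
  show "?l ! j = ?r ! j"
  proof (cases j)
    case (Suc k)
    have e: "itA (Suc n) (Suc k) h = itA n k ?h" by (simp add: iter_face0_Suc Defs.arr_sset_def)
    have k: "k \<le> n" using Suc j by simp
    obtain b where b: "R.itA n k (src (lev H n) ?h, a) = (src (lev H (n - k)) (itA n k ?h), b)"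
      "R.itA n k (trg (lev H n) ?h, ract A n ?h a) = (trg (lev H (n - k)) (itA n k ?h), ract A (n - k) (itA n k ?h) b)"
      using itA_act[OF h'(1) _ k, of a] a h'(2) by auto
    show ?thesis using Suc k e b h'(2,3) itA_trg[OF h'(1) k]
      by (simp add: ract_W_nth wcons_nth lev_rep_simps obj_sset_rep_gpd)
  qed (simp add: ract_W_nth wcons_nth)
qed (simp add: length_W length_wcons)

lemma radd_W_aux: "u \<in> simp WS n \<Longrightarrow> v \<in> simp WS n \<Longrightarrow> wob u = y \<Longrightarrow> wob v = y \<Longrightarrow>
    radd W n y u v \<in> simp WS n \<and> wob (radd W n y u v) = y \<and>
    (\<forall>m. n = Suc m \<longrightarrow>
      snd (war (radd W n y u v)) = radd A m (fob (gface H n 0) y) (snd (war u)) (snd (war v)) \<and>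
      face WS n 0 (radd W n y u v) = radd W m (fob (gface H n 0) y) (face WS n 0 u) (face WS n 0 v))"
proof (induction n arbitrary: u v y)
  case 0
  then have "radd W 0 y u v = u"
    by (auto simp: R.Wbar_0 radd_W_nth length_W intro!: nth_equalityI)
  then show ?case using 0 by simp
next
  case (Suc n)
  let ?y = "fob (gface H (Suc n) 0) y"
  have y: "y \<in> Ob (lev H (Suc n))" "?y \<in> Ob (lev H n)" using Suc.prems W_wob_Ob dob_Ob by auto
  have uv: "snd (war u) \<in> rcar A n ?y" "snd (war v) \<in> rcar A n ?y"
    "face WS (Suc n) 0 u \<in> simp WS n" "face WS (Suc n) 0 v \<in> simp WS n"
    "wob (face WS (Suc n) 0 u) = ?y" "wob (face WS (Suc n) 0 v) = ?y"
    using Suc.prems snd_war_in[of u n] snd_war_in[of v n] by (auto simp: R.face_Wbar_in W_wob_face)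
  have "radd W (Suc n) y u v = wcons (rep_gpd H A) n y (?y, radd A n ?y (snd (war u)) (snd (war v)))
      (radd W n ?y (face WS (Suc n) 0 u) (face WS (Suc n) 0 v))"
    using radd_wcons[OF y(2) uv(1,2), of y y "face WS (Suc n) 0 u" "face WS (Suc n) 0 v"] W_eta[of u n] W_eta[of v n] Suc.prems
    by simp
  moreover have "R.wcomp n y (?y, radd A n ?y (snd (war u)) (snd (war v)))
      (radd W n ?y (face WS (Suc n) 0 u) (face WS (Suc n) 0 v))"
    using Suc.IH[OF uv(3-6)] uv y by (intro W_wcomp) (simp_all add: add_in)
  ultimately show ?case using R.wcons_in R.face_0_wcons by (simp add: wob_wcons war_wcons)
qed

lemma rneg_W_aux: "u \<in> simp WS n \<Longrightarrow> wob u = y \<Longrightarrow>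
    rneg W n y u \<in> simp WS n \<and> wob (rneg W n y u) = y \<and>
    (\<forall>m. n = Suc m \<longrightarrow>
      snd (war (rneg W n y u)) = rneg A m (fob (gface H n 0) y) (snd (war u)) \<and>
      face WS n 0 (rneg W n y u) = rneg W m (fob (gface H n 0) y) (face WS n 0 u))"
proof (induction n arbitrary: u y)
  case 0
  then have "rneg W 0 y u = u"
    by (auto simp: R.Wbar_0 rneg_W_nth length_W intro!: nth_equalityI)
  then show ?case using 0 by simp
next
  case (Suc n)
  let ?y = "fob (gface H (Suc n) 0) y"
  have y: "y \<in> Ob (lev H (Suc n))" "?y \<in> Ob (lev H n)" using Suc.prems W_wob_Ob dob_Ob by auto
  have uv: "snd (war u) \<in> rcar A n ?y" "face WS (Suc n) 0 u \<in> simp WS n" "wob (face WS (Suc n) 0 u) = ?y"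
    using Suc.prems snd_war_in[of u n] by (auto simp: R.face_Wbar_in W_wob_face)
  have "rneg W (Suc n) y u = wcons (rep_gpd H A) n y (?y, rneg A n ?y (snd (war u)))
      (rneg W n ?y (face WS (Suc n) 0 u))"
    using rneg_wcons[OF y(2) uv(1), of y y "face WS (Suc n) 0 u"] W_eta[of u n] Suc.prems by simp
  moreover have "R.wcomp n y (?y, rneg A n ?y (snd (war u))) (rneg W n ?y (face WS (Suc n) 0 u))"
    using Suc.IH[OF uv(2,3)] uv y by (intro W_wcomp) (simp_all add: neg_in)
  ultimately show ?case using R.wcons_in R.face_0_wcons by (simp add: wob_wcons war_wcons)
qed

lemma rzero_W_aux: "y \<in> Ob (lev H n) \<Longrightarrow>
    rzero W n y \<in> simp WS n \<and> wob (rzero W n y) = y \<and>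
    (\<forall>m. n = Suc m \<longrightarrow>
      snd (war (rzero W n y)) = rzero A m (fob (gface H n 0) y) \<and>
      face WS n 0 (rzero W n y) = rzero W m (fob (gface H n 0) y))"
proof (induction n arbitrary: y)
  case 0
  have "rzero W 0 y = [(y, [])]" by (rule nth_equalityI) (simp_all add: rzero_W_nth length_W)
  then show ?case using 0 by (simp add: R.Wbar_0 lev_rep_simps wob_def)
next
  case (Suc n)
  let ?y = "fob (gface H (Suc n) 0) y"
  have y: "?y \<in> Ob (lev H n)" using Suc.prems dob_Ob by auto
  have "R.wcomp n y (?y, rzero A n ?y) (rzero W n ?y)"
    using Suc.IH[OF y] Suc.prems y by (intro W_wcomp) (simp_all add: zero_in)
  then show ?case using R.wcons_in R.face_0_wcons rzero_wcons[OF Suc.prems] by (simp add: wob_wcons war_wcons)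
qed

lemma ract_W_aux: "h \<in> Ar (lev H n) \<Longrightarrow> u \<in> simp WS n \<Longrightarrow> wob u = src (lev H n) h \<Longrightarrow>
    ract W n h u \<in> simp WS n \<and> wob (ract W n h u) = trg (lev H n) h \<and>
    (\<forall>m. n = Suc m \<longrightarrow>
      snd (war (ract W n h u)) = ract A m (far (gface H n 0) h) (snd (war u)) \<and>
      face WS n 0 (ract W n h u) = ract W m (far (gface H n 0) h) (face WS n 0 u))"
proof (induction n arbitrary: u h)
  case 0
  then have "u = [(src (lev H 0) h, [])]" by (auto simp: R.Wbar_0 wob_def)
  then have "ract W 0 h u = [(trg (lev H 0) h, [])]" by (intro nth_equalityI) (simp_all add: ract_W_nth length_W)
  then show ?case using 0 by (simp add: R.Wbar_0 lev_rep_simps wob_def typing)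
next
  case (Suc n)
  let ?y = "fob (gface H (Suc n) 0) (src (lev H (Suc n)) h)" and ?h = "far (gface H (Suc n) 0) h"
  have h: "?h \<in> Ar (lev H n)" "src (lev H n) ?h = ?y" "trg (lev H n) ?h = fob (gface H (Suc n) 0) (trg (lev H (Suc n)) h)"
    using Suc.prems by (simp_all add: typing)
  have uv: "snd (war u) \<in> rcar A n ?y" "face WS (Suc n) 0 u \<in> simp WS n" "wob (face WS (Suc n) 0 u) = ?y"
    using Suc.prems snd_war_in[of u n] by (auto simp: R.face_Wbar_in W_wob_face)
  have "ract W (Suc n) h u = wcons (rep_gpd H A) n (trg (lev H (Suc n)) h)
      (fob (gface H (Suc n) 0) (trg (lev H (Suc n)) h), ract A n ?h (snd (war u))) (ract W n ?h (face WS (Suc n) 0 u))"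
    using ract_wcons[OF Suc.prems(1) uv(1), of "wob u" "face WS (Suc n) 0 u"] W_eta[of u n] Suc.prems by simp
  moreover have "R.wcomp n (trg (lev H (Suc n)) h)
      (fob (gface H (Suc n) 0) (trg (lev H (Suc n)) h), ract A n ?h (snd (war u))) (ract W n ?h (face WS (Suc n) 0 u))"
    using Suc.IH[of ?h "face WS (Suc n) 0 u"] Suc.prems uv h act_in[of ?h n "snd (war u)"]
    by (intro W_wcomp) (simp_all add: typing)
  ultimately show ?case using R.wcons_in R.face_0_wcons by (simp add: wob_wcons war_wcons)
qed

lemma radd_W: "u \<in> simp WS n \<Longrightarrow> v \<in> simp WS n \<Longrightarrow> wob u = y \<Longrightarrow> wob v = y \<Longrightarrow> radd W n y u v \<in> simp WS n"
    "u \<in> simp WS n \<Longrightarrow> v \<in> simp WS n \<Longrightarrow> wob u = y \<Longrightarrow> wob v = y \<Longrightarrow> wob (radd W n y u v) = y"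
    "u \<in> simp WS (Suc n) \<Longrightarrow> v \<in> simp WS (Suc n) \<Longrightarrow> wob u = y \<Longrightarrow> wob v = y \<Longrightarrow>
      snd (war (radd W (Suc n) y u v)) = radd A n (fob (gface H (Suc n) 0) y) (snd (war u)) (snd (war v))"
    "u \<in> simp WS (Suc n) \<Longrightarrow> v \<in> simp WS (Suc n) \<Longrightarrow> wob u = y \<Longrightarrow> wob v = y \<Longrightarrow>
      face WS (Suc n) 0 (radd W (Suc n) y u v) = radd W n (fob (gface H (Suc n) 0) y) (face WS (Suc n) 0 u) (face WS (Suc n) 0 v)"
  and rneg_W: "u \<in> simp WS n \<Longrightarrow> wob u = y \<Longrightarrow> rneg W n y u \<in> simp WS n"
    "u \<in> simp WS n \<Longrightarrow> wob u = y \<Longrightarrow> wob (rneg W n y u) = y"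
    "u \<in> simp WS (Suc n) \<Longrightarrow> wob u = y \<Longrightarrow>
      snd (war (rneg W (Suc n) y u)) = rneg A n (fob (gface H (Suc n) 0) y) (snd (war u))"
    "u \<in> simp WS (Suc n) \<Longrightarrow> wob u = y \<Longrightarrow>
      face WS (Suc n) 0 (rneg W (Suc n) y u) = rneg W n (fob (gface H (Suc n) 0) y) (face WS (Suc n) 0 u)"
  and rzero_W: "y \<in> Ob (lev H n) \<Longrightarrow> rzero W n y \<in> simp WS n"
    "y \<in> Ob (lev H n) \<Longrightarrow> wob (rzero W n y) = y"
    "y \<in> Ob (lev H (Suc n)) \<Longrightarrow> snd (war (rzero W (Suc n) y)) = rzero A n (fob (gface H (Suc n) 0) y)"
    "y \<in> Ob (lev H (Suc n)) \<Longrightarrow> face WS (Suc n) 0 (rzero W (Suc n) y) = rzero W n (fob (gface H (Suc n) 0) y)"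
  and ract_W: "h \<in> Ar (lev H n) \<Longrightarrow> u \<in> simp WS n \<Longrightarrow> wob u = src (lev H n) h \<Longrightarrow> ract W n h u \<in> simp WS n"
    "h \<in> Ar (lev H n) \<Longrightarrow> u \<in> simp WS n \<Longrightarrow> wob u = src (lev H n) h \<Longrightarrow> wob (ract W n h u) = trg (lev H n) h"
    "h \<in> Ar (lev H (Suc n)) \<Longrightarrow> u \<in> simp WS (Suc n) \<Longrightarrow> wob u = src (lev H (Suc n)) h \<Longrightarrow>
      snd (war (ract W (Suc n) h u)) = ract A n (far (gface H (Suc n) 0) h) (snd (war u))"
    "h \<in> Ar (lev H (Suc n)) \<Longrightarrow> u \<in> simp WS (Suc n) \<Longrightarrow> wob u = src (lev H (Suc n)) h \<Longrightarrow>
      face WS (Suc n) 0 (ract W (Suc n) h u) = ract W n (far (gface H (Suc n) 0) h) (face WS (Suc n) 0 u)"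
  using radd_W_aux rneg_W_aux rzero_W_aux ract_W_aux by simp_all

lemmas W_chart = R.face_Wbar_in R.degen_Wbar_in W_wob_Ob W_wob_face W_wob_degen snd_war_in
  snd_war_face_1 snd_war_face_Suc_Suc snd_war_degen_0 snd_war_degen_Suc
  R.face_0_face R.face_0_degen_0 R.face_0_degen_Suc radd_W rneg_W rzero_W ract_W

lemma W_add_assoc: "u \<in> simp WS n \<Longrightarrow> v \<in> simp WS n \<Longrightarrow> w \<in> simp WS n \<Longrightarrow> wob u = y \<Longrightarrow> wob v = y \<Longrightarrow> wob w = y \<Longrightarrow>
    radd W n y (radd W n y u v) w = radd W n y u (radd W n y v w)"
proof (induction n arbitrary: u v w y)
  case 0
  then show ?case by - (rule W_eqI_0, simp_all add: W_chart)
next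
  case (Suc n)
  have y: "y \<in> Ob (lev H (Suc n))" "fob (gface H (Suc n) 0) y \<in> Ob (lev H n)" using Suc.prems W_wob_Ob dob_Ob by auto
  show ?case using Suc y snd_war_in[of u n] snd_war_in[of v n] snd_war_in[of w n]
    by - (rule W_eqI[of _ n], simp_all add: W_chart add_assoc)
qed

lemma W_add_comm: "u \<in> simp WS n \<Longrightarrow> v \<in> simp WS n \<Longrightarrow> wob u = y \<Longrightarrow> wob v = y \<Longrightarrow>
    radd W n y u v = radd W n y v u"
proof (induction n arbitrary: u v y)
  case 0
  then show ?case by - (rule W_eqI_0, simp_all add: W_chart)
next
  case (Suc n)
  have y: "y \<in> Ob (lev H (Suc n))" "fob (gface H (Suc n) 0) y \<in> Ob (lev H n)" using Suc.prems W_wob_Ob dob_Ob by auto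
  have "radd W n (fob (gface H (Suc n) 0) y) (face WS (Suc n) 0 u) (face WS (Suc n) 0 v) =
      radd W n (fob (gface H (Suc n) 0) y) (face WS (Suc n) 0 v) (face WS (Suc n) 0 u)"
    by (rule Suc.IH) (use Suc.prems in \<open>simp_all add: W_chart\<close>)
  then show ?case using Suc.prems y snd_war_in[of u n] snd_war_in[of v n]
      add_comm[of "fob (gface H (Suc n) 0) y" n "snd (war u)" "snd (war v)"]
    by - (rule W_eqI[of _ n], simp_all add: W_chart)
qed

lemma W_zero_add: "u \<in> simp WS n \<Longrightarrow> wob u = y \<Longrightarrow> radd W n y (rzero W n y) u = u"
proof (induction n arbitrary: u y)
  case 0
  have y: "y \<in> Ob (lev H 0)" using 0 W_wob_Ob by auto
  then show ?case using 0 by - (rule W_eqI_0, simp_all add: W_chart)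
next
  case (Suc n)
  have y: "y \<in> Ob (lev H (Suc n))" "fob (gface H (Suc n) 0) y \<in> Ob (lev H n)" using Suc.prems W_wob_Ob dob_Ob by auto
  show ?case using Suc y snd_war_in[of u n]
    by - (rule W_eqI[of _ n], simp_all add: W_chart zero_add)
qed

lemma W_neg_add: "u \<in> simp WS n \<Longrightarrow> wob u = y \<Longrightarrow> radd W n y (rneg W n y u) u = rzero W n y"
proof (induction n arbitrary: u y)
  case 0
  have y: "y \<in> Ob (lev H 0)" using 0 W_wob_Ob by auto
  then show ?case using 0 by - (rule W_eqI_0, simp_all add: W_chart)
next
  case (Suc n)
  have y: "y \<in> Ob (lev H (Suc n))" "fob (gface H (Suc n) 0) y \<in> Ob (lev H n)" using Suc.prems W_wob_Ob dob_Ob by auto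
  show ?case using Suc y snd_war_in[of u n]
    by - (rule W_eqI[of _ n], simp_all add: W_chart neg_add)
qed

lemma W_act_add: "h \<in> Ar (lev H n) \<Longrightarrow> u \<in> simp WS n \<Longrightarrow> v \<in> simp WS n \<Longrightarrow> wob u = src (lev H n) h \<Longrightarrow> wob v = src (lev H n) h \<Longrightarrow>
    ract W n h (radd W n (src (lev H n) h) u v) = radd W n (trg (lev H n) h) (ract W n h u) (ract W n h v)"
proof (induction n arbitrary: u v h)
  case 0
  then show ?case by - (rule W_eqI_0, simp_all add: W_chart)
next
  case (Suc n)
  let ?h = "far (gface H (Suc n) 0) h"
  have h: "?h \<in> Ar (lev H n)" "src (lev H n) ?h = fob (gface H (Suc n) 0) (src (lev H (Suc n)) h)"
    "trg (lev H n) ?h = fob (gface H (Suc n) 0) (trg (lev H (Suc n)) h)"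
    using Suc.prems by (simp_all add: typing)
  show ?case using Suc.prems h snd_war_in[of u n] snd_war_in[of v n] Suc.IH[of ?h "face WS (Suc n) 0 u" "face WS (Suc n) 0 v"]
    by - (rule W_eqI[of _ n], simp_all add: W_chart act_add')
qed

lemma W_act_id: "u \<in> simp WS n \<Longrightarrow> wob u = y \<Longrightarrow> ract W n (gid (lev H n) y) u = u"
proof (induction n arbitrary: u y)
  case 0
  have y: "y \<in> Ob (lev H 0)" using 0 W_wob_Ob by auto
  then show ?case using 0 by - (rule W_eqI_0, simp_all add: W_chart typing)
next
  case (Suc n)
  have y: "y \<in> Ob (lev H (Suc n))" "fob (gface H (Suc n) 0) y \<in> Ob (lev H n)" using Suc.prems W_wob_Ob dob_Ob by auto
  show ?case using Suc y snd_war_in[of u n]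
    by - (rule W_eqI[of _ n], simp_all add: W_chart act_id typing dar_id)
qed

lemma W_act_comp: "g \<in> Ar (lev H n) \<Longrightarrow> h \<in> Ar (lev H n) \<Longrightarrow> src (lev H n) g = trg (lev H n) h \<Longrightarrow>
    u \<in> simp WS n \<Longrightarrow> wob u = src (lev H n) h \<Longrightarrow> ract W n (gcomp (lev H n) g h) u = ract W n g (ract W n h u)"
proof (induction n arbitrary: u g h)
  case 0
  then show ?case by - (rule W_eqI_0, simp_all add: W_chart typing)
next
  case (Suc n)
  let ?h = "far (gface H (Suc n) 0) h" and ?g = "far (gface H (Suc n) 0) g"
  have "ract W n (gcomp (lev H n) ?g ?h) (face WS (Suc n) 0 u) = ract W n ?g (ract W n ?h (face WS (Suc n) 0 u))"
    by (rule Suc.IH) (use Suc.prems in \<open>simp_all add: W_chart typing\<close>)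
  moreover have "ract A n (gcomp (lev H n) ?g ?h) (snd (war u)) = ract A n ?g (ract A n ?h (snd (war u)))"
    by (rule act_comp) (use Suc.prems snd_war_in[of u n] in \<open>simp_all add: typing\<close>)
  ultimately show ?case using Suc.prems
    by - (rule W_eqI[of _ n], simp_all add: W_chart typing dar_comp)
qed

lemma add_add_add:
  assumes y: "y \<in> Ob (lev H n)" and m: "a \<in> rcar A n y" "b \<in> rcar A n y" "c \<in> rcar A n y" "d \<in> rcar A n y"
  shows "radd A n y (radd A n y a b) (radd A n y c d) = radd A n y (radd A n y a c) (radd A n y b d)"
proof -
  have "radd A n y (radd A n y a b) (radd A n y c d) = radd A n y a (radd A n y (radd A n y b c) d)"
    using y m by (simp add: add_assoc add_in)
  also have "radd A n y b c = radd A n y c b" using y m add_comm by blast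
  finally show ?thesis using y m by (simp add: add_assoc add_in)
qed

text \<open>The first face adds two entries of a simplex; it is additive because \<open>A\<close> is commutative.\<close>

lemma W_face_add: "u \<in> simp WS (Suc n) \<Longrightarrow> v \<in> simp WS (Suc n) \<Longrightarrow> wob u = y \<Longrightarrow> wob v = y \<Longrightarrow> i \<le> Suc n \<Longrightarrow>
    face WS (Suc n) i (radd W (Suc n) y u v) =
    radd W n (fob (gface H (Suc n) i) y) (face WS (Suc n) i u) (face WS (Suc n) i v)"
proof (induction n arbitrary: u v y i)
  case 0
  then show ?case by - (rule W_eqI_0, simp_all add: W_chart)
next
  case (Suc n)
  let ?d = "fob (gface H (Suc n) 0)" and ?y = "fob (gface H (Suc (Suc n)) 0) y"
  have y: "y \<in> Ob (lev H (Suc (Suc n)))" "?y \<in> Ob (lev H (Suc n))" "?d ?y \<in> Ob (lev H n)"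
    using Suc.prems W_wob_Ob dob_Ob by auto
  have m: "snd (war u) \<in> rcar A (Suc n) ?y" "snd (war v) \<in> rcar A (Suc n) ?y"
    "snd (war (face WS (Suc (Suc n)) 0 u)) \<in> rcar A n (?d ?y)" "snd (war (face WS (Suc (Suc n)) 0 v)) \<in> rcar A n (?d ?y)"
    using Suc.prems snd_war_in[of u "Suc n"] snd_war_in[of v "Suc n"]
      snd_war_in[of "face WS (Suc (Suc n)) 0 u" n] snd_war_in[of "face WS (Suc (Suc n)) 0 v" n] by (simp_all add: W_chart)
  consider "i = 0" | "i = Suc 0" | k where "i = Suc (Suc k)" "k \<le> n"
    using Suc.prems(5) by (metis not0_implies_Suc Suc_le_mono)
  then show ?case
  proof cases
    case 1
    then show ?thesis using Suc.prems by (simp add: W_chart)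
  next
    case 2
    then show ?thesis using Suc.prems Suc.IH[of "face WS (Suc (Suc n)) 0 u" "face WS (Suc (Suc n)) 0 v" ?y 0] m y
        dob_dob[OF y(1), of 0 0]
      by - (rule W_eqI[of _ n], simp_all add: W_chart rface_add rface_in add_add_add)
  next
    case 3
    then show ?thesis using Suc.prems Suc.IH[of "face WS (Suc (Suc n)) 0 u" "face WS (Suc (Suc n)) 0 v" ?y "Suc k"] m y
        dob_dob[OF y(1), of 0 "Suc k"]
      by - (rule W_eqI[of _ n], simp_all add: W_chart rface_add)
  qed
qed

lemma W_degen_add: "u \<in> simp WS n \<Longrightarrow> v \<in> simp WS n \<Longrightarrow> wob u = y \<Longrightarrow> wob v = y \<Longrightarrow> i \<le> n \<Longrightarrow>
    degen WS n i (radd W n y u v) = radd W (Suc n) (fob (gdegen H n i) y) (degen WS n i u) (degen WS n i v)"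
proof (induction n arbitrary: u v y i)
  case 0
  have y: "y \<in> Ob (lev H 0)" using 0 W_wob_Ob by auto
  then show ?case using 0 dob_sob_same[OF y, of 0]
    by - (rule W_eqI[of _ 0], simp_all add: W_chart zero_in zero_add)
next
  case (Suc n)
  have y: "y \<in> Ob (lev H (Suc n))" "fob (gface H (Suc n) 0) y \<in> Ob (lev H n)" using Suc.prems W_wob_Ob dob_Ob by auto
  have m: "snd (war u) \<in> rcar A n (fob (gface H (Suc n) 0) y)" "snd (war v) \<in> rcar A n (fob (gface H (Suc n) 0) y)"
    using Suc.prems snd_war_in[of u n] snd_war_in[of v n] by simp_all
  show ?case
  proof (cases i)
    case 0
    then show ?thesis using Suc.prems dob_sob_same[OF y(1), of 0] y
      by - (rule W_eqI[of _ "Suc n"], simp_all add: W_chart zero_in zero_add)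
  next
    case (Suc k)
    then show ?thesis using Suc.prems Suc.IH[of "face WS (Suc n) 0 u" "face WS (Suc n) 0 v" "fob (gface H (Suc n) 0) y" k] m y
        dob_sob_low[OF y(1), of 0 k]
      by - (rule W_eqI[of _ "Suc n"], simp_all add: W_chart rdegen_add)
  qed
qed

lemma W_face_act: "h \<in> Ar (lev H (Suc n)) \<Longrightarrow> u \<in> simp WS (Suc n) \<Longrightarrow> wob u = src (lev H (Suc n)) h \<Longrightarrow> i \<le> Suc n \<Longrightarrow>
    face WS (Suc n) i (ract W (Suc n) h u) = ract W n (far (gface H (Suc n) i) h) (face WS (Suc n) i u)"
proof (induction n arbitrary: u h i)
  case 0
  then show ?case by - (rule W_eqI_0, simp_all add: W_chart typing)
next
  case (Suc n)
  let ?d = "far (gface H (Suc n) 0)" and ?h = "far (gface H (Suc (Suc n)) 0) h" and ?u = "face WS (Suc (Suc n)) 0 u"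
  have h: "h \<in> Ar (lev H (Suc (Suc n)))" by fact
  have h': "?h \<in> Ar (lev H (Suc n))" "src (lev H (Suc n)) ?h = fob (gface H (Suc (Suc n)) 0) (src (lev H (Suc (Suc n))) h)"
      "trg (lev H (Suc n)) ?h = fob (gface H (Suc (Suc n)) 0) (trg (lev H (Suc (Suc n))) h)"
    using h by (simp_all add: typing)
  have h'': "?d ?h \<in> Ar (lev H n)" "src (lev H n) (?d ?h) = fob (gface H (Suc n) 0) (fob (gface H (Suc (Suc n)) 0) (src (lev H (Suc (Suc n))) h))"
      "trg (lev H n) (?d ?h) = fob (gface H (Suc n) 0) (fob (gface H (Suc (Suc n)) 0) (trg (lev H (Suc (Suc n))) h))"
    using h' by (simp_all add: typing)
  have m: "snd (war u) \<in> rcar A (Suc n) (src (lev H (Suc n)) ?h)" "snd (war ?u) \<in> rcar A n (src (lev H n) (?d ?h))"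
    "?u \<in> simp WS (Suc n)" "wob ?u = src (lev H (Suc n)) ?h"
    using Suc.prems snd_war_in[of u "Suc n"] snd_war_in[of ?u n] h' h'' by (simp_all add: W_chart)
  have s: "src (lev H (Suc n)) ?h \<in> Ob (lev H (Suc n))" using h' typing by blast
  consider "i = 0" | "i = Suc 0" | k where "i = Suc (Suc k)" "k \<le> n"
    using Suc.prems(4) by (metis not0_implies_Suc Suc_le_mono)
  then show ?case
  proof cases
    case 1
    then show ?thesis using Suc.prems by (simp add: W_chart)
  next
    case 2
    have "ract A n (?d ?h) (radd A n (src (lev H n) (?d ?h)) (snd (war ?u)) (rface A (Suc n) 0 (src (lev H (Suc n)) ?h) (snd (war u)))) =
      radd A n (trg (lev H n) (?d ?h)) (ract A n (?d ?h) (snd (war ?u)))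
        (rface A (Suc n) 0 (trg (lev H (Suc n)) ?h) (ract A (Suc n) ?h (snd (war u))))"
      using act_add[OF h''(1) m(2), of "rface A (Suc n) 0 (src (lev H (Suc n)) ?h) (snd (war u))"]
        rface_act[OF h'(1) m(1), of 0] rface_in[OF s m(1), of 0] h'(2) h''(2) by simp
    then show ?thesis using 2 Suc.prems Suc.IH[of ?h ?u 0] m h' h'' dar_dar[OF h, of 0 0]
      by - (rule W_eqI[of _ n], simp_all add: W_chart typing)
  next
    case 3
    then show ?thesis using Suc.prems Suc.IH[of ?h ?u "Suc k"] m h' rface_act[OF h'(1) m(1), of "Suc k"] dar_dar[OF h, of 0 "Suc k"]
      by - (rule W_eqI[of _ n], simp_all add: W_chart typing)
  qed
qed

lemma W_degen_act: "h \<in> Ar (lev H n) \<Longrightarrow> u \<in> simp WS n \<Longrightarrow> wob u = src (lev H n) h \<Longrightarrow> i \<le> n \<Longrightarrow>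
    degen WS n i (ract W n h u) = ract W (Suc n) (far (gdegen H n i) h) (degen WS n i u)"
proof (induction n arbitrary: u h i)
  case 0
  then show ?case using dar_sar_same[of h 0 0]
    by - (rule W_eqI[of _ 0], simp_all add: W_chart typing act_zero')
next
  case (Suc n)
  let ?h = "far (gface H (Suc n) 0) h" and ?u = "face WS (Suc n) 0 u"
  have h: "h \<in> Ar (lev H (Suc n))" by fact
  have h': "?h \<in> Ar (lev H n)" "src (lev H n) ?h = fob (gface H (Suc n) 0) (src (lev H (Suc n)) h)"
      "trg (lev H n) ?h = fob (gface H (Suc n) 0) (trg (lev H (Suc n)) h)"
    using h by (simp_all add: typing)
  have m: "snd (war u) \<in> rcar A n (src (lev H n) ?h)" "?u \<in> simp WS n" "wob ?u = src (lev H n) ?h"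
    using Suc.prems snd_war_in[of u n] h' by (simp_all add: W_chart)
  show ?case
  proof (cases i)
    case 0
    then show ?thesis using Suc.prems dar_sar_same[OF h, of 0]
      by - (rule W_eqI[of _ "Suc n"], simp_all add: W_chart typing act_zero')
  next
    case (Suc k)
    then show ?thesis using Suc.prems Suc.IH[of ?h ?u k] m h' rdegen_act[OF h'(1) m(1), of k] dar_sar_low[OF h, of 0 k]
      by - (rule W_eqI[of _ "Suc n"], simp_all add: W_chart typing)
  qed
qed

lemma srep_Wbar_rep: "srep H W"
proof
  show "sset (Defs.arr_sset (rep_gpd H W))"
    by (rule ssetI)
      (auto simp: rep_sset_simps mem_W W_face_simps W_chart dob_dob sob_sob dob_sob_same dob_sob_Suc
        dob_sob_low dob_sob_high typing R.Wbar_face_face R.Wbar_degen_degen R.Wbar_face_degen_same R.Wbar_face_degen_Suc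
        R.Wbar_face_degen_low R.Wbar_face_degen_high)
qed (auto simp: mem_W W_face_simps W_chart W_add_assoc W_zero_add W_neg_add W_act_add W_act_id W_act_comp
    W_face_add W_degen_add W_face_act W_degen_act intro: W_add_comm)

end

section \<open>Trivial fibrations\<close>

text \<open>The right lifting property against the inclusions of the boundaries of standard simplices. Simplices
  of degree 0 have no faces, so that the two ends of a 1-simplex are subject to no compatibility.\<close>

definition boundary_lifting :: "'a sset \<Rightarrow> 'b sset \<Rightarrow> (nat \<Rightarrow> 'a \<Rightarrow> 'b) \<Rightarrow> bool" where
  "boundary_lifting X Y p \<longleftrightarrow>
    (\<forall>b \<in> simp Y 0. \<exists>x \<in> simp X 0. p 0 x = b) \<and>
    (\<forall>n y b. b \<in> simp Y (Suc n) \<and>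
       (\<forall>i \<le> Suc n. y i \<in> simp X n \<and> p n (y i) = face Y (Suc n) i b) \<and>
       (\<forall>m i j. n = Suc m \<and> i \<le> j \<and> j \<le> n \<longrightarrow> face X n i (y (Suc j)) = face X n j (y i))
     \<longrightarrow> (\<exists>x \<in> simp X (Suc n). p (Suc n) x = b \<and> (\<forall>i \<le> Suc n. face X (Suc n) i x = y i)))"

lemma smapD:
  assumes "smap X Y f"
  shows "x \<in> simp X n \<Longrightarrow> f n x \<in> simp Y n"
    "x \<in> simp X (Suc n) \<Longrightarrow> i \<le> Suc n \<Longrightarrow> f n (face X (Suc n) i x) = face Y (Suc n) i (f (Suc n) x)"
    "x \<in> simp X n \<Longrightarrow> i \<le> n \<Longrightarrow> f (Suc n) (degen X n i x) = degen Y n i (f n x)"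
  using assms unfolding smap_def by blast+

text \<open>A special case of the Eilenberg--Zilber lemma: a simplex that is degenerate in two different
  directions is doubly degenerate. The simplex \<open>w\<close> is a face of either of the two given ones.\<close>

lemma degen_eq_degen:
  assumes K: "sset K" and y: "y \<in> simp K n" "y' \<in> simp K n" and i: "i < i'" "i' \<le> n"
    and e: "degen K n i y = degen K n i' y'"
  obtains m k w where "n = Suc m" "i' = Suc k" "i \<le> k" "k \<le> m" "w \<in> simp K m" "y = degen K m k w" "y' = degen K m i w"
proof -
  obtain m k where mk: "n = Suc m" "i' = Suc k" "i \<le> k" "k \<le> m" using i by (cases n; cases i') auto
  define w where "w = face K n i y'"
  have w: "w \<in> simp K m" using sset_face[OF K, of y' m i] y mk by (simp add: w_def)
  have "y = face K (Suc n) i (degen K n i' y')" using sset_face_degen_same[OF K y(1), of i] i e by simp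
  also have "\<dots> = degen K m k w" using sset_face_degen_low[OF K, of y' m i k] y mk by (simp add: w_def)
  finally have yw: "y = degen K m k w" .
  have "y' = face K (Suc n) (Suc i') (degen K n i y)" using sset_face_degen_Suc[OF K y(2), of i'] i e by simp
  also have "\<dots> = degen K m i (face K n i' y)" using sset_face_degen_high[OF K, of y m i i'] y mk i by simp
  also have "face K n i' y = w" using sset_face_degen_Suc[OF K w, of k] yw mk by simp
  finally show ?thesis using that mk w yw by blast
qed

text \<open>Skeletal induction. The lift is prescribed on \<open>L\<close>, it is forced on the degenerate simplices, where it
  is well defined by the preceding lemma, and on all other simplices it fills a boundary that has been
  lifted before.\<close>

lemma boundary_lifting_extension:
  fixes X :: "'x sset" and B :: "'b sset" and K :: "'k sset" and L :: "nat \<Rightarrow> 'k set"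
  assumes X: "sset X" and p: "smap X B p" and bl: "boundary_lifting X B p"
    and K: "sset K" and q: "smap K B q"
    and L: "\<And>n. L n \<subseteq> simp K n"
    and L_face: "\<And>n x i. x \<in> L (Suc n) \<Longrightarrow> i \<le> Suc n \<Longrightarrow> face K (Suc n) i x \<in> L n"
    and l: "\<And>n x. x \<in> L n \<Longrightarrow> l n x \<in> simp X n" "\<And>n x. x \<in> L n \<Longrightarrow> p n (l n x) = q n x"
    and l_face: "\<And>n x i. x \<in> L (Suc n) \<Longrightarrow> i \<le> Suc n \<Longrightarrow> l n (face K (Suc n) i x) = face X (Suc n) i (l (Suc n) x)"
    and l_degen: "\<And>n x i. x \<in> L n \<Longrightarrow> i \<le> n \<Longrightarrow> l (Suc n) (degen K n i x) = degen X n i (l n x)"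
  obtains f where "smap K X f" "\<And>n x. x \<in> simp K n \<Longrightarrow> p n (f n x) = q n x" "\<And>n x. x \<in> L n \<Longrightarrow> f n x = l n x"
proof -
  define f where "f = rec_nat
    (\<lambda>x. if x \<in> L 0 then l 0 x else SOME z. z \<in> simp X 0 \<and> p 0 z = q 0 x)
    (\<lambda>n g x. if x \<in> L (Suc n) then l (Suc n) x
      else if \<exists>c. fst c \<le> n \<and> snd c \<in> simp K n \<and> x = degen K n (fst c) (snd c)
      then (let c = SOME c. fst c \<le> n \<and> snd c \<in> simp K n \<and> x = degen K n (fst c) (snd c) in degen X n (fst c) (g (snd c)))
      else SOME z. z \<in> simp X (Suc n) \<and> p (Suc n) z = q (Suc n) x \<and>
        (\<forall>i \<le> Suc n. face X (Suc n) i z = g (face K (Suc n) i x)))"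
  have f0: "f 0 x = (if x \<in> L 0 then l 0 x else SOME z. z \<in> simp X 0 \<and> p 0 z = q 0 x)" for x
    by (simp add: f_def)
  have fS: "f (Suc n) x = (if x \<in> L (Suc n) then l (Suc n) x
      else if \<exists>c. fst c \<le> n \<and> snd c \<in> simp K n \<and> x = degen K n (fst c) (snd c)
      then (let c = SOME c. fst c \<le> n \<and> snd c \<in> simp K n \<and> x = degen K n (fst c) (snd c) in degen X n (fst c) (f n (snd c)))
      else SOME z. z \<in> simp X (Suc n) \<and> p (Suc n) z = q (Suc n) x \<and>
        (\<forall>i \<le> Suc n. face X (Suc n) i z = f n (face K (Suc n) i x)))" for n x
    unfolding f_def by (simp only: old.nat.rec(2))
  have fL: "f n x = l n x" if "x \<in> L n" for n x
    using that by (cases n) (simp_all add: f0 fS)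
  define Inv where "Inv n \<longleftrightarrow> (\<forall>x \<in> simp K n. f n x \<in> simp X n \<and> p n (f n x) = q n x)" for n
  define FC where "FC n \<longleftrightarrow> (\<forall>x \<in> simp K (Suc n). \<forall>i \<le> Suc n. face X (Suc n) i (f (Suc n) x) = f n (face K (Suc n) i x))" for n
  define DC where "DC n \<longleftrightarrow> (\<forall>y \<in> simp K n. \<forall>i \<le> n. f (Suc n) (degen K n i y) = degen X n i (f n y))" for n
  have "Inv n \<and> (\<forall>m. n = Suc m \<longrightarrow> FC m \<and> DC m)" for n
  proof (induction n)
    case 0
    have "f 0 x \<in> simp X 0 \<and> p 0 (f 0 x) = q 0 x" if x: "x \<in> simp K 0" for x
    proof (cases "x \<in> L 0")
      case False
      have "\<exists>z. z \<in> simp X 0 \<and> p 0 z = q 0 x"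
        using bl smapD(1)[OF q x] unfolding boundary_lifting_def by blast
      from someI_ex[OF this] show ?thesis using False by (simp add: f0)
    qed (use fL l in simp)
    then show ?case by (simp add: Inv_def)
  next
    case (Suc n)
    then have inv: "\<And>x. x \<in> simp K n \<Longrightarrow> f n x \<in> simp X n" "\<And>x. x \<in> simp K n \<Longrightarrow> p n (f n x) = q n x"
      and fc: "\<And>m x i. n = Suc m \<Longrightarrow> x \<in> simp K n \<Longrightarrow> i \<le> n \<Longrightarrow> face X n i (f n x) = f m (face K n i x)"
      and dc: "\<And>m y i. n = Suc m \<Longrightarrow> y \<in> simp K m \<Longrightarrow> i \<le> m \<Longrightarrow> f n (degen K m i y) = degen X m i (f m y)"
      by (auto simp: Inv_def FC_def DC_def)
    have inv': "f m w \<in> simp X m" if "n = Suc m" "w \<in> simp K m" for m w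
      using fc[OF that(1), of "degen K m 0 w" 0] sset_degen[OF K that(2), of 0] sset_face_degen_same[OF K that(2), of 0]
        sset_face[OF X, of "f n (degen K m 0 w)" m 0] inv(1) that by simp
    \<comment> \<open>the lift on a degenerate simplex does not depend on the way in which it is degenerate\<close>
    have lt: "degen X n i (f n y) = degen X n i' (f n y')"
      if y: "y \<in> simp K n" "y' \<in> simp K n" and i: "i < i'" "i' \<le> n" and e: "degen K n i y = degen K n i' y'" for i i' y y'
    proof -
      obtain m k w where m: "n = Suc m" "i' = Suc k" "i \<le> k" "k \<le> m" "w \<in> simp K m" "y = degen K m k w" "y' = degen K m i w"
        using degen_eq_degen[OF K y i e] .
      have "f n y = degen X m k (f m w)" "f n y' = degen X m i (f m w)" using dc m by auto
      then show ?thesis using sset_degen_degen[OF X inv'[OF m(1,5)] m(3,4)] m by simp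
    qed
    have wd: "degen X n i (f n y) = degen X n i' (f n y')"
      if "y \<in> simp K n" "y' \<in> simp K n" "i \<le> n" "i' \<le> n" "degen K n i y = degen K n i' y'" for i i' y y'
    proof (cases i i' rule: linorder_cases)
      case equal
      then have "y = y'" using sset_face_degen_same[OF K] that by metis
      then show ?thesis using equal by simp
    qed (use lt that in metis)+
    have DCn: "f (Suc n) (degen K n i y) = degen X n i (f n y)" if y: "y \<in> simp K n" "i \<le> n" for y i
    proof (cases "degen K n i y \<in> L (Suc n)")
      case True
      then have "y \<in> L n" using L_face[OF True, of i] sset_face_degen_same[OF K y] y by simp
      then show ?thesis using True fL l_degen y by simp
    next
      case False
      let ?P = "\<lambda>c. fst c \<le> n \<and> snd c \<in> simp K n \<and> degen K n i y = degen K n (fst c) (snd c)"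
      have ex: "\<exists>c. ?P c" using y by (intro exI[of _ "(i, y)"]) simp
      define c where "c = (SOME c. ?P c)"
      have c: "?P c" unfolding c_def by (rule someI_ex[OF ex])
      have "f (Suc n) (degen K n i y) = degen X n (fst c) (f n (snd c))"
        using False ex by (simp add: fS c_def Let_def)
      then show ?thesis using wd[of y "snd c" i "fst c"] y c by simp
    qed
    have main: "f (Suc n) x \<in> simp X (Suc n) \<and> p (Suc n) (f (Suc n) x) = q (Suc n) x \<and>
        (\<forall>i \<le> Suc n. face X (Suc n) i (f (Suc n) x) = f n (face K (Suc n) i x))" if x: "x \<in> simp K (Suc n)" for x
    proof -
      consider "x \<in> L (Suc n)" | i y where "i \<le> n" "y \<in> simp K n" "x = degen K n i y"
        | "x \<notin> L (Suc n)" "\<nexists>c. fst c \<le> n \<and> snd c \<in> simp K n \<and> x = degen K n (fst c) (snd c)"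
        by fastforce
      then show ?thesis
      proof cases
        case 1
        then show ?thesis using fL l L_face l_face by simp
      next
        case 2
        have y: "f n y \<in> simp X n" "p n (f n y) = q n y" using inv 2 by auto
        have fx: "f (Suc n) x = degen X n i (f n y)" using DCn 2 by simp
        have "face X (Suc n) k (degen X n i (f n y)) = f n (face K (Suc n) k (degen K n i y))" if k: "k \<le> Suc n" for k
        proof -
          consider "k < i" | "k = i" | "k = Suc i" | "Suc i < k" by linarith
          then show ?thesis
          proof cases
            case 1
            obtain m j where m: "n = Suc m" "i = Suc j" "k \<le> j" "j \<le> m" using 1 2 by (cases n; cases i) auto
            have "face K n k y \<in> simp K m" using sset_face[OF K, of y m k] 2 m by simp
            then show ?thesis
              using sset_face_degen_low[OF X, of "f n y" m k j] sset_face_degen_low[OF K, of y m k j] y 2 m fc dc by simp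
          next
            case 4
            obtain m j where m: "n = Suc m" "k = Suc j" "i < j" "j \<le> Suc m" using 4 k 2 by (cases n; cases k) auto
            have "face K n j y \<in> simp K m" using sset_face[OF K, of y m j] 2 m by simp
            then show ?thesis
              using sset_face_degen_high[OF X, of "f n y" m i j] sset_face_degen_high[OF K, of y m i j] y 2 m fc dc by simp
          qed (use 2 y sset_face_degen_same[OF X] sset_face_degen_same[OF K] sset_face_degen_Suc[OF X]
              sset_face_degen_Suc[OF K] in simp_all)
        qed
        then show ?thesis using fx y 2 sset_degen[OF X] smapD(3)[OF p] smapD(3)[OF q] by simp
      next
        case 3
        let ?Q = "\<lambda>z. z \<in> simp X (Suc n) \<and> p (Suc n) z = q (Suc n) x \<and>
          (\<forall>i \<le> Suc n. face X (Suc n) i z = f n (face K (Suc n) i x))"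
        have "\<exists>z \<in> simp X (Suc n). p (Suc n) z = q (Suc n) x \<and> (\<forall>i \<le> Suc n. face X (Suc n) i z = f n (face K (Suc n) i x))"
        proof (rule bl[unfolded boundary_lifting_def, THEN conjunct2, rule_format], intro conjI allI impI)
          show "q (Suc n) x \<in> simp B (Suc n)" using smapD(1)[OF q x] .
          fix i
          show "f n (face K (Suc n) i x) \<in> simp X n" "p n (f n (face K (Suc n) i x)) = face B (Suc n) i (q (Suc n) x)"
            if "i \<le> Suc n" using inv sset_face[OF K x that] smapD(2)[OF q x that] by auto
          fix m j assume m: "n = Suc m \<and> i \<le> j \<and> j \<le> n"
          then show "face X n i (f n (face K (Suc n) (Suc j) x)) = face X n j (f n (face K (Suc n) i x))"
            using fc[of m "face K (Suc n) (Suc j) x" i] fc[of m "face K (Suc n) i x" j] sset_face[OF K x, of "Suc j"]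
              sset_face[OF K x, of i] sset_face_face[OF K, of x m i j] x by simp
        qed
        then have "\<exists>z. ?Q z" by blast
        from someI_ex[OF this] show ?thesis unfolding fS if_not_P[OF 3(1)] if_not_P[OF 3(2)] by blast
      qed
    qed
    then show ?case using DCn by (simp add: Inv_def FC_def DC_def)
  qed
  then have I: "Inv n" and D: "FC n" "DC n" for n by blast+
  show ?thesis
  proof (rule that[of f])
    show "smap K X f" using I D unfolding Inv_def FC_def DC_def smap_def by simp
    show "p n (f n x) = q n x" if "x \<in> simp K n" for n x using I that unfolding Inv_def by blast
    show "f n x = l n x" if "x \<in> L n" for n x using fL that .
  qed
qed

text \<open>The faces and degeneracies of standard simplices. Identities between them are checked entrywise.\<close>

definition omit :: "nat \<Rightarrow> 'a list \<Rightarrow> 'a list" where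
  "omit i xs = take i xs @ drop (Suc i) xs"

definition repeat :: "nat \<Rightarrow> 'a list \<Rightarrow> 'a list" where
  "repeat i xs = take (Suc i) xs @ drop i xs"

lemma length_omit: "i < length xs \<Longrightarrow> length (omit i xs) = length xs - 1"
  by (simp add: omit_def)

lemma length_repeat: "i < length xs \<Longrightarrow> length (repeat i xs) = Suc (length xs)"
  by (simp add: repeat_def)

lemma nth_omit: "i < length xs \<Longrightarrow> Suc k < length xs \<Longrightarrow>
    omit i xs ! k = xs ! (if k < i then k else Suc k)"
  by (auto simp: omit_def nth_append)

lemma nth_repeat: "i < length xs \<Longrightarrow> k \<le> length xs \<Longrightarrow>
    repeat i xs ! k = xs ! (if k \<le> i then k else k - 1)"
proof (cases "Suc i < length xs")
  case True
  then show "i < length xs \<Longrightarrow> k \<le> length xs \<Longrightarrow> ?thesis" by (auto simp: repeat_def nth_append min_def Suc_diff_le)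
next
  case False
  assume "i < length xs" "k \<le> length xs"
  then have "length xs = Suc i" "k \<le> Suc i" using False by auto
  then show ?thesis by (auto simp: repeat_def nth_append min_def le_Suc_eq)
qed

lemma sset_std_simplex: "sset (std_simplex m)"
proof (rule ssetI)
  let ?D = "std_simplex m"
  have mem: "xs \<in> simp ?D n \<longleftrightarrow> length xs = Suc n \<and> sorted xs \<and> set xs \<subseteq> {0..m}" for xs n
    by (simp add: std_simplex_def)
  have fd: "face ?D n i xs = omit i xs" "degen ?D n i xs = repeat i xs" for n i xs
    by (simp_all add: std_simplex_def omit_def repeat_def)
  note nth = length_omit length_repeat nth_omit nth_repeat
  fix n i and xs :: "nat list"
  { assume x: "xs \<in> simp ?D (Suc n)" and i: "i \<le> Suc n"
    have "sorted (omit i xs)"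
      using x i unfolding mem sorted_iff_nth_mono by (auto simp: nth)
    then show "face ?D (Suc n) i xs \<in> simp ?D n"
      using x i set_take_subset[of i xs] set_drop_subset[of "Suc i" xs] by (auto simp: mem fd nth(1,2)) (auto simp: omit_def repeat_def) }
  { assume x: "xs \<in> simp ?D n" and i: "i \<le> n"
    have "sorted (repeat i xs)"
      using x i unfolding mem sorted_iff_nth_mono by (auto simp: nth)
    then show "degen ?D n i xs \<in> simp ?D (Suc n)"
      using x i set_take_subset[of "Suc i" xs] set_drop_subset[of i xs] by (auto simp: mem fd nth(1,2)) (auto simp: omit_def repeat_def)
    show "face ?D (Suc n) i (degen ?D n i xs) = xs" "face ?D (Suc n) (Suc i) (degen ?D n i xs) = xs"
      using x i unfolding mem fd by (auto intro!: nth_equalityI simp: nth) }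
  fix j
  show "face ?D (Suc n) i (face ?D (Suc (Suc n)) (Suc j) xs) = face ?D (Suc n) j (face ?D (Suc (Suc n)) i xs)"
    if "xs \<in> simp ?D (Suc (Suc n))" "i \<le> j" "j \<le> Suc n"
    using that unfolding mem fd
    by (intro nth_equalityI) (auto simp: nth)
  show "degen ?D (Suc n) i (degen ?D n j xs) = degen ?D (Suc n) (Suc j) (degen ?D n i xs)"
    if "xs \<in> simp ?D n" "i \<le> j" "j \<le> n"
    using that unfolding mem fd
    by (intro nth_equalityI) (auto simp: nth)
  show "face ?D (Suc (Suc n)) i (degen ?D (Suc n) (Suc j) xs) = degen ?D n j (face ?D (Suc n) i xs)"
    if "xs \<in> simp ?D (Suc n)" "i \<le> j" "j \<le> n"
    using that unfolding mem fd
    by (intro nth_equalityI) (auto simp: nth)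
  show "face ?D (Suc (Suc n)) (Suc i) (degen ?D (Suc n) j xs) = degen ?D n j (face ?D (Suc n) i xs)"
    if "xs \<in> simp ?D (Suc n)" "j < i" "i \<le> Suc n"
    using that unfolding mem fd
    by (intro nth_equalityI) (auto simp: nth)
qed

lemma sset_sprod:
  assumes X: "sset X" and Y: "sset Y" shows "sset (sprod X Y)"
  by (rule ssetI)
    (auto simp: sprod_def sset_face[OF X] sset_face[OF Y] sset_degen[OF X] sset_degen[OF Y]
      sset_face_face[OF X] sset_face_face[OF Y] sset_degen_degen[OF X] sset_degen_degen[OF Y]
      sset_face_degen_same[OF X] sset_face_degen_same[OF Y] sset_face_degen_Suc[OF X] sset_face_degen_Suc[OF Y]
      sset_face_degen_low[OF X] sset_face_degen_low[OF Y] sset_face_degen_high[OF X] sset_face_degen_high[OF Y])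

lemma smap_comp: "smap X Y f \<Longrightarrow> smap Y Z g \<Longrightarrow> smap X Z (\<lambda>n. g n \<circ> f n)"
  unfolding smap_def by simp

lemma smap_sprod_fst: "smap (sprod X Y) X (\<lambda>n. fst)"
  unfolding smap_def sprod_def by auto

lemma homotopy_precomp:
  assumes "homotopy X Z u v" "smap Y X s"
  shows "homotopy Y Z (\<lambda>n. u n \<circ> s n) (\<lambda>n. v n \<circ> s n)"
proof -
  obtain h where h: "smap (sprod X (std_simplex 1)) Z h"
    "\<And>n x. x \<in> simp X n \<Longrightarrow> h n (x, replicate (Suc n) 0) = u n x \<and> h n (x, replicate (Suc n) 1) = v n x"
    using assms(1) unfolding homotopy_def by blast
  have "smap (sprod Y (std_simplex 1)) (sprod X (std_simplex 1)) (\<lambda>n. map_prod (s n) (\<lambda>t. t))"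
    using assms(2) unfolding smap_def sprod_def by auto
  from smap_comp[OF this h(1)] show ?thesis
    unfolding homotopy_def using h(2) smapD(1)[OF assms(2)]
    by (intro exI[of _ "\<lambda>n. h n \<circ> map_prod (s n) (\<lambda>t. t)"]) simp
qed

lemma homotopy_if_eq_on_simplices:
  assumes "smap X Z u" "\<And>n x. x \<in> simp X n \<Longrightarrow> v n x = u n x"
  shows "homotopy X Z u v"
  unfolding homotopy_def using smap_comp[OF smap_sprod_fst assms(1)] assms(2)
  by (intro exI[of _ "\<lambda>n. u n \<circ> fst"]) simp

text \<open>Precomposition with the section is, up to homotopy, inverse to precomposition with \<open>f\<close>.\<close>

lemma weak_equivalence_if_deformation:
  assumes X: "sset X" and Y: "sset Y" and f: "smap X Y f" and s: "smap Y X s"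
    and fs: "\<And>n y. y \<in> simp Y n \<Longrightarrow> f n (s n y) = y"
    and h: "homotopy X X (\<lambda>n x. s n (f n x)) (\<lambda>n x. x)"
  shows "weak_equivalence X Y f"
proof -
  obtain H where H: "smap (sprod X (std_simplex 1)) X H"
    "\<And>n x. x \<in> simp X n \<Longrightarrow> H n (x, replicate (Suc n) 0) = s n (f n x) \<and> H n (x, replicate (Suc n) 1) = x"
    using h unfolding homotopy_def by blast
  have "\<exists>v. smap Y Z v \<and> equivclp (homotopy X Z) (\<lambda>n. v n \<circ> f n) u" if u: "smap X Z u" for Z :: "'z sset" and u
  proof (intro exI conjI)
    show "smap Y Z (\<lambda>n. u n \<circ> s n)" by (rule smap_comp[OF s u])
    have "homotopy X Z (\<lambda>n. (u n \<circ> s n) \<circ> f n) u"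
      unfolding homotopy_def using smap_comp[OF H(1) u] H(2)
      by (intro exI[of _ "\<lambda>n. u n \<circ> H n"]) simp
    then show "equivclp (homotopy X Z) (\<lambda>n. (u n \<circ> s n) \<circ> f n) u" by - (rule r_into_equivclp)
  qed
  moreover have "equivclp (homotopy Y Z) v v'"
    if v: "smap Y Z v" "smap Y Z v'" and e: "equivclp (homotopy X Z) (\<lambda>n. v n \<circ> f n) (\<lambda>n. v' n \<circ> f n)"
    for Z :: "'z sset" and v v'
  proof -
    have pre: "equivclp (homotopy Y Z) (\<lambda>n. a n \<circ> s n) (\<lambda>n. b n \<circ> s n)" if "equivclp (homotopy X Z) a b" for a b
      using that
    proof (induction rule: equivclp_induct)
      case (step b c)
      then have "homotopy Y Z (\<lambda>n. b n \<circ> s n) (\<lambda>n. c n \<circ> s n) \<or> homotopy Y Z (\<lambda>n. c n \<circ> s n) (\<lambda>n. b n \<circ> s n)"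
        using homotopy_precomp s by blast
      then have "equivclp (homotopy Y Z) (\<lambda>n. b n \<circ> s n) (\<lambda>n. c n \<circ> s n)"
        using r_into_equivclp[of "homotopy Y Z"] equivclp_sym[of "homotopy Y Z"] by blast
      with step.IH show ?case by - (rule equivclp_trans)
    qed (rule equivclp_refl)
    have vs: "equivclp (homotopy Y Z) v (\<lambda>n. (v n \<circ> f n) \<circ> s n)" if "smap Y Z v" for v
      by (rule r_into_equivclp, rule homotopy_if_eq_on_simplices[OF that]) (simp add: fs)
    show ?thesis
      by (rule equivclp_trans[OF equivclp_trans[OF vs[OF v(1)] pre[OF e]] equivclp_sym[OF vs[OF v(2)]]])
  qed
  ultimately show ?thesis using X Y f unfolding weak_equivalence_def by blast
qed

lemma face_replicate: "i \<le> n \<Longrightarrow> take i (replicate (Suc n) c) @ drop (Suc i) (replicate (Suc n) c) = replicate n c"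
  by (rule nth_equalityI) (auto simp: nth_append simp del: replicate_Suc)

lemma degen_replicate: "i \<le> n \<Longrightarrow> take (Suc i) (replicate (Suc n) c) @ drop i (replicate (Suc n) c) = replicate (Suc (Suc n)) c"
  by (rule nth_equalityI) (auto simp: nth_append simp del: replicate_Suc)

text \<open>Extending the empty partial lift gives a section, and extending a lift that is given on the two ends
  of the cylinder gives the homotopy.\<close>

lemma weak_equivalence_if_boundary_lifting:
  assumes X: "sset X" and Y: "sset Y" and p: "smap X Y p" and bl: "boundary_lifting X Y p"
  shows "weak_equivalence X Y p"
proof -
  obtain s where s: "smap Y X s" "\<And>n y. y \<in> simp Y n \<Longrightarrow> p n (s n y) = y"
    by (rule boundary_lifting_extension[OF X p bl Y, of "\<lambda>n y. y" "\<lambda>n. {}"]) (auto simp: smap_def)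
  let ?K = "sprod X (std_simplex 1)"
  \<comment> \<open>on the end \<open>0\<close> of the cylinder the homotopy is the projection followed by the section, on the end \<open>1\<close> the identity\<close>
  define L where "L n = simp X n \<times> {replicate (Suc n) 0, replicate (Suc n) (1::nat)}" for n
  define l where "l n z = (if snd z = replicate (Suc n) 0 then s n (p n (fst z)) else fst z)" for n and z :: "'a \<times> nat list"
  have K: "sset ?K" by (rule sset_sprod[OF X sset_std_simplex])
  have r: "replicate (Suc n) (1::nat) \<noteq> replicate (Suc n) 0" for n by simp
  note rep = face_replicate[of _ "Suc _"] degen_replicate
  obtain h where h: "smap ?K X h" "\<And>n z. z \<in> L n \<Longrightarrow> h n z = l n z"
  proof (rule boundary_lifting_extension[OF X p bl K, of "\<lambda>n. p n \<circ> fst" L l])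
    show "smap ?K Y (\<lambda>n. p n \<circ> fst)" by (rule smap_comp[OF smap_sprod_fst p])
    show "L n \<subseteq> simp ?K n" for n by (auto simp: L_def sprod_def std_simplex_def sorted_replicate)
    fix n i z
    show "face ?K (Suc n) i z \<in> L n" "l n (face ?K (Suc n) i z) = face X (Suc n) i (l (Suc n) z)"
      if "z \<in> L (Suc n)" "i \<le> Suc n"
      using that rep(1)[of i n 0] rep(1)[of i n "Suc 0"] r smapD(2)[OF p] smapD(2)[OF s(1)] smapD(1)[OF p] sset_face[OF X]
      by (auto simp: L_def l_def sprod_def std_simplex_def simp del: replicate_Suc take_replicate drop_replicate)
    show "l (Suc n) (degen ?K n i z) = degen X n i (l n z)" if "z \<in> L n" "i \<le> n"
      using that rep(2)[of i n 0] rep(2)[of i n "Suc 0"] r smapD(3)[OF p] smapD(3)[OF s(1)] smapD(1)[OF p]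
      by (auto simp: L_def l_def sprod_def std_simplex_def simp del: replicate_Suc take_replicate drop_replicate)
    show "l n z \<in> simp X n" "p n (l n z) = (p n \<circ> fst) z" if "z \<in> L n"
      using that smapD(1)[OF p] smapD(1)[OF s(1)] s(2) by (auto simp: L_def l_def)
  qed (use that in blast)
  have "homotopy X X (\<lambda>n x. s n (p n x)) (\<lambda>n x. x)"
    unfolding homotopy_def using h r
    by (intro exI[of _ h]) (auto simp: L_def l_def simp del: replicate_Suc)
  then show ?thesis using weak_equivalence_if_deformation[OF X Y p s] by blast
qed

section \<open>Lifting properties of \<open>Wbar\<close>\<close>

text \<open>The first face can replace the zeroth one as a coordinate: its arrow is the composite of the first
  two arrows, from which the first one can be cancelled.\<close>

lemma (in sgroupoid) Wbar_eqI_1: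
  assumes u: "u \<in> simp (Wbar G) (Suc n)" and v: "v \<in> simp (Wbar G) (Suc n)" and ob: "wob u = wob v" and ar: "war u = war v"
    and d: "n \<noteq> 0 \<Longrightarrow> face (Wbar G) (Suc n) (Suc 0) u = face (Wbar G) (Suc n) (Suc 0) v"
  shows "u = v"
proof -
  have du: "face (Wbar G) (Suc n) 0 u \<in> simp (Wbar G) n" "face (Wbar G) (Suc n) 0 v \<in> simp (Wbar G) n"
    using u v by (simp_all add: chart)
  have dw: "wob (face (Wbar G) (Suc n) 0 u) = wob (face (Wbar G) (Suc n) 0 v)"
    using war_trg[OF u] war_trg[OF v] ar by simp
  have "face (Wbar G) (Suc n) 0 u = face (Wbar G) (Suc n) 0 v"
  proof (cases n)
    case 0
    then show ?thesis using Wbar_eqI_0 du dw by simp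
  next
    case (Suc m)
    let ?u = "face (Wbar G) (Suc (Suc m)) 0 u" and ?v = "face (Wbar G) (Suc (Suc m)) 0 v"
    have uv: "u \<in> simp (Wbar G) (Suc (Suc m))" "v \<in> simp (Wbar G) (Suc (Suc m))"
      "?u \<in> simp (Wbar G) (Suc m)" "?v \<in> simp (Wbar G) (Suc m)" using u v du Suc by simp_all
    have d1: "face (Wbar G) (Suc (Suc m)) (Suc 0) u = face (Wbar G) (Suc (Suc m)) (Suc 0) v" using d Suc by simp
    have "gcomp (lev G m) (war ?u) (far (gface G (Suc m) 0) (war u)) = gcomp (lev G m) (war ?v) (far (gface G (Suc m) 0) (war u))"
      using war_face_1[OF uv(1)] war_face_1[OF uv(2)] d1 ar by simp
    then have "war ?u = war ?v"
      by (rule lv.right_cancel[rotated -1]) (use uv dw Suc ar in \<open>simp_all add: chart typing\<close>)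
    moreover have "face (Wbar G) (Suc m) 0 ?u = face (Wbar G) (Suc m) 0 ?v"
      using face_0_face[OF uv(1), of 0] face_0_face[OF uv(2), of 0] d1 by simp
    ultimately show ?thesis using Wbar_eqI[OF uv(3,4)] dw Suc by simp
  qed
  then show ?thesis using Wbar_eqI[OF u v ob ar] by blast
qed

locale sgroupoid_map_id = sgroupoid_map G H F
  for G :: "('o, 'm) sgpd" and H :: "('o, 'q) sgpd" and F :: "nat \<Rightarrow> ('o, 'm, 'o, 'q) gfun" +
  assumes Ob_eq: "Ob (lev G n) = Ob (lev H n)" and F_id: "x \<in> Ob (lev H n) \<Longrightarrow> fob (F n) x = x"
begin

lemma F_src: "g \<in> Ar (lev G n) \<Longrightarrow> src (lev H n) (far (F n) g) = src (lev G n) g"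
  and F_trg: "g \<in> Ar (lev G n) \<Longrightarrow> trg (lev H n) (far (F n) g) = trg (lev G n) g"
  using F_typing(4,5)[of g n] F_id Ob_eq G.typing(1,2)[of g n] by auto

lemma wob_map: "x \<in> simp (Wbar G) n \<Longrightarrow> wob (Wbar_map F n x) = wob x"
  using wob_Wbar_map[of x n] G.wob_Ob[of x n] F_id Ob_eq by simp

lemmas map_chart_id = Wbar_map_in wob_map war_Wbar_map face_0_Wbar_map

lemma dob_eq: "x \<in> Ob (lev H (Suc n)) \<Longrightarrow> i \<le> Suc n \<Longrightarrow> fob (gface G (Suc n) i) x = fob (gface H (Suc n) i) x"
  using F_face(1)[of x n i] F_id Ob_eq G.dob_Ob[of i n x] by auto

lemma lift_0:
  assumes "b \<in> simp (Wbar H) 0"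
  shows "[(wob b, [])] \<in> simp (Wbar G) 0" "Wbar_map F 0 [(wob b, [])] = b"
  using assms F_id[of _ 0] by (auto simp: G.Wbar_0 H.Wbar_0 Ob_eq Wbar_map_def nerve_map_def wob_def)

lemma lift_1:
  assumes g: "g \<in> Ar (lev G 0)" and b: "b \<in> simp (Wbar H) (Suc 0)" and gb: "far (F 0) g = war b"
  obtains x where "x \<in> simp (Wbar G) (Suc 0)" "Wbar_map F (Suc 0) x = b"
    "\<And>i v. i \<le> Suc 0 \<Longrightarrow> v \<in> simp (Wbar G) 0 \<Longrightarrow> Wbar_map F 0 v = face (Wbar H) (Suc 0) i b \<Longrightarrow> face (Wbar G) (Suc 0) i x = v"
proof -
  let ?d = "face (Wbar H) (Suc 0) 0 b"
  let ?x = "[(wob ?d, [])] :: ('o \<times> 'm list) list"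
  have x0: "?d \<in> simp (Wbar H) 0" using b by (simp add: H.chart)
  have wx: "wob ?x = wob ?d" by (simp add: wob_def)
  have st: "src (lev G 0) g = fob (gface H (Suc 0) 0) (wob b)" "trg (lev G 0) g = wob ?d"
    using F_src[OF g] F_trg[OF g] H.war_src[OF b] H.war_trg[OF b] gb by auto
  have wc: "G.wcomp 0 (wob b) g ?x"
    using g st wx lift_0[OF x0] H.wob_Ob[OF b] dob_eq[of "wob b" 0 0] by (simp add: G.wcomp_def Ob_eq)
  define x where "x = wcons G 0 (wob b) g ?x"
  have x: "x \<in> simp (Wbar G) (Suc 0)" "wob x = wob b" "war x = g" "face (Wbar G) (Suc 0) 0 x = ?x"
    using G.wcons_in[OF wc] G.face_0_wcons[OF wc] by (simp_all add: x_def wob_wcons war_wcons)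
  have px: "Wbar_map F (Suc 0) x = b"
    by (rule H.Wbar_eqI[of _ 0]) (use x b gb lift_0[OF x0] in \<open>simp_all add: map_chart_id del: One_nat_def\<close>)
  show ?thesis
  proof (rule that[OF x(1) px])
    fix i v assume v: "i \<le> Suc 0" "v \<in> simp (Wbar G) 0" "Wbar_map F 0 v = face (Wbar H) (Suc 0) i b"
    have f: "face (Wbar G) (Suc 0) i x \<in> simp (Wbar G) 0" using x v by (simp add: G.chart)
    have "wob (face (Wbar G) (Suc 0) i x) = wob v"
      using wob_map[OF v(2)] v(3) wob_map[OF f] Wbar_map_face[OF x(1) v(1)] px by simp
    then show "face (Wbar G) (Suc 0) i x = v" using G.Wbar_eqI_0 f v by blast
  qed
qed

end

text \<open>A lifting problem in which the faces selected by \<open>J\<close> are prescribed. Boundaries are the case where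
  \<open>J\<close> selects all faces, horns the case where it omits one.\<close>

locale partial_boundary = sgroupoid_map_id G H F
  for G :: "('o, 'm) sgpd" and H :: "('o, 'q) sgpd" and F :: "nat \<Rightarrow> ('o, 'm, 'o, 'q) gfun" +
  fixes m :: nat and J :: "nat \<Rightarrow> bool" and b :: "('o \<times> 'q list) list" and y :: "nat \<Rightarrow> ('o \<times> 'm list) list"
  assumes b: "b \<in> simp (Wbar H) (Suc (Suc m))"
    and y: "i \<le> Suc (Suc m) \<Longrightarrow> J i \<Longrightarrow> y i \<in> simp (Wbar G) (Suc m)"
    and p_y: "i \<le> Suc (Suc m) \<Longrightarrow> J i \<Longrightarrow> Wbar_map F (Suc m) (y i) = face (Wbar H) (Suc (Suc m)) i b"
    and y_y: "i \<le> j \<Longrightarrow> j \<le> Suc m \<Longrightarrow> J i \<Longrightarrow> J (Suc j) \<Longrightarrow>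
      face (Wbar G) (Suc m) i (y (Suc j)) = face (Wbar G) (Suc m) j (y i)"
begin

lemma wob_y: "i \<le> Suc (Suc m) \<Longrightarrow> J i \<Longrightarrow> wob (y i) = wob (face (Wbar H) (Suc (Suc m)) i b)"
  using wob_map[OF y] p_y by metis

lemma F_war_y: "i \<le> Suc (Suc m) \<Longrightarrow> J i \<Longrightarrow> far (F m) (war (y i)) = war (face (Wbar H) (Suc (Suc m)) i b)"
  using war_Wbar_map[OF y] p_y by metis

lemma wb: "war b \<in> Ar (lev H (Suc m))" "wob b \<in> Ob (lev H (Suc (Suc m)))"
  using b by (simp_all add: H.chart)

lemma war_y_high:
  assumes "i \<le> m" "J (Suc (Suc i))"
  shows "war (y (Suc (Suc i))) \<in> Ar (lev G m)"
    "far (F m) (war (y (Suc (Suc i)))) = far (gface H (Suc m) (Suc i)) (war b)"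
  using assms F_war_y[of "Suc (Suc i)"] y[of "Suc (Suc i)"] b by (simp_all add: G.chart H.chart)

lemma war_y_high_compat:
  assumes "m = Suc l" "i \<le> j" "j \<le> l" "J (Suc (Suc i))" "J (Suc (Suc (Suc j)))"
  shows "far (gface G m (Suc i)) (war (y (Suc (Suc (Suc j))))) = far (gface G m (Suc j)) (war (y (Suc (Suc i))))"
proof -
  have "war (face (Wbar G) (Suc (Suc l)) (Suc (Suc i)) (y (Suc (Suc (Suc j))))) =
      war (face (Wbar G) (Suc (Suc l)) (Suc (Suc j)) (y (Suc (Suc i))))"
    using y_y[of "Suc (Suc i)" "Suc (Suc j)"] assms by simp
  then show ?thesis
    using assms y[of "Suc (Suc (Suc j))"] y[of "Suc (Suc i)"] by (simp add: G.chart)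
qed

text \<open>The faces that the first arrow of a filler must have when the zeroth face of the filler is
  prescribed. The arrow of its first face is the composite of \<open>war (y 0)\<close> and of the zeroth face of
  the first arrow, and the latter is solved for.\<close>

definition z :: "nat \<Rightarrow> 'm" where
  "z i = (if i = 0 then gcomp (lev G m) (ginv (lev G m) (war (y 0))) (war (y 1)) else war (y (Suc i)))"

context
  assumes J0: "J 0"
begin

lemma y01:
  assumes "J (Suc 0)"
  shows "war (y 0) \<in> Ar (lev G m)" "war (y (Suc 0)) \<in> Ar (lev G m)"
    "trg (lev G m) (war (y 0)) = trg (lev G m) (war (y (Suc 0)))"
    "face (Wbar G) (Suc m) 0 (y (Suc 0)) = face (Wbar G) (Suc m) 0 (y 0)"
proof -
  show f: "face (Wbar G) (Suc m) 0 (y (Suc 0)) = face (Wbar G) (Suc m) 0 (y 0)" using y_y[of 0 0] J0 assms by simp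
  show "war (y 0) \<in> Ar (lev G m)" "war (y (Suc 0)) \<in> Ar (lev G m)"
    "trg (lev G m) (war (y 0)) = trg (lev G m) (war (y (Suc 0)))"
    using y[of 0] y[of "Suc 0"] J0 assms f by (simp_all add: G.chart)
qed

lemma z_lift:
  assumes "i \<le> Suc m" "J (Suc i)"
  shows "z i \<in> Ar (lev G m)" "far (F m) (z i) = far (gface H (Suc m) i) (war b)"
proof -
  have "z i \<in> Ar (lev G m) \<and> far (F m) (z i) = far (gface H (Suc m) i) (war b)"
  proof (cases i)
    case 0
    then have J1: "J (Suc 0)" using assms by simp
    note w = y01[OF J1]
    have d0: "war (face (Wbar H) (Suc (Suc m)) 0 b) \<in> Ar (lev H m)"
      "src (lev H m) (war (face (Wbar H) (Suc (Suc m)) 0 b)) = trg (lev H m) (far (gface H (Suc m) 0) (war b))"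
      using b wb by (simp_all add: H.chart H.typing)
    have "far (F m) (z 0) = gcomp (lev H m) (ginv (lev H m) (war (face (Wbar H) (Suc (Suc m)) 0 b)))
        (gcomp (lev H m) (war (face (Wbar H) (Suc (Suc m)) 0 b)) (far (gface H (Suc m) 0) (war b)))"
      using w F_comp[of "ginv (lev G m) (war (y 0))" m "war (y (Suc 0))"] G.lv.functor_inv[OF F_functor H.lv.gpd, of "war (y 0)"]
        F_war_y[of 0] F_war_y[of "Suc 0"] J0 J1 b by (simp add: z_def G.typing H.chart)
    also have "\<dots> = far (gface H (Suc m) 0) (war b)"
      using H.lv.inv_comp_cancel'[OF d0(1) _ d0(2)] wb by (simp add: H.typing)
    finally show ?thesis using 0 w by (simp add: z_def G.typing)
  next
    case (Suc k)
    then show ?thesis using war_y_high[of k] assms by (simp add: z_def)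
  qed
  then show "z i \<in> Ar (lev G m)" "far (F m) (z i) = far (gface H (Suc m) i) (war b)" by blast+
qed

text \<open>For \<open>i = 0\<close> the arrows of the first faces have to be compared; they are composites, and the
  factor that comes from the zeroth faces cancels.\<close>

lemma z_compat:
  assumes m: "m = Suc l" and ij: "i \<le> j" "j \<le> m" "J (Suc i)" "J (Suc (Suc j))"
  shows "far (gface G m i) (z (Suc j)) = far (gface G m j) (z i)"
proof (cases i)
  case (Suc k)
  then obtain j' where "j = Suc j'" using ij by (cases j) auto
  then have "z (Suc j) = war (y (Suc (Suc (Suc j'))))" "z i = war (y (Suc (Suc k)))"
    using Suc by (simp_all add: z_def)
  then show ?thesis using Suc \<open>j = Suc j'\<close> war_y_high_compat[OF m, of k j'] ij m by (simp only: Suc_le_mono)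
next
  case 0
  then have J1: "J (Suc 0)" using ij by simp
  note w = y01[OF J1]
  let ?Y = "y (Suc (Suc j))" and ?d = "face (Wbar G) (Suc (Suc l))"
  have Y: "?Y \<in> simp (Wbar G) (Suc (Suc l))" "y 0 \<in> simp (Wbar G) (Suc (Suc l))" "y (Suc 0) \<in> simp (Wbar G) (Suc (Suc l))"
    using y[of "Suc (Suc j)"] y[of 0] y[of "Suc 0"] ij m J0 J1 by simp_all
  have f0: "?d 0 ?Y = ?d (Suc j) (y 0)" using y_y[of 0 "Suc j"] J0 ij m by simp
  have f1: "?d (Suc 0) ?Y = ?d (Suc j) (y (Suc 0))" using y_y[of "Suc 0" "Suc j"] J1 ij m by simp
  let ?c = "gcomp (lev G l)" and ?i = "ginv (lev G l)" and ?D = "far (gface G (Suc l) 0)"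
  have a: "war (?d 0 ?Y) \<in> Ar (lev G l)" "?D (war ?Y) \<in> Ar (lev G l)"
    "src (lev G l) (war (?d 0 ?Y)) = trg (lev G l) (?D (war ?Y))"
    using Y by (simp_all add: G.chart G.typing)
  have "war (?d (Suc 0) ?Y) = ?c (war (?d 0 ?Y)) (?D (war ?Y))" using Y by (simp add: G.chart)
  then have "?D (war ?Y) = ?c (?i (war (?d 0 ?Y))) (war (?d (Suc 0) ?Y))"
    using G.lv.inv_comp_cancel'[OF a] by simp
  then have e: "?D (war ?Y) = ?c (?i (war (?d (Suc j) (y 0)))) (war (?d (Suc j) (y (Suc 0))))"
    using f0 f1 by simp
  have w': "war (y 0) \<in> Ar (lev G (Suc l))" "war (y (Suc 0)) \<in> Ar (lev G (Suc l))"
    "trg (lev G (Suc l)) (war (y 0)) = trg (lev G (Suc l)) (war (y (Suc 0)))" using w m by simp_all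
  have z0: "z 0 = gcomp (lev G m) (ginv (lev G m) (war (y 0))) (war (y (Suc 0)))"
    by (simp add: z_def)
  have zS: "z (Suc j) = war ?Y" by (simp add: z_def)
  have r: "far (gface G (Suc l) j) (z 0) =
      ?c (?i (far (gface G (Suc l) j) (war (y 0)))) (far (gface G (Suc l) j) (war (y (Suc 0))))"
    using w' ij m G.dar_comp[of j l "ginv (lev G (Suc l)) (war (y 0))" "war (y (Suc 0))"] G.dar_inv[of j l "war (y 0)"]
    unfolding z0 by (simp add: G.typing)
  have "?c (?i (war (?d (Suc j) (y 0)))) (war (?d (Suc j) (y (Suc 0)))) =
      ?c (?i (far (gface G (Suc l) j) (war (y 0)))) (far (gface G (Suc l) j) (war (y (Suc 0))))"
  proof (cases j)
    case 0
    let ?v = "war (?d 0 (y 0))" and ?a = "?D (war (y 0))" and ?b = "?D (war (y (Suc 0)))"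
    have v: "?v \<in> Ar (lev G l)" "?a \<in> Ar (lev G l)" "?b \<in> Ar (lev G l)" "src (lev G l) ?v = trg (lev G l) ?a"
      "src (lev G l) ?v = trg (lev G l) ?b"
      using Y w' by (simp_all add: G.chart G.typing)
    have "?d 0 (y (Suc 0)) = ?d 0 (y 0)" using w(4) m by simp
    then have 1: "war (?d (Suc 0) (y 0)) = ?c ?v ?a" "war (?d (Suc 0) (y (Suc 0))) = ?c ?v ?b"
      using Y by (simp_all add: G.chart)
    have "?c (?i (?c ?v ?a)) (?c ?v ?b) = ?c (?i ?a) ?b"
    proof (rule G.lv.left_cancel[of "?c ?v ?a"])
      have "?c (?c ?v ?a) (?c (?i (?c ?v ?a)) (?c ?v ?b)) = ?c ?v ?b"
        using G.lv.inv_comp_cancel[of "?c ?v ?a" l "?c ?v ?b"] v by (simp add: G.typing)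
      also have "\<dots> = ?c (?c ?v ?a) (?c (?i ?a) ?b)"
        using G.lv.comp_assoc[of ?v l ?a "?c (?i ?a) ?b"] G.lv.inv_comp_cancel[of ?a l ?b] v by (simp add: G.typing)
      finally show "?c (?c ?v ?a) (?c (?i (?c ?v ?a)) (?c ?v ?b)) = ?c (?c ?v ?a) (?c (?i ?a) ?b)" .
    qed (use v in \<open>simp_all add: G.typing\<close>)
    then show ?thesis using 0 1 by simp
  next
    case (Suc k)
    then show ?thesis using Y ij m by (simp add: G.chart)
  qed
  then show ?thesis unfolding zS using e r 0 unfolding m by simp
qed

lemma fill:
  assumes g: "g \<in> Ar (lev G (Suc m))" and gb: "far (F (Suc m)) g = war b"
    and gz: "\<And>i. i \<le> Suc m \<Longrightarrow> J (Suc i) \<Longrightarrow> far (gface G (Suc m) i) g = z i"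
  shows "\<exists>x \<in> simp (Wbar G) (Suc (Suc m)). Wbar_map F (Suc (Suc m)) x = b \<and>
    (\<forall>i \<le> Suc (Suc m). J i \<longrightarrow> face (Wbar G) (Suc (Suc m)) i x = y i)"
proof -
  have y0: "y 0 \<in> simp (Wbar G) (Suc m)" using y[of 0] J0 by simp
  have st: "src (lev G (Suc m)) g = fob (gface H (Suc (Suc m)) 0) (wob b)" "trg (lev G (Suc m)) g = wob (y 0)"
    using F_src[OF g] F_trg[OF g] H.war_src[OF b] H.war_trg[OF b] gb wob_y[of 0] J0 by auto
  have wc: "G.wcomp (Suc m) (wob b) g (y 0)"
    using g st y0 wb dob_eq[of "wob b" "Suc m" 0] by (simp add: G.wcomp_def Ob_eq)
  define x where "x = wcons G (Suc m) (wob b) g (y 0)"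
  have x: "x \<in> simp (Wbar G) (Suc (Suc m))" "wob x = wob b" "war x = g" "face (Wbar G) (Suc (Suc m)) 0 x = y 0"
    using G.wcons_in[OF wc] G.face_0_wcons[OF wc] by (simp_all add: x_def wob_wcons war_wcons)
  have px: "Wbar_map F (Suc (Suc m)) x = b"
    by (rule H.Wbar_eqI[of _ "Suc m"]) (use x b gb p_y[of 0] J0 in \<open>simp_all add: map_chart_id\<close>)
  have "face (Wbar G) (Suc (Suc m)) i x = y i" if i: "i \<le> Suc (Suc m)" "J i" for i
  proof (cases i)
    case 0
    then show ?thesis using x by simp
  next
    case (Suc k)
    have f: "face (Wbar G) (Suc (Suc m)) i x \<in> simp (Wbar G) (Suc m)" using x i by (simp add: G.chart)
    have o: "wob (face (Wbar G) (Suc (Suc m)) i x) = wob (y i)"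
      using wob_map[OF f] Wbar_map_face[OF x(1) i(1)] px wob_y[OF i] by simp
    have d: "face (Wbar G) (Suc m) 0 (face (Wbar G) (Suc (Suc m)) i x) = face (Wbar G) (Suc m) 0 (y i)"
      using G.face_0_face[OF x(1), of k] Suc i x y_y[of 0 k] J0 by simp
    have w: "war (face (Wbar G) (Suc (Suc m)) i x) = war (y i)"
    proof (cases k)
      case 0
      then have "J (Suc 0)" using Suc i by simp
      note w = y01[OF this]
      show ?thesis using x 0 Suc gz[of 0] i w G.lv.inv_comp_cancel[OF w(1-3)]
        by (simp add: G.chart z_def)
    next
      case l: (Suc l)
      then show ?thesis using x Suc gz[of k] i by (simp add: G.chart z_def)
    qed
    show ?thesis by (rule G.Wbar_eqI[OF f y[OF i] o w d])
  qed
  then show ?thesis using x px by blast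
qed

end

text \<open>The horn without its zeroth face. The first face contains all the arrows after the second one, and
  the composite of the first two, so that the filler is determined by its first arrow.\<close>

lemma fill_outer:
  assumes g: "g \<in> Ar (lev G (Suc m))" and gb: "far (F (Suc m)) g = war b"
    and gz: "\<And>i. i \<le> m \<Longrightarrow> far (gface G (Suc m) (Suc i)) g = war (y (Suc (Suc i)))"
    and J: "\<And>i. J i \<longleftrightarrow> 0 < i"
  shows "\<exists>x \<in> simp (Wbar G) (Suc (Suc m)). Wbar_map F (Suc (Suc m)) x = b \<and>
    (\<forall>i \<le> Suc (Suc m). J i \<longrightarrow> face (Wbar G) (Suc (Suc m)) i x = y i)"
proof -
  let ?w = "war (y (Suc 0))" and ?g = "far (gface G (Suc m) 0) g" and ?d = "face (Wbar G) (Suc (Suc m))"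
  let ?d' = "face (Wbar H) (Suc (Suc m))"
  have y1: "y (Suc 0) \<in> simp (Wbar G) (Suc m)" using y[of "Suc 0"] J by simp
  have st: "src (lev G (Suc m)) g = fob (gface H (Suc (Suc m)) 0) (wob b)" "trg (lev G (Suc m)) g = wob (?d' 0 b)"
    using F_src[OF g] F_trg[OF g] H.war_src[OF b] H.war_trg[OF b] gb by auto
  have w: "?w \<in> Ar (lev G m)" using y1 by (simp add: G.chart)
  have dg: "?g \<in> Ar (lev G m)" using g by (simp add: G.typing)
  have fw: "far (F m) ?w = gcomp (lev H m) (war (?d' 0 b)) (far (gface H (Suc m) 0) (war b))"
    using F_war_y[of "Suc 0"] J b by (simp add: H.chart)
  have fg: "far (F m) ?g = far (gface H (Suc m) 0) (war b)" using F_face(2)[OF g, of 0] gb by simp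
  have d0: "war (?d' 0 b) \<in> Ar (lev H m)" "far (gface H (Suc m) 0) (war b) \<in> Ar (lev H m)"
    "src (lev H m) (war (?d' 0 b)) = trg (lev H m) (far (gface H (Suc m) 0) (war b))"
    using b wb by (simp_all add: H.chart H.typing)
  have sw: "src (lev G m) ?w = src (lev G m) ?g"
    using F_src[OF w] F_src[OF dg] fw fg d0 by (simp add: H.typing)
  define g' where "g' = gcomp (lev G m) ?w (ginv (lev G m) ?g)"
  have g': "g' \<in> Ar (lev G m)" "src (lev G m) g' = fob (gface G (Suc m) 0) (trg (lev G (Suc m)) g)"
    "trg (lev G m) g' = wob (face (Wbar G) (Suc m) 0 (y (Suc 0)))" "gcomp (lev G m) g' ?g = ?w"
    using w dg sw G.lv.comp_inv_cancel'[OF w dg sw] y1 g by (simp_all add: g'_def G.typing G.chart)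
  have fg': "far (F m) g' = war (?d' 0 b)"
    unfolding g'_def using F_comp[OF w, of "ginv (lev G m) ?g"] G.lv.functor_inv[OF F_functor H.lv.gpd dg] dg sw fw fg
      H.lv.comp_inv_cancel[OF d0] by (simp add: G.typing)
  have wc': "G.wcomp m (trg (lev G (Suc m)) g) g' (face (Wbar G) (Suc m) 0 (y (Suc 0)))"
    using g g' y1 by (simp add: G.wcomp_def G.typing G.chart)
  define x' where "x' = wcons G m (trg (lev G (Suc m)) g) g' (face (Wbar G) (Suc m) 0 (y (Suc 0)))"
  have x': "x' \<in> simp (Wbar G) (Suc m)" "wob x' = trg (lev G (Suc m)) g" "war x' = g'"
    "face (Wbar G) (Suc m) 0 x' = face (Wbar G) (Suc m) 0 (y (Suc 0))"
    using G.wcons_in[OF wc'] G.face_0_wcons[OF wc'] by (simp_all add: x'_def wob_wcons war_wcons)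
  have wc: "G.wcomp (Suc m) (wob b) g x'"
    using g st x' wb dob_eq[of "wob b" "Suc m" 0] by (simp add: G.wcomp_def Ob_eq)
  define x where "x = wcons G (Suc m) (wob b) g x'"
  have x: "x \<in> simp (Wbar G) (Suc (Suc m))" "wob x = wob b" "war x = g" "?d 0 x = x'"
    using G.wcons_in[OF wc] G.face_0_wcons[OF wc] by (simp_all add: x_def wob_wcons war_wcons)
  have "Wbar_map F m (face (Wbar G) (Suc m) 0 (y (Suc 0))) = face (Wbar H) (Suc m) 0 (?d' (Suc 0) b)"
    using face_0_Wbar_map[OF y1] p_y[of "Suc 0"] J by simp
  then have px': "Wbar_map F (Suc m) x' = ?d' 0 b"
    using x' b fg' st by - (rule H.Wbar_eqI[of _ m], simp_all add: map_chart_id H.chart)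
  have px: "Wbar_map F (Suc (Suc m)) x = b"
    by (rule H.Wbar_eqI[of _ "Suc m"]) (use x b gb px' in \<open>simp_all add: map_chart_id\<close>)
  have f: "?d i x \<in> simp (Wbar G) (Suc m)" if "i \<le> Suc (Suc m)" for i using x that by (simp add: G.chart)
  have o: "wob (?d i x) = wob (y i)" if "i \<le> Suc (Suc m)" "0 < i" for i
    using wob_map[OF f[OF that(1)]] Wbar_map_face[OF x(1) that(1)] px wob_y[of i] that J by simp
  have 1: "?d (Suc 0) x = y (Suc 0)"
    by (rule G.Wbar_eqI[OF f y1 o]) (use x x' g' G.face_0_face[OF x(1), of 0] in \<open>simp_all add: G.chart\<close>)
  have 2: "?d (Suc (Suc i)) x = y (Suc (Suc i))" if i: "i \<le> m" for i
  proof (rule G.Wbar_eqI_1[OF f y o])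
    show "war (?d (Suc (Suc i)) x) = war (y (Suc (Suc i)))" using x gz[OF i] i by (simp add: G.chart)
    show "face (Wbar G) (Suc m) (Suc 0) (?d (Suc (Suc i)) x) = face (Wbar G) (Suc m) (Suc 0) (y (Suc (Suc i)))" if "m \<noteq> 0"
      using G.Wbar_face_face[OF x(1), of "Suc 0" "Suc i"] y_y[of "Suc 0" "Suc i"] i J 1 by simp
  qed (use i J in simp_all)
  have "?d i x = y i" if "i \<le> Suc (Suc m)" "J i" for i
    using 1 2[of "i - 2"] that J by (cases i; cases "i - 1") auto
  then show ?thesis using x px by blast
qed

end

context sgroupoid_map_id
begin

text \<open>A horn in \<open>Wbar\<close> that omits the face \<open>k > 0\<close> needs a filler of a horn of arrows that omits the face
  \<open>k - 1\<close>; for \<open>k = 0\<close> the omitted face of the arrow is again the zeroth one. The first arrow of the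
  filler of a horn in degree 1 has no prescribed faces, hence the assumption in degree 0.\<close>

lemma kan_fibration_Wbar_map:
  assumes kan: "kan_fibration (Defs.arr_sset G) (Defs.arr_sset H) (\<lambda>n. far (F n))"
    and surj: "Ar (lev H 0) \<subseteq> far (F 0) ` Ar (lev G 0)"
  shows "kan_fibration (Wbar G) (Wbar H) (Wbar_map F)"
  unfolding kan_fibration_def
proof (intro conjI allI impI)
  show "sset (Wbar G)" "sset (Wbar H)" "smap (Wbar G) (Wbar H) (Wbar_map F)"
    by (rule G.sset_Wbar H.sset_Wbar smap_Wbar_map)+
  have arr: "\<exists>g \<in> Ar (lev G (Suc m)). far (F (Suc m)) g = h \<and> (\<forall>i \<le> Suc m. i \<noteq> k \<longrightarrow> far (gface G (Suc m) i) g = z i)"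
    if k: "k \<le> Suc m" "h \<in> Ar (lev H (Suc m))"
      and zi: "\<And>i. i \<le> Suc m \<Longrightarrow> i \<noteq> k \<Longrightarrow> z i \<in> Ar (lev G m) \<and> far (F m) (z i) = far (gface H (Suc m) i) h"
      and zz: "\<And>l i j. m = Suc l \<Longrightarrow> i \<le> j \<Longrightarrow> j \<le> m \<Longrightarrow> i \<noteq> k \<Longrightarrow> Suc j \<noteq> k \<Longrightarrow> far (gface G m i) (z (Suc j)) = far (gface G m j) (z i)"
    for m k h z
  proof -
    have c: "far (gface G m i) (z j) = far (gface G m (j - 1)) (z i)"
      if "i < j" "j \<le> Suc m" "i \<noteq> k" "j \<noteq> k" for i j
    proof -
      have "m \<noteq> 0" using that k by auto
      then obtain l where "m = Suc l" by (cases m) auto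
      then show ?thesis using that zz[of l i "j - 1"] by (cases j) auto
    qed
    show ?thesis
      using kan[unfolded kan_fibration_def, THEN conjunct2, THEN conjunct2, THEN conjunct2, rule_format, of k m h z] k zi c
      by (simp add: Defs.arr_sset_def)
  qed
  fix n k b and y :: "nat \<Rightarrow> ('o \<times> 'm list) list"
  assume h: "k \<le> Suc n \<and> b \<in> simp (Wbar H) (Suc n) \<and>
       (\<forall>i \<le> Suc n. i \<noteq> k \<longrightarrow> y i \<in> simp (Wbar G) n \<and> Wbar_map F n (y i) = face (Wbar H) (Suc n) i b) \<and>
       (\<forall>i j. i < j \<and> j \<le> Suc n \<and> i \<noteq> k \<and> j \<noteq> k \<longrightarrow> face (Wbar G) n i (y j) = face (Wbar G) n (j - 1) (y i))"
  show "\<exists>x \<in> simp (Wbar G) (Suc n). Wbar_map F (Suc n) x = b \<and> (\<forall>i \<le> Suc n. i \<noteq> k \<longrightarrow> face (Wbar G) (Suc n) i x = y i)"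
  proof (cases n)
    case 0
    then have b: "b \<in> simp (Wbar H) (Suc 0)" using h by simp
    obtain g where g: "g \<in> Ar (lev G 0)" "far (F 0) g = war b" using surj H.war_Ar[OF b] by (metis imageE subsetD)
    obtain x where "x \<in> simp (Wbar G) (Suc 0)" "Wbar_map F (Suc 0) x = b"
      "\<And>i v. i \<le> Suc 0 \<Longrightarrow> v \<in> simp (Wbar G) 0 \<Longrightarrow> Wbar_map F 0 v = face (Wbar H) (Suc 0) i b \<Longrightarrow> face (Wbar G) (Suc 0) i x = v"
      using lift_1[OF g(1) b g(2)] by metis
    then show ?thesis using 0 h by (intro bexI[of _ x]) auto
  next
    case (Suc m)
    interpret partial_boundary G H F m "\<lambda>i. i \<noteq> k" b y
      using h Suc by unfold_locales auto
    show ?thesis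
    proof (cases k)
      case 0
      obtain g where "g \<in> Ar (lev G (Suc m))" "far (F (Suc m)) g = war b"
        "\<And>i. i \<le> Suc m \<Longrightarrow> i \<noteq> 0 \<Longrightarrow> far (gface G (Suc m) i) g = war (y (Suc i))"
      proof -
        have "\<exists>g \<in> Ar (lev G (Suc m)). far (F (Suc m)) g = war b \<and>
            (\<forall>i \<le> Suc m. i \<noteq> 0 \<longrightarrow> far (gface G (Suc m) i) g = war (y (Suc i)))"
        proof (rule arr)
          show "war (y (Suc i)) \<in> Ar (lev G m) \<and> far (F m) (war (y (Suc i))) = far (gface H (Suc m) i) (war b)"
            if "i \<le> Suc m" "i \<noteq> 0" for i
            using war_y_high[of "i - 1"] that 0 by (cases i) auto
          show "far (gface G m i) (war (y (Suc (Suc j)))) = far (gface G m j) (war (y (Suc i)))"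
            if "m = Suc l" "i \<le> j" "j \<le> m" "i \<noteq> 0" "Suc j \<noteq> 0" for l i j
            using war_y_high_compat[of l "i - 1" "j - 1"] that 0 by (cases i; cases j) auto
        qed (use wb in auto)
        then show ?thesis using that by blast
      qed
      then show ?thesis using fill_outer[of g] 0 Suc by simp
    next
      case k: (Suc k')
      have J0: "0 \<noteq> k" using k by simp
      have "\<exists>g \<in> Ar (lev G (Suc m)). far (F (Suc m)) g = war b \<and>
            (\<forall>i \<le> Suc m. i \<noteq> k' \<longrightarrow> far (gface G (Suc m) i) g = z i)"
        by (rule arr) (use wb z_lift[OF J0] z_compat[OF J0] k h Suc in auto)
      then show ?thesis using fill[OF J0] k Suc by auto
    qed
  qed
qed

lemma boundary_lifting_Wbar_map:
  assumes bl: "boundary_lifting (Defs.arr_sset G) (Defs.arr_sset H) (\<lambda>n. far (F n))"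
  shows "boundary_lifting (Wbar G) (Wbar H) (Wbar_map F)"
  unfolding boundary_lifting_def
proof (intro conjI allI impI ballI)
  show "\<exists>x \<in> simp (Wbar G) 0. Wbar_map F 0 x = b" if "b \<in> simp (Wbar H) 0" for b
    using lift_0[OF that] by blast
  fix n b and y :: "nat \<Rightarrow> ('o \<times> 'm list) list"
  assume h: "b \<in> simp (Wbar H) (Suc n) \<and>
       (\<forall>i \<le> Suc n. y i \<in> simp (Wbar G) n \<and> Wbar_map F n (y i) = face (Wbar H) (Suc n) i b) \<and>
       (\<forall>m i j. n = Suc m \<and> i \<le> j \<and> j \<le> n \<longrightarrow> face (Wbar G) n i (y (Suc j)) = face (Wbar G) n j (y i))"
  show "\<exists>x \<in> simp (Wbar G) (Suc n). Wbar_map F (Suc n) x = b \<and> (\<forall>i \<le> Suc n. face (Wbar G) (Suc n) i x = y i)"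
  proof (cases n)
    case 0
    then have b: "b \<in> simp (Wbar H) (Suc 0)" using h by simp
    obtain g where g: "g \<in> Ar (lev G 0)" "far (F 0) g = war b"
      using bl H.war_Ar[OF b] unfolding boundary_lifting_def by (auto simp: Defs.arr_sset_def)
    obtain x where "x \<in> simp (Wbar G) (Suc 0)" "Wbar_map F (Suc 0) x = b"
      "\<And>i v. i \<le> Suc 0 \<Longrightarrow> v \<in> simp (Wbar G) 0 \<Longrightarrow> Wbar_map F 0 v = face (Wbar H) (Suc 0) i b \<Longrightarrow> face (Wbar G) (Suc 0) i x = v"
      using lift_1[OF g(1) b g(2)] by metis
    then show ?thesis using 0 h by (intro bexI[of _ x]) auto
  next
    case (Suc m)
    interpret partial_boundary G H F m "\<lambda>i. True" b y
      using h Suc by unfold_locales auto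
    have "\<exists>g \<in> Ar (lev G (Suc m)). far (F (Suc m)) g = war b \<and> (\<forall>i \<le> Suc m. far (gface G (Suc m) i) g = z i)"
      using bl[unfolded boundary_lifting_def, THEN conjunct2, rule_format, of "war b" m z]
        wb z_lift z_compat by (simp add: Defs.arr_sset_def)
    then show ?thesis using fill Suc by auto
  qed
qed

end

section \<open>The kernel as a representation\<close>

text \<open>The groupoid \<open>G\<close> with its objects renamed to those of \<open>H\<close>, so that the projection becomes the identity
  on objects and kernels and arrows of \<open>G\<close> have sources and targets among the same objects.\<close>

definition rebase :: "('o, 'm, 'p, 'q) gext \<Rightarrow> ('p, 'm) sgpd" where
  "rebase E = \<lparr>
     lev = (\<lambda>n. \<lparr> Ob = Ob (lev (ebase E) n), Ar = Ar (lev (etot E) n),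
        src = (\<lambda>g. src (lev (ebase E) n) (far (eprj E n) g)), trg = (\<lambda>g. trg (lev (ebase E) n) (far (eprj E n) g)),
        gid = (\<lambda>y. gid (lev (etot E) n) (inv_into (Ob (lev (etot E) n)) (fob (eprj E n)) y)),
        gcomp = gcomp (lev (etot E) n), ginv = ginv (lev (etot E) n) \<rparr>),
     gface = (\<lambda>n i. \<lparr> fob = fob (gface (ebase E) n i), far = far (gface (etot E) n i) \<rparr>),
     gdegen = (\<lambda>n i. \<lparr> fob = fob (gdegen (ebase E) n i), far = far (gdegen (etot E) n i) \<rparr>) \<rparr>"

definition rebased_prj :: "('o, 'm, 'p, 'q) gext \<Rightarrow> nat \<Rightarrow> ('p, 'm, 'p, 'q) gfun" where
  "rebased_prj E n = \<lparr> fob = (\<lambda>y. y), far = far (eprj E n) \<rparr>"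

lemma rebase_simps:
  "Ob (lev (rebase E) n) = Ob (lev (ebase E) n)" "Ar (lev (rebase E) n) = Ar (lev (etot E) n)"
  "src (lev (rebase E) n) g = src (lev (ebase E) n) (far (eprj E n) g)"
  "trg (lev (rebase E) n) g = trg (lev (ebase E) n) (far (eprj E n) g)"
  "gid (lev (rebase E) n) y = gid (lev (etot E) n) (inv_into (Ob (lev (etot E) n)) (fob (eprj E n)) y)"
  "gcomp (lev (rebase E) n) = gcomp (lev (etot E) n)" "ginv (lev (rebase E) n) = ginv (lev (etot E) n)"
  "fob (gface (rebase E) n i) = fob (gface (ebase E) n i)" "far (gface (rebase E) n i) = far (gface (etot E) n i)"
  "fob (gdegen (rebase E) n i) = fob (gdegen (ebase E) n i)" "far (gdegen (rebase E) n i) = far (gdegen (etot E) n i)"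
  by (simp_all add: rebase_def)

locale extension =
  fixes E :: "('o, 'm, 'p, 'q) gext"
  assumes ext: "abelian_extension E"

sublocale extension \<subseteq> T: sgroupoid "etot E"
  using ext by unfold_locales (simp add: abelian_extension_def)

sublocale extension \<subseteq> H: sgroupoid "ebase E"
  using ext by unfold_locales (simp add: abelian_extension_def)

sublocale extension \<subseteq> prj: sgroupoid_map "etot E" "ebase E" "eprj E"
  using ext by unfold_locales (simp add: abelian_extension_def)

context extension
begin

lemma ext_level: "abelian_gpd_extension (lev (etot E) n) (lev (ebase E) n) (eprj E n)"
  using ext by (simp add: abelian_extension_def)

abbreviation "obT n \<equiv> inv_into (Ob (lev (etot E) n)) (fob (eprj E n))"

lemma bij_ob: "bij_betw (fob (eprj E n)) (Ob (lev (etot E) n)) (Ob (lev (ebase E) n))"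
  and surj_ar: "far (eprj E n) ` Ar (lev (etot E) n) = Ar (lev (ebase E) n)"
  and kernel_comm: "x \<in> Ob (lev (etot E) n) \<Longrightarrow> a \<in> gkernel (lev (etot E) n) (lev (ebase E) n) (eprj E n) x \<Longrightarrow>
     c \<in> gkernel (lev (etot E) n) (lev (ebase E) n) (eprj E n) x \<Longrightarrow> gcomp (lev (etot E) n) a c = gcomp (lev (etot E) n) c a"
  using ext_level[of n] unfolding abelian_gpd_extension_def by blast+

lemma obT: "y \<in> Ob (lev (ebase E) n) \<Longrightarrow> obT n y \<in> Ob (lev (etot E) n)"
  "y \<in> Ob (lev (ebase E) n) \<Longrightarrow> fob (eprj E n) (obT n y) = y"
  "x \<in> Ob (lev (etot E) n) \<Longrightarrow> obT n (fob (eprj E n) x) = x"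
  using bij_ob[of n] unfolding bij_betw_def by (auto simp: inv_into_into f_inv_into_f)

lemma ob_eq_iff: "x \<in> Ob (lev (etot E) n) \<Longrightarrow> x' \<in> Ob (lev (etot E) n) \<Longrightarrow>
    fob (eprj E n) x = fob (eprj E n) x' \<longleftrightarrow> x = x'"
  using bij_ob[of n] unfolding bij_betw_def inj_on_def by blast

lemma prj_src: "g \<in> Ar (lev (etot E) n) \<Longrightarrow> src (lev (ebase E) n) (far (eprj E n) g) = fob (eprj E n) (src (lev (etot E) n) g)"
  and prj_trg: "g \<in> Ar (lev (etot E) n) \<Longrightarrow> trg (lev (ebase E) n) (far (eprj E n) g) = fob (eprj E n) (trg (lev (etot E) n) g)"
  using prj.F_typing by auto

lemma obT_face: "y \<in> Ob (lev (ebase E) (Suc n)) \<Longrightarrow> i \<le> Suc n \<Longrightarrow>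
    fob (gface (etot E) (Suc n) i) (obT (Suc n) y) = obT n (fob (gface (ebase E) (Suc n) i) y)"
  using prj.F_face(1)[of "obT (Suc n) y" n i] obT T.dob_Ob by metis

lemma obT_degen: "y \<in> Ob (lev (ebase E) n) \<Longrightarrow> i \<le> n \<Longrightarrow>
    fob (gdegen (etot E) n i) (obT n y) = obT (Suc n) (fob (gdegen (ebase E) n i) y)"
  using prj.F_degen(1)[of "obT n y" n i] obT T.sob_Ob by metis

lemma simplicial_groupoid_rebase: "simplicial_groupoid (rebase E)"
  unfolding simplicial_groupoid_def
proof (intro conjI allI impI)
  show "groupoid (lev (rebase E) n)" for n
    unfolding groupoid_def
    by (auto simp: rebase_simps prj_src prj_trg ob_eq_iff T.typing H.typing prj.F_typing prj.F_comp obT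
        T.lv.comp_id T.lv.id_comp T.lv.comp_assoc T.lv.inv_comp T.lv.comp_inv)
  show "gfunctor (lev (rebase E) (Suc n)) (lev (rebase E) n) (gface (rebase E) (Suc n) i)" if "i \<le> Suc n" for n i
    using that unfolding gfunctor_def
    by (auto simp: rebase_simps prj_src prj_trg ob_eq_iff T.typing H.typing obT T.dar_id obT_face T.dar_comp
        prj.F_face prj.F_typing)
  show "gfunctor (lev (rebase E) n) (lev (rebase E) (Suc n)) (gdegen (rebase E) n i)" if "i \<le> n" for n i
    using that unfolding gfunctor_def
    by (auto simp: rebase_simps prj_src prj_trg ob_eq_iff T.typing H.typing obT T.sar_id obT_degen T.sar_comp
        prj.F_degen prj.F_typing)
  have "Defs.obj_sset (rebase E) = Defs.obj_sset (ebase E)" "Defs.arr_sset (rebase E) = Defs.arr_sset (etot E)"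
    by (simp_all add: Defs.obj_sset_def Defs.arr_sset_def rebase_simps)
  then show "sset (Defs.obj_sset (rebase E))" "sset (Defs.arr_sset (rebase E))"
    using H.obj_sset T.arr_sset by simp_all
qed

end

sublocale extension \<subseteq> G: sgroupoid "rebase E"
  by unfold_locales (rule simplicial_groupoid_rebase)

context extension
begin

lemma sgpd_map_rebased_prj: "sgpd_map (rebase E) (ebase E) (rebased_prj E)"
proof -
  have "gfunctor (lev (rebase E) n) (lev (ebase E) n) (rebased_prj E n)" for n
    unfolding gfunctor_def rebased_prj_def
    by (auto simp: rebase_simps prj_src prj_trg ob_eq_iff T.typing H.typing prj.F_typing prj.F_comp obT)
  moreover have "smap (Defs.arr_sset (rebase E)) (Defs.arr_sset (ebase E)) (\<lambda>n. far (rebased_prj E n))"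
    using prj.F_arr by (simp add: smap_def Defs.arr_sset_def rebase_simps rebased_prj_def)
  ultimately show ?thesis
    using H.obj_sset sset_degen[OF H.obj_sset]
    unfolding sgpd_map_def by (auto simp: smap_def Defs.obj_sset_def rebase_simps rebased_prj_def)
qed

end

sublocale extension \<subseteq> rp: sgroupoid_map_id "rebase E" "ebase E" "rebased_prj E"
  by unfold_locales (simp_all add: sgpd_map_rebased_prj rebase_simps, simp add: rebased_prj_def)

context extension
begin

lemma far_rebased_prj: "far (rebased_prj E n) = far (eprj E n)"
  by (simp add: rebased_prj_def)

abbreviation "gG n \<equiv> lev (rebase E) n"
abbreviation "gH n \<equiv> lev (ebase E) n"
abbreviation "f n \<equiv> far (eprj E n)"
abbreviation "AA \<equiv> kernel_rep E"

lemmas f_src = rp.F_src[unfolded far_rebased_prj] and f_trg = rp.F_trg[unfolded far_rebased_prj]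
lemmas f_Ar = rp.F_typing(3)[unfolded far_rebased_prj]
lemmas f_comp = rp.F_comp[unfolded far_rebased_prj]
lemmas f_face = rp.F_face(2)[unfolded far_rebased_prj] and f_degen = rp.F_degen(2)[unfolded far_rebased_prj]

lemma f_id: "y \<in> Ob (gH n) \<Longrightarrow> f n (gid (gG n) y) = gid (gH n) y"
  using rp.F_typing(2)[of y n] by (simp add: rebased_prj_def rebase_simps)

lemma f_inv: "g \<in> Ar (gG n) \<Longrightarrow> f n (ginv (gG n) g) = ginv (gH n) (f n g)"
  using G.lv.functor_inv[OF rp.F_functor H.lv.gpd, of g n] by (simp add: far_rebased_prj)

lemma f_surj: "h \<in> Ar (gH n) \<Longrightarrow> \<exists>g \<in> Ar (gG n). f n g = h"
  unfolding rebase_simps surj_ar[of n, symmetric] by blast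

lemma mem_A: "y \<in> Ob (gH n) \<Longrightarrow> a \<in> rcar AA n y \<longleftrightarrow> a \<in> Ar (gG n) \<and> f n a = gid (gH n) y"
proof -
  assume y: "y \<in> Ob (gH n)"
  have "src (lev (etot E) n) a = trg (lev (etot E) n) a" if "a \<in> Ar (gG n)" "f n a = gid (gH n) y"
    using that y prj_src[of a n] prj_trg[of a n] ob_eq_iff T.typing by (simp add: rebase_simps H.typing)
  then show ?thesis using mem_kernel[OF ext y] by (auto simp: rebase_simps)
qed

lemma A_typing:
  assumes "y \<in> Ob (gH n)" "a \<in> rcar AA n y"
  shows "a \<in> Ar (gG n)" "src (gG n) a = y" "trg (gG n) a = y" "f n a = gid (gH n) y"
  using assms mem_A[OF assms(1)] by (auto simp: rebase_simps H.typing)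

lemma A_simps: "radd AA n y = gcomp (gG n)" "rzero AA n y = gid (gG n) y" "rneg AA n y = ginv (gG n)"
  "rface AA n i y = far (gface (rebase E) n i)" "rdegen AA n i y = far (gdegen (rebase E) n i)"
  by (simp_all add: kernel_rep_def Let_def rebase_simps)

lemma A_comm: "y \<in> Ob (gH n) \<Longrightarrow> a \<in> rcar AA n y \<Longrightarrow> c \<in> rcar AA n y \<Longrightarrow> gcomp (gG n) a c = gcomp (gG n) c a"
  using kernel_comm[of "obT n y" n a c] obT by (simp add: kernel_rep_def Let_def rebase_simps)

lemma Ob_rebase: "Ob (gG n) = Ob (gH n)" by (simp add: rebase_simps)

lemma quotient_in_A:
  assumes "g \<in> Ar (gG n)" "g' \<in> Ar (gG n)" "f n g = f n g'"
  shows "gcomp (gG n) g (ginv (gG n) g') \<in> rcar AA n (trg (gH n) (f n g))"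
proof -
  have s: "src (gG n) g = src (gG n) g'" "trg (gG n) g = trg (gG n) g'" using assms by (simp_all add: rebase_simps)
  have "f n (gcomp (gG n) g (ginv (gG n) g')) = gcomp (gH n) (f n g) (ginv (gH n) (f n g))"
    using f_comp[of g n "ginv (gG n) g'"] f_inv assms s by (simp add: G.typing)
  also have "\<dots> = gid (gH n) (trg (gH n) (f n g))" using H.lv.comp_inv f_Ar assms by simp
  finally show ?thesis using mem_A s assms f_Ar by (simp add: G.typing H.typing)
qed

lemma conj_in_A:
  assumes "g \<in> Ar (gG n)" "a \<in> rcar AA n (src (gG n) g)"
  shows "gcomp (gG n) (gcomp (gG n) g a) (ginv (gG n) g) \<in> rcar AA n (trg (gG n) g)"
proof -
  have s: "src (gG n) g \<in> Ob (gH n)" "trg (gG n) g \<in> Ob (gH n)" using assms G.typing Ob_rebase by auto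
  note a = A_typing[OF s(1) assms(2)]
  have fg: "f n g \<in> Ar (gH n)" "src (gH n) (f n g) = src (gG n) g" "trg (gH n) (f n g) = trg (gG n) g"
    using f_Ar f_src f_trg assms by auto
  have "f n (gcomp (gG n) (gcomp (gG n) g a) (ginv (gG n) g)) =
      gcomp (gH n) (gcomp (gH n) (f n g) (gid (gH n) (src (gG n) g))) (ginv (gH n) (f n g))"
    using f_comp[of "gcomp (gG n) g a" n "ginv (gG n) g"] f_comp[of g n a] f_inv assms a by (simp add: G.typing)
  also have "\<dots> = gid (gH n) (trg (gG n) g)" using H.lv.comp_inv H.lv.comp_id fg by simp
  finally show ?thesis using mem_A[OF s(2)] assms a by (simp add: G.typing)
qed

text \<open>Two lifts of an arrow of \<open>H\<close> differ by an element of the kernel, which commutes with the conjugates of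
  elements of the kernel.\<close>

lemma act_eq:
  assumes g: "g \<in> Ar (gG n)" and a: "a \<in> rcar AA n (src (gG n) g)"
  shows "ract AA n (f n g) a = gcomp (gG n) (gcomp (gG n) g a) (ginv (gG n) g)"
proof -
  define k where "k = (SOME k. k \<in> Ar (gG n) \<and> f n k = f n g)"
  have k: "k \<in> Ar (gG n)" "f n k = f n g"
    using someI[of "\<lambda>k. k \<in> Ar (gG n) \<and> f n k = f n g" g] g unfolding k_def by auto
  have s: "src (gG n) g \<in> Ob (gH n)" "trg (gG n) g \<in> Ob (gH n)" using g G.typing Ob_rebase by auto
  have sk: "src (gG n) k = src (gG n) g" "trg (gG n) k = trg (gG n) g" using k by (simp_all add: rebase_simps)
  note at = A_typing[OF s(1) a]
  let ?c = "gcomp (gG n)" and ?i = "ginv (gG n)"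
  let ?q = "?c k (?i g)" and ?b = "?c (?c g a) (?i g)"
  have q: "?q \<in> rcar AA n (trg (gG n) g)" using quotient_in_A[OF k(1) g k(2)] k f_trg g by simp
  have b: "?b \<in> rcar AA n (trg (gG n) g)" by (rule conj_in_A[OF g a])
  note qt = A_typing[OF s(2) q] and bt = A_typing[OF s(2) b]
  have kq: "k = ?c ?q g" using G.lv.comp_inv_cancel'[OF k(1) g sk(1)] by simp
  have "?c (?c ?b ?q) g = ?c ?b k"
    using G.lv.comp_assoc[of ?b n ?q g] kq bt qt g by simp
  also have "?c (?c ?b ?q) g = ?c (?c ?q ?b) g" using A_comm[OF s(2) q b] by simp
  also have "\<dots> = ?c ?q (?c g a)"
    using G.lv.comp_assoc[of ?q n ?b g] G.lv.comp_inv_cancel'[of "?c g a" n g] at bt qt g by (simp add: G.typing)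
  also have "\<dots> = ?c k a" using G.lv.comp_assoc[of ?q n g a] kq at qt g by simp
  finally have "?c ?b k = ?c k a" by simp
  then have "?c (?c k a) (?i k) = ?b"
    using G.lv.comp_inv_cancel[of ?b n k] bt k sk by simp
  moreover have "ract AA n (f n g) a = ?c (?c k a) (?i k)"
    by (simp add: kernel_rep_def Let_def k_def rebase_simps)
  ultimately show ?thesis by simp
qed

lemma srep_kernel_rep: "srep (ebase E) AA"
proof
  have ob: "\<And>y n. y \<in> Ob (gH n) \<Longrightarrow> y \<in> Ob (gG n)" by (simp add: rebase_simps)
  fix n y a c d assume y: "y \<in> Ob (gH n)" and a: "a \<in> rcar AA n y"
  note at = A_typing[OF y a]
  show "radd AA n y (rzero AA n y) a = a" "rneg AA n y a \<in> rcar AA n y" "radd AA n y (rneg AA n y a) a = rzero AA n y"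
    using at y ob mem_A[OF y] H.lv.comp_inv[of "gid (gH n) y" n]  H.lv.id_comp[of "ginv (gH n) (gid (gH n) y)" n]
    by (simp_all add: A_simps G.lv.id_comp G.lv.inv_comp G.typing f_inv H.typing)
  show "ract AA n (gid (gH n) y) a = a"
    using act_eq[of "gid (gG n) y" n a] a at y ob f_id G.lv.id_comp G.lv.comp_inv_cancel[of a n "gid (gG n) y"] G.lv.comp_id[of a n]
    by (simp add: G.typing)
  assume c: "c \<in> rcar AA n y"
  note ct = A_typing[OF y c]
  show "radd AA n y a c \<in> rcar AA n y"
    using at ct y mem_A[OF y] H.lv.comp_id[of "gid (gH n) y" n] by (simp add: A_simps f_comp G.typing H.typing)
  show "radd AA n y a c = radd AA n y c a" using A_comm[OF y a c] by (simp add: A_simps)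
  assume d: "d \<in> rcar AA n y"
  show "radd AA n y (radd AA n y a c) d = radd AA n y a (radd AA n y c d)"
    using at ct A_typing[OF y d] by (simp add: A_simps G.lv.comp_assoc)
next
  fix n y assume y: "y \<in> Ob (gH n)"
  then show "rzero AA n y \<in> rcar AA n y" using mem_A[OF y] f_id[OF y] G.lv.id_Ar by (simp add: A_simps Ob_rebase)
next
  fix n h a c assume h: "h \<in> Ar (gH n)" and a: "a \<in> rcar AA n (src (gH n) h)"
  obtain g where g: "g \<in> Ar (gG n)" "f n g = h" using f_surj[OF h] by blast
  have s: "src (gG n) g = src (gH n) h" "trg (gG n) g = trg (gH n) h" using g by (simp_all add: rebase_simps)
  have so: "src (gH n) h \<in> Ob (gH n)" using h by (simp add: H.typing)
  note at = A_typing[OF so a]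
  show "ract AA n h a \<in> rcar AA n (trg (gH n) h)" using act_eq[OF g(1), of a] conj_in_A[OF g(1), of a] a g s by simp
  assume c: "c \<in> rcar AA n (src (gH n) h)"
  note ct = A_typing[OF so c]
  have ac: "gcomp (gG n) a c \<in> rcar AA n (src (gH n) h)"
    using at ct mem_A[OF so] H.lv.comp_id[of "gid (gH n) (src (gH n) h)" n] so by (simp add: f_comp G.typing H.typing)
  have "gcomp (gG n) (gcomp (gG n) g (gcomp (gG n) a c)) (ginv (gG n) g) =
      gcomp (gG n) (gcomp (gG n) (gcomp (gG n) g a) (ginv (gG n) g)) (gcomp (gG n) (gcomp (gG n) g c) (ginv (gG n) g))"
    using at ct g s G.lv.inv_comp_cancel'[of g n "gcomp (gG n) c (ginv (gG n) g)"]
    by (simp add: G.lv.comp_assoc G.typing)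
  then show "ract AA n h (radd AA n (src (gH n) h) a c) = radd AA n (trg (gH n) h) (ract AA n h a) (ract AA n h c)"
    using act_eq[OF g(1), of a] act_eq[OF g(1), of c] act_eq[OF g(1), of "gcomp (gG n) a c"] a c ac g s by (simp add: A_simps)
next
  fix n g h a assume g: "g \<in> Ar (gH n)" and h: "h \<in> Ar (gH n)" and gh: "src (gH n) g = trg (gH n) h"
    and a: "a \<in> rcar AA n (src (gH n) h)"
  obtain g' where g': "g' \<in> Ar (gG n)" "f n g' = g" using f_surj[OF g] by blast
  obtain h' where h': "h' \<in> Ar (gG n)" "f n h' = h" using f_surj[OF h] by blast
  have s: "src (gG n) g' = src (gH n) g" "trg (gG n) g' = trg (gH n) g"
    "src (gG n) h' = src (gH n) h" "trg (gG n) h' = trg (gH n) h" using g' h' by (simp_all add: rebase_simps)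
  have so: "src (gH n) h \<in> Ob (gH n)" using h by (simp add: H.typing)
  note at = A_typing[OF so a]
  have r: "ract AA n h a = gcomp (gG n) (gcomp (gG n) h' a) (ginv (gG n) h')" using act_eq[OF h'(1), of a] a h' s by simp
  have r': "ract AA n h a \<in> rcar AA n (src (gG n) g')" using r conj_in_A[OF h'(1), of a] a s gh by simp
  have c: "f n (gcomp (gG n) g' h') = gcomp (gH n) g h" using f_comp[OF g'(1) h'(1)] s gh g' h' by simp
  have inv: "ginv (gG n) (gcomp (gG n) g' h') = gcomp (gG n) (ginv (gG n) h') (ginv (gG n) g')"
  proof (rule G.lv.left_cancel[of "gcomp (gG n) g' h'"])
    have "gcomp (gG n) (gcomp (gG n) g' h') (gcomp (gG n) (ginv (gG n) h') (ginv (gG n) g')) = gid (gG n) (trg (gG n) g')"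
      using G.lv.comp_assoc[of g' n h' "gcomp (gG n) (ginv (gG n) h') (ginv (gG n) g')"]
        G.lv.inv_comp_cancel[of h' n "ginv (gG n) g'"] G.lv.comp_inv[of g' n] g' h' s gh by (simp add: G.typing)
    then show "gcomp (gG n) (gcomp (gG n) g' h') (ginv (gG n) (gcomp (gG n) g' h')) =
        gcomp (gG n) (gcomp (gG n) g' h') (gcomp (gG n) (ginv (gG n) h') (ginv (gG n) g'))"
      using G.lv.comp_inv[of "gcomp (gG n) g' h'" n] g' h' s gh by (simp add: G.typing)
  qed (use g' h' s gh in \<open>simp_all add: G.typing\<close>)
  have "gcomp (gG n) (gcomp (gG n) (gcomp (gG n) g' h') a) (ginv (gG n) (gcomp (gG n) g' h')) =
      gcomp (gG n) (gcomp (gG n) g' (gcomp (gG n) (gcomp (gG n) h' a) (ginv (gG n) h'))) (ginv (gG n) g')"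
    unfolding inv using g' h' s gh at by (simp add: G.lv.comp_assoc G.typing)
  then show "ract AA n (gcomp (gH n) g h) a = ract AA n g (ract AA n h a)"
    using act_eq[of "gcomp (gG n) g' h'" n a] act_eq[OF g'(1) r'] c r a g' h' s gh by (simp add: G.typing)
next
  fix n y i a c assume "y \<in> Ob (gH (Suc n))" "a \<in> rcar AA (Suc n) y" "c \<in> rcar AA (Suc n) y" "i \<le> Suc n"
  then show "rface AA (Suc n) i y (radd AA (Suc n) y a c) =
    radd AA n (fob (gface (ebase E) (Suc n) i) y) (rface AA (Suc n) i y a) (rface AA (Suc n) i y c)"
    using A_typing[of y "Suc n"] by (simp add: A_simps G.dar_comp)
next
  fix n y i a c assume "y \<in> Ob (gH n)" "a \<in> rcar AA n y" "c \<in> rcar AA n y" "i \<le> n"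
  then show "rdegen AA n i y (radd AA n y a c) =
    radd AA (Suc n) (fob (gdegen (ebase E) n i) y) (rdegen AA n i y a) (rdegen AA n i y c)"
    using A_typing[of y n] by (simp add: A_simps G.sar_comp)
next
  fix n i h a assume h: "h \<in> Ar (gH (Suc n))" and a: "a \<in> rcar AA (Suc n) (src (gH (Suc n)) h)" and i: "i \<le> Suc n"
  obtain g where g: "g \<in> Ar (gG (Suc n))" "f (Suc n) g = h" using f_surj[OF h] by blast
  have s: "src (gG (Suc n)) g = src (gH (Suc n)) h" using g by (simp add: rebase_simps)
  have so: "src (gH (Suc n)) h \<in> Ob (gH (Suc n))" using h by (simp add: H.typing)
  note at = A_typing[OF so a]
  have "(src (gH (Suc n)) h, a) \<in> simp (kernel_sset E) (Suc n)" using a so by (simp add: kernel_sset_simps)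
  from sset_face[OF sset_kernel(1)[OF ext] this i]
  have d: "far (gface (rebase E) (Suc n) i) a \<in> rcar AA n (src (gG n) (far (gface (rebase E) (Suc n) i) g))"
    using g s i by (simp add: kernel_sset_simps G.typing) (simp add: rebase_simps)
  show "rface AA (Suc n) i (trg (gH (Suc n)) h) (ract AA (Suc n) h a) =
      ract AA n (far (gface (ebase E) (Suc n) i) h) (rface AA (Suc n) i (src (gH (Suc n)) h) a)"
    using act_eq[OF g(1), of a] act_eq[OF _ d] g a s i at f_face[of g n i]
    by (simp add: A_simps G.dar_comp G.dar_inv G.typing)
next
  fix n i h a assume h: "h \<in> Ar (gH n)" and a: "a \<in> rcar AA n (src (gH n) h)" and i: "i \<le> n"
  obtain g where g: "g \<in> Ar (gG n)" "f n g = h" using f_surj[OF h] by blast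
  have s: "src (gG n) g = src (gH n) h" using g by (simp add: rebase_simps)
  have so: "src (gH n) h \<in> Ob (gH n)" using h by (simp add: H.typing)
  note at = A_typing[OF so a]
  have "(src (gH n) h, a) \<in> simp (kernel_sset E) n" using a so by (simp add: kernel_sset_simps)
  from sset_degen[OF sset_kernel(1)[OF ext] this i]
  have d: "far (gdegen (rebase E) n i) a \<in> rcar AA (Suc n) (src (gG (Suc n)) (far (gdegen (rebase E) n i) g))"
    using g s i by (simp add: kernel_sset_simps G.typing) (simp add: rebase_simps)
  show "rdegen AA n i (trg (gH n) h) (ract AA n h a) =
      ract AA (Suc n) (far (gdegen (ebase E) n i) h) (rdegen AA n i (src (gH n) h) a)"
    using act_eq[OF g(1), of a] act_eq[OF _ d] g a s i at f_degen[of g n i]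
    by (simp add: A_simps G.sar_comp G.lv.functor_inv[OF sgpdD(2)[OF G.sgpd] G.lv.gpd] G.typing)
next
  show "sset (Defs.arr_sset (rep_gpd (ebase E) AA))" using sset_kernel(1)[OF ext] by (simp add: kernel_sset_def)
qed

end

sublocale extension \<subseteq> A: srep "ebase E" "kernel_rep E"
  by (rule srep_kernel_rep)

section \<open>The extension by \<open>W A\<close>\<close>

sublocale extension \<subseteq> V: srep "ebase E" "Wbar_rep (ebase E) (kernel_rep E)"
  by (rule A.srep_Wbar_rep)

definition pullback_rep :: "('o, 'm, 'p, 'q) gext \<Rightarrow> ('p, 'm, ('p \<times> ('p \<times> 'm) list) list) srep" where
  "pullback_rep E = (let V = Wbar_rep (ebase E) (kernel_rep E) in
     \<lparr> rcar = rcar V, radd = radd V, rzero = rzero V, rneg = rneg V,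
       ract = (\<lambda>n g. ract V n (far (eprj E n) g)), rface = rface V, rdegen = rdegen V \<rparr>)"

lemma pullback_rep_simps:
  "rcar (pullback_rep E) = rcar (Wbar_rep (ebase E) (kernel_rep E))"
  "radd (pullback_rep E) = radd (Wbar_rep (ebase E) (kernel_rep E))"
  "rzero (pullback_rep E) = rzero (Wbar_rep (ebase E) (kernel_rep E))"
  "rneg (pullback_rep E) = rneg (Wbar_rep (ebase E) (kernel_rep E))"
  "ract (pullback_rep E) n g = ract (Wbar_rep (ebase E) (kernel_rep E)) n (far (eprj E n) g)"
  "rface (pullback_rep E) = rface (Wbar_rep (ebase E) (kernel_rep E))"
  "rdegen (pullback_rep E) = rdegen (Wbar_rep (ebase E) (kernel_rep E))"
  by (simp_all add: pullback_rep_def Let_def)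

text \<open>The push-forward of the extension along \<open>A \<rightarrow> W A\<close>. An element of \<open>W A\<close> is a pair of an element \<open>a\<close> of
  \<open>A\<close> and an element \<open>u\<close> of \<open>Wbar A\<close> in the same degree, and its zeroth face is formed by adding the
  first entry of \<open>u\<close>, which has one degree less, to \<open>\<partial>\<^sub>0 a\<close>. The formula here is the same with an arrow
  of \<open>G\<close> in place of \<open>a\<close>.\<close>

definition W_ext :: "('o, 'm, 'p, 'q) gext \<Rightarrow> ('p, 'm \<times> ('p \<times> ('p \<times> 'm) list) list) sgpd" where
  "W_ext E = (semidirect (rebase E) (pullback_rep E)) \<lparr> gface := (\<lambda>n i. if i = 0 then
     \<lparr> fob = fob (gface (ebase E) n 0),
       far = (\<lambda>(g, u). (gcomp (lev (etot E) (n - 1)) (snd (war u)) (far (gface (etot E) n 0) g),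
         face (Wbar (rep_gpd (ebase E) (kernel_rep E))) n 0 u)) \<rparr>
     else gface (semidirect (rebase E) (pullback_rep E)) n i) \<rparr>"

context extension
begin

abbreviation "VV \<equiv> Wbar_rep (ebase E) (kernel_rep E)"
abbreviation "WA \<equiv> Wbar (rep_gpd (ebase E) (kernel_rep E))"

lemma srep_pullback_rep: "srep (rebase E) (pullback_rep E)"
proof
  show "sset (Defs.arr_sset (rep_gpd (rebase E) (pullback_rep E)))"
    using V.sset_rep by (simp add: Defs.arr_sset_def rep_gpd_def pullback_rep_simps rebase_simps)
  fix n h i a assume "h \<in> Ar (gG (Suc n))" "a \<in> rcar (pullback_rep E) (Suc n) (src (gG (Suc n)) h)" "i \<le> Suc n"
  then show "rface (pullback_rep E) (Suc n) i (trg (gG (Suc n)) h) (ract (pullback_rep E) (Suc n) h a) =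
      ract (pullback_rep E) n (far (gface (rebase E) (Suc n) i) h) (rface (pullback_rep E) (Suc n) i (src (gG (Suc n)) h) a)"
    using V.rface_act[of "f (Suc n) h" n a i] by (simp add: pullback_rep_simps f_face f_Ar f_src f_trg)
next
  fix n h i a assume "h \<in> Ar (gG n)" "a \<in> rcar (pullback_rep E) n (src (gG n) h)" "i \<le> n"
  then show "rdegen (pullback_rep E) n i (trg (gG n) h) (ract (pullback_rep E) n h a) =
      ract (pullback_rep E) (Suc n) (far (gdegen (rebase E) n i) h) (rdegen (pullback_rep E) n i (src (gG n) h) a)"
    using V.rdegen_act[of "f n h" n a i] by (simp add: pullback_rep_simps f_degen f_Ar f_src f_trg)
next
  fix n h a assume "h \<in> Ar (gG n)" "a \<in> rcar (pullback_rep E) n (src (gG n) h)"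
  then show "ract (pullback_rep E) n h a \<in> rcar (pullback_rep E) n (trg (gG n) h)"
    using V.act_in[of "f n h" n a] by (simp add: pullback_rep_simps f_Ar f_src f_trg)
next
  fix n h a b assume "h \<in> Ar (gG n)" "a \<in> rcar (pullback_rep E) n (src (gG n) h)" "b \<in> rcar (pullback_rep E) n (src (gG n) h)"
  then show "ract (pullback_rep E) n h (radd (pullback_rep E) n (src (gG n) h) a b) =
      radd (pullback_rep E) n (trg (gG n) h) (ract (pullback_rep E) n h a) (ract (pullback_rep E) n h b)"
    using V.act_add[of "f n h" n a b] by (simp add: pullback_rep_simps f_Ar f_src f_trg)
next
  fix n g h a assume "g \<in> Ar (gG n)" "h \<in> Ar (gG n)" "src (gG n) g = trg (gG n) h" "a \<in> rcar (pullback_rep E) n (src (gG n) h)"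
  then show "ract (pullback_rep E) n (gcomp (gG n) g h) a = ract (pullback_rep E) n g (ract (pullback_rep E) n h a)"
    using V.act_comp[of "f n g" n "f n h" a] by (simp add: pullback_rep_simps f_Ar f_src f_trg f_comp)
qed (simp_all add: pullback_rep_simps Ob_rebase V.add_in V.add_assoc V.zero_in V.zero_add V.neg_in V.neg_add
    V.act_id V.rface_add V.rdegen_add f_id, auto simp: rebase_simps V.rface_add V.rdegen_add intro: V.add_comm)

end

sublocale extension \<subseteq> S: srep "rebase E" "pullback_rep E"
  by (rule srep_pullback_rep)

context extension
begin

abbreviation "TT n \<equiv> lev (W_ext E) n"

lemma lev_W_ext: "lev (W_ext E) = lev (semidirect (rebase E) (pullback_rep E))"
  "gdegen (W_ext E) = gdegen (semidirect (rebase E) (pullback_rep E))"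
  "i \<noteq> 0 \<Longrightarrow> gface (W_ext E) n i = gface (semidirect (rebase E) (pullback_rep E)) n i"
  by (simp_all add: W_ext_def)

lemma lev_W_ext_simps:
  "Ob (TT n) = Ob (gH n)"
  "(g, u) \<in> Ar (TT n) \<longleftrightarrow> g \<in> Ar (gG n) \<and> u \<in> simp WA n \<and> wob u = trg (gG n) g"
  "src (TT n) (g, u) = src (gG n) g" "trg (TT n) (g, u) = trg (gG n) g"
  "gid (TT n) y = (gid (gG n) y, rzero VV n y)"
  "gcomp (TT n) (k, v) (g, u) = (gcomp (gG n) k g, radd VV n (trg (gG n) k) v (ract VV n (f n k) u))"
  "fob (gface (W_ext E) n i) = fob (gface (ebase E) n i)"
  "fob (gdegen (W_ext E) n i) = fob (gdegen (ebase E) n i)"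
  "far (gface (W_ext E) (Suc n) (Suc i)) (g, u) = (far (gface (rebase E) (Suc n) (Suc i)) g, face WA (Suc n) (Suc i) u)"
  "far (gface (W_ext E) (Suc n) 0) (g, u) =
     (gcomp (gG n) (snd (war u)) (far (gface (rebase E) (Suc n) 0) g), face WA (Suc n) 0 u)"
  "far (gdegen (W_ext E) n i) (g, u) = (far (gdegen (rebase E) n i) g, degen WA n i u)"
  by (auto simp: lev_W_ext S.lev_semidirect_simps pullback_rep_simps A.mem_W A.W_face_simps)
    (simp_all add: W_ext_def rebase_simps S.lev_semidirect_simps pullback_rep_simps A.W_face_simps)

text \<open>The first entry of \<open>u\<close> is an element of the kernel at the target of \<open>\<partial>\<^sub>0 g\<close>, so that it can be composed
  with \<open>\<partial>\<^sub>0 g\<close>.\<close>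

lemma twist:
  assumes "(g, u) \<in> Ar (TT (Suc n))"
  shows "g \<in> Ar (gG (Suc n))" "u \<in> simp WA (Suc n)" "wob u = trg (gG (Suc n)) g"
    "trg (gG (Suc n)) g \<in> Ob (gH (Suc n))"
    "snd (war u) \<in> rcar AA n (fob (gface (ebase E) (Suc n) 0) (trg (gG (Suc n)) g))"
    "snd (war u) \<in> Ar (gG n)" "src (gG n) (snd (war u)) = trg (gG n) (far (gface (rebase E) (Suc n) 0) g)"
    "trg (gG n) (snd (war u)) = trg (gG n) (far (gface (rebase E) (Suc n) 0) g)"
    "f n (snd (war u)) = gid (gH n) (trg (gG n) (far (gface (rebase E) (Suc n) 0) g))"
    "far (gface (rebase E) (Suc n) 0) g \<in> Ar (gG n)"
    "trg (gG n) (far (gface (rebase E) (Suc n) 0) g) = fob (gface (ebase E) (Suc n) 0) (trg (gG (Suc n)) g)"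
    "src (gG n) (far (gface (rebase E) (Suc n) 0) g) = fob (gface (ebase E) (Suc n) 0) (src (gG (Suc n)) g)"
proof -
  show 1: "g \<in> Ar (gG (Suc n))" "u \<in> simp WA (Suc n)" "wob u = trg (gG (Suc n)) g"
    using assms by (simp_all add: lev_W_ext_simps)
  show o: "trg (gG (Suc n)) g \<in> Ob (gH (Suc n))" using 1 G.typing Ob_rebase by auto
  show a: "snd (war u) \<in> rcar AA n (fob (gface (ebase E) (Suc n) 0) (trg (gG (Suc n)) g))"
    using A.snd_war_in[OF 1(2)] 1 by simp
  show "far (gface (rebase E) (Suc n) 0) g \<in> Ar (gG n)" using 1 by (simp add: G.typing)
  show t: "trg (gG n) (far (gface (rebase E) (Suc n) 0) g) = fob (gface (ebase E) (Suc n) 0) (trg (gG (Suc n)) g)"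
    "src (gG n) (far (gface (rebase E) (Suc n) 0) g) = fob (gface (ebase E) (Suc n) 0) (src (gG (Suc n)) g)"
    using G.dar_trg[of 0 n g] G.dar_src[of 0 n g] 1 by (simp_all add: rebase_simps(8))
  have "fob (gface (ebase E) (Suc n) 0) (trg (gG (Suc n)) g) \<in> Ob (gH n)" using o H.dob_Ob by simp
  from A_typing[OF this a]
  show "snd (war u) \<in> Ar (gG n)" "src (gG n) (snd (war u)) = trg (gG n) (far (gface (rebase E) (Suc n) 0) g)"
    "trg (gG n) (snd (war u)) = trg (gG n) (far (gface (rebase E) (Suc n) 0) g)"
    "f n (snd (war u)) = gid (gH n) (trg (gG n) (far (gface (rebase E) (Suc n) 0) g))"
    using t by simp_all
qed

lemma f_twist:
  assumes "(g, u) \<in> Ar (TT (Suc n))"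
  shows "f n (gcomp (gG n) (snd (war u)) (far (gface (rebase E) (Suc n) 0) g)) = far (gface (ebase E) (Suc n) 0) (f (Suc n) g)"
proof -
  note t = twist[OF assms]
  show ?thesis using t f_comp[OF t(6,10,7)] f_trg[OF t(10)] f_Ar[OF t(10)] f_face[OF t(1), of 0] H.lv.id_comp[of "f n (far (gface (rebase E) (Suc n) 0) g)" n]
    by simp
qed

lemma S_functor: "gfunctor (TT (Suc n)) (TT n) (gface (semidirect (rebase E) (pullback_rep E)) (Suc n) i)" if "i \<le> Suc n"
  using S.gfunctor_semidirect_face[OF that] by (simp add: lev_W_ext)

lemma ract_W_in: "g \<in> Ar (gG n) \<Longrightarrow> u \<in> simp WA n \<Longrightarrow> wob u = src (gG n) g \<Longrightarrow>
    ract VV n (f n g) u \<in> simp WA n \<and> wob (ract VV n (f n g) u) = trg (gG n) g"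
  using A.ract_W(1,2)[of "f n g" n u] f_Ar f_src f_trg by simp

text \<open>Let \<open>k\<close> and \<open>g\<close> be composable, and let \<open>u\<close> belong to \<open>g\<close>. In the twisted face of the composite, the
  first entry of \<open>k \<cdot> u\<close> is the conjugate of that of \<open>u\<close> by \<open>\<partial>\<^sub>0 k\<close>, which is exactly what is needed to
  move \<open>\<partial>\<^sub>0 k\<close> past the first entry of \<open>u\<close>.\<close>

lemma gfunctor_twisted_face: "gfunctor (TT (Suc n)) (TT n) (gface (W_ext E) (Suc n) 0)"
  unfolding gfunctor_def
proof (intro conjI ballI impI)
  let ?d = "far (gface (rebase E) (Suc n) 0)" and ?D = "far (gface (W_ext E) (Suc n) 0)"
  fix y assume y: "y \<in> Ob (TT (Suc n))"
  then have y': "y \<in> Ob (gH (Suc n))" "y \<in> Ob (gG (Suc n))" "fob (gface (ebase E) (Suc n) 0) y \<in> Ob (gH n)"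
    using H.dob_Ob by (simp_all add: lev_W_ext_simps Ob_rebase)
  then show "fob (gface (W_ext E) (Suc n) 0) y \<in> Ob (TT n)" by (simp add: lev_W_ext_simps)
  have d: "?d (gid (gG (Suc n)) y) = gid (gG n) (fob (gface (ebase E) (Suc n) 0) y)"
    using G.dar_id[of 0 n y] y' by (simp add: rebase_simps)
  show "?D (gid (TT (Suc n)) y) = gid (TT n) (fob (gface (W_ext E) (Suc n) 0) y)"
    using y' d A.rzero_W(3,4)[OF y'(1)] G.lv.id_comp[of "gid (gG n) (fob (gface (ebase E) (Suc n) 0) y)" n]
    by (simp add: lev_W_ext_simps A_simps G.typing Ob_rebase)
next
  let ?d = "far (gface (rebase E) (Suc n) 0)" and ?D = "far (gface (W_ext E) (Suc n) 0)"
  fix z assume "z \<in> Ar (TT (Suc n))"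
  then obtain g u where z: "z = (g, u)" "(g, u) \<in> Ar (TT (Suc n))" by (cases z) auto
  note t = twist[OF z(2)]
  have w: "wob (face WA (Suc n) 0 u) = trg (gG n) (?d g)" using A.W_wob_face_0[OF t(2)] t by simp
  show "?D z \<in> Ar (TT n)" "src (TT n) (?D z) = fob (gface (W_ext E) (Suc n) 0) (src (TT (Suc n)) z)"
    "trg (TT n) (?D z) = fob (gface (W_ext E) (Suc n) 0) (trg (TT (Suc n)) z)"
    using z t w by (simp_all add: lev_W_ext_simps G.typing A.W_chart)
next
  let ?d = "far (gface (rebase E) (Suc n) 0)" and ?D = "far (gface (W_ext E) (Suc n) 0)"
  let ?c = "gcomp (gG n)" and ?i = "ginv (gG n)"
  fix z z' assume "z \<in> Ar (TT (Suc n))" "z' \<in> Ar (TT (Suc n))" and st: "src (TT (Suc n)) z = trg (TT (Suc n)) z'"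
  then obtain k v g u where z: "z = (k, v)" "(k, v) \<in> Ar (TT (Suc n))" "z' = (g, u)" "(g, u) \<in> Ar (TT (Suc n))"
    by (cases z; cases z') auto
  note t = twist[OF z(2)] and t' = twist[OF z(4)]
  have kg: "src (gG (Suc n)) k = trg (gG (Suc n)) g" using st z by (simp add: lev_W_ext_simps)
  have dk: "src (gG n) (?d k) = trg (gG n) (?d g)" using t t' kg by simp
  have r: "ract VV (Suc n) (f (Suc n) k) u \<in> simp WA (Suc n)" "wob (ract VV (Suc n) (f (Suc n) k) u) = trg (gG (Suc n)) k"
    using ract_W_in[OF t(1) t'(2)] t' kg by simp_all
  have fk: "far (gface (ebase E) (Suc n) 0) (f (Suc n) k) = f n (?d k)" using f_face[OF t(1), of 0] by simp
  have wu: "wob u = src (gH (Suc n)) (f (Suc n) k)" using t'(3) kg f_src[OF t(1)] by simp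
  have a: "snd (war (ract VV (Suc n) (f (Suc n) k) u)) = ?c (?c (?d k) (snd (war u))) (?i (?d k))"
    using A.ract_W(3)[OF f_Ar[OF t(1)] t'(2) wu] fk act_eq[OF t(10), of "snd (war u)"] t'(5,11) dk by simp
  have s: "snd (war (radd VV (Suc n) (trg (gG (Suc n)) k) v (ract VV (Suc n) (f (Suc n) k) u))) =
      ?c (snd (war v)) (?c (?c (?d k) (snd (war u))) (?i (?d k)))"
    using A.radd_W(3)[OF t(2) r(1) t(3) r(2)] a by (simp add: A_simps)
  have c: "?c (?c (snd (war v)) (?c (?c (?d k) (snd (war u))) (?i (?d k)))) (?d (gcomp (gG (Suc n)) k g)) =
      ?c (?c (snd (war v)) (?d k)) (?c (snd (war u)) (?d g))"
    using t t' dk kg G.dar_comp[of 0 n k g] G.lv.inv_comp_cancel'[of "?d k" n "?d g"]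
    by (simp add: G.lv.comp_assoc G.typing)
  have fr: "f n (?c (snd (war v)) (?d k)) = f n (?d k)" using f_twist[OF z(2)] fk by simp
  have tr: "trg (gG n) (?c (snd (war v)) (?d k)) = fob (gface (ebase E) (Suc n) 0) (trg (gG (Suc n)) k)"
    using t by (simp add: G.typing)
  show "?D (gcomp (TT (Suc n)) z z') = gcomp (TT n) (?D z) (?D z')"
    unfolding z lev_W_ext_simps fr s c tr
    using A.radd_W(4)[OF t(2) r(1) t(3) r(2)] A.ract_W(4)[OF f_Ar[OF t(1)] t'(2) wu] fk by simp
qed

lemma W_ext_arr: "simp (Defs.arr_sset (W_ext E)) n = Ar (TT n)"
  "face (Defs.arr_sset (W_ext E)) n i = far (gface (W_ext E) n i)"
  "degen (Defs.arr_sset (W_ext E)) n i = far (gdegen (W_ext E) n i)"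
  by (simp_all add: Defs.arr_sset_def)

text \<open>Only the identities that involve the zeroth face differ from those of the semidirect product. They
  are the identities of a twisting function for the first entry \<open>\<tau>\<close>: \<open>\<tau>(\<partial>\<^sub>1 u) = \<tau>(\<partial>\<^sub>0 u) + \<partial>\<^sub>0 \<tau>(u)\<close>,
  \<open>\<tau>(\<sigma>\<^sub>0 u) = 0\<close>, and \<open>\<tau>\<close> commutes with all higher operations, with a shift of the index.\<close>

lemma sset_W_ext_arr: "sset (Defs.arr_sset (W_ext E))"
proof -
  let ?S = "semidirect (rebase E) (pullback_rep E)"
  note SS = S.sset_semidirect_arr
  have e: "simp (Defs.arr_sset ?S) n = Ar (TT n)" "face (Defs.arr_sset ?S) n i = far (gface ?S n i)"
    "degen (Defs.arr_sset ?S) n i = far (gdegen (W_ext E) n i)" for n i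
    by (simp_all add: Defs.arr_sset_def lev_W_ext)
  have eS: "face (Defs.arr_sset ?S) n (Suc i) = far (gface (W_ext E) n (Suc i))" for n i
    by (simp add: Defs.arr_sset_def lev_W_ext)
  note in_face = sset_face[OF SS, unfolded e] and in_degen = sset_degen[OF SS, unfolded e]
  have in_face': "far (gface (W_ext E) (Suc n) i) z \<in> Ar (TT n)" if "z \<in> Ar (TT (Suc n))" "i \<le> Suc n" for n i z
    using in_face[OF that] gfunctorD(3)[OF gfunctor_twisted_face that(1)] by (cases i) (simp_all add: lev_W_ext)
  show ?thesis
  proof (rule ssetI, unfold W_ext_arr)
    fix n z and i j :: nat
    let ?d = "far (gface (W_ext E) n i)" and ?D = "\<lambda>n i. far (gface (W_ext E) n i)" and ?s = "\<lambda>n i. far (gdegen (W_ext E) n i)"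
    show "?D (Suc n) i z \<in> Ar (TT n)" if "z \<in> Ar (TT (Suc n))" "i \<le> Suc n" using in_face' that .
    show "?s n i z \<in> Ar (TT (Suc n))" if "z \<in> Ar (TT n)" "i \<le> n" using in_degen that .
    show "?D (Suc n) i (?D (Suc (Suc n)) (Suc j) z) = ?D (Suc n) j (?D (Suc (Suc n)) i z)"
      if z: "z \<in> Ar (TT (Suc (Suc n)))" and ij: "i \<le> j" "j \<le> Suc n"
    proof (cases i)
      case (Suc k)
      then obtain l where "j = Suc l" using ij by (cases j) auto
      then show ?thesis using sset_face_face[OF SS, of z n i j] z ij Suc by (simp add: e(1,3) eS)
    next
      case 0
      obtain g u where g: "z = (g, u)" by (cases z) auto
      have z': "(g, u) \<in> Ar (TT (Suc (Suc n)))" using z g by simp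
      note t = twist[OF z']
      have "far (gface (W_ext E) (Suc (Suc n)) 0) (g, u) \<in> Ar (TT (Suc n))" using in_face'[OF z', of 0] by simp
      then have t1: "(gcomp (gG (Suc n)) (snd (war u)) (far (gface (rebase E) (Suc (Suc n)) 0) g), face WA (Suc (Suc n)) 0 u) \<in> Ar (TT (Suc n))"
        by (simp add: lev_W_ext_simps)
      note t1 = twist[OF t1]
      let ?d = "\<lambda>n i. far (gface (rebase E) n i)"
      have wd: "wob u \<in> Ob (gH (Suc (Suc n)))" using t by simp
      show ?thesis
      proof (cases j)
        case j: 0
        have "gcomp (gG n) (snd (war (face WA (Suc (Suc n)) (Suc 0) u))) (?d (Suc n) 0 (?d (Suc (Suc n)) (Suc 0) g)) =
            gcomp (gG n) (gcomp (gG n) (snd (war (face WA (Suc (Suc n)) 0 u))) (?d (Suc n) 0 (snd (war u)))) (?d (Suc n) 0 (?d (Suc (Suc n)) 0 g))"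
          using A.snd_war_face_1[OF t(2)] G.dar_dar[OF t(1), of 0 0] by (simp add: A_simps)
        also have "\<dots> = gcomp (gG n) (snd (war (face WA (Suc (Suc n)) 0 u)))
            (?d (Suc n) 0 (gcomp (gG (Suc n)) (snd (war u)) (?d (Suc (Suc n)) 0 g)))"
          using t t1 G.dar_comp[of 0 n "snd (war u)" "?d (Suc (Suc n)) 0 g"] by (simp add: G.lv.comp_assoc G.typing)
        finally show ?thesis using 0 j g A.R.face_0_face[OF t(2), of 0] by (simp add: lev_W_ext_simps)
      next
        case j: (Suc l)
        then have l: "l \<le> n" using ij by simp
        have "gcomp (gG n) (snd (war (face WA (Suc (Suc n)) (Suc (Suc l)) u))) (?d (Suc n) 0 (?d (Suc (Suc n)) (Suc (Suc l)) g)) =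
            gcomp (gG n) (?d (Suc n) (Suc l) (snd (war u))) (?d (Suc n) (Suc l) (?d (Suc (Suc n)) 0 g))"
          using A.snd_war_face_Suc_Suc[OF t(2) l] G.dar_dar[OF t(1), of 0 "Suc l"] l by (simp add: A_simps)
        also have "\<dots> = ?d (Suc n) (Suc l) (gcomp (gG (Suc n)) (snd (war u)) (?d (Suc (Suc n)) 0 g))"
          using t l G.dar_comp[of "Suc l" n "snd (war u)" "?d (Suc (Suc n)) 0 g"] by (simp add: G.typing)
        finally show ?thesis using 0 j g A.R.face_0_face[OF t(2), of j] ij by (simp add: lev_W_ext_simps)
      qed
    qed
    show "?s (Suc n) i (?s n j z) = ?s (Suc n) (Suc j) (?s n i z)" if "z \<in> Ar (TT n)" "i \<le> j" "j \<le> n"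
      using sset_degen_degen[OF SS, of z n i j] that by (simp add: e)
    show "?D (Suc n) i (?s n i z) = z" if z: "z \<in> Ar (TT n)" and i: "i \<le> n"
    proof (cases i)
      case 0
      obtain g u where g: "z = (g, u)" by (cases z) auto
      have t: "g \<in> Ar (gG n)" "u \<in> simp WA n" "wob u = trg (gG n) g" using z g by (simp_all add: lev_W_ext_simps)
      show ?thesis using 0 g t A.snd_war_degen_0[OF t(2)] A.R.face_0_degen_0[OF t(2)] G.dar_sar_same[OF t(1), of 0] G.lv.id_comp[OF t(1)]
        by (simp add: lev_W_ext_simps A_simps)
    next
      case (Suc k)
      then show ?thesis using sset_face_degen_same[OF SS, of z n i] z i by (simp add: e(1,3) eS)
    qed
    show "?D (Suc n) (Suc i) (?s n i z) = z" if "z \<in> Ar (TT n)" "i \<le> n"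
      using sset_face_degen_Suc[OF SS, of z n i] that by (simp add: e(1,3) eS)
    show "?D (Suc (Suc n)) i (?s (Suc n) (Suc j) z) = ?s n j (?D (Suc n) i z)"
      if z: "z \<in> Ar (TT (Suc n))" and ij: "i \<le> j" "j \<le> n"
    proof (cases i)
      case (Suc k)
      then show ?thesis using sset_face_degen_low[OF SS, of z n i j] z ij by (simp add: e(1,3) eS)
    next
      case 0
      obtain g u where g: "z = (g, u)" by (cases z) auto
      have z': "(g, u) \<in> Ar (TT (Suc n))" using z g by simp
      note t = twist[OF z']
      show ?thesis using 0 g t A.snd_war_degen_Suc[OF t(2) ij(2)] A.R.face_0_degen_Suc[OF t(2) ij(2)] G.dar_sar_low[OF t(1), of 0 j] ij
          G.sar_comp[OF ij(2) t(6,10,7)]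
        by (simp add: lev_W_ext_simps A_simps)
    qed
    show "?D (Suc (Suc n)) (Suc i) (?s (Suc n) j z) = ?s n j (?D (Suc n) i z)"
      if "z \<in> Ar (TT (Suc n))" "j < i" "i \<le> Suc n"
      using sset_face_degen_high[OF SS, of z n j i] that by (cases i) (simp_all add: e(1,3) eS)
  qed
qed

lemma simplicial_groupoid_W_ext: "simplicial_groupoid (W_ext E)"
  unfolding simplicial_groupoid_def
proof (intro conjI allI impI)
  let ?S = "semidirect (rebase E) (pullback_rep E)"
  show "groupoid (TT n)" for n using S.groupoid_semidirect by (simp add: lev_W_ext)
  show "gfunctor (TT (Suc n)) (TT n) (gface (W_ext E) (Suc n) i)" if "i \<le> Suc n" for n i
    using gfunctor_twisted_face S_functor[OF that] by (cases i) (simp_all add: lev_W_ext)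
  show "gfunctor (TT n) (TT (Suc n)) (gdegen (W_ext E) n i)" if "i \<le> n" for n i
    using S.gfunctor_semidirect_degen[OF that] by (simp add: lev_W_ext)
  have "Defs.obj_sset (W_ext E) = Defs.obj_sset (ebase E)"
    by (simp add: Defs.obj_sset_def lev_W_ext_simps)
  then show "sset (Defs.obj_sset (W_ext E))" using H.obj_sset by simp
qed (rule sset_W_ext_arr)

end

section \<open>Lifting of arrows in extensions\<close>

context extension
begin

text \<open>An arbitrary lift of \<open>h\<close> has the wrong faces, but the quotients of the given faces by these wrong ones
  form a horn in the kernel, and a filler of it is the required correction.\<close>

lemma horn_G:
  assumes fib: "fibrant_kernel E" and k: "k \<le> Suc n" and h: "h \<in> Ar (gH (Suc n))"
    and g: "\<And>i. i \<le> Suc n \<Longrightarrow> i \<noteq> k \<Longrightarrow> g i \<in> Ar (gG n)"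
      "\<And>i. i \<le> Suc n \<Longrightarrow> i \<noteq> k \<Longrightarrow> f n (g i) = far (gface (ebase E) (Suc n) i) h"
    and gg: "\<And>m i j. n = Suc m \<Longrightarrow> i \<le> j \<Longrightarrow> j \<le> n \<Longrightarrow> i \<noteq> k \<Longrightarrow> Suc j \<noteq> k \<Longrightarrow>
      far (gface (rebase E) n i) (g (Suc j)) = far (gface (rebase E) n j) (g i)"
  obtains x where "x \<in> Ar (gG (Suc n))" "f (Suc n) x = h" "\<And>i. i \<le> Suc n \<Longrightarrow> i \<noteq> k \<Longrightarrow> far (gface (rebase E) (Suc n) i) x = g i"
proof -
  let ?d = "\<lambda>n i. far (gface (rebase E) n i)" and ?t = "trg (gH (Suc n)) h"
  obtain g0 where g0: "g0 \<in> Ar (gG (Suc n))" "f (Suc n) g0 = h" using f_surj[OF h] by blast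
  define c where "c i = gcomp (gG n) (g i) (ginv (gG n) (?d (Suc n) i g0))" for i
  have t: "?t \<in> Ob (gH (Suc n))" using h by (simp add: H.typing)
  have dg0: "?d (Suc n) i g0 \<in> Ar (gG n)" "f n (?d (Suc n) i g0) = far (gface (ebase E) (Suc n) i) h" if "i \<le> Suc n" for i
    using g0 that f_face[OF g0(1) that] by (simp_all add: G.typing)
  have same: "src (gG n) (g i) = src (gG n) (?d (Suc n) i g0)" "trg (gG n) (g i) = trg (gG n) (?d (Suc n) i g0)"
    if "i \<le> Suc n" "i \<noteq> k" for i
    using g(2)[OF that] dg0(2)[OF that(1)] by (simp_all add: rebase_simps)
  have c: "c i \<in> rcar AA n (fob (gface (ebase E) (Suc n) i) ?t)" if "i \<le> Suc n" "i \<noteq> k" for i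
    using quotient_in_A[OF g(1)[OF that] dg0(1)[OF that(1)]] g(2)[OF that] dg0(2)[OF that(1)] that h
    by (simp add: c_def H.typing)
  have cc: "?d n i (c j) = ?d n (j - 1) (c i)" if ij: "i < j" "j \<le> Suc n" "i \<noteq> k" "j \<noteq> k" for i j
  proof -
    have "n \<noteq> 0" using ij k by auto
    then obtain m l where m: "n = Suc m" "j = Suc l" "i \<le> l" "l \<le> n" using ij by (cases n; cases j) auto
    have "?d n i (c j) = gcomp (gG m) (?d n i (g j)) (ginv (gG m) (?d n i (?d (Suc n) j g0)))"
      using g(1)[of j] dg0(1)[of j] same[of j] ij m G.dar_comp[of i m "g j" "ginv (gG n) (?d (Suc n) j g0)"]
        G.dar_inv[of i m "?d (Suc n) j g0"] by (simp add: c_def G.typing)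
    also have "\<dots> = gcomp (gG m) (?d n l (g i)) (ginv (gG m) (?d n l (?d (Suc n) i g0)))"
      using gg[OF m(1), of i l] G.dar_dar[of g0 m i l] g0 ij m by simp
    also have "\<dots> = ?d n l (c i)"
      using g(1)[of i] dg0(1)[of i] same[of i] ij m G.dar_comp[of l m "g i" "ginv (gG n) (?d (Suc n) i g0)"]
        G.dar_inv[of l m "?d (Suc n) i g0"] by (simp add: c_def G.typing)
    finally show ?thesis using m by simp
  qed
  have "\<exists>x \<in> simp (kernel_sset E) (Suc n). fst x = ?t \<and>
      (\<forall>i \<le> Suc n. i \<noteq> k \<longrightarrow> face (kernel_sset E) (Suc n) i x = (fob (gface (ebase E) (Suc n) i) ?t, c i))"
  proof (rule fib[unfolded fibrant_kernel_def kan_fibration_def, THEN conjunct2, THEN conjunct2, THEN conjunct2, rule_format], intro conjI allI impI)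
    show "?t \<in> simp (Defs.obj_sset (ebase E)) (Suc n)" using t by (simp add: Defs.obj_sset_def)
    fix i
    show "(fob (gface (ebase E) (Suc n) i) ?t, c i) \<in> simp (kernel_sset E) n"
      "fst (fob (gface (ebase E) (Suc n) i) ?t, c i) = face (Defs.obj_sset (ebase E)) (Suc n) i ?t"
      if "i \<le> Suc n" "i \<noteq> k" using c[OF that] t that by (simp_all add: kernel_sset_simps Defs.obj_sset_def H.typing)
    fix j assume ij: "i < j \<and> j \<le> Suc n \<and> i \<noteq> k \<and> j \<noteq> k"
    then have "n \<noteq> 0" using k by auto
    then obtain m l where m: "n = Suc m" "j = Suc l" "i \<le> l" "l \<le> Suc m" using ij by (cases n; cases j) auto
    show "face (kernel_sset E) n i (fob (gface (ebase E) (Suc n) j) ?t, c j) =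
        face (kernel_sset E) n (j - 1) (fob (gface (ebase E) (Suc n) i) ?t, c i)"
      using cc[of i j] ij H.dob_dob[of ?t m i l] t m by (simp add: kernel_sset_simps rebase_simps)
  qed (use k in auto)
  then obtain x where x: "x \<in> simp (kernel_sset E) (Suc n)" "fst x = ?t"
    "\<And>i. i \<le> Suc n \<Longrightarrow> i \<noteq> k \<Longrightarrow> face (kernel_sset E) (Suc n) i x = (fob (gface (ebase E) (Suc n) i) ?t, c i)" by blast
  obtain a where a: "x = (?t, a)" "a \<in> rcar AA (Suc n) ?t" "\<And>i. i \<le> Suc n \<Longrightarrow> i \<noteq> k \<Longrightarrow> ?d (Suc n) i a = c i"
    using x by (cases x) (auto simp: kernel_sset_simps rebase_simps)
  note at = A_typing[OF t a(2)]
  have ag: "src (gG (Suc n)) a = trg (gG (Suc n)) g0" using at g0 by (simp add: rebase_simps)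
  show ?thesis
  proof (rule that[of "gcomp (gG (Suc n)) a g0"])
    show "gcomp (gG (Suc n)) a g0 \<in> Ar (gG (Suc n))" using at g0 ag by (simp add: G.typing)
    show "f (Suc n) (gcomp (gG (Suc n)) a g0) = h"
      using f_comp[OF at(1) g0(1) ag] at g0 h H.lv.id_comp by simp
    show "?d (Suc n) i (gcomp (gG (Suc n)) a g0) = g i" if "i \<le> Suc n" "i \<noteq> k" for i
      using G.dar_comp[OF that(1) at(1) g0(1) ag] a(3)[OF that] G.lv.comp_inv_cancel'[OF g(1)[OF that] dg0(1)[OF that(1)] same(1)[OF that]]
      by (simp add: c_def)
  qed
qed

end

definition W_ext_prj :: "('o, 'm, 'p, 'q) gext \<Rightarrow> nat \<Rightarrow>
    ('p, 'm \<times> ('p \<times> ('p \<times> 'm) list) list, 'p, 'q \<times> ('p \<times> ('p \<times> 'm) list) list) gfun" where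
  "W_ext_prj E n = \<lparr> fob = (\<lambda>y. y), far = (\<lambda>(g, u). (far (eprj E n) g, u)) \<rparr>"

sublocale extension \<subseteq> T': sgroupoid "W_ext E"
  by unfold_locales (rule simplicial_groupoid_W_ext)

lemma sgpd_map_comp:
  assumes "sgpd_map G H F" "sgpd_map H K F'"
  shows "sgpd_map G K (\<lambda>n. gfun_comp (F' n) (F n))"
  using assms unfolding sgpd_map_def
  by (auto simp: gfun_comp_def smap_def gfunctor_def)

lemma (in srep) sgpd_map_semidirect_proj: "sgpd_map (semidirect H A) H semidirect_proj"
  unfolding sgpd_map_def
proof (intro conjI allI)
  show "gfunctor (lev (semidirect H A) n) (lev H n) (semidirect_proj n)" for n
    unfolding gfunctor_def semidirect_proj_def by (auto simp: lev_semidirect_simps)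
  show "smap (Defs.obj_sset (semidirect H A)) (Defs.obj_sset H) (\<lambda>n. fob (semidirect_proj n))"
    unfolding smap_def Defs.obj_sset_def semidirect_proj_def by (simp add: lev_semidirect_simps)
  show "smap (Defs.arr_sset (semidirect H A)) (Defs.arr_sset H) (\<lambda>n. far (semidirect_proj n))"
    unfolding smap_def Defs.arr_sset_def semidirect_proj_def by (auto simp: lev_semidirect_simps)
qed

context extension
begin

abbreviation "HV \<equiv> semidirect (ebase E) VV"

lemma sgpd_map_W_ext_prj: "sgpd_map (W_ext E) HV (W_ext_prj E)"
  unfolding sgpd_map_def
proof (intro conjI allI)
  show "gfunctor (TT n) (lev HV n) (W_ext_prj E n)" for n
    unfolding gfunctor_def W_ext_prj_def
    by (auto simp: lev_W_ext_simps V.lev_semidirect_simps f_id f_Ar f_src f_trg f_comp Ob_rebase A.mem_W)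
  show "smap (Defs.obj_sset (W_ext E)) (Defs.obj_sset HV) (\<lambda>n. fob (W_ext_prj E n))"
    unfolding smap_def Defs.obj_sset_def W_ext_prj_def by (simp add: lev_W_ext_simps V.lev_semidirect_simps)
  have "far (W_ext_prj E n) (far (gface (W_ext E) (Suc n) i) z) = far (gface HV (Suc n) i) (far (W_ext_prj E (Suc n)) z)"
    if z: "z \<in> Ar (TT (Suc n))" and i: "i \<le> Suc n" for n i z
  proof -
    obtain g u where g: "z = (g, u)" by (cases z) auto
    have z': "(g, u) \<in> Ar (TT (Suc n))" using z g by simp
    show ?thesis using g f_twist[OF z'] f_face[OF twist(1)[OF z'] i]
      by (cases i) (simp_all add: W_ext_prj_def lev_W_ext_simps V.lev_semidirect_simps A.W_face_simps)
  qed
  moreover have "far (W_ext_prj E (Suc n)) (far (gdegen (W_ext E) n i) z) = far (gdegen HV n i) (far (W_ext_prj E n) z)"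
    if z: "z \<in> Ar (TT n)" and i: "i \<le> n" for n i z
    using z i by (cases z) (simp add: W_ext_prj_def lev_W_ext_simps V.lev_semidirect_simps A.W_face_simps f_degen)
  ultimately show "smap (Defs.arr_sset (W_ext E)) (Defs.arr_sset HV) (\<lambda>n. far (W_ext_prj E n))"
    unfolding smap_def Defs.arr_sset_def W_ext_prj_def
    by (auto simp: lev_W_ext_simps V.lev_semidirect_simps f_Ar f_trg A.mem_W)
qed

end

sublocale extension \<subseteq> HV: sgroupoid "semidirect (ebase E) (Wbar_rep (ebase E) (kernel_rep E))"
  by unfold_locales (rule V.simplicial_groupoid_semidirect)

sublocale extension \<subseteq> p: sgroupoid_map_id "W_ext E" "semidirect (ebase E) (Wbar_rep (ebase E) (kernel_rep E))" "W_ext_prj E"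
  by unfold_locales (rule sgpd_map_W_ext_prj, simp_all add: lev_W_ext_simps V.lev_semidirect_simps W_ext_prj_def)

sublocale extension \<subseteq> w: sgroupoid_map_id "W_ext E" "ebase E" "\<lambda>n. gfun_comp (semidirect_proj n) (W_ext_prj E n)"
  by unfold_locales (rule sgpd_map_comp[OF sgpd_map_W_ext_prj V.sgpd_map_semidirect_proj],
    simp_all add: lev_W_ext_simps W_ext_prj_def gfun_comp_def semidirect_proj_def)

context extension
begin

text \<open>The component in \<open>Wbar A\<close> of a lift is given, so that the twist in the zeroth face is known. Removing it
  from the prescribed zeroth face leaves a horn of arrows of \<open>G\<close>.\<close>

lemma kan_fibration_W_ext_arr:
  assumes fib: "fibrant_kernel E"
  shows "kan_fibration (Defs.arr_sset (W_ext E)) (Defs.arr_sset HV) (\<lambda>n. far (W_ext_prj E n))"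
  unfolding kan_fibration_def
proof (intro conjI allI impI)
  show "sset (Defs.arr_sset (W_ext E))" "sset (Defs.arr_sset HV)"
    "smap (Defs.arr_sset (W_ext E)) (Defs.arr_sset HV) (\<lambda>n. far (W_ext_prj E n))"
    using T'.arr_sset HV.arr_sset p.F_arr by blast+
  let ?d = "\<lambda>n i. far (gface (rebase E) n i)" and ?D = "\<lambda>n i. far (gface (W_ext E) n i)"
  fix n k z b
  assume hyp: "k \<le> Suc n \<and> b \<in> simp (Defs.arr_sset HV) (Suc n) \<and>
       (\<forall>i \<le> Suc n. i \<noteq> k \<longrightarrow> z i \<in> simp (Defs.arr_sset (W_ext E)) n \<and>
          far (W_ext_prj E n) (z i) = face (Defs.arr_sset HV) (Suc n) i b) \<and>
       (\<forall>i j. i < j \<and> j \<le> Suc n \<and> i \<noteq> k \<and> j \<noteq> k \<longrightarrow>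
          face (Defs.arr_sset (W_ext E)) n i (z j) = face (Defs.arr_sset (W_ext E)) n (j - 1) (z i))"
  obtain h u where b: "b = (h, u)" by (cases b) auto
  have k: "k \<le> Suc n" and h: "h \<in> Ar (gH (Suc n))" and u: "u \<in> simp WA (Suc n)" "wob u = trg (gH (Suc n)) h"
    using hyp b by (auto simp: Defs.arr_sset_def V.lev_semidirect_simps A.mem_W)
  define g where "g i = fst (z i)" for i
  have zi: "z i = (g i, face WA (Suc n) i u)" "(g i, face WA (Suc n) i u) \<in> Ar (TT n)"
    "g i \<in> Ar (gG n)" "f n (g i) = far (gface (ebase E) (Suc n) i) h" if "i \<le> Suc n" "i \<noteq> k" for i
  proof -
    have "z i \<in> Ar (TT n)" "far (W_ext_prj E n) (z i) = far (gface HV (Suc n) i) (h, u)"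
      using hyp that b by (auto simp: Defs.arr_sset_def)
    then show "z i = (g i, face WA (Suc n) i u)" "(g i, face WA (Suc n) i u) \<in> Ar (TT n)"
      "g i \<in> Ar (gG n)" "f n (g i) = far (gface (ebase E) (Suc n) i) h"
      by (cases "z i"; simp add: g_def W_ext_prj_def V.lev_semidirect_simps A.W_face_simps lev_W_ext_simps)+
  qed
  have zz: "?D n i (z (Suc j)) = ?D n j (z i)" if "i \<le> j" "j \<le> n" "i \<noteq> k" "Suc j \<noteq> k" for i j
  proof -
    have "i < Suc j \<and> Suc j \<le> Suc n \<and> i \<noteq> k \<and> Suc j \<noteq> k" using that by simp
    then have "face (Defs.arr_sset (W_ext E)) n i (z (Suc j)) = face (Defs.arr_sset (W_ext E)) n (Suc j - 1) (z i)"
      using hyp by blast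
    then show ?thesis by (simp add: Defs.arr_sset_def)
  qed
  let ?t = "snd (war u)"
  have th: "trg (gH (Suc n)) h \<in> Ob (gH (Suc n))" "fob (gface (ebase E) (Suc n) 0) (trg (gH (Suc n)) h) \<in> Ob (gH n)"
    using h by (simp_all add: H.typing)
  have tA: "?t \<in> rcar AA n (fob (gface (ebase E) (Suc n) 0) (trg (gH (Suc n)) h))" using A.snd_war_in[OF u(1)] u by simp
  note tt = A_typing[OF th(2) tA]
  have t0: "trg (gG n) (g 0) = trg (gG n) ?t" if "0 \<noteq> k" using zi(4)[of 0] that tt h by (simp add: rebase_simps H.typing)
  \<comment> \<open>the prescribed faces without the twist by \<open>u\<close>\<close>
  define e where "e i = (if i = 0 then gcomp (gG n) (ginv (gG n) ?t) (g 0) else g i)" for i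
  have e: "e i \<in> Ar (gG n)" "f n (e i) = far (gface (ebase E) (Suc n) i) h" if i: "i \<le> Suc n" "i \<noteq> k" for i
  proof -
    have "e 0 \<in> Ar (gG n) \<and> f n (e 0) = far (gface (ebase E) (Suc n) 0) h" if "0 \<noteq> k"
    proof -
      have dh: "far (gface (ebase E) (Suc n) 0) h \<in> Ar (gH n)"
        "trg (gH n) (far (gface (ebase E) (Suc n) 0) h) = fob (gface (ebase E) (Suc n) 0) (trg (gH (Suc n)) h)"
        using h by (simp_all add: H.typing)
      have "ginv (gH n) (gid (gH n) (fob (gface (ebase E) (Suc n) 0) (trg (gH (Suc n)) h))) =
          gid (gH n) (fob (gface (ebase E) (Suc n) 0) (trg (gH (Suc n)) h))"
        using th(2) H.lv.comp_inv[of "gid (gH n) (fob (gface (ebase E) (Suc n) 0) (trg (gH (Suc n)) h))" n]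
          H.lv.id_comp[of "ginv (gH n) (gid (gH n) (fob (gface (ebase E) (Suc n) 0) (trg (gH (Suc n)) h)))" n]
        by (simp add: H.typing)
      then show ?thesis
        using zi(3,4)[of 0] that t0[OF that] tt f_comp[of "ginv (gG n) ?t" n "g 0"] f_inv[of ?t n] dh H.lv.id_comp[OF dh]
        by (simp add: e_def G.typing)
    qed
    then show "e i \<in> Ar (gG n)" "f n (e i) = far (gface (ebase E) (Suc n) i) h"
      using zi(3,4)[OF i] i by (cases i; simp add: e_def)+
  qed
  have ee: "?d n i (e (Suc j)) = ?d n j (e i)" if m: "n = Suc m" and ij: "i \<le> j" "j \<le> n" "i \<noteq> k" "Suc j \<noteq> k" for m i j
  proof (cases i)
    case (Suc l)
    then obtain l' where l': "j = Suc l'" using ij by (cases j) auto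
    have "?D n i (z (Suc j)) = ?D n j (z i)" using zz ij by simp
    then show ?thesis using zi(1)[of i] zi(1)[of "Suc j"] ij Suc l' m by (simp add: lev_W_ext_simps e_def)
  next
    case 0
    then have k0: "0 \<noteq> k" using ij by simp
    let ?c = "gcomp (gG m)"
    have "?D n 0 (z (Suc j)) = ?D n j (z 0)" using zz ij 0 by simp
    then have eq: "?D n 0 (g (Suc j), face WA (Suc n) (Suc j) u) = ?D n j (g 0, face WA (Suc n) 0 u)"
      using zi(1)[of "Suc j"] zi(1)[of 0] ij k0 by simp
    \<comment> \<open>The zeroth faces of the prescribed arrows are compared: both are twisted for \<open>j = 0\<close>, one for \<open>j > 0\<close>.\<close>
    note t = twist[OF zi(2)[of "Suc j", unfolded m]] and t' = twist[OF zi(2)[of 0, unfolded m]]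
    have mem: "Suc j \<le> Suc (Suc m)" "Suc j \<noteq> k" "0 \<le> Suc (Suc m)" "0 \<noteq> k" using ij m k0 by simp_all
    note t = t[OF mem(1,2)] and t' = t'[OF mem(3,4)]
    have u': "u \<in> simp WA (Suc (Suc m))" using u m by simp
    have tt': "?t \<in> Ar (gG (Suc m))" "trg (gG (Suc m)) (g 0) = trg (gG (Suc m)) ?t" "src (gG (Suc m)) ?t = trg (gG (Suc m)) ?t"
      "g 0 \<in> Ar (gG (Suc m))"
      using tt t0[OF k0] t' m by simp_all
    have r: "?d (Suc m) j (e 0) = ?c (ginv (gG m) (?d (Suc m) j ?t)) (?d (Suc m) j (g 0))"
      using tt' ij m G.dar_comp[of j m "ginv (gG (Suc m)) ?t" "g 0"] G.dar_inv[of j m ?t] by (simp add: e_def G.typing)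
    have dt: "?d (Suc m) j ?t \<in> Ar (gG m)" "?d (Suc m) j (g 0) \<in> Ar (gG m)"
      "trg (gG m) (?d (Suc m) j ?t) = trg (gG m) (?d (Suc m) j (g 0))"
      "src (gG m) (?d (Suc m) j ?t) = trg (gG m) (?d (Suc m) j (g 0))"
      using tt' ij m by (simp_all add: G.typing)
    have "?d (Suc m) 0 (g (Suc j)) = ?c (ginv (gG m) (?d (Suc m) j ?t)) (?d (Suc m) j (g 0))"
    proof (cases j)
      case (Suc l)
      then have l: "l \<le> m" using ij m by simp
      have "?c (snd (war (face WA (Suc (Suc m)) (Suc j) u))) (?d (Suc m) 0 (g (Suc j))) = ?d (Suc m) j (g 0)"
        using eq m Suc by (simp add: lev_W_ext_simps)
      moreover have "snd (war (face WA (Suc (Suc m)) (Suc j) u)) = ?d (Suc m) j ?t"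
        using A.snd_war_face_Suc_Suc[OF u' l] Suc by (simp add: A_simps)
      ultimately have e1: "?c (?d (Suc m) j ?t) (?d (Suc m) 0 (g (Suc j))) = ?d (Suc m) j (g 0)" by simp
      show ?thesis using G.lv.inv_comp_cancel'[of "?d (Suc m) j ?t" m "?d (Suc m) 0 (g (Suc j))"] e1 dt t m
          \<open>snd (war (face WA (Suc (Suc m)) (Suc j) u)) = ?d (Suc m) j ?t\<close> by simp
    next
      case j: 0
      let ?v = "snd (war (face WA (Suc (Suc m)) 0 u))"
      have "?c (snd (war (face WA (Suc (Suc m)) (Suc 0) u))) (?d (Suc m) 0 (g (Suc 0))) = ?c ?v (?d (Suc m) 0 (g 0))"
        using eq m j by (simp add: lev_W_ext_simps)
      moreover have w1: "snd (war (face WA (Suc (Suc m)) (Suc 0) u)) = ?c ?v (?d (Suc m) 0 ?t)"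
        using A.snd_war_face_1[OF u'] by (simp add: A_simps)
      ultimately have e1: "?c (?c ?v (?d (Suc m) 0 ?t)) (?d (Suc m) 0 (g (Suc 0))) = ?c ?v (?d (Suc m) 0 (g 0))" by simp
      have v: "?v \<in> Ar (gG m)" "src (gG m) ?v = trg (gG m) (?d (Suc m) 0 (g 0))" using t' m by simp_all
      have s: "src (gG m) (?c ?v (?d (Suc m) 0 ?t)) = trg (gG m) (?d (Suc m) 0 (g (Suc 0)))"
        "?d (Suc m) 0 (g (Suc 0)) \<in> Ar (gG m)" using t w1 m j by simp_all
      then have s': "src (gG m) (?d (Suc m) 0 ?t) = trg (gG m) (?d (Suc m) 0 (g (Suc 0)))"
        using v dt j by (simp add: G.typing)
      have "?c ?v (?c (?d (Suc m) 0 ?t) (?d (Suc m) 0 (g (Suc 0)))) = ?c ?v (?d (Suc m) 0 (g 0))"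
        using e1 v dt s s' j by (simp add: G.lv.comp_assoc)
      then have "?c (?d (Suc m) 0 ?t) (?d (Suc m) 0 (g (Suc 0))) = ?d (Suc m) 0 (g 0)"
        by (rule G.lv.left_cancel[rotated -1]) (use v dt s s' j in \<open>simp_all add: G.typing\<close>)
      then show ?thesis using G.lv.inv_comp_cancel'[of "?d (Suc m) 0 ?t" m "?d (Suc m) 0 (g (Suc 0))"] dt s s' j by simp
    qed
    then show ?thesis using 0 r m by (simp add: e_def)
  qed
  obtain x where x: "x \<in> Ar (gG (Suc n))" "f (Suc n) x = h" "\<And>i. i \<le> Suc n \<Longrightarrow> i \<noteq> k \<Longrightarrow> ?d (Suc n) i x = e i"
    by (rule horn_G[OF fib k h e ee]) auto
  have xu: "(x, u) \<in> Ar (TT (Suc n))" using x u by (simp add: lev_W_ext_simps rebase_simps)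
  show "\<exists>x \<in> simp (Defs.arr_sset (W_ext E)) (Suc n). far (W_ext_prj E (Suc n)) x = b \<and>
      (\<forall>i \<le> Suc n. i \<noteq> k \<longrightarrow> face (Defs.arr_sset (W_ext E)) (Suc n) i x = z i)"
  proof (rule bexI[of _ "(x, u)"], intro conjI allI impI)
    show "far (W_ext_prj E (Suc n)) (x, u) = b" using x b by (simp add: W_ext_prj_def)
    show "(x, u) \<in> simp (Defs.arr_sset (W_ext E)) (Suc n)" using xu by (simp add: Defs.arr_sset_def)
    show "face (Defs.arr_sset (W_ext E)) (Suc n) i (x, u) = z i" if i: "i \<le> Suc n" "i \<noteq> k" for i
    proof (cases i)
      case 0
      then have "?d (Suc n) 0 x = gcomp (gG n) (ginv (gG n) ?t) (g 0)" using x(3)[OF i] by (simp add: e_def)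
      then show ?thesis using 0 i zi(1,3)[OF i] tt t0 G.lv.inv_comp_cancel[of ?t n "g 0"]
        by (simp add: Defs.arr_sset_def lev_W_ext_simps)
    next
      case (Suc l)
      then show ?thesis using x(3)[OF i] zi(1)[OF i] by (simp add: Defs.arr_sset_def lev_W_ext_simps e_def)
    qed
  qed
qed

text \<open>Leaving out the zeroth face, the components in \<open>G\<close> of the given boundary form a horn with a filler
  \<open>x\<close>. The zeroth face of \<open>x\<close> misses the prescribed one by an element \<open>a\<close> of the kernel, and the lift is
  the pair of \<open>x\<close> and the element of \<open>Wbar A\<close> with first entry \<open>a\<close> and with the prescribed zeroth face.\<close>

lemma boundary_lifting_W_ext_arr:
  assumes fib: "fibrant_kernel E"
  shows "boundary_lifting (Defs.arr_sset (W_ext E)) (Defs.arr_sset (ebase E)) (\<lambda>n. far (gfun_comp (semidirect_proj n) (W_ext_prj E n)))"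
  unfolding boundary_lifting_def
proof (intro conjI allI impI ballI)
  have P: "far (gfun_comp (semidirect_proj n) (W_ext_prj E n)) (g, u) = f n g" for n g u
    by (simp add: gfun_comp_def semidirect_proj_def W_ext_prj_def)
  let ?d = "\<lambda>n i. far (gface (rebase E) n i)" and ?D = "\<lambda>n i. far (gface (W_ext E) n i)"
  show "\<exists>x \<in> simp (Defs.arr_sset (W_ext E)) 0. far (gfun_comp (semidirect_proj 0) (W_ext_prj E 0)) x = b"
    if "b \<in> simp (Defs.arr_sset (ebase E)) 0" for b
  proof -
    have b: "b \<in> Ar (gH 0)" using that by (simp add: Defs.arr_sset_def)
    then obtain g where g: "g \<in> Ar (gG 0)" "f 0 g = b" using f_surj by blast
    have "(g, rzero VV 0 (trg (gH 0) b)) \<in> Ar (TT 0)"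
      using g A.rzero_W(1,2)[of "trg (gH 0) b" 0] b by (simp add: lev_W_ext_simps H.typing rebase_simps)
    then show ?thesis using g by (intro bexI[of _ "(g, rzero VV 0 (trg (gH 0) b))"]) (auto simp: P Defs.arr_sset_def)
  qed
  fix n h and z
  assume hyp: "h \<in> simp (Defs.arr_sset (ebase E)) (Suc n) \<and>
       (\<forall>i \<le> Suc n. z i \<in> simp (Defs.arr_sset (W_ext E)) n \<and>
          far (gfun_comp (semidirect_proj n) (W_ext_prj E n)) (z i) = face (Defs.arr_sset (ebase E)) (Suc n) i h) \<and>
       (\<forall>m i j. n = Suc m \<and> i \<le> j \<and> j \<le> n \<longrightarrow>
          face (Defs.arr_sset (W_ext E)) n i (z (Suc j)) = face (Defs.arr_sset (W_ext E)) n j (z i))"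
  define g where "g i = fst (z i)" for i
  define v where "v i = snd (z i)" for i
  have z: "z i = (g i, v i)" for i by (simp add: g_def v_def)
  have h: "h \<in> Ar (gH (Suc n))" using hyp by (simp add: Defs.arr_sset_def)
  have zi: "(g i, v i) \<in> Ar (TT n)" "g i \<in> Ar (gG n)" "f n (g i) = far (gface (ebase E) (Suc n) i) h"
    "v i \<in> simp WA n" "wob (v i) = fob (gface (ebase E) (Suc n) i) (trg (gH (Suc n)) h)" if "i \<le> Suc n" for i
  proof -
    have "z i \<in> Ar (TT n)" "far (gfun_comp (semidirect_proj n) (W_ext_prj E n)) (z i) = far (gface (ebase E) (Suc n) i) h"
      using hyp that by (auto simp: Defs.arr_sset_def)
    then show "(g i, v i) \<in> Ar (TT n)" "g i \<in> Ar (gG n)" "f n (g i) = far (gface (ebase E) (Suc n) i) h"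
      "v i \<in> simp WA n" "wob (v i) = fob (gface (ebase E) (Suc n) i) (trg (gH (Suc n)) h)"
      using that h by (simp_all add: z P lev_W_ext_simps rebase_simps H.typing)
  qed
  have zz: "?D n i (g (Suc j), v (Suc j)) = ?D n j (g i, v i)" if "n = Suc m" "i \<le> j" "j \<le> n" for m i j
    using hyp that by (auto simp: Defs.arr_sset_def z)
  obtain x where x: "x \<in> Ar (gG (Suc n))" "f (Suc n) x = h" "\<And>i. i \<le> Suc n \<Longrightarrow> i \<noteq> 0 \<Longrightarrow> ?d (Suc n) i x = g i"
  proof (rule horn_G[OF fib, of 0 n h g])
    show "?d n i (g (Suc j)) = ?d n j (g i)" if m: "n = Suc m" and ij: "i \<le> j" "j \<le> n" "i \<noteq> 0" for m i j
    proof -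
      obtain l l' where "i = Suc l" "j = Suc l'" using ij by (cases i; cases j) auto
      then show ?thesis using zz[OF m ij(1,2)] m by (simp add: lev_W_ext_simps)
    qed
  qed (use h zi that in auto)
  let ?y = "trg (gH (Suc n)) h" and ?o = "fob (gface (ebase E) (Suc n) 0)"
  have y: "?y \<in> Ob (gH (Suc n))" "?o ?y \<in> Ob (gH n)" using h by (simp_all add: H.typing)
  have dx: "?d (Suc n) 0 x \<in> Ar (gG n)" "f n (?d (Suc n) 0 x) = far (gface (ebase E) (Suc n) 0) h"
    using x f_face[OF x(1), of 0] by (simp_all add: G.typing)
  \<comment> \<open>the defect of the zeroth face of \<open>x\<close>\<close>
  define a where "a = gcomp (gG n) (g 0) (ginv (gG n) (?d (Suc n) 0 x))"
  have a: "a \<in> rcar AA n (?o ?y)"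
    using quotient_in_A[OF zi(2)[of 0] dx(1)] zi(3)[of 0] dx h by (simp add: a_def H.typing)
  note at = A_typing[OF y(2) a]
  have ag: "gcomp (gG n) a (?d (Suc n) 0 x) = g 0"
    unfolding a_def by (rule G.lv.comp_inv_cancel') (use zi[of 0] dx in \<open>simp_all add: rebase_simps\<close>)
  have wc: "A.R.wcomp n ?y (?o ?y, a) (v 0)"
    using A.W_wcomp[OF y(1) a] zi[of 0] by simp
  define u where "u = wcons (rep_gpd (ebase E) AA) n ?y (?o ?y, a) (v 0)"
  have u: "u \<in> simp WA (Suc n)" "wob u = ?y" "snd (war u) = a" "face WA (Suc n) 0 u = v 0"
    using A.R.wcons_in[OF wc] A.R.face_0_wcons[OF wc] by (simp_all add: u_def wob_wcons war_wcons)
  have vi: "face WA (Suc n) i u = v i" if i: "i \<le> Suc n" for i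
  proof (cases i)
    case 0
    then show ?thesis using u by simp
  next
    case i': (Suc l)
    have fu: "face WA (Suc n) i u \<in> simp WA n" "wob (face WA (Suc n) i u) = wob (v i)"
      using A.W_wob_face[OF u(1) i] u zi(5)[OF i] A.R.face_Wbar_in[OF u(1) i] by simp_all
    show ?thesis
    proof (cases n)
      case 0
      then show ?thesis using A.W_eqI_0 fu zi(4)[OF i] by simp
    next
      case n: (Suc m)
      let ?c = "gcomp (gG m)"
      have u': "u \<in> simp WA (Suc (Suc m))" using u n by simp
      have eq: "?D (Suc m) 0 (g (Suc l), v (Suc l)) = ?D (Suc m) l (g 0, v 0)" using zz[OF n, of 0 l] i i' n by simp
      have f0: "face WA (Suc m) 0 (face WA (Suc (Suc m)) (Suc l) u) = face WA (Suc m) l (v 0)"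
        using A.R.face_0_face[OF u', of l] u n i i' by simp
      have "face WA (Suc m) 0 (v (Suc l)) = face WA (Suc m) l (v 0)" using eq by (cases l) (simp_all add: lev_W_ext_simps)
      note f0 = f0[folded this]
      have t: "(g (Suc l), v (Suc l)) \<in> Ar (TT (Suc m))" "(g 0, v 0) \<in> Ar (TT (Suc m))"
        using zi(1)[of "Suc l"] zi(1)[of 0] n i i' by simp_all
      note tl = twist[OF t(1)] and t0 = twist[OF t(2)]
      have x': "x \<in> Ar (gG (Suc (Suc m)))" using x n by simp
      have a': "a \<in> Ar (gG (Suc m))" "?d (Suc (Suc m)) 0 x \<in> Ar (gG (Suc m))" "src (gG (Suc m)) a = trg (gG (Suc m)) (?d (Suc (Suc m)) 0 x)"
        "gcomp (gG (Suc m)) a (?d (Suc (Suc m)) 0 x) = g 0"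
        using at dx ag n f_trg[OF dx(1)] h by (simp_all add: H.typing)
      have lm: "l \<le> Suc m" using i i' n by simp
      have da: "?d (Suc m) l (g 0) = ?c (?d (Suc m) l a) (?d (Suc m) 0 (g (Suc l)))"
      proof -
        have "?d (Suc m) l (?d (Suc (Suc m)) 0 x) = ?d (Suc m) 0 (g (Suc l))"
          using G.dar_dar[OF x', of 0 l] x(3)[of "Suc l"] lm n i i' by simp
        then show ?thesis using G.dar_comp[OF lm a'(1-3)] a'(4) by simp
      qed
      have ad: "?d (Suc m) l a \<in> Ar (gG m)" "src (gG m) (?d (Suc m) l a) = trg (gG m) (?d (Suc m) 0 (g (Suc l)))"
      proof -
        show "?d (Suc m) l a \<in> Ar (gG m)" using a' lm by (simp add: G.typing)
        have "trg (gG m) (?d (Suc m) l (?d (Suc (Suc m)) 0 x)) = trg (gG m) (?d (Suc m) 0 (g (Suc l)))"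
          using G.dar_dar[OF x', of 0 l] x(3)[of "Suc l"] lm n i i' by simp
        then show "src (gG m) (?d (Suc m) l a) = trg (gG m) (?d (Suc m) 0 (g (Suc l)))" using a' lm by (simp add: G.typing)
      qed
      have "snd (war (face WA (Suc (Suc m)) (Suc l) u)) = snd (war (v (Suc l)))"
      proof (cases l)
        case 0
        let ?v = "snd (war (v 0))"
        have "trg (gG m) (?d (Suc m) 0 (g 0)) = trg (gG m) (?d (Suc m) 0 a)"
          using da G.lv.comp_trg[OF ad(1) tl(10) ad(2)] 0 by simp
        then have va: "src (gG m) ?v = trg (gG m) (?d (Suc m) 0 a)" using t0(7) by simp
        have "?c (snd (war (v (Suc 0)))) (?d (Suc m) 0 (g (Suc 0))) = ?c ?v (?d (Suc m) 0 (g 0))"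
          using eq 0 by (simp add: lev_W_ext_simps)
        also have "\<dots> = ?c (?c ?v (?d (Suc m) 0 a)) (?d (Suc m) 0 (g (Suc 0)))"
          using da ad 0 va t0(6) tl(10) G.lv.comp_assoc[of ?v m "?d (Suc m) 0 a" "?d (Suc m) 0 (g (Suc 0))"]
          by simp
        finally have "snd (war (v (Suc 0))) = ?c ?v (?d (Suc m) 0 a)"
          by (rule G.lv.right_cancel[rotated -1])
            (use ad 0 va t0(6) tl(6,7,10) in \<open>simp_all add: G.lv.comp_Ar G.lv.comp_src\<close>)
        moreover have "snd (war (face WA (Suc (Suc m)) (Suc 0) u)) = ?c ?v (?d (Suc m) 0 a)"
          using A.snd_war_face_1[OF u'] u n by (simp add: A_simps)
        ultimately show ?thesis using 0 by simp
      next
        case l: (Suc l')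
        have "?c (snd (war (v (Suc l)))) (?d (Suc m) 0 (g (Suc l))) = ?c (?d (Suc m) l a) (?d (Suc m) 0 (g (Suc l)))"
          using eq l da by (simp add: lev_W_ext_simps)
        then have "snd (war (v (Suc l))) = ?d (Suc m) l a"
          by (rule G.lv.right_cancel[rotated -1]) (use ad tl in simp_all)
        moreover have "snd (war (face WA (Suc (Suc m)) (Suc l) u)) = ?d (Suc m) l a"
          using A.snd_war_face_Suc_Suc[OF u', of l'] u l lm by (simp add: A_simps)
        ultimately show ?thesis by simp
      qed
      then show ?thesis
        using A.W_eqI[of "face WA (Suc n) i u" m "v i"] fu zi(4)[OF i] f0 n i' by simp
    qed
  qed
  have xu: "(x, u) \<in> Ar (TT (Suc n))" using x u by (simp add: lev_W_ext_simps rebase_simps)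
  show "\<exists>x \<in> simp (Defs.arr_sset (W_ext E)) (Suc n). far (gfun_comp (semidirect_proj (Suc n)) (W_ext_prj E (Suc n))) x = h \<and>
      (\<forall>i \<le> Suc n. face (Defs.arr_sset (W_ext E)) (Suc n) i x = z i)"
  proof (rule bexI[of _ "(x, u)"], intro conjI allI impI)
    show "far (gfun_comp (semidirect_proj (Suc n)) (W_ext_prj E (Suc n))) (x, u) = h" using x by (simp add: P)
    show "(x, u) \<in> simp (Defs.arr_sset (W_ext E)) (Suc n)" using xu by (simp add: Defs.arr_sset_def)
    show "face (Defs.arr_sset (W_ext E)) (Suc n) i (x, u) = z i" if i: "i \<le> Suc n" for i
      using vi[OF i] x(3)[OF i] ag u by (cases i) (simp_all add: Defs.arr_sset_def lev_W_ext_simps z)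
  qed
qed

lemma kan_fibration_W_ext:
  assumes "fibrant_kernel E"
  shows "kan_fibration (Wbar (W_ext E)) (Wbar HV) (Wbar_map (W_ext_prj E))"
proof (rule p.kan_fibration_Wbar_map[OF kan_fibration_W_ext_arr[OF assms]], rule subsetI)
  fix z assume "z \<in> Ar (lev HV 0)"
  then obtain h u where z: "z = (h, u)" "h \<in> Ar (gH 0)" "u \<in> simp WA 0" "wob u = trg (gH 0) h"
    by (cases z) (auto simp: V.lev_semidirect_simps A.mem_W)
  obtain g where "g \<in> Ar (gG 0)" "f 0 g = h" using f_surj[OF z(2)] by blast
  then show "z \<in> far (W_ext_prj E 0) ` Ar (TT 0)"
    using z by (intro image_eqI[of _ _ "(g, u)"]) (simp_all add: W_ext_prj_def lev_W_ext_simps rebase_simps)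
qed

lemma weak_equivalence_W_ext:
  assumes "fibrant_kernel E"
  shows "weak_equivalence (Wbar (W_ext E)) (Wbar (ebase E)) (\<lambda>n. Wbar_map semidirect_proj n \<circ> Wbar_map (W_ext_prj E) n)"
proof -
  have e: "(\<lambda>n. Wbar_map semidirect_proj n \<circ> Wbar_map (W_ext_prj E) n) =
      Wbar_map (\<lambda>n. gfun_comp (semidirect_proj n) (W_ext_prj E n))"
    by (simp add: fun_eq_iff Wbar_map_comp)
  show ?thesis
    unfolding e
    by (rule weak_equivalence_if_boundary_lifting[OF T'.sset_Wbar H.sset_Wbar w.smap_Wbar_map
          w.boundary_lifting_Wbar_map[OF boundary_lifting_W_ext_arr[OF assms]]])
qed

end

section \<open>The pullback along the zero section\<close>

lemma siso_inv_into:
  assumes X: "sset X" and s: "smap X Y f" and b: "\<And>n. bij_betw (f n) (simp X n) (simp Y n)"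
  shows "siso Y X (\<lambda>n. inv_into (simp X n) (f n))"
proof -
  have inv: "inv_into (simp X n) (f n) (f n x) = x" if "x \<in> simp X n" for n x
    using b[of n] that by (simp add: bij_betw_def)
  have ex: "\<exists>x \<in> simp X n. y = f n x" if "y \<in> simp Y n" for n y
    using b[of n] that unfolding bij_betw_def by blast
  have "smap Y X (\<lambda>n. inv_into (simp X n) (f n))"
    unfolding smap_def
  proof (intro conjI allI ballI impI)
    fix n y i
    show "inv_into (simp X n) (f n) y \<in> simp X n" if "y \<in> simp Y n" using ex[OF that] inv by auto
    show "inv_into (simp X n) (f n) (face Y (Suc n) i y) = face X (Suc n) i (inv_into (simp X (Suc n)) (f (Suc n)) y)"
      if y: "y \<in> simp Y (Suc n)" and i: "i \<le> Suc n"
    proof -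
      obtain x where x: "x \<in> simp X (Suc n)" "y = f (Suc n) x" using ex[OF y] by blast
      then show ?thesis using smapD(2)[OF s x(1) i, symmetric] inv sset_face[OF X x(1) i] by simp
    qed
    show "inv_into (simp X (Suc n)) (f (Suc n)) (degen Y n i y) = degen X n i (inv_into (simp X n) (f n) y)"
      if y: "y \<in> simp Y n" and i: "i \<le> n"
    proof -
      obtain x where x: "x \<in> simp X n" "y = f n x" using ex[OF y] by blast
      then show ?thesis using smapD(3)[OF s x(1) i, symmetric] inv sset_degen[OF X x(1) i] by simp
    qed
  qed
  then show ?thesis unfolding siso_def using b bij_betw_inv_into by blast
qed

lemma (in srep) sgpd_map_zero_section: "sgpd_map H (semidirect H A) (zero_section H A)"
  unfolding sgpd_map_def
proof (intro conjI allI)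
  show "gfunctor (lev H n) (lev (semidirect H A) n) (zero_section H A n)" for n
    unfolding gfunctor_def zero_section_def by (auto simp: lev_semidirect_simps rep_typing act_zero' zero_add)
  show "smap (Defs.obj_sset H) (Defs.obj_sset (semidirect H A)) (\<lambda>n. fob (zero_section H A n))"
    unfolding smap_def Defs.obj_sset_def zero_section_def by (simp add: lev_semidirect_simps)
  show "smap (Defs.arr_sset H) (Defs.arr_sset (semidirect H A)) (\<lambda>n. far (zero_section H A n))"
    unfolding smap_def Defs.arr_sset_def zero_section_def
    by (auto simp: lev_semidirect_simps rep_typing rface_zero rdegen_zero)
qed

text \<open>The inclusion of \<open>G\<close> as the fibre over the zero section. It respects the twisted zeroth face because
  the twist vanishes at zero.\<close>

definition W_ext_incl :: "('o, 'm, 'p, 'q) gext \<Rightarrow> nat \<Rightarrow> ('o, 'm, 'p, 'm \<times> ('p \<times> ('p \<times> 'm) list) list) gfun" where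
  "W_ext_incl E n = \<lparr> fob = fob (eprj E n),
     far = (\<lambda>g. (g, rzero (Wbar_rep (ebase E) (kernel_rep E)) n (trg (lev (ebase E) n) (far (eprj E n) g)))) \<rparr>"

context extension
begin

lemma sgpd_map_W_ext_incl: "sgpd_map (etot E) (W_ext E) (W_ext_incl E)"
  unfolding sgpd_map_def
proof (intro conjI allI)
  let ?z = "\<lambda>n g. rzero VV n (trg (gG n) g)"
  have J: "far (W_ext_incl E n) g = (g, ?z n g)" for n g by (simp add: W_ext_incl_def rebase_simps)
  have Jo: "fob (W_ext_incl E n) = fob (eprj E n)" for n by (simp add: W_ext_incl_def)
  have ar: "Ar (lev (etot E) n) = Ar (gG n)" for n by (simp add: rebase_simps)
  have st: "fob (eprj E n) (src (lev (etot E) n) g) = src (gG n) g" "fob (eprj E n) (trg (lev (etot E) n) g) = trg (gG n) g"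
    if "g \<in> Ar (gG n)" for n g using that prj_src[of g n] prj_trg[of g n] by (simp_all add: rebase_simps)
  have o: "trg (gG n) g \<in> Ob (gH n)" if "g \<in> Ar (gG n)" for n g using that G.typing Ob_rebase by auto
  have comp: "src (gG n) g = trg (gG n) h" if "g \<in> Ar (gG n)" "h \<in> Ar (gG n)" "src (lev (etot E) n) g = trg (lev (etot E) n) h" for n g h
    using st[OF that(1)] st[OF that(2)] that(3) by simp
  show "gfunctor (lev (etot E) n) (TT n) (W_ext_incl E n)" for n
    unfolding gfunctor_def
  proof (intro conjI ballI impI)
    fix x assume x: "x \<in> Ob (lev (etot E) n)"
    then show "fob (W_ext_incl E n) x \<in> Ob (TT n)" using prj.F_typing(1) by (simp add: Jo lev_W_ext_simps)
    have e: "gid (lev (etot E) n) x = gid (gG n) (fob (eprj E n) x)" using obT(3)[OF x] by (simp add: rebase_simps)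
    have ox: "fob (eprj E n) x \<in> Ob (gG n)" using x prj.F_typing(1) by (simp add: rebase_simps)
    show "far (W_ext_incl E n) (gid (lev (etot E) n) x) = gid (TT n) (fob (W_ext_incl E n) x)"
      using G.lv.id_trg[OF ox] by (simp add: J Jo e lev_W_ext_simps)
  next
    fix g assume "g \<in> Ar (lev (etot E) n)"
    then have g: "g \<in> Ar (gG n)" by (simp add: ar)
    show "far (W_ext_incl E n) g \<in> Ar (TT n)"
      "src (TT n) (far (W_ext_incl E n) g) = fob (W_ext_incl E n) (src (lev (etot E) n) g)"
      "trg (TT n) (far (W_ext_incl E n) g) = fob (W_ext_incl E n) (trg (lev (etot E) n) g)"
      using g st[OF g] A.rzero_W(1,2)[OF o[OF g]] by (simp_all add: J Jo lev_W_ext_simps)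
  next
    fix g h assume "g \<in> Ar (lev (etot E) n)" "h \<in> Ar (lev (etot E) n)" and c: "src (lev (etot E) n) g = trg (lev (etot E) n) h"
    then have g: "g \<in> Ar (gG n)" "h \<in> Ar (gG n)" by (simp_all add: ar)
    note cc = comp[OF g c]
    have "radd VV n (trg (gG n) g) (?z n g) (ract VV n (f n g) (?z n h)) = ?z n g"
      using V.act_zero'[of "f n g" n "trg (gG n) h"] f_Ar[OF g(1)] f_src[OF g(1)] f_trg[OF g(1)] cc
        V.zero_add[OF o[OF g(1)] V.zero_in[OF o[OF g(1)]]] by simp
    then show "far (W_ext_incl E n) (gcomp (lev (etot E) n) g h) = gcomp (TT n) (far (W_ext_incl E n) g) (far (W_ext_incl E n) h)"
      using G.lv.comp_trg[OF g cc] by (simp add: J lev_W_ext_simps) (simp add: rebase_simps)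
  qed
  show "smap (Defs.obj_sset (etot E)) (Defs.obj_sset (W_ext E)) (\<lambda>n. fob (W_ext_incl E n))"
    using prj.F_obj unfolding smap_def Defs.obj_sset_def Jo by (simp add: lev_W_ext_simps)
  show "smap (Defs.arr_sset (etot E)) (Defs.arr_sset (W_ext E)) (\<lambda>n. far (W_ext_incl E n))"
    unfolding smap_def Defs.arr_sset_def
  proof (intro conjI allI ballI impI, simp_all)
    fix n g i
    show "far (W_ext_incl E n) g \<in> Ar (TT n)" if "g \<in> Ar (lev (etot E) n)"
      using that A.rzero_W(1,2)[OF o] by (simp add: J lev_W_ext_simps ar)
    show "far (W_ext_incl E n) (far (gface (etot E) (Suc n) i) g) = far (gface (W_ext E) (Suc n) i) (far (W_ext_incl E (Suc n)) g)"
      if "g \<in> Ar (lev (etot E) (Suc n))" and i: "i \<le> Suc n"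
    proof -
      have g: "g \<in> Ar (gG (Suc n))" using that ar by simp
      have t: "trg (gG n) (far (gface (rebase E) (Suc n) i) g) = fob (gface (ebase E) (Suc n) i) (trg (gG (Suc n)) g)"
        "far (gface (rebase E) (Suc n) i) g \<in> Ar (gG n)"
        using G.dar_trg[OF i g] G.dar_Ar[OF i g] by (simp_all add: rebase_simps(8))
      have z: "face WA (Suc n) i (?z (Suc n) g) = rzero VV n (fob (gface (ebase E) (Suc n) i) (trg (gG (Suc n)) g))"
        using V.rface_zero[OF o[OF g] i] by (simp add: A.W_face_simps)
      have e: "far (gface (etot E) (Suc n) j) g = far (gface (rebase E) (Suc n) j) g" for j by (simp add: rebase_simps)
      show ?thesis
      proof (cases i)
        case 0
        have "gcomp (gG n) (gid (gG n) (trg (gG n) (far (gface (rebase E) (Suc n) i) g))) (far (gface (rebase E) (Suc n) i) g) =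
            far (gface (rebase E) (Suc n) i) g"
          using G.lv.id_comp[OF t(2)] by simp
        then show ?thesis using t z 0 A.rzero_W(3)[OF o[OF g]] by (simp add: J e lev_W_ext_simps A_simps)
      next
        case (Suc l)
        then show ?thesis using t z by (simp add: J e lev_W_ext_simps)
      qed
    qed
    show "far (W_ext_incl E (Suc n)) (far (gdegen (etot E) n i) g) = far (gdegen (W_ext E) n i) (far (W_ext_incl E n) g)"
      if "g \<in> Ar (lev (etot E) n)" and i: "i \<le> n"
    proof -
      have g: "g \<in> Ar (gG n)" using that ar by simp
      have t: "trg (gG (Suc n)) (far (gdegen (rebase E) n i) g) = fob (gdegen (ebase E) n i) (trg (gG n) g)"
        using G.sar_trg[OF i g] by (simp add: rebase_simps(10))
      have e: "far (gdegen (etot E) n i) g = far (gdegen (rebase E) n i) g" by (simp add: rebase_simps)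
      show ?thesis using t V.rdegen_zero[OF o[OF g] i] by (simp add: J e lev_W_ext_simps A.W_face_simps)
    qed
  qed
qed

end

sublocale extension \<subseteq> inc: sgroupoid_map "etot E" "W_ext E" "W_ext_incl E"
  by unfold_locales (rule sgpd_map_W_ext_incl)

sublocale extension \<subseteq> zer: sgroupoid_map "ebase E" "semidirect (ebase E) (Wbar_rep (ebase E) (kernel_rep E))"
    "zero_section (ebase E) (Wbar_rep (ebase E) (kernel_rep E))"
  by unfold_locales (rule V.sgpd_map_zero_section)

context extension
begin

text \<open>The projection of \<open>y\<close> lies in the zero section, so that all the components in \<open>Wbar A\<close> of the arrows in
  \<open>y\<close> vanish; the simplex of \<open>Wbar G\<close> is built coordinate by coordinate.\<close>

lemma zero_locus:
  "y \<in> simp (Wbar (W_ext E)) n \<Longrightarrow> b \<in> simp (Wbar (ebase E)) n \<Longrightarrow>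
    Wbar_map (W_ext_prj E) n y = Wbar_map (zero_section (ebase E) VV) n b \<Longrightarrow>
    \<exists>x \<in> simp (Wbar (etot E)) n. Wbar_map (W_ext_incl E) n x = y"
proof (induction n arbitrary: y b)
  case 0
  then obtain c where c: "c \<in> Ob (gH 0)" "y = [(c, [])]" by (auto simp: T'.Wbar_0 lev_W_ext_simps)
  have x: "[(obT 0 c, [])] \<in> simp (Wbar (etot E)) 0" using obT(1)[OF c(1)] by (simp add: T.Wbar_0)
  have "Wbar_map (W_ext_incl E) 0 [(obT 0 c, [])] = y"
    using obT(2)[OF c(1)] c by (simp add: Wbar_map_def nerve_map_def W_ext_incl_def)
  then show ?case using x by blast
next
  case (Suc n)
  let ?d = "face (Wbar (W_ext E)) (Suc n) 0"
  have y: "y \<in> simp (Wbar (W_ext E)) (Suc n)" and b: "b \<in> simp (Wbar (ebase E)) (Suc n)" by fact+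
  have "Wbar_map (W_ext_prj E) n (?d y) = Wbar_map (zero_section (ebase E) VV) n (face (Wbar (ebase E)) (Suc n) 0 b)"
    using p.face_0_Wbar_map[OF y] zer.face_0_Wbar_map[OF b] Suc.prems(3) by simp
  then obtain x' where x': "x' \<in> simp (Wbar (etot E)) n" "Wbar_map (W_ext_incl E) n x' = ?d y"
    using Suc.IH[of "?d y" "face (Wbar (ebase E)) (Suc n) 0 b"] T'.face_Wbar_in[OF y] H.face_Wbar_in[OF b] by auto
  obtain g u where gu: "war y = (g, u)" by (cases "war y") auto
  have wy: "(g, u) \<in> Ar (TT n)" using T'.war_Ar[OF y] gu by simp
  have g: "g \<in> Ar (gG n)" using wy by (simp add: lev_W_ext_simps)
  have "far (W_ext_prj E n) (war y) = far (zero_section (ebase E) VV n) (war b)"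
    using p.war_Wbar_map[OF y] zer.war_Wbar_map[OF b] Suc.prems(3) by simp
  then have "u = rzero VV n (trg (gH n) (f n g))" by (simp add: gu W_ext_prj_def zero_section_def)
  then have inc: "far (W_ext_incl E n) g = war y" by (simp add: W_ext_incl_def gu)
  define c where "c = obT (Suc n) (wob y)"
  have wo: "wob y \<in> Ob (gH (Suc n))" using T'.wob_Ob[OF y] by (simp add: lev_W_ext_simps)
  have c: "c \<in> Ob (lev (etot E) (Suc n))" "fob (eprj E (Suc n)) c = wob y" using obT(1,2)[OF wo] by (auto simp: c_def)
  have gT: "g \<in> Ar (lev (etot E) n)" using g by (simp add: rebase_simps)
  have s: "src (lev (etot E) n) g = fob (gface (etot E) (Suc n) 0) c"
  proof -
    have "fob (eprj E n) (src (lev (etot E) n) g) = src (TT n) (war y)"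
      using prj_src[OF gT] by (simp add: gu lev_W_ext_simps rebase_simps)
    also have "\<dots> = fob (gface (ebase E) (Suc n) 0) (wob y)" using T'.war_src[OF y] by (simp add: lev_W_ext_simps)
    also have "\<dots> = fob (eprj E n) (fob (gface (etot E) (Suc n) 0) c)" using prj.F_face(1)[OF c(1), of 0] c(2) by simp
    finally show ?thesis using ob_eq_iff T.lv.src_Ob[OF gT] T.dob_Ob[OF _ c(1), of 0] by simp
  qed
  have t: "trg (lev (etot E) n) g = wob x'"
  proof -
    have "fob (eprj E n) (trg (lev (etot E) n) g) = trg (TT n) (war y)"
      using prj_trg[OF gT] by (simp add: gu lev_W_ext_simps rebase_simps)
    also have "\<dots> = wob (Wbar_map (W_ext_incl E) n x')" using T'.war_trg[OF y] x' by simp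
    also have "\<dots> = fob (eprj E n) (wob x')" using inc.wob_Wbar_map[OF x'(1)] by (simp add: W_ext_incl_def)
    finally show ?thesis using ob_eq_iff T.lv.trg_Ob[OF gT] T.wob_Ob[OF x'(1)] by simp
  qed
  have wc: "T.wcomp n c g x'" using c gT s t x' by (simp add: T.wcomp_def)
  have "Wbar_map (W_ext_incl E) (Suc n) (wcons (etot E) n c g x') = wcons (W_ext E) n (wob y) (war y) (?d y)"
    using inc.Wbar_map_wcons[OF wc] x'(2) inc c(2) by (simp add: W_ext_incl_def)
  then show ?case using T'.wcons_eta[OF y] T.wcons_in[OF wc] by (intro bexI) simp_all
qed

lemma zero_section_prj: "b \<in> simp (Wbar (ebase E)) n \<Longrightarrow>
    Wbar_map semidirect_proj n (Wbar_map (zero_section (ebase E) VV) n b) = b"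
  using H.Wbar_map_id[of "\<lambda>n. gfun_comp (semidirect_proj n) (zero_section (ebase E) VV n)" b n]
  by (simp add: gfun_comp_def semidirect_proj_def zero_section_def flip: Wbar_map_comp)

lemma prj_incl: "x \<in> simp (Wbar (etot E)) n \<Longrightarrow>
    Wbar_map (W_ext_prj E) n (Wbar_map (W_ext_incl E) n x) =
    Wbar_map (zero_section (ebase E) VV) n (Wbar_map (eprj E) n x)"
  unfolding Wbar_map_comp[symmetric]
  by (rule T.Wbar_map_cong) (simp_all add: gfun_comp_def W_ext_prj_def W_ext_incl_def zero_section_def)

lemma pullback_iso:
  defines "P \<equiv> fibprod (Wbar (W_ext E)) (Wbar (ebase E)) (Wbar_map (W_ext_prj E)) (Wbar_map (zero_section (ebase E) VV))"
  shows "\<exists>\<phi>. siso P (Wbar (etot E)) \<phi> \<and> (\<forall>n. \<forall>z \<in> simp P n. Wbar_map (eprj E) n (\<phi> n z) = snd z)"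
proof -
  define \<psi> where "\<psi> n x = (Wbar_map (W_ext_incl E) n x, Wbar_map (eprj E) n x)" for n x
  have mem: "(y, b) \<in> simp P n \<longleftrightarrow> y \<in> simp (Wbar (W_ext E)) n \<and> b \<in> simp (Wbar (ebase E)) n \<and>
      Wbar_map (W_ext_prj E) n y = Wbar_map (zero_section (ebase E) VV) n b" for n y b
    by (auto simp: P_def fibprod_def)
  have ops: "face P n i = map_prod (face (Wbar (W_ext E)) n i) (face (Wbar (ebase E)) n i)"
    "degen P n i = map_prod (degen (Wbar (W_ext E)) n i) (degen (Wbar (ebase E)) n i)" for n i
    by (simp_all add: P_def fibprod_def sprod_def)
  have \<psi>: "\<psi> n x \<in> simp P n" if "x \<in> simp (Wbar (etot E)) n" for n x
    unfolding \<psi>_def mem using inc.Wbar_map_in[OF that] prj.Wbar_map_in[OF that] prj_incl[OF that] by blast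
  have sm: "smap (Wbar (etot E)) P \<psi>"
    unfolding smap_def using \<psi>
    by (auto simp: ops \<psi>_def inc.Wbar_map_face prj.Wbar_map_face inc.Wbar_map_degen prj.Wbar_map_degen)
  have inj_ob: "inj_on (fob (W_ext_incl E n)) (Ob (lev (etot E) n))" for n
    using bij_ob[of n] by (simp add: W_ext_incl_def bij_betw_def)
  have inj_ar: "inj_on (far (W_ext_incl E n)) (Ar (lev (etot E) n))" for n
    by (rule inj_onI) (simp add: W_ext_incl_def)
  have bij: "bij_betw (\<psi> n) (simp (Wbar (etot E)) n) (simp P n)" for n
  proof (rule bij_betwI')
    fix x x' assume "x \<in> simp (Wbar (etot E)) n" "x' \<in> simp (Wbar (etot E)) n"
    then show "\<psi> n x = \<psi> n x' \<longleftrightarrow> x = x'" using inc.Wbar_map_inj[OF inj_ob inj_ar] by (auto simp: \<psi>_def)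
  next
    fix z assume "z \<in> simp P n"
    then obtain y b where z: "z = (y, b)" "y \<in> simp (Wbar (W_ext E)) n" "b \<in> simp (Wbar (ebase E)) n"
      "Wbar_map (W_ext_prj E) n y = Wbar_map (zero_section (ebase E) VV) n b" by (cases z) (auto simp: mem)
    obtain x where x: "x \<in> simp (Wbar (etot E)) n" "Wbar_map (W_ext_incl E) n x = y" using zero_locus[OF z(2-4)] by blast
    have e: "Wbar_map (zero_section (ebase E) VV) n (Wbar_map (eprj E) n x) = Wbar_map (zero_section (ebase E) VV) n b"
      using prj_incl[OF x(1)] x z by simp
    have "Wbar_map (eprj E) n x =
        Wbar_map semidirect_proj n (Wbar_map (zero_section (ebase E) VV) n (Wbar_map (eprj E) n x))"
      by (rule zero_section_prj[OF prj.Wbar_map_in[OF x(1)], symmetric])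
    also have "\<dots> = b" unfolding e by (rule zero_section_prj[OF z(3)])
    finally have "Wbar_map (eprj E) n x = b" .
    then show "\<exists>x \<in> simp (Wbar (etot E)) n. z = \<psi> n x" using x z by (auto simp: \<psi>_def)
  qed (rule \<psi>)
  have "Wbar_map (eprj E) n (inv_into (simp (Wbar (etot E)) n) (\<psi> n) z) = snd z" if "z \<in> simp P n" for n z
  proof -
    have "\<psi> n (inv_into (simp (Wbar (etot E)) n) (\<psi> n) z) = z"
      using bij[of n] that by (simp add: bij_betw_def f_inv_into_f)
    then have "snd (\<psi> n (inv_into (simp (Wbar (etot E)) n) (\<psi> n) z)) = snd z" by (rule arg_cong)
    then show ?thesis by (simp only: \<psi>_def snd_conv)
  qed
  then show ?thesis using siso_inv_into[OF T.sset_Wbar sm bij] by blast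
qed

end

section \<open>Functoriality in the extension\<close>

definition kernel_map :: "('o, 'm, 'p, 'q) gext_map \<Rightarrow> nat \<Rightarrow> ('p, 'p \<times> 'm, 'p, 'p \<times> 'm) gfun" where
  "kernel_map F n = \<lparr> fob = fob (mbase F n), far = map_prod (fob (mbase F n)) (far (mtot F n)) \<rparr>"

definition W_ext_map :: "('o, 'm, 'p, 'q) gext_map \<Rightarrow> nat \<Rightarrow>
    ('p, 'm \<times> ('p \<times> ('p \<times> 'm) list) list, 'p, 'm \<times> ('p \<times> ('p \<times> 'm) list) list) gfun" where
  "W_ext_map F n = \<lparr> fob = fob (mbase F n), far = map_prod (far (mtot F n)) (Wbar_map (kernel_map F) n) \<rparr>"

locale extension_morphism = E: extension E + E': extension E'
  for E E' :: "('o, 'm, 'p, 'q) gext" +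
  fixes F :: "('o, 'm, 'p, 'q) gext_map"
  assumes morphism: "extension_map E E' F"

sublocale extension_morphism \<subseteq> mt: sgroupoid_map "etot E" "etot E'" "mtot F"
  using morphism by unfold_locales (simp add: extension_map_def)

sublocale extension_morphism \<subseteq> mb: sgroupoid_map "ebase E" "ebase E'" "mbase F"
  using morphism by unfold_locales (simp add: extension_map_def)

context extension_morphism
begin

abbreviation "\<tau> n \<equiv> far (mtot F n)"
abbreviation "\<beta> n \<equiv> fob (mbase F n)"

lemma square_ob: "x \<in> Ob (lev (etot E) n) \<Longrightarrow> fob (eprj E' n) (fob (mtot F n) x) = \<beta> n (fob (eprj E n) x)"
  and square_ar: "g \<in> Ar (E.gG n) \<Longrightarrow> E'.f n (\<tau> n g) = far (mbase F n) (E.f n g)"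
  using morphism unfolding extension_map_def gfun_eq_def gfun_comp_def by (simp_all add: rebase_simps)

lemma mtot_Ar: "g \<in> Ar (E.gG n) \<Longrightarrow> \<tau> n g \<in> Ar (E'.gG n)"
  using mt.F_typing(3) by (simp add: rebase_simps)

lemma mtot_src: "g \<in> Ar (E.gG n) \<Longrightarrow> src (E'.gG n) (\<tau> n g) = \<beta> n (src (E.gG n) g)"
  and mtot_trg: "g \<in> Ar (E.gG n) \<Longrightarrow> trg (E'.gG n) (\<tau> n g) = \<beta> n (trg (E.gG n) g)"
  using square_ar[of g n] mb.F_typing(4,5)[of "E.f n g" n] E.f_Ar[of g n] by (simp_all add: rebase_simps)

lemma mtot_comp: "g \<in> Ar (E.gG n) \<Longrightarrow> h \<in> Ar (E.gG n) \<Longrightarrow> src (E.gG n) g = trg (E.gG n) h \<Longrightarrow>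
    \<tau> n (gcomp (E.gG n) g h) = gcomp (E'.gG n) (\<tau> n g) (\<tau> n h)"
  using mt.F_comp[of g n h] E.ob_eq_iff E.prj_src[of g n] E.prj_trg[of h n] E.T.typing(1,2)
  by (simp add: rebase_simps)

lemma mtot_inv: "g \<in> Ar (E.gG n) \<Longrightarrow> \<tau> n (ginv (E.gG n) g) = ginv (E'.gG n) (\<tau> n g)"
  using E.T.lv.functor_inv[OF mt.F_functor E'.T.lv.gpd, of g n] by (simp add: rebase_simps)

lemma mtot_id: "y \<in> Ob (E.gH n) \<Longrightarrow> \<tau> n (gid (E.gG n) y) = gid (E'.gG n) (\<beta> n y)"
  using mt.F_typing(1,2)[of "E.obT n y" n] square_ob[of "E.obT n y" n] E.obT(1,2)[of y n]
    E'.obT(3)[of "fob (mtot F n) (E.obT n y)" n] by (simp add: rebase_simps)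

lemma mtot_face: "g \<in> Ar (E.gG (Suc n)) \<Longrightarrow> i \<le> Suc n \<Longrightarrow>
    \<tau> n (far (gface (rebase E) (Suc n) i) g) = far (gface (rebase E') (Suc n) i) (\<tau> (Suc n) g)"
  using mt.F_face(2)[of g n i] by (simp add: rebase_simps)

lemma mtot_degen: "g \<in> Ar (E.gG n) \<Longrightarrow> i \<le> n \<Longrightarrow>
    \<tau> (Suc n) (far (gdegen (rebase E) n i) g) = far (gdegen (rebase E') n i) (\<tau> n g)"
  using mt.F_degen(2)[of g n i] by (simp add: rebase_simps)

lemma mtot_kernel: "y \<in> Ob (E.gH n) \<Longrightarrow> a \<in> rcar E.AA n y \<Longrightarrow> \<tau> n a \<in> rcar E'.AA n (\<beta> n y)"
  using E.A_typing[of y n a] E'.mem_A[OF mb.F_typing(1)[of y n]] mtot_Ar[of a n] square_ar[of a n] mb.F_typing(2)[of y n]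
  by simp

lemma mtot_act:
  assumes h: "h \<in> Ar (E.gH n)" and a: "a \<in> rcar E.AA n (src (E.gH n) h)"
  shows "\<tau> n (ract E.AA n h a) = ract E'.AA n (far (mbase F n) h) (\<tau> n a)"
proof -
  obtain g where g: "g \<in> Ar (E.gG n)" "E.f n g = h" using E.f_surj[OF h] by blast
  have s: "src (E.gG n) g = src (E.gH n) h" using g by (simp add: rebase_simps)
  have so: "src (E.gH n) h \<in> Ob (E.gH n)" using h by (simp add: E.H.typing)
  note at = E.A_typing[OF so a]
  have "\<tau> n (ract E.AA n h a) = gcomp (E'.gG n) (gcomp (E'.gG n) (\<tau> n g) (\<tau> n a)) (ginv (E'.gG n) (\<tau> n g))"
    using E.act_eq[OF g(1), of a] a s g at mtot_comp[of "gcomp (E.gG n) g a" n "ginv (E.gG n) g"] mtot_comp[of g n a] mtot_inv[of g n]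
    by (simp add: E.G.typing)
  also have "\<dots> = ract E'.AA n (E'.f n (\<tau> n g)) (\<tau> n a)"
    using E'.act_eq[OF mtot_Ar[OF g(1)], of "\<tau> n a"] mtot_kernel[OF so a] mtot_src[OF g(1)] s by simp
  finally show ?thesis using square_ar g by simp
qed

lemma sgpd_map_kernel_map: "sgpd_map (rep_gpd (ebase E) E.AA) (rep_gpd (ebase E') E'.AA) (kernel_map F)"
  unfolding sgpd_map_def
proof (intro conjI allI)
  show "gfunctor (lev (rep_gpd (ebase E) E.AA) n) (lev (rep_gpd (ebase E') E'.AA) n) (kernel_map F n)" for n
    unfolding gfunctor_def kernel_map_def
    by (auto simp: E.A.lev_rep_simps E'.A.lev_rep_simps mb.F_typing E.A_simps E'.A_simps mtot_id mtot_kernel E.A_typing mtot_comp)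
  show "smap (Defs.obj_sset (rep_gpd (ebase E) E.AA)) (Defs.obj_sset (rep_gpd (ebase E') E'.AA)) (\<lambda>n. fob (kernel_map F n))"
    using mb.F_obj by (simp add: kernel_map_def E.A.obj_sset_rep_gpd E'.A.obj_sset_rep_gpd)
  show "smap (Defs.arr_sset (rep_gpd (ebase E) E.AA)) (Defs.arr_sset (rep_gpd (ebase E') E'.AA)) (\<lambda>n. far (kernel_map F n))"
    unfolding smap_def kernel_map_def
    by (auto simp: rep_sset_simps mb.F_typing mtot_kernel mb.F_face mb.F_degen E.A_simps E'.A_simps mtot_face mtot_degen E.A_typing)
qed

end

sublocale extension_morphism \<subseteq> km: sgroupoid_map "rep_gpd (ebase E) (kernel_rep E)" "rep_gpd (ebase E') (kernel_rep E')" "kernel_map F"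
  by unfold_locales (rule sgpd_map_kernel_map)

context extension_morphism
begin

abbreviation "\<kappa> n \<equiv> Wbar_map (kernel_map F) n"

lemma \<kappa>_in: "u \<in> simp E.WA n \<Longrightarrow> \<kappa> n u \<in> simp E'.WA n"
  and \<kappa>_wob: "u \<in> simp E.WA n \<Longrightarrow> wob (\<kappa> n u) = \<beta> n (wob u)"
  and \<kappa>_war: "u \<in> simp E.WA (Suc n) \<Longrightarrow> snd (war (\<kappa> (Suc n) u)) = \<tau> n (snd (war u))"
  and \<kappa>_face_0: "u \<in> simp E.WA (Suc n) \<Longrightarrow> face E'.WA (Suc n) 0 (\<kappa> (Suc n) u) = \<kappa> n (face E.WA (Suc n) 0 u)"
  using km.map_chart by (simp_all add: kernel_map_def)

text \<open>The map that a morphism of extensions induces on \<open>Wbar A\<close> respects the group structure and the action,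
  as the map on \<open>A\<close> does.\<close>

lemma \<kappa>_add: "u \<in> simp E.WA n \<Longrightarrow> v \<in> simp E.WA n \<Longrightarrow> wob u = y \<Longrightarrow> wob v = y \<Longrightarrow>
    \<kappa> n (radd E.VV n y u v) = radd E'.VV n (\<beta> n y) (\<kappa> n u) (\<kappa> n v)"
proof (induction n arbitrary: u v y)
  case 0
  then show ?case by - (rule E'.A.W_eqI_0, simp_all add: E.A.W_chart E'.A.W_chart \<kappa>_in \<kappa>_wob)
next
  case (Suc n)
  have y: "y \<in> Ob (E.gH (Suc n))" "fob (gface (ebase E) (Suc n) 0) y \<in> Ob (E.gH n)"
    using Suc.prems E.A.W_wob_Ob E.H.dob_Ob by auto
  have a: "snd (war u) \<in> rcar E.AA n (fob (gface (ebase E) (Suc n) 0) y)" "snd (war v) \<in> rcar E.AA n (fob (gface (ebase E) (Suc n) 0) y)"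
    using E.A.snd_war_in[of u n] E.A.snd_war_in[of v n] Suc.prems by simp_all
  have "\<tau> n (radd E.AA n (fob (gface (ebase E) (Suc n) 0) y) (snd (war u)) (snd (war v))) =
      radd E'.AA n (fob (gface (ebase E') (Suc n) 0) (\<beta> (Suc n) y)) (\<tau> n (snd (war u))) (\<tau> n (snd (war v)))"
    using E.A_typing[OF y(2) a(1)] E.A_typing[OF y(2) a(2)] by (simp add: E.A_simps E'.A_simps mtot_comp)
  then show ?case using Suc.prems y Suc.IH[of "face E.WA (Suc n) 0 u" "face E.WA (Suc n) 0 v"] mb.F_face(1)[OF y(1), of 0]
    by - (rule E'.A.W_eqI[of _ n], simp_all add: E.A.W_chart E'.A.W_chart \<kappa>_in \<kappa>_wob \<kappa>_war \<kappa>_face_0)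
qed

lemma \<kappa>_zero: "y \<in> Ob (E.gH n) \<Longrightarrow> \<kappa> n (rzero E.VV n y) = rzero E'.VV n (\<beta> n y)"
proof (induction n arbitrary: y)
  case 0
  then show ?case using mb.F_typing(1)[of y 0]
    by - (rule E'.A.W_eqI_0, simp_all add: E.A.W_chart E'.A.W_chart \<kappa>_in \<kappa>_wob)
next
  case (Suc n)
  have y: "y \<in> Ob (E.gH (Suc n))" "fob (gface (ebase E) (Suc n) 0) y \<in> Ob (E.gH n)" "\<beta> (Suc n) y \<in> Ob (E'.gH (Suc n))"
    using Suc.prems E.H.dob_Ob mb.F_typing(1) by auto
  have "\<tau> n (rzero E.AA n (fob (gface (ebase E) (Suc n) 0) y)) = rzero E'.AA n (fob (gface (ebase E') (Suc n) 0) (\<beta> (Suc n) y))"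
    using mtot_id[OF y(2)] mb.F_face(1)[OF y(1), of 0] by (simp add: E.A_simps E'.A_simps)
  then show ?case using y Suc.IH[OF y(2)] mb.F_face(1)[OF y(1), of 0]
    by - (rule E'.A.W_eqI[of _ n], simp_all add: E.A.W_chart E'.A.W_chart \<kappa>_in \<kappa>_wob \<kappa>_war \<kappa>_face_0)
qed

lemma \<kappa>_act: "h \<in> Ar (E.gH n) \<Longrightarrow> u \<in> simp E.WA n \<Longrightarrow> wob u = src (E.gH n) h \<Longrightarrow>
    \<kappa> n (ract E.VV n h u) = ract E'.VV n (far (mbase F n) h) (\<kappa> n u)"
proof (induction n arbitrary: u h)
  case 0
  then show ?case using mb.F_typing(3-5)[of h 0]
    by - (rule E'.A.W_eqI_0, simp_all add: E.A.W_chart E'.A.W_chart \<kappa>_in \<kappa>_wob)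
next
  case (Suc n)
  let ?h = "far (gface (ebase E) (Suc n) 0) h"
  have h: "h \<in> Ar (E.gH (Suc n))" by fact
  have dh: "?h \<in> Ar (E.gH n)" "src (E.gH n) ?h = fob (gface (ebase E) (Suc n) 0) (src (E.gH (Suc n)) h)"
    using h by (simp_all add: E.H.typing)
  have a: "snd (war u) \<in> rcar E.AA n (src (E.gH n) ?h)" using E.A.snd_war_in[of u n] Suc.prems dh by simp
  show ?case
    using Suc.prems dh mb.F_typing(3-5)[OF h] mtot_act[OF dh(1) a] mb.F_face(2)[OF h, of 0] Suc.IH[of ?h "face E.WA (Suc n) 0 u"]
    by - (rule E'.A.W_eqI[of _ n], simp_all add: E.A.W_chart E'.A.W_chart \<kappa>_in \<kappa>_wob \<kappa>_war \<kappa>_face_0)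
qed

lemma sgpd_map_W_ext_map: "sgpd_map (W_ext E) (W_ext E') (W_ext_map F)"
  unfolding sgpd_map_def
proof (intro conjI allI)
  have M: "far (W_ext_map F n) (g, u) = (\<tau> n g, \<kappa> n u)" "fob (W_ext_map F n) = \<beta> n" for n g u
    by (simp_all add: W_ext_map_def)
  have o: "trg (E.gG n) g \<in> Ob (E.gH n)" if "g \<in> Ar (E.gG n)" for n g using that E.G.typing E.Ob_rebase by auto
  have Ar: "(\<tau> n g, \<kappa> n u) \<in> Ar (E'.TT n)" if "(g, u) \<in> Ar (E.TT n)" for n g u
    using that by (simp add: E.lev_W_ext_simps E'.lev_W_ext_simps mtot_Ar mtot_trg \<kappa>_in \<kappa>_wob)
  show "gfunctor (E.TT n) (E'.TT n) (W_ext_map F n)" for n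
    unfolding gfunctor_def
  proof (intro conjI ballI impI)
    fix y assume "y \<in> Ob (E.TT n)"
    then have y: "y \<in> Ob (E.gH n)" by (simp add: E.lev_W_ext_simps)
    then show "fob (W_ext_map F n) y \<in> Ob (E'.TT n)" "far (W_ext_map F n) (gid (E.TT n) y) = gid (E'.TT n) (fob (W_ext_map F n) y)"
      using mb.F_typing(1)[OF y] mtot_id[OF y] \<kappa>_zero[OF y] by (simp_all add: E.lev_W_ext_simps E'.lev_W_ext_simps M)
  next
    fix z assume "z \<in> Ar (E.TT n)"
    then obtain g u where z: "z = (g, u)" "(g, u) \<in> Ar (E.TT n)" by (cases z) auto
    then have g: "g \<in> Ar (E.gG n)" by (simp add: E.lev_W_ext_simps)
    show "far (W_ext_map F n) z \<in> Ar (E'.TT n)"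
      "src (E'.TT n) (far (W_ext_map F n) z) = fob (W_ext_map F n) (src (E.TT n) z)"
      "trg (E'.TT n) (far (W_ext_map F n) z) = fob (W_ext_map F n) (trg (E.TT n) z)"
      using z Ar[OF z(2)] mtot_src[OF g] mtot_trg[OF g] by (simp_all only: M E.lev_W_ext_simps E'.lev_W_ext_simps)
  next
    fix z z' assume "z \<in> Ar (E.TT n)" "z' \<in> Ar (E.TT n)" and c: "src (E.TT n) z = trg (E.TT n) z'"
    then obtain k v g u where z: "z = (k, v)" "(k, v) \<in> Ar (E.TT n)" "z' = (g, u)" "(g, u) \<in> Ar (E.TT n)"
      by (cases z; cases z') auto
    have kg: "k \<in> Ar (E.gG n)" "g \<in> Ar (E.gG n)" "src (E.gG n) k = trg (E.gG n) g"
      and uv: "v \<in> simp E.WA n" "wob v = trg (E.gG n) k" "u \<in> simp E.WA n" "wob u = src (E.gG n) k"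
      using z c by (simp_all add: E.lev_W_ext_simps)
    have r: "ract E.VV n (E.f n k) u \<in> simp E.WA n" "wob (ract E.VV n (E.f n k) u) = trg (E.gG n) k"
      using E.ract_W_in[OF kg(1) uv(3,4)] by auto
    show "far (W_ext_map F n) (gcomp (E.TT n) z z') = gcomp (E'.TT n) (far (W_ext_map F n) z) (far (W_ext_map F n) z')"
      using z mtot_comp[OF kg] \<kappa>_add[OF uv(1) r(1) uv(2) r(2)] \<kappa>_act[OF E.f_Ar[OF kg(1)] uv(3)] uv E.f_src[OF kg(1)]
        mtot_trg[OF kg(1)] square_ar[OF kg(1)]
      by (simp add: E.lev_W_ext_simps E'.lev_W_ext_simps M)
  qed
  show "smap (Defs.obj_sset (W_ext E)) (Defs.obj_sset (W_ext E')) (\<lambda>n. fob (W_ext_map F n))"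
    using mb.F_obj by (simp add: smap_def Defs.obj_sset_def E.lev_W_ext_simps E'.lev_W_ext_simps M)
  have "far (W_ext_map F n) (far (gface (W_ext E) (Suc n) i) z) = far (gface (W_ext E') (Suc n) i) (far (W_ext_map F (Suc n)) z)"
    if zA: "z \<in> Ar (E.TT (Suc n))" and i: "i \<le> Suc n" for n i z
  proof -
    obtain g u where z: "z = (g, u)" by (cases z) auto
    have z': "(g, u) \<in> Ar (E.TT (Suc n))" using zA z by simp
    note t = E.twist[OF z']
    show ?thesis
    proof (cases i)
      case 0
      then show ?thesis
        using z mtot_comp[OF t(6,10,7)] mtot_face[OF t(1), of 0] \<kappa>_war[OF t(2)] \<kappa>_face_0[OF t(2)]
        by (simp add: E.lev_W_ext_simps E'.lev_W_ext_simps M)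
    next
      case (Suc l)
      then show ?thesis using z mtot_face[OF t(1) i] km.Wbar_map_face[OF t(2) i]
        by (simp add: E.lev_W_ext_simps E'.lev_W_ext_simps M)
    qed
  qed
  moreover have "far (W_ext_map F (Suc n)) (far (gdegen (W_ext E) n i) z) = far (gdegen (W_ext E') n i) (far (W_ext_map F n) z)"
    if zA: "z \<in> Ar (E.TT n)" and i: "i \<le> n" for n i z
  proof -
    obtain g u where z: "z = (g, u)" by (cases z) auto
    have "g \<in> Ar (E.gG n)" "u \<in> simp E.WA n" using zA z by (simp_all add: E.lev_W_ext_simps)
    then show ?thesis using z mtot_degen[OF _ i] km.Wbar_map_degen[OF _ i]
      by (simp add: E.lev_W_ext_simps E'.lev_W_ext_simps M)
  qed
  ultimately show "smap (Defs.arr_sset (W_ext E)) (Defs.arr_sset (W_ext E')) (\<lambda>n. far (W_ext_map F n))"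
    unfolding smap_def Defs.arr_sset_def using Ar by (auto simp: M)
qed

end

sublocale extension_morphism \<subseteq> wm: sgroupoid_map "W_ext E" "W_ext E'" "W_ext_map F"
  by unfold_locales (rule sgpd_map_W_ext_map)

context extension_morphism
begin

lemma W_ext_map_over_base:
  assumes "y \<in> simp (Wbar (W_ext E)) n"
  shows "Wbar_map semidirect_proj n (Wbar_map (W_ext_prj E') n (Wbar_map (W_ext_map F) n y)) =
    Wbar_map (mbase F) n (Wbar_map semidirect_proj n (Wbar_map (W_ext_prj E) n y))"
  unfolding Wbar_map_comp[symmetric]
proof (rule E.T'.Wbar_map_cong[OF _ _ assms])
  fix n z assume "z \<in> Ar (E.TT n)"
  then show "far (gfun_comp (semidirect_proj n) (gfun_comp (W_ext_prj E' n) (W_ext_map F n))) z =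
      far (gfun_comp (mbase F n) (gfun_comp (semidirect_proj n) (W_ext_prj E n))) z"
    by (cases z) (simp add: gfun_comp_def semidirect_proj_def W_ext_prj_def W_ext_map_def E.lev_W_ext_simps square_ar)
qed (simp add: gfun_comp_def semidirect_proj_def W_ext_prj_def W_ext_map_def)

end

text \<open>Morphisms of extensions are compared on objects and arrows only, and so are the maps that they induce.\<close>

lemma (in extension) W_ext_map_cong:
  assumes "extension_map_eq E F F'" "y \<in> simp (Wbar (W_ext E)) n"
  shows "Wbar_map (W_ext_map F) n y = Wbar_map (W_ext_map F') n y"
proof -
  have ob: "fob (mbase F n) x = fob (mbase F' n) x" if "x \<in> Ob (gH n)" for n x
    using assms(1) that by (simp add: extension_map_eq_def gfun_eq_def)
  have ar: "far (mtot F n) g = far (mtot F' n) g" if "g \<in> Ar (gG n)" for n g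
    using assms(1) that by (simp add: extension_map_eq_def gfun_eq_def rebase_simps)
  have k: "Wbar_map (kernel_map F) n u = Wbar_map (kernel_map F') n u" if "u \<in> simp WA n" for n u
    by (rule A.R.Wbar_map_cong[OF _ _ that])
      (auto simp: kernel_map_def A.lev_rep_simps ob intro!: ar A_typing(1))
  show ?thesis
    by (rule T'.Wbar_map_cong[OF _ _ assms(2)]) (auto simp: W_ext_map_def lev_W_ext_simps ob ar k)
qed

lemma (in extension) W_ext_map_id:
  assumes "y \<in> simp (Wbar (W_ext E)) n"
  shows "Wbar_map (W_ext_map extension_map_id) n y = y"
proof (rule T'.Wbar_map_id[OF _ _ assms])
  fix n z assume "z \<in> Ar (TT n)"
  then obtain g u where z: "z = (g, u)" "u \<in> simp WA n" by (cases z) (auto simp: lev_W_ext_simps)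
  have "Wbar_map (kernel_map extension_map_id) n u = u"
    by (rule A.R.Wbar_map_id[OF _ _ z(2)]) (auto simp: kernel_map_def extension_map_id_def)
  then show "far (W_ext_map extension_map_id n) z = z" using z by (simp add: W_ext_map_def extension_map_id_def)
qed (simp add: W_ext_map_def extension_map_id_def)

lemma W_ext_map_comp:
  "Wbar_map (W_ext_map (extension_map_comp F' F)) n y = Wbar_map (W_ext_map F') n (Wbar_map (W_ext_map F) n y)"
proof -
  have k0: "kernel_map (extension_map_comp F' F) = (\<lambda>n. gfun_comp (kernel_map F' n) (kernel_map F n))"
    by (simp add: fun_eq_iff kernel_map_def extension_map_comp_def gfun_comp_def map_prod_compose)
  have k: "Wbar_map (kernel_map (extension_map_comp F' F)) n = Wbar_map (kernel_map F') n \<circ> Wbar_map (kernel_map F) n" for n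
    by (rule ext) (simp add: k0 Wbar_map_comp)
  have "W_ext_map (extension_map_comp F' F) = (\<lambda>n. gfun_comp (W_ext_map F' n) (W_ext_map F n))"
    unfolding W_ext_map_def k by (simp add: fun_eq_iff extension_map_comp_def gfun_comp_def map_prod_compose)
  then show ?thesis by (simp add: Wbar_map_comp)
qed

theorem proposition1p5:
  "\<exists>(Y :: ('o, 'm, 'p, 'q) gext \<Rightarrow> ('p \<times> ('m \<times> ('p \<times> ('p \<times> 'm) list) list) list) list sset) p M w.
     (\<forall>E. w E = (\<lambda>n. Wbar_map semidirect_proj n \<circ> p E n)) \<and>
     (\<forall>E. abelian_extension E \<and> fibrant_kernel E \<longrightarrow>
        kan_fibration (Y E) (Wbar (semidirect_Wbar E)) (p E) \<and>
        weak_equivalence (Y E) (Wbar (ebase E)) (w E) \<and>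
        (let P = fibprod (Y E) (Wbar (ebase E)) (p E)
                   (Wbar_map (zero_section (ebase E) (Wbar_rep (ebase E) (kernel_rep E))))
         in \<exists>\<phi>. siso P (Wbar (etot E)) \<phi> \<and>
              (\<forall>n. \<forall>z \<in> simp P n. Wbar_map (eprj E) n (\<phi> n z) = snd z))) \<and>
     (\<forall>E E' F. abelian_extension E \<and> fibrant_kernel E \<and> abelian_extension E' \<and> fibrant_kernel E' \<and>
          extension_map E E' F \<longrightarrow>
        smap (Y E) (Y E') (M E E' F) \<and>
        (\<forall>n. \<forall>y \<in> simp (Y E) n. w E' n (M E E' F n y) = Wbar_map (mbase F) n (w E n y))) \<and>
     (\<forall>E F. abelian_extension E \<and> fibrant_kernel E \<and> extension_map E E F \<and>
          extension_map_eq E F extension_map_id \<longrightarrow>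
        (\<forall>n. \<forall>y \<in> simp (Y E) n. M E E F n y = y)) \<and>
     (\<forall>E E' E'' F F' F''. abelian_extension E \<and> fibrant_kernel E \<and>
          abelian_extension E' \<and> fibrant_kernel E' \<and> abelian_extension E'' \<and> fibrant_kernel E'' \<and>
          extension_map E E' F \<and> extension_map E' E'' F' \<and> extension_map E E'' F'' \<and>
          extension_map_eq E F'' (extension_map_comp F' F) \<longrightarrow>
        (\<forall>n. \<forall>y \<in> simp (Y E) n. M E E'' F'' n y = M E' E'' F' n (M E E' F n y)))"
proof (intro exI conjI allI impI)
  let ?Y = "\<lambda>E :: ('o, 'm, 'p, 'q) gext. Wbar (W_ext E)" and ?p = "\<lambda>E :: ('o, 'm, 'p, 'q) gext. Wbar_map (W_ext_prj E)"
  let ?M = "\<lambda>(E :: ('o, 'm, 'p, 'q) gext) (E' :: ('o, 'm, 'p, 'q) gext) F. Wbar_map (W_ext_map F)"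
  let ?w = "\<lambda>(E :: ('o, 'm, 'p, 'q) gext) n. Wbar_map semidirect_proj n \<circ> ?p E n"
  fix E :: "('o, 'm, 'p, 'q) gext"
  show "?w E = (\<lambda>n. Wbar_map semidirect_proj n \<circ> ?p E n)" by (rule refl)
  {
    assume E: "abelian_extension E \<and> fibrant_kernel E"
    then interpret extension E by unfold_locales simp
    show "kan_fibration (?Y E) (Wbar (semidirect_Wbar E)) (?p E)"
      using kan_fibration_W_ext E by (simp add: semidirect_Wbar_def)
    show "weak_equivalence (?Y E) (Wbar (ebase E)) (?w E)"
      using weak_equivalence_W_ext E by blast
    show "let P = fibprod (?Y E) (Wbar (ebase E)) (?p E)
                   (Wbar_map (zero_section (ebase E) (Wbar_rep (ebase E) (kernel_rep E))))
         in \<exists>\<phi>. siso P (Wbar (etot E)) \<phi> \<and>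
              (\<forall>n. \<forall>z \<in> simp P n. Wbar_map (eprj E) n (\<phi> n z) = snd z)"
      unfolding Let_def by (rule pullback_iso)
  }
  {
    fix F
    assume F: "abelian_extension E \<and> fibrant_kernel E \<and> extension_map E E F \<and> extension_map_eq E F extension_map_id"
    then interpret extension E by unfold_locales simp
    show "\<forall>y \<in> simp (?Y E) n. ?M E E F n y = y" for n
      using W_ext_map_cong[of F extension_map_id] W_ext_map_id F by auto
  }
  fix E' :: "('o, 'm, 'p, 'q) gext"
  {
    fix F
    assume F: "abelian_extension E \<and> fibrant_kernel E \<and> abelian_extension E' \<and> fibrant_kernel E' \<and> extension_map E E' F"
    then interpret extension_morphism E E' F
      by (simp add: extension_morphism_def extension_morphism_axioms_def extension_def)
    show "smap (?Y E) (?Y E') (?M E E' F)" by (rule wm.smap_Wbar_map)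
    show "\<forall>y \<in> simp (?Y E) n. ?w E' n (?M E E' F n y) = Wbar_map (mbase F) n (?w E n y)" for n
      using W_ext_map_over_base by auto
  }
  fix E'' :: "('o, 'm, 'p, 'q) gext" and F F' F'' n
  assume F: "abelian_extension E \<and> fibrant_kernel E \<and> abelian_extension E' \<and> fibrant_kernel E' \<and>
      abelian_extension E'' \<and> fibrant_kernel E'' \<and>
      extension_map E E' F \<and> extension_map E' E'' F' \<and> extension_map E E'' F'' \<and>
      extension_map_eq E F'' (extension_map_comp F' F)"
  then interpret extension E by unfold_locales simp
  show "\<forall>y \<in> simp (?Y E) n. ?M E E'' F'' n y = ?M E' E'' F' n (?M E E' F n y)"
    using W_ext_map_cong[of F'' "extension_map_comp F' F"] F by (auto simp: W_ext_map_comp)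
qed

end
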